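(* Let $1<p<\infty$, let $\Omega\subset\mathbb R^N$ be a bounded domain with Lipschitz boundary, and let $\varphi\in W^{1-\frac1p,p}(\partial\Omega)$. Let either $D=\Omega$, or $D=\Omega^e:=\mathbb R^N\setminus\overline\Omega$ and $p<N$. Then the weak solution of $${\rm div}\big(F^{p-1}(\nabla u)\,\partial F(\nabla u)\big)=0\ \text{ in } D,\qquad u=\varphi\ \text{ on }\partial\Omega,\qquad u\to0\ \text{as }|x|\to\infty\ \text{ if } D=\Omega^e,$$ is unique. In particular, in the case $\varphi\equiv1$ (with $D=\Omega^e$ and $1<p<N$), the minimizer of the anisotropic $p$-capacity functional $$u\mapsto\int_{\mathbb R^N}F^p(\nabla u)\,dx$$ in the class $\{u\in L^{pN/(N-p)}(\mathbb R^N):\ \nabla u\in L^p(\mathbb R^N),\ u\ge1\text{ in }\Omega\}$ is unique.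
   Context: $N\ge2$; $F:\mathbb R^N\to[0,\infty)$ is an arbitrary norm (no smoothness or strict convexity assumed); $\partial F(\xi)=\{\zeta\in\mathbb R^N:F(\eta)-F(\xi)\ge\zeta\cdot(\eta-\xi)\ \forall\eta\}$ is its subdifferential. Weak solution: for $D=\Omega$, a function $u\in W^{1,p}(\Omega)$ with trace $\varphi$ on $\partial\Omega$; for $D=\Omega^e$ (with $p<N$), a function $u\in L^{pN/(N-p)}(\Omega^e)$ with $\nabla u\in L^p(\Omega^e)$, trace $\varphi$ on $\partial\Omega$ and $\lim_{|x|\to\infty}u(x)=0$; in both cases it is required that there exist a measurable vector field $\mathbf z$ with $\mathbf z\in\partial F(\nabla u)$ a.e. in $D$ and $\int_D F^{p-1}(\nabla u)\,\mathbf z\cdot\nabla\psi=0$ for all $\psi\in W^{1,p}_0(D)$. The anisotropic $p$-capacity is ${\rm Cap}^F_p(\overline\Omega)=\inf\{\int_{\mathbb R^N}F^p(\nabla u)\,dx: u\in C_c^\infty(\mathbb R^N),\ u\ge1\text{ in }\overline\Omega\}$. Uniqueness of functions is meant a.e. (Existence of weak solutions was established in earlier work.) *)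

theory Defs
  imports "HOL-Analysis.Analysis"
begin

section \<open>Norms and subdifferentials\<close>

definition is_norm :: "(real ^ 'n \<Rightarrow> real) \<Rightarrow> bool" where
  "is_norm F \<longleftrightarrow>
     (\<forall>x. 0 \<le> F x) \<and> (\<forall>x. F x = 0 \<longleftrightarrow> x = 0) \<and>
     (\<forall>c x. F (c *\<^sub>R x) = \<bar>c\<bar> * F x) \<and> (\<forall>x y. F (x + y) \<le> F x + F y)"

definition subdifferential :: "(real ^ 'n \<Rightarrow> real) \<Rightarrow> real ^ 'n \<Rightarrow> (real ^ 'n) set" where
  "subdifferential F \<xi> = {\<zeta>. \<forall>\<eta>. F \<eta> - F \<xi> \<ge> \<zeta> \<bullet> (\<eta> - \<xi>)}"

section \<open>Smooth functions with compact support\<close>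

definition partial :: "'n \<Rightarrow> (real ^ 'n \<Rightarrow> real) \<Rightarrow> real ^ 'n \<Rightarrow> real" where
  "partial i f x = frechet_derivative f (at x) (axis i 1)"

definition grad :: "(real ^ 'n \<Rightarrow> real) \<Rightarrow> real ^ 'n \<Rightarrow> real ^ 'n" where
  "grad f x = (\<chi> i. partial i f x)"

text \<open>\<open>foldr partial [i\<^sub>1, \<dots>, i\<^sub>k] f\<close> is the iterated partial derivative
  \<open>\<partial>\<^sub>i\<^sub>1 \<dots> \<partial>\<^sub>i\<^sub>k f\<close>; requiring every one of them to be (Frechet) differentiable everywhere
  gives exactly the functions of class \<open>C\<^sup>\<infinity>\<close>.\<close>

definition smooth :: "(real ^ 'n \<Rightarrow> real) \<Rightarrow> bool" where
  "smooth f \<longleftrightarrow> (\<forall>is. foldr partial is f differentiable_on UNIV)"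

definition test_functions :: "(real ^ 'n) set \<Rightarrow> (real ^ 'n \<Rightarrow> real) set" where
  "test_functions D =
     {\<psi>. smooth \<psi> \<and> compact (closure {x. \<psi> x \<noteq> 0}) \<and> closure {x. \<psi> x \<noteq> 0} \<subseteq> D}"

section \<open>Sobolev spaces\<close>

definition Lp :: "real \<Rightarrow> 'a measure \<Rightarrow> ('a \<Rightarrow> 'b::euclidean_space) set" where
  "Lp p M = {f \<in> borel_measurable M. integrable M (\<lambda>x. norm (f x) powr p)}"

text \<open>Convergence in \<open>L\<^sup>p\<close> is stated with the nonnegative integral, because the Bochner integral
  of a non-integrable function is \<open>0\<close>.\<close>

definition Lp_tendsto ::
    "real \<Rightarrow> 'a measure \<Rightarrow> (nat \<Rightarrow> 'a \<Rightarrow> 'b::euclidean_space) \<Rightarrow> ('a \<Rightarrow> 'b) \<Rightarrow> bool" where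
  "Lp_tendsto p M f g \<longleftrightarrow>
     (\<lambda>k. \<integral>\<^sup>+x. ennreal (norm (f k x - g x) powr p) \<partial>M) \<longlonglongrightarrow> 0"

definition locally_integrable_on ::
    "(real ^ 'n \<Rightarrow> 'b::euclidean_space) \<Rightarrow> (real ^ 'n) set \<Rightarrow> bool" where
  "locally_integrable_on f D \<longleftrightarrow> (\<forall>K. compact K \<and> K \<subseteq> D \<longrightarrow> integrable (lebesgue_on K) f)"

definition has_weak_gradient ::
    "(real ^ 'n) set \<Rightarrow> (real ^ 'n \<Rightarrow> real) \<Rightarrow> (real ^ 'n \<Rightarrow> real ^ 'n) \<Rightarrow> bool" where
  "has_weak_gradient D u G \<longleftrightarrow>
     locally_integrable_on u D \<and> locally_integrable_on G D \<and>
     (\<forall>\<psi> \<in> test_functions D.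
        (LINT x|lebesgue_on D. u x *\<^sub>R grad \<psi> x) = - (LINT x|lebesgue_on D. \<psi> x *\<^sub>R G x))"

text \<open>On an open set the weak gradient is unique up to a null set, so the choice is immaterial.\<close>

definition weak_grad :: "(real ^ 'n) set \<Rightarrow> (real ^ 'n \<Rightarrow> real) \<Rightarrow> real ^ 'n \<Rightarrow> real ^ 'n" where
  "weak_grad D u = (SOME G. has_weak_gradient D u G)"

text \<open>\<open>sobolev q p D\<close> consists of the \<open>u \<in> L\<^sup>q(D)\<close> with \<open>\<nabla>u \<in> L\<^sup>p(D)\<close>.\<close>

definition sobolev :: "real \<Rightarrow> real \<Rightarrow> (real ^ 'n) set \<Rightarrow> (real ^ 'n \<Rightarrow> real) set" where
  "sobolev q p D = {u \<in> Lp q (lebesgue_on D).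
     (\<exists>G. has_weak_gradient D u G) \<and> weak_grad D u \<in> Lp p (lebesgue_on D)}"

abbreviation W1p :: "real \<Rightarrow> (real ^ 'n) set \<Rightarrow> (real ^ 'n \<Rightarrow> real) set" where
  "W1p p D \<equiv> sobolev p p D"

definition W1p_0 :: "real \<Rightarrow> (real ^ 'n) set \<Rightarrow> (real ^ 'n \<Rightarrow> real) set" where
  "W1p_0 p D = {\<psi> \<in> W1p p D. \<exists>w. (\<forall>k. w k \<in> test_functions D) \<and>
     Lp_tendsto p (lebesgue_on D) w \<psi> \<and>
     Lp_tendsto p (lebesgue_on D) (\<lambda>k. grad (w k)) (weak_grad D \<psi>)}"

definition sobolev_exponent :: "'n itself \<Rightarrow> real \<Rightarrow> real" where
  "sobolev_exponent _ p = p * real CARD('n) / (real CARD('n) - p)"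

section \<open>Lipschitz domains, surface measure and traces\<close>

text \<open>Near each boundary point, \<open>\<Omega>\<close> is the part above a Lipschitz graph over the hyperplane
  orthogonal to a unit vector \<open>e\<close>; \<open>y - (y \<bullet> e) *\<^sub>R e\<close> is the projection of \<open>y\<close> to it.\<close>

definition lipschitz_domain :: "(real ^ 'n) set \<Rightarrow> bool" where
  "lipschitz_domain \<Omega> \<longleftrightarrow> open \<Omega> \<and> connected \<Omega> \<and> \<Omega> \<noteq> {} \<and>
     (\<forall>x \<in> frontier \<Omega>. \<exists>r>0. \<exists>e \<gamma> L. norm e = 1 \<and> L-lipschitz_on {y. y \<bullet> e = 0} \<gamma> \<and>
        \<Omega> \<inter> ball x r = {y \<in> ball x r. \<gamma> (y - (y \<bullet> e) *\<^sub>R e) < y \<bullet> e})"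

text \<open>Boundedness of the covering sets is required because \<open>diameter\<close> is total and takes a
  junk value on unbounded sets.  The usual constant normalises the measure so that it agrees
  with Lebesgue measure in integer dimensions.\<close>

definition hausdorff_outer :: "real \<Rightarrow> (real ^ 'n) set \<Rightarrow> ennreal" where
  "hausdorff_outer s A = (SUP \<delta>\<in>{0<..}.
     INF C\<in>{C :: nat \<Rightarrow> (real ^ 'n) set.
              (\<forall>i. bounded (C i) \<and> diameter (C i) \<le> \<delta>) \<and> A \<subseteq> (\<Union>i. C i)}.
       (\<Sum>i. ennreal (unit_ball_vol s * (diameter (C i) / 2) powr s)))"

text \<open>The surface measure on \<open>\<partial>\<Omega>\<close> is the completed \<open>(N - 1)\<close>-dimensional Hausdorff measure.\<close>

definition surface_measure :: "(real ^ 'n) set \<Rightarrow> (real ^ 'n) measure" where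
  "surface_measure \<Omega> = completion (restrict_space
     (measure_of UNIV (sets borel) (hausdorff_outer (real CARD('n) - 1))) (frontier \<Omega>))"

text \<open>The Gagliardo--Slobodeckij space \<open>W\<^bsup>s,p\<^esup>(\<partial>\<Omega>)\<close>, for \<open>0 < s < 1\<close>.\<close>

definition boundary_sobolev :: "real \<Rightarrow> real \<Rightarrow> (real ^ 'n) set \<Rightarrow> (real ^ 'n \<Rightarrow> real) set" where
  "boundary_sobolev s p \<Omega> = {\<phi> \<in> Lp p (surface_measure \<Omega>).
     (\<integral>\<^sup>+x. \<integral>\<^sup>+y. ennreal (\<bar>\<phi> x - \<phi> y\<bar> powr p / norm (x - y) powr (real CARD('n) - 1 + s * p))
        \<partial>surface_measure \<Omega> \<partial>surface_measure \<Omega>) < \<infinity>}"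

text \<open>\<open>u\<close>, defined on \<open>D = \<Omega>\<close> or \<open>D = - closure \<Omega>\<close>, has trace \<open>\<phi>\<close> on \<open>\<partial>\<Omega>\<close>: the graph of the trace
  operator is the closure of that of the restriction map \<open>w \<mapsto> w|\<^bsub>\<partial>\<Omega>\<^esub>\<close> on smooth functions.
  Convergence to \<open>u\<close> is in \<open>W\<^bsup>1,p\<^esup>\<close> on bounded parts of \<open>D\<close>, hence in \<open>W\<^bsup>1,p\<^esup>(\<Omega>)\<close> when \<open>D = \<Omega>\<close> is
  bounded; for unbounded \<open>D\<close> the function \<open>u\<close> need not itself be in \<open>L\<^sup>p(D)\<close>.\<close>

definition has_trace ::
    "real \<Rightarrow> (real ^ 'n) set \<Rightarrow> (real ^ 'n) set \<Rightarrow> (real ^ 'n \<Rightarrow> real) \<Rightarrow> (real ^ 'n \<Rightarrow> real) \<Rightarrow> bool" where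
  "has_trace p \<Omega> D u \<phi> \<longleftrightarrow> (\<exists>w. (\<forall>k. w k \<in> test_functions UNIV) \<and>
     (\<forall>R>0. Lp_tendsto p (lebesgue_on (D \<inter> ball 0 R)) w u \<and>
            Lp_tendsto p (lebesgue_on (D \<inter> ball 0 R)) (\<lambda>k. grad (w k)) (weak_grad D u)) \<and>
     Lp_tendsto p (surface_measure \<Omega>) w \<phi>)"

section \<open>Weak solutions and the capacity functional\<close>

definition satisfies_equation ::
    "(real ^ 'n \<Rightarrow> real) \<Rightarrow> real \<Rightarrow> (real ^ 'n) set \<Rightarrow> (real ^ 'n \<Rightarrow> real) \<Rightarrow> bool" where
  "satisfies_equation F p D u \<longleftrightarrow> (\<exists>z \<in> borel_measurable (lebesgue_on D).
     (AE x in lebesgue_on D. z x \<in> subdifferential F (weak_grad D u x)) \<and>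
     (\<forall>\<psi> \<in> W1p_0 p D.
        (LINT x|lebesgue_on D. F (weak_grad D u x) powr (p - 1) * (z x \<bullet> weak_grad D \<psi> x)) = 0))"

text \<open>The limit at infinity of a function that is only defined almost everywhere.\<close>

definition vanishes_at_infinity_on :: "(real ^ 'n) set \<Rightarrow> (real ^ 'n \<Rightarrow> real) \<Rightarrow> bool" where
  "vanishes_at_infinity_on D u \<longleftrightarrow>
     (\<forall>\<epsilon>>0. \<exists>R. AE x in lebesgue_on D. R \<le> norm x \<longrightarrow> \<bar>u x\<bar> < \<epsilon>)"

definition weak_solution_interior ::
    "(real ^ 'n \<Rightarrow> real) \<Rightarrow> real \<Rightarrow> (real ^ 'n) set \<Rightarrow> (real ^ 'n \<Rightarrow> real) \<Rightarrow> (real ^ 'n \<Rightarrow> real) \<Rightarrow> bool" where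
  "weak_solution_interior F p \<Omega> \<phi> u \<longleftrightarrow>
     u \<in> W1p p \<Omega> \<and> has_trace p \<Omega> \<Omega> u \<phi> \<and> satisfies_equation F p \<Omega> u"

definition weak_solution_exterior ::
    "(real ^ 'n \<Rightarrow> real) \<Rightarrow> real \<Rightarrow> (real ^ 'n) set \<Rightarrow> (real ^ 'n \<Rightarrow> real) \<Rightarrow> (real ^ 'n \<Rightarrow> real) \<Rightarrow> bool" where
  "weak_solution_exterior F p \<Omega> \<phi> u \<longleftrightarrow>
     u \<in> sobolev (sobolev_exponent TYPE('n) p) p (- closure \<Omega>) \<and>
     has_trace p \<Omega> (- closure \<Omega>) u \<phi> \<and>
     vanishes_at_infinity_on (- closure \<Omega>) u \<and>
     satisfies_equation F p (- closure \<Omega>) u"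

definition capacity_functional ::
    "(real ^ 'n \<Rightarrow> real) \<Rightarrow> real \<Rightarrow> (real ^ 'n \<Rightarrow> real) \<Rightarrow> real" where
  "capacity_functional F p u = (LINT x|lebesgue. F (weak_grad UNIV u x) powr p)"

definition capacity_class :: "real \<Rightarrow> (real ^ 'n) set \<Rightarrow> (real ^ 'n \<Rightarrow> real) set" where
  "capacity_class p \<Omega> =
     {u \<in> sobolev (sobolev_exponent TYPE('n) p) p UNIV. AE x in lebesgue_on \<Omega>. 1 \<le> u x}"

end

(* Let u and v be two solutions.  The test function v - u, the subdifferential inequality and the
   strict monotonicity of t -> t^(p-1) give F(grad u) = F(grad v) a.e.; since F need not be strictly
   convex, this does not give grad u = grad v.  Instead, test with a function mix(u,v) - u, where
   mix lies between the two arguments, is nondecreasing in each of them, and the sum of its partial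
   derivatives is less than 1 off the diagonal.  By F(grad u) = F(grad v) the equation then forces
   F(grad u) = 0 wherever u differs from v, so bell(u - v) = 1 - exp(-(u-v)^2) has zero gradient; it extends by
   zero to an integrable power on the whole space and therefore vanishes.  Minimizers of the capacity
   are treated in the same way, with (u+v)/2 and mix(u,v) as competitors. *)

theory Submission
  imports Defs
begin

text \<open>Once F(grad u) = F(grad v), the chain rule and the triangle inequality give F(grad
  mix(u,v)) <= (mix1 + mix2) F(grad u), with \<open>mix1\<close>, \<open>mix2\<close> the partial
  derivatives. Their sum below 1 is the gain that strict convexity of F would otherwise supply. The
  identity on the diagonal gives mix(u,v) - u zero trace, and lying between the arguments preserves
  u >= 1. All profiles are smooth with bounded slopes, so that composing them with smooth
  approximations of u and v again gives smooth approximations; traces and gradients of functions of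
  (u,v) are obtained in this way. The main obstacle is the boundary: equal traces mean convergence
  of restrictions to the boundary, while admissible test functions are limits of functions supported
  inside D. The bridge is a collar estimate: a function with zero trace has L^p mass o(eps^p) within
  distance eps of the boundary, just enough to pay for a cutoff of slope 1/eps. It compares Lebesgue
  measure of thin slabs with Hausdorff measure of their feet. On an exterior domain u - v need not
  lie in L^p, so test functions are first cut off at infinity.\<close>

section \<open>Smooth functions\<close>

lemma foldr_partial_closed:
  assumes "f \<in> A" and "\<And>g i. g \<in> A \<Longrightarrow> partial i g \<in> A"
  shows "foldr partial is f \<in> A"
  using assms by (induction "is") auto

text \<open>Smoothness behaves like a greatest fixed point: a class of differentiable functions that
  is closed under partial derivatives contains every iterated partial of its members. Applications
  only have to guess such a class, without an induction on the order of differentiation.\<close>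

lemma smooth_coinduct:
  assumes "f \<in> A" and "\<And>g i. g \<in> A \<Longrightarrow> partial i g \<in> A"
    and "\<And>g x. g \<in> A \<Longrightarrow> g differentiable at x"
  shows "smooth f"
  unfolding smooth_def differentiable_on_def
  using foldr_partial_closed[OF assms(1,2)] assms(3) by auto

lemma smooth_differentiable:
  assumes "smooth f" shows "f differentiable at x"
  using assms[unfolded smooth_def, rule_format, of "[]"] by (auto simp: differentiable_on_def)

lemma smooth_partial:
  assumes "smooth f" shows "smooth (partial i f)"
  unfolding smooth_def
proof
  fix js
  \<comment> \<open>\<open>foldr\<close> works from the right end of the list, so
    \<open>js @ [i]\<close> differentiates in direction \<open>i\<close> first.\<close>
  show "foldr partial js (partial i f) differentiable_on UNIV"
    using assms[unfolded smooth_def, rule_format, of "js @ [i]"] by simp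
qed

lemma smooth_continuous: "smooth f \<Longrightarrow> continuous_on S f"
  by (meson smooth_differentiable continuous_at_imp_continuous_on differentiable_imp_continuous_within)

lemma partial_eqI:
  assumes "(f has_derivative f') (at x)"
  shows "partial i f x = f' (axis i 1)"
  using frechet_derivative_at[OF assms] by (simp add: partial_def)

lemma has_derivative_grad:
  assumes "f differentiable at x"
  shows "(f has_derivative (\<lambda>h. grad f x \<bullet> h)) (at x)"
proof -
  obtain f' where f': "(f has_derivative f') (at x)" using assms by (auto simp: differentiable_def)
  interpret bounded_linear f' using f' by (rule has_derivative_bounded_linear)
  have "f' h = grad f x \<bullet> h" for h
  proof -
    have "f' h = f' (\<Sum>i\<in>UNIV. h $ i *\<^sub>R axis i 1)"
      using basis_expansion[of h] by (simp add: scalar_mult_eq_scaleR)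
    also have "\<dots> = (\<Sum>i\<in>UNIV. h $ i * f' (axis i 1))" by (simp add: sum scaleR)
    also have "\<dots> = grad f x \<bullet> h"
      by (simp add: inner_vec_def grad_def partial_eqI[OF f'] mult.commute)
    finally show ?thesis .
  qed
  then have "f' = (\<lambda>h. grad f x \<bullet> h)" by auto
  with f' show ?thesis by simp
qed

lemma grad_eqI:
  assumes "(f has_derivative (\<lambda>h. g \<bullet> h)) (at x)"
  shows "grad f x = g"
  by (simp add: vec_eq_iff grad_def partial_eqI[OF assms] inner_axis)

lemma partial_eq_grad: "partial i f x = grad f x $ i"
  by (simp add: grad_def)

lemma smooth_has_grad: "smooth f \<Longrightarrow> (f has_derivative (\<lambda>h. grad f x \<bullet> h)) (at x)"
  by (intro has_derivative_grad smooth_differentiable)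

lemma smooth_grad_continuous: "smooth f \<Longrightarrow> continuous_on S (grad f)"
  unfolding grad_def by (intro continuous_on_vec_lambda smooth_continuous smooth_partial)

text \<open>Sums and products of partial derivatives of the generators are again of this form, so a set
  of generators whose first partials lie in the closure consists of smooth functions.\<close>

inductive_set alg_closure :: "(real ^ 'n \<Rightarrow> real) set \<Rightarrow> (real ^ 'n \<Rightarrow> real) set"
  for B :: "(real ^ 'n \<Rightarrow> real) set" where
  base: "f \<in> B \<Longrightarrow> f \<in> alg_closure B"
| const: "(\<lambda>x. c) \<in> alg_closure B"
| add: "f \<in> alg_closure B \<Longrightarrow> g \<in> alg_closure B \<Longrightarrow> (\<lambda>x. f x + g x) \<in> alg_closure B"
| mult: "f \<in> alg_closure B \<Longrightarrow> g \<in> alg_closure B \<Longrightarrow> (\<lambda>x. f x * g x) \<in> alg_closure B"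

lemma smooth_alg_closure:
  assumes diff: "\<And>f x. f \<in> B \<Longrightarrow> f differentiable at x"
    and part: "\<And>f i. f \<in> B \<Longrightarrow> partial i f \<in> alg_closure B"
    and f: "f \<in> alg_closure B"
  shows "smooth f"
proof (rule smooth_coinduct[OF f])
  show d: "g differentiable at x" if "g \<in> alg_closure B" for g x
    using that by induction (auto intro!: diff derivative_intros)
  show "partial i g \<in> alg_closure B" if "g \<in> alg_closure B" for g i
    using that
  proof induction
    case (base f) then show ?case by (rule part)
  next
    case (const c)
    have "partial i (\<lambda>x. c) = (\<lambda>x. 0)"
      by (rule ext, rule partial_eqI[THEN trans]) (auto intro!: derivative_eq_intros)
    then show ?case by (simp add: alg_closure.const)
  next
    case (add f g)
    have "partial i (\<lambda>x. f x + g x) = (\<lambda>x. partial i f x + partial i g x)"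
    proof
      fix x
      show "partial i (\<lambda>x. f x + g x) x = partial i f x + partial i g x"
        using has_derivative_add[OF has_derivative_grad[OF d[OF add(1), of x]] has_derivative_grad[OF d[OF add(2), of x]]]
        by (subst partial_eqI, assumption) (simp add: partial_eq_grad inner_axis)
    qed
    then show ?case using add by (simp add: alg_closure.add)
  next
    case (mult f g)
    have "partial i (\<lambda>x. f x * g x) = (\<lambda>x. f x * partial i g x + partial i f x * g x)"
    proof
      fix x
      show "partial i (\<lambda>x. f x * g x) x = f x * partial i g x + partial i f x * g x"
        using has_derivative_mult[OF has_derivative_grad[OF d[OF mult(1), of x]] has_derivative_grad[OF d[OF mult(2), of x]]]
        by (subst partial_eqI, assumption) (simp add: partial_eq_grad inner_axis)
    qed
    then show ?case using mult by (simp add: alg_closure.add alg_closure.mult)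
  qed
qed

lemma smooth_mem_closure: "f \<in> alg_closure (Collect smooth) \<Longrightarrow> smooth f"
  by (rule smooth_alg_closure[of "Collect smooth"])
     (auto simp: smooth_differentiable smooth_partial intro: alg_closure.base)

lemma smooth_const [simp]: "smooth (\<lambda>x. c)"
  by (intro smooth_mem_closure alg_closure.const)

lemma smooth_add: "smooth f \<Longrightarrow> smooth g \<Longrightarrow> smooth (\<lambda>x. f x + g x)"
  by (intro smooth_mem_closure alg_closure.intros) auto

lemma smooth_mult: "smooth f \<Longrightarrow> smooth g \<Longrightarrow> smooth (\<lambda>x. f x * g x)"
  by (intro smooth_mem_closure alg_closure.intros) auto

lemma smooth_cmult: "smooth f \<Longrightarrow> smooth (\<lambda>x. c * f x)"
  by (intro smooth_mult) auto

lemma smooth_uminus: "smooth f \<Longrightarrow> smooth (\<lambda>x. - f x)"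
  using smooth_cmult[of f "-1"] by simp

lemma smooth_diff: "smooth f \<Longrightarrow> smooth g \<Longrightarrow> smooth (\<lambda>x. f x - g x)"
  using smooth_add[OF _ smooth_uminus, of f g] by simp

lemma smooth_sum: "(\<And>i. i \<in> I \<Longrightarrow> smooth (f i)) \<Longrightarrow> smooth (\<lambda>x. \<Sum>i\<in>I. f i x)"
  by (induction I rule: infinite_finite_induct) (auto intro!: smooth_add)

lemma smooth_nth [simp]: "smooth (\<lambda>x. x $ i)"
proof (rule smooth_mem_closure[OF alg_closure.base], simp add: smooth_def differentiable_on_def, safe)
  fix js and x :: "real ^ 'a"
  \<comment> \<open>The partial derivatives of a coordinate are constants, so the coordinate and all
    constants form a closed class.\<close>
  let ?A = "insert (\<lambda>x. x $ i) (range (\<lambda>(c::real) (x::real^'a). c))"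
  have der: "((\<lambda>x. x $ i) has_derivative (\<lambda>h. h $ i)) (at x)" for x :: "real ^ 'a"
    by (intro bounded_linear_imp_has_derivative bounded_linear_vec_nth)
  have "smooth (\<lambda>x::real^'a. x $ i)"
  proof (rule smooth_coinduct[of _ ?A])
    show "g differentiable at x" if "g \<in> ?A" for g x
      using that der by (auto intro: differentiableI)
    show "partial j g \<in> ?A" if "g \<in> ?A" for g j
    proof -
      have "partial j (\<lambda>x::real^'a. x $ i) = (\<lambda>x. axis j 1 $ i)"
        by (rule ext) (rule partial_eqI[OF der])
      moreover have "partial j (\<lambda>x::real^'a. c) = (\<lambda>x. 0)" for c
        by (rule ext, rule partial_eqI[THEN trans]) (auto intro!: derivative_eq_intros)
      ultimately show ?thesis using that by auto
    qed
  qed simp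
  then show "foldr partial js (\<lambda>x::real^'a. x $ i) differentiable at x"
    by (auto simp: smooth_def differentiable_on_def)
qed

lemma smooth_inner_self: "smooth (\<lambda>x. x \<bullet> x)"
  by (simp add: inner_vec_def smooth_sum smooth_mult)

lemma partial_affine:
  assumes "smooth f"
  shows "partial i (\<lambda>x. f (c *\<^sub>R x + a)) = (\<lambda>x. c * partial i f (c *\<^sub>R x + a))"
proof
  fix x
  have "((\<lambda>x. f (c *\<^sub>R x + a)) has_derivative (\<lambda>h. grad f (c *\<^sub>R x + a) \<bullet> (c *\<^sub>R h))) (at x)"
    by (rule has_derivative_compose[OF _ smooth_has_grad[OF assms], of "\<lambda>x. c *\<^sub>R x + a"])
       (auto intro!: derivative_eq_intros)
  then show "partial i (\<lambda>x. f (c *\<^sub>R x + a)) x = c * partial i f (c *\<^sub>R x + a)"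
    by (subst partial_eqI, assumption) (simp add: partial_eq_grad inner_axis)
qed

lemma smooth_affine:
  assumes "smooth f" shows "smooth (\<lambda>x. f (c *\<^sub>R x + a))"
\<comment> \<open>Each differentiation produces a factor \<open>c\<close>; the free factor
  \<open>d\<close> absorbs it and makes the class closed.\<close>
proof (rule smooth_coinduct[of _ "{\<lambda>x. d * g (c *\<^sub>R x + a) |d g. smooth g}"])
  show "(\<lambda>x. f (c *\<^sub>R x + a)) \<in> {\<lambda>x. d * g (c *\<^sub>R x + a) |d g. smooth g}"
    using assms by (auto intro!: exI[of _ 1])
  show "h differentiable at x" if h: "h \<in> {\<lambda>x. d * g (c *\<^sub>R x + a) |d g. smooth g}" for h x
  proof -
    from h obtain d g where h: "h = (\<lambda>x. d * g (c *\<^sub>R x + a))" and g: "smooth g" by auto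
    have "((\<lambda>x. g (c *\<^sub>R x + a)) has_derivative (\<lambda>h. grad g (c *\<^sub>R x + a) \<bullet> (c *\<^sub>R h))) (at x)"
      by (rule has_derivative_compose[OF _ smooth_has_grad[OF g], of "\<lambda>x. c *\<^sub>R x + a"])
         (auto intro!: derivative_eq_intros)
    then show ?thesis unfolding h by (intro derivative_intros) (auto simp: differentiable_def)
  qed
  show "partial i h \<in> {\<lambda>x. d * g (c *\<^sub>R x + a) |d g. smooth g}"
    if h: "h \<in> {\<lambda>x. d * g (c *\<^sub>R x + a) |d g. smooth g}" for h i
  proof -
    from h obtain d g where h: "h = (\<lambda>x. d * g (c *\<^sub>R x + a))" and g: "smooth g" by auto
    have "partial i h = (\<lambda>x. (d * c) * partial i g (c *\<^sub>R x + a))"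
      using partial_affine[OF smooth_cmult[OF g, of d], of i c a] smooth_differentiable[OF g]
      unfolding h
      by (auto simp: fun_eq_iff) (simp add: partial_eqI[OF has_derivative_mult_right[OF smooth_has_grad[OF g]]] partial_eq_grad inner_axis)
    then show ?thesis using smooth_partial[OF g] by blast
  qed
qed

text \<open>\<open>g n\<close> stands for the n-th derivative of one real function on
  \<open>S\<close>. Differentiating the composition replaces \<open>g n\<close> by
  \<open>g (Suc n)\<close> times a partial of \<open>f\<close>, so these compositions together with
  the smooth functions generate a closed algebra. It suffices to write down a formula for all
  derivatives of the outer function.\<close>

lemma smooth_compose:
  fixes g :: "nat \<Rightarrow> real \<Rightarrow> real" and n :: nat
  assumes g: "\<And>n t. t \<in> S \<Longrightarrow> (g n has_real_derivative g (Suc n) t) (at t)"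
    and f: "smooth f" "\<And>x. f x \<in> S"
  shows "smooth (\<lambda>x. g n (f x))"
proof -
  let ?B = "Collect smooth \<union> range (\<lambda>n x. g n (f x))"
  have der: "((\<lambda>x. g n (f x)) has_derivative (\<lambda>h. g (Suc n) (f x) * (grad f x \<bullet> h))) (at x)" for n x
    using has_derivative_compose[OF smooth_has_grad[OF f(1)] g[OF f(2)[of x], of n, unfolded has_field_derivative_def]]
    by simp
  show ?thesis
  proof (rule smooth_alg_closure[of ?B])
    show "h differentiable at x" if "h \<in> ?B" for h x
      using that der by (auto simp: smooth_differentiable intro: differentiableI)
    show "partial i h \<in> alg_closure ?B" if "h \<in> ?B" for h i
    proof (cases "smooth h")
      case True
      then show ?thesis by (auto intro: alg_closure.base smooth_partial)
    next
      case False
      then obtain n where h: "h = (\<lambda>x. g n (f x))" using \<open>h \<in> ?B\<close> by auto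
      have "partial i h = (\<lambda>x. g (Suc n) (f x) * partial i f x)"
        unfolding h by (rule ext, subst partial_eqI[OF der]) (simp add: partial_eq_grad inner_axis)
      moreover have "(\<lambda>x. g (Suc n) (f x)) \<in> alg_closure ?B" "partial i f \<in> alg_closure ?B"
        by (auto intro!: alg_closure.base smooth_partial f)
      ultimately show ?thesis by (simp add: alg_closure.mult)
    qed
    show "(\<lambda>x. g n (f x)) \<in> alg_closure ?B" by (auto intro!: alg_closure.base)
  qed
qed

lemma smooth_exp: "smooth f \<Longrightarrow> smooth (\<lambda>x. exp (f x))"
  by (rule smooth_compose[of UNIV "\<lambda>_. exp"]) (auto intro!: derivative_eq_intros)

lemma smooth_inverse:
  assumes "smooth f" "\<And>x. 0 < f x" shows "smooth (\<lambda>x. inverse (f x))"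
proof -
  \<comment> \<open>The n-th derivative of \<open>1 / t\<close>; restricting to \<open>t > 0\<close>
    keeps away from the pole.\<close>
  let ?g = "\<lambda>n t :: real. (-1) ^ n * fact n * inverse t ^ Suc n"
  have *: "(?g n has_real_derivative ?g (Suc n) t) (at t)" if "t \<in> {0<..}" for n t
  proof -
    have "(?g n has_real_derivative ((-1) ^ n * fact n) * (real (Suc n) * inverse t ^ n * (- (inverse t * inverse t)))) (at t)"
      using that by (auto intro!: derivative_eq_intros simp del: power_Suc)
    also have "((-1) ^ n * fact n) * (real (Suc n) * inverse t ^ n * (- (inverse t * inverse t))) = ?g (Suc n) t"
      by (simp add: algebra_simps)
    finally show ?thesis .
  qed
  show ?thesis using smooth_compose[of "{0<..}" ?g f 0, OF * assms(1)] assms(2) by simp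
qed

section \<open>Test functions\<close>

text \<open>The polynomial parameter closes the family under differentiation: all derivatives of
  \<open>exp (- (1 / t))\<close>, extended by 0 to \<open>t \<le> 0\<close>, have this form.\<close>

definition bump_profile :: "real poly \<Rightarrow> real \<Rightarrow> real" where
  "bump_profile P t = (if 0 < t then poly P (1 / t) * exp (- (1 / t)) else 0)"

lemma poly_mult_exp_neg_tendsto_0:
  fixes P :: "real poly"
  shows "((\<lambda>y. poly P y * exp (- y)) \<longlongrightarrow> 0) at_top"
proof -
  have "((\<lambda>y::real. \<Sum>i\<le>degree P. coeff P i * (y ^ i / exp y)) \<longlongrightarrow> (\<Sum>i\<le>degree P. coeff P i * 0)) at_top"
    by (intro tendsto_sum tendsto_mult tendsto_const tendsto_power_div_exp_0)
  then show ?thesis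
    by (simp add: poly_altdef sum_distrib_right exp_minus divide_inverse mult.assoc)
qed

text \<open>In the variable y = 1/t the derivative d/dt is -y^2 d/dy, which turns P(y) exp(-y) into
  y^2 (P - P')(y) exp(-y). At 0 the right difference quotient tends to 0 because exp(-y) beats every
  polynomial, and the left one is 0.\<close>

lemma bump_profile_has_derivative:
  "(bump_profile P has_real_derivative bump_profile (monom 1 2 * (P - pderiv P)) t) (at t)"
proof -
  consider "t > 0" | "t < 0" | "t = 0" by linarith
  then show ?thesis
  proof cases
    case 1
    have d: "((\<lambda>t. 1 / t) has_real_derivative - (1 / t ^ 2)) (at t)"
      using 1 by (auto intro!: derivative_eq_intros simp: power2_eq_square)
    have dp: "((\<lambda>t. poly P (1 / t)) has_real_derivative poly (pderiv P) (1 / t) * (- (1 / t ^ 2))) (at t)"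
      by (rule DERIV_chain2[OF poly_DERIV d])
    have de: "((\<lambda>t. exp (- (1 / t))) has_real_derivative exp (- (1 / t)) * (1 / t ^ 2)) (at t)"
      using d 1 by (auto intro!: derivative_eq_intros simp: power2_eq_square)
    have "((\<lambda>t. poly P (1 / t) * exp (- (1 / t))) has_real_derivative
        poly (monom 1 2 * (P - pderiv P)) (1 / t) * exp (- (1 / t))) (at t)"
      using DERIV_mult[OF dp de] by (rule DERIV_cong) (simp add: poly_monom power_one_over divide_inverse power_inverse algebra_simps)
    moreover have "\<forall>\<^sub>F s in nhds t. bump_profile P s = poly P (1 / s) * exp (- (1 / s))"
      using eventually_nhds_in_open[of "{0<..}" t] 1 by (auto elim!: eventually_mono simp: bump_profile_def)
    ultimately have "(bump_profile P has_real_derivative poly (monom 1 2 * (P - pderiv P)) (1 / t) * exp (- (1 / t))) (at t)"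
      by (simp only: DERIV_cong_ev[OF refl _ refl])
    then show ?thesis using 1 by (simp add: bump_profile_def)
  next
    case 2
    have "\<forall>\<^sub>F s in nhds t. bump_profile P s = 0"
      using eventually_nhds_in_open[of "{..<0}" t] 2 by (auto elim!: eventually_mono simp: bump_profile_def)
    then have "(bump_profile P has_real_derivative 0) (at t)"
      by (simp only: DERIV_cong_ev[OF refl _ refl, of _ "\<lambda>_. 0"] DERIV_const)
    then show ?thesis using 2 by (simp add: bump_profile_def)
  next
    case 3
    have "((\<lambda>s. (bump_profile P s - bump_profile P 0) / (s - 0)) \<longlongrightarrow> 0) (at_right 0)"
    proof -
      \<comment> \<open>The factor \<open>monom 1 1\<close> is the division by \<open>s\<close> in
        the difference quotient, written in the variable \<open>inverse s\<close>.\<close>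
      have "((\<lambda>s. poly (monom 1 1 * P) (inverse s) * exp (- inverse s)) \<longlongrightarrow> 0) (at_right 0)"
        by (rule filterlim_compose[OF poly_mult_exp_neg_tendsto_0 filterlim_inverse_at_top_right])
      moreover have "\<forall>\<^sub>F s in at_right 0. poly (monom 1 1 * P) (inverse s) * exp (- inverse s)
          = (bump_profile P s - bump_profile P 0) / (s - 0)"
        by (auto simp: eventually_at_filter bump_profile_def poly_monom field_simps)
      ultimately show ?thesis by (rule Lim_transform_eventually)
    qed
    moreover have "((\<lambda>s. (bump_profile P s - bump_profile P 0) / (s - 0)) \<longlongrightarrow> 0) (at_left 0)"
      by (rule Lim_transform_eventually[OF tendsto_const])
         (auto simp: eventually_at_filter bump_profile_def)
    ultimately show ?thesis
      using 3 by (simp add: has_field_derivative_iff filterlim_split_at bump_profile_def)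
  qed
qed

text \<open>The usual kernel exp(-1/(1 - |x|^2)) on the unit ball, extended by 0; the squared norm
  is itself smooth, also at the origin.\<close>

definition bump :: "real ^ 'n \<Rightarrow> real" where
  "bump x = bump_profile [:1:] (1 - x \<bullet> x)"

lemma smooth_bump: "smooth bump"
proof -
  let ?g = "\<lambda>n. bump_profile (((\<lambda>P. monom 1 2 * (P - pderiv P)) ^^ n) [:1:])"
  have "smooth (\<lambda>x. ?g 0 (1 - x \<bullet> x))"
    by (rule smooth_compose[of UNIV]) (auto intro!: bump_profile_has_derivative smooth_diff smooth_inner_self)
  then show ?thesis by (simp add: bump_def[abs_def])
qed

lemma bump_nonneg: "0 \<le> bump x"
  by (simp add: bump_def bump_profile_def)

lemma bump_eq_0: "1 \<le> norm x \<Longrightarrow> bump x = 0"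
  using power_mono[of 1 "norm x" 2]
  by (simp add: bump_def bump_profile_def dot_square_norm not_less)

lemma test_functionsI:
  assumes "smooth \<psi>" "compact K" "K \<subseteq> D" "\<And>x. x \<notin> K \<Longrightarrow> \<psi> x = 0"
  shows "\<psi> \<in> test_functions D"
proof -
  have "closure {x. \<psi> x \<noteq> 0} \<subseteq> K"
    using assms by (intro closure_minimal) (auto simp: compact_imp_closed)
  moreover have "compact (closure {x. \<psi> x \<noteq> 0})"
    using assms(2) calculation by (meson bounded_subset compact_eq_bounded_closed closed_closure)
  ultimately show ?thesis using assms by (auto simp: test_functions_def)
qed

lemma grad_eq_0_outside:
  assumes "closed K" "\<And>x. x \<notin> K \<Longrightarrow> \<psi> x = 0" "x \<notin> K"
  shows "grad \<psi> x = 0"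
proof (rule grad_eqI)
  have "((\<lambda>_. 0) has_derivative (\<lambda>h. 0 \<bullet> h)) (at x)" by simp
  then show "(\<psi> has_derivative (\<lambda>h. 0 \<bullet> h)) (at x)"
  proof (rule has_derivative_transform_within_open)
    show "open (- K)" using assms(1) by (rule open_Compl)
    show "x \<in> - K" using assms(3) by simp
    show "0 = \<psi> y" if "y \<in> - K" for y using assms(2)[of y] that by simp
  qed
qed

lemma test_functionE:
  assumes "\<psi> \<in> test_functions D"
  obtains K where "smooth \<psi>" "compact K" "K \<subseteq> D" "\<forall>x. x \<notin> K \<longrightarrow> \<psi> x = 0" "\<forall>x. x \<notin> K \<longrightarrow> grad \<psi> x = 0"
proof (rule that)
  let ?K = "closure {x. \<psi> x \<noteq> 0}"
  show "smooth \<psi>" "compact ?K" "?K \<subseteq> D" using assms by (auto simp: test_functions_def)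
  have *: "\<psi> x = 0" if "x \<notin> ?K" for x using that closure_subset[of "{x. \<psi> x \<noteq> 0}"] by auto
  have "grad \<psi> x = 0" if "x \<notin> ?K" for x by (rule grad_eq_0_outside[OF closed_closure _ that]) (rule *)
  then show "\<forall>x. x \<notin> ?K \<longrightarrow> grad \<psi> x = 0" by blast
  show "\<forall>x. x \<notin> ?K \<longrightarrow> \<psi> x = 0" using * by blast
qed

lemma test_functions_mono: "D \<subseteq> D' \<Longrightarrow> test_functions D \<subseteq> test_functions D'"
  by (auto simp: test_functions_def)

lemma test_functions_smooth: "\<psi> \<in> test_functions D \<Longrightarrow> smooth \<psi>"
  by (auto simp: test_functions_def)

lemma test_functions_partial: "\<psi> \<in> test_functions D \<Longrightarrow> partial i \<psi> \<in> test_functions D"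
  by (erule test_functionE, rule test_functionsI) (auto simp: smooth_partial partial_eq_grad)

lemma test_functions_mult: "smooth f \<Longrightarrow> \<psi> \<in> test_functions D \<Longrightarrow> (\<lambda>x. f x * \<psi> x) \<in> test_functions D"
  by (erule test_functionE, rule test_functionsI) (auto simp: smooth_mult)

lemma grad_mult: "smooth f \<Longrightarrow> smooth g \<Longrightarrow> grad (\<lambda>x. f x * g x) x = f x *\<^sub>R grad g x + g x *\<^sub>R grad f x"
  by (rule grad_eqI) (auto intro!: derivative_eq_intros smooth_has_grad simp: inner_add_left)

lemma continuous_compact_support_bounded:
  fixes f :: "'a::topological_space \<Rightarrow> 'b::real_normed_vector"
  assumes "continuous_on UNIV f" "compact K" "\<And>x. x \<notin> K \<Longrightarrow> f x = 0"
  obtains B where "B > 0" "\<forall>x. norm (f x) \<le> B"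
proof -
  have "compact (f ` K)" using assms by (auto intro: compact_continuous_image continuous_on_subset)
  then obtain B where "B > 0" "\<forall>y\<in>f ` K. norm y \<le> B" by (meson bounded_pos compact_imp_bounded)
  moreover have "norm (f x) \<le> B" for x using calculation assms(3)[of x] by (cases "x \<in> K") auto
  ultimately show ?thesis using that by blast
qed

lemma test_function_bounded:
  assumes "\<psi> \<in> test_functions D"
  obtains B where "B > 0" "\<forall>x. \<bar>\<psi> x\<bar> \<le> B" "\<forall>x. norm (grad \<psi> x) \<le> B"
proof -
  obtain K where K: "smooth \<psi>" "compact K" "K \<subseteq> D" "\<forall>x. x \<notin> K \<longrightarrow> \<psi> x = 0" "\<forall>x. x \<notin> K \<longrightarrow> grad \<psi> x = 0"
    by (rule test_functionE[OF assms])
  note K = K[rule_format]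
  obtain B where B: "B > 0" "\<forall>x. norm (\<psi> x) \<le> B"
    by (rule continuous_compact_support_bounded[OF smooth_continuous[OF K(1)] K(2,4)])
  note B = B[rule_format]
  obtain C where C: "C > 0" "\<forall>x. norm (grad \<psi> x) \<le> C"
    by (rule continuous_compact_support_bounded[OF smooth_grad_continuous[OF K(1)] K(2,5)])
  note C = C[rule_format]
  show ?thesis by (rule that[of "max B C"]) (use B C in \<open>auto simp: le_max_iff_disj\<close>)
qed

section \<open>Regularization of locally integrable functions\<close>

section \<open>Convolution with test functions\<close>

lemma locally_integrable_onD:
  fixes U :: "real ^ 'n \<Rightarrow> 'b::euclidean_space"
  assumes "locally_integrable_on U D" "compact K" "K \<subseteq> D"
  shows "integrable lebesgue (\<lambda>x. indicator K x *\<^sub>R U x)"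
  using assms by (auto simp: locally_integrable_on_def integrable_restrict_space compact_imp_closed)

lemma continuous_imp_lebesgue_measurable:
  assumes "continuous_on UNIV f" shows "f \<in> borel_measurable lebesgue"
  using measurable_completion[of f lborel borel] borel_measurable_continuous_onI[OF assms] by simp

text \<open>A bounded factor supported in \<open>K\<close> times a function integrable on
  \<open>K\<close>. The general bilinear product covers both u grad psi and psi G, the two sides of
  the definition of a weak gradient.\<close>

lemma integrable_mult_compact:
  fixes U :: "real ^ 'n \<Rightarrow> 'b::euclidean_space" and f :: "real ^ 'n \<Rightarrow> 'c::euclidean_space"
    and h :: "'c \<Rightarrow> 'b \<Rightarrow> 'd::euclidean_space"
  assumes U: "locally_integrable_on U D" and K: "compact K" "K \<subseteq> D"
    and f: "continuous_on UNIV f" "\<And>x. x \<notin> K \<Longrightarrow> f x = 0" and h: "bounded_bilinear h"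
  shows "integrable lebesgue (\<lambda>x. h (f x) (U x))"
proof -
  interpret bounded_bilinear h by fact
  obtain B where B: "B > 0" "\<forall>x. norm (f x) \<le> B" by (rule continuous_compact_support_bounded[OF f(1) K(1) f(2)])
  note B = B[rule_format]
  obtain C where C: "C > 0" "\<forall>a b. norm (h a b) \<le> norm a * norm b * C" using pos_bounded by blast
  note C = C[rule_format]
  have eq: "h (f x) (U x) = h (f x) (indicator K x *\<^sub>R U x)" for x
    using f(2)[of x] by (auto simp: zero_left indicator_def)
  have i: "integrable lebesgue (\<lambda>x. indicator K x *\<^sub>R U x)" by (rule locally_integrable_onD[OF U K])
  have m: "(\<lambda>x. indicator K x *\<^sub>R U x) \<in> borel_measurable lebesgue" using i by auto
  have mf: "f \<in> borel_measurable lebesgue" by (rule continuous_imp_lebesgue_measurable[OF f(1)])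
  have "continuous_on UNIV (\<lambda>z. h (fst z) (snd z))"
    by (intro continuous_on continuous_intros)
  then have "(\<lambda>x. h (f x) (indicator K x *\<^sub>R U x)) \<in> borel_measurable lebesgue"
    using borel_measurable_continuous_on[OF _ borel_measurable_Pair[OF mf m], of "\<lambda>z. h (fst z) (snd z)"] by simp
  note meas = this
  show ?thesis unfolding eq
  proof (rule Bochner_Integration.integrable_bound[OF integrable_scaleR_right[OF integrable_norm[OF i], of "B * C"] meas], intro always_eventually allI)
    fix x
    have "norm (h (f x) (indicator K x *\<^sub>R U x)) \<le> norm (f x) * norm (indicator K x *\<^sub>R U x) * C" by (rule C)
    also have "\<dots> \<le> B * norm (indicator K x *\<^sub>R U x) * C"
      using B C by (intro mult_right_mono) auto
    also have "\<dots> \<le> norm ((B * C) *\<^sub>R norm (indicator K x *\<^sub>R U x))"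
      using abs_ge_self[of "B * C * norm (indicator K x *\<^sub>R U x)"] by (simp add: mult_ac abs_mult)
    finally show "norm (h (f x) (indicator K x *\<^sub>R U x)) \<le> norm ((B * C) *\<^sub>R norm (indicator K x *\<^sub>R U x))" .
  qed
qed

text \<open>The gradient is continuous with compact support, hence uniformly continuous. Uniformity
  in \<open>x\<close> is what allows the remainder to be integrated against \<open>U\<close> when a
  convolution is differentiated.\<close>

lemma test_function_uniform_remainder:
  assumes "\<rho> \<in> test_functions D" "e > 0"
  obtains d where "d > 0" "\<forall>x h. norm h < d \<longrightarrow> \<bar>\<rho> (x + h) - \<rho> x - grad \<rho> x \<bullet> h\<bar> \<le> e * norm h"
proof -
  obtain K where K: "smooth \<rho>" "compact K" "K \<subseteq> D" "\<forall>x. x \<notin> K \<longrightarrow> \<rho> x = 0" "\<forall>x. x \<notin> K \<longrightarrow> grad \<rho> x = 0"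
    by (rule test_functionE[OF assms(1)])
  note K = K[rule_format]
  obtain r where r: "r > 0" "K \<subseteq> cball 0 r"
    using compact_imp_bounded[OF K(2)] unfolding bounded_pos by (auto simp: subset_eq)
  have "uniformly_continuous_on (cball 0 (r + 1)) (grad \<rho>)"
    by (intro compact_uniformly_continuous smooth_grad_continuous K(1)) auto
  then obtain d where d: "d > 0" "\<And>x y. x \<in> cball 0 (r+1) \<Longrightarrow> y \<in> cball 0 (r+1) \<Longrightarrow> dist y x < d \<Longrightarrow> dist (grad \<rho> y) (grad \<rho> x) < e"
    using assms(2) by (rule uniformly_continuous_onE) auto
  \<comment> \<open>For points less than 1 apart, if one lies outside the ball of radius
    \<open>r + 1\<close>, then both lie outside the ball of radius \<open>r\<close>, where the
    gradient is 0.\<close>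
  have uc: "norm (grad \<rho> y - grad \<rho> x) \<le> e" if "dist y x < min d 1" for x y
  proof (cases "x \<in> cball 0 (r+1) \<and> y \<in> cball 0 (r+1)")
    case True then show ?thesis using d(2)[of x y] that by (auto simp: dist_norm)
  next
    case False
    then have "x \<notin> cball 0 r \<and> y \<notin> cball 0 r"
      using that dist_triangle[of 0 x y] dist_triangle[of 0 y x] by (auto simp: dist_commute)
    then have "grad \<rho> x = 0" "grad \<rho> y = 0" using K(5) r by blast+
    then show ?thesis using assms(2) by simp
  qed
  show ?thesis
  proof (rule that[of "min d 1"])
    show "0 < min d 1" using d by simp
    {
    fix x h :: "real ^ 'a" assume h: "norm h < min d 1"
    have "norm (\<rho> (x + h) - \<rho> x - grad \<rho> x \<bullet> (x + h - x)) \<le> norm (x + h - x) * e"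
    proof (rule differentiable_bound_linearization[where S = "ball x (min d 1)" and f' = "\<lambda>y h. grad \<rho> y \<bullet> h"])
      show "x + t *\<^sub>R (x + h - x) \<in> ball x (min d 1)" if "t \<in> {0..1}" for t
      proof -
        have "norm (t *\<^sub>R h) \<le> norm h" using that by (auto intro: mult_left_le_one_le)
        then show ?thesis using h by (auto simp: dist_norm)
      qed
      show "(\<rho> has_derivative (\<bullet>) (grad \<rho> y)) (at y within ball x (min d 1))" for y
        using smooth_has_grad[OF K(1)] by (rule has_derivative_at_withinI)
      show "onorm ((\<bullet>) (grad \<rho> y) - (\<bullet>) (grad \<rho> x)) \<le> e" if "y \<in> ball x (min d 1)" for y
      proof (rule onorm_le)
        show "norm (((\<bullet>) (grad \<rho> y) - (\<bullet>) (grad \<rho> x)) v) \<le> e * norm v" for v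
          using Cauchy_Schwarz_ineq2[of "grad \<rho> y - grad \<rho> x" v] mult_right_mono[OF uc[of y x] norm_ge_zero[of v]] that
          by (auto simp: inner_diff_left[symmetric] dist_commute)
      qed
      show "x \<in> ball x (min d 1)" using d by simp
    qed
    then have "\<bar>\<rho> (x + h) - \<rho> x - grad \<rho> x \<bullet> h\<bar> \<le> e * norm h" by (simp add: mult.commute)
  }
  then show "\<forall>x h. norm h < min d 1 \<longrightarrow> \<bar>\<rho> (x + h) - \<rho> x - grad \<rho> x \<bullet> h\<bar> \<le> e * norm h" by blast
  qed
qed

definition convolve :: "(real ^ 'n \<Rightarrow> real) \<Rightarrow> (real ^ 'n \<Rightarrow> real) \<Rightarrow> real ^ 'n \<Rightarrow> real" where
  "convolve \<rho> U x = (LINT y|lebesgue. \<rho> (x - y) * U y)"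

lemma compact_reflect: "compact K \<Longrightarrow> compact ((\<lambda>y. x - y) ` K)" for x :: "real ^ 'n"
  by (intro compact_continuous_image continuous_intros)

lemma integrable_convolve:
  assumes U: "locally_integrable_on U UNIV" and \<rho>: "\<rho> \<in> test_functions UNIV"
  shows "integrable lebesgue (\<lambda>y. \<rho> (x - y) * U y)"
    and "integrable lebesgue (\<lambda>y. U y *\<^sub>R grad \<rho> (x - y))"
proof -
  obtain K where K: "smooth \<rho>" "compact K" "K \<subseteq> UNIV" "\<forall>x. x \<notin> K \<longrightarrow> \<rho> x = 0" "\<forall>x. x \<notin> K \<longrightarrow> grad \<rho> x = 0"
    by (rule test_functionE[OF \<rho>])
  note K = K[rule_format]
  have out: "x - y \<notin> K" if "y \<notin> (\<lambda>y. x - y) ` K" for y using that image_eqI[of y "\<lambda>y. x - y" "x - y" K] by auto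
  show "integrable lebesgue (\<lambda>y. \<rho> (x - y) * U y)"
    by (rule integrable_mult_compact[OF U compact_reflect[OF K(2), of x] _ _ _ bounded_bilinear_mult])
       (auto intro!: continuous_on_compose2[OF smooth_continuous[OF K(1), of UNIV]] continuous_intros K(4) out)
  show "integrable lebesgue (\<lambda>y. U y *\<^sub>R grad \<rho> (x - y))"
    by (rule integrable_mult_compact[OF U compact_reflect[OF K(2), of x] _ _ _ bounded_bilinear.flip[OF bounded_bilinear_scaleR]])
       (auto intro!: continuous_on_compose2[OF smooth_grad_continuous[OF K(1), of UNIV]] continuous_intros K(5) out)
qed

lemma convolve_has_derivative:
  assumes U: "locally_integrable_on U UNIV" and \<rho>: "\<rho> \<in> test_functions UNIV"
  shows "(convolve \<rho> U has_derivative (\<lambda>h. (LINT y|lebesgue. U y *\<^sub>R grad \<rho> (x - y)) \<bullet> h)) (at x)"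
  unfolding has_derivative_at_alt
proof (intro conjI allI impI bounded_linear_inner_right)
  fix e :: real assume "e > 0"
  obtain K where K: "smooth \<rho>" "compact K" "K \<subseteq> UNIV" "\<forall>x. x \<notin> K \<longrightarrow> \<rho> x = 0" "\<forall>x. x \<notin> K \<longrightarrow> grad \<rho> x = 0"
    by (rule test_functionE[OF \<rho>])
  note K = K[rule_format]
  obtain r where r: "r > 0" "K \<subseteq> cball 0 r"
    using compact_imp_bounded[OF K(2)] unfolding bounded_pos by (auto simp: subset_eq)
  define J where "J = (LINT y|lebesgue. norm (indicator (cball x (r + 1)) y *\<^sub>R U y))"
  have J: "integrable lebesgue (\<lambda>y. norm (indicator (cball x (r + 1)) y *\<^sub>R U y))"
    by (intro integrable_norm locally_integrable_onD[OF U]) auto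
  have "J \<ge> 0" unfolding J_def by simp
  \<comment> \<open>All kernels involved live in a ball of radius \<open>r + 1\<close> around
    \<open>x\<close>, where \<open>U\<close> has mass \<open>J\<close>; with this \<open>e'\<close>
    the integrated remainder is at most \<open>e * norm (z - x)\<close>. The summand 1 avoids
    division by 0.\<close>
  define e' where "e' = e / (J + 1)"
  have e': "e' > 0" "e' * J \<le> e" using \<open>e > 0\<close> \<open>J \<ge> 0\<close> by (auto simp: e'_def field_simps)
  obtain d where d: "d > 0" "\<forall>x h. norm h < d \<longrightarrow> \<bar>\<rho> (x + h) - \<rho> x - grad \<rho> x \<bullet> h\<bar> \<le> e' * norm h"
    by (rule test_function_uniform_remainder[OF \<rho> e'(1)])
  note d = d[rule_format]
  show "\<exists>d>0. \<forall>z. norm (z - x) < d \<longrightarrow>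
      norm (convolve \<rho> U z - convolve \<rho> U x - (LINT y|lebesgue. U y *\<^sub>R grad \<rho> (x - y)) \<bullet> (z - x)) \<le> e * norm (z - x)"
  proof (intro exI[of _ "min d 1"] conjI allI impI)
    show "0 < min d 1" using d by simp
    fix z assume z: "norm (z - x) < min d 1"
    let ?R = "\<lambda>y. \<rho> (z - y) * U y - \<rho> (x - y) * U y - (U y *\<^sub>R grad \<rho> (x - y)) \<bullet> (z - x)"
    have iR: "integrable lebesgue ?R"
      by (intro Bochner_Integration.integrable_diff integrable_convolve[OF U \<rho>] integrable_inner_left)
    have "convolve \<rho> U z - convolve \<rho> U x - (LINT y|lebesgue. U y *\<^sub>R grad \<rho> (x - y)) \<bullet> (z - x) = (LINT y|lebesgue. ?R y)"
    proof -
      note i = integrable_convolve(1)[OF U \<rho>, of x] integrable_convolve(1)[OF U \<rho>, of z]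
        integrable_convolve(2)[OF U \<rho>, of x]
      have "(LINT y|lebesgue. (U y *\<^sub>R grad \<rho> (x - y)) \<bullet> (z - x)) = (LINT y|lebesgue. U y *\<^sub>R grad \<rho> (x - y)) \<bullet> (z - x)"
        by (rule integral_inner_left) (use i in auto)
      moreover have "integrable lebesgue (\<lambda>y. (U y *\<^sub>R grad \<rho> (x - y)) \<bullet> (z - x))"
        using i by (intro integrable_inner_left)
      ultimately show ?thesis unfolding convolve_def
        by (simp only: Bochner_Integration.integral_diff[OF Bochner_Integration.integrable_diff[OF i(2,1)]]
            Bochner_Integration.integral_diff[OF i(2,1)])
    qed
    also have "norm \<dots> \<le> (LINT y|lebesgue. (e' * norm (z - x)) * norm (indicator (cball x (r + 1)) y *\<^sub>R U y))"
    proof (rule order_trans[OF integral_norm_bound], rule integral_mono)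
      fix y
      have *: "?R y = (\<rho> ((x - y) + (z - x)) - \<rho> (x - y) - grad \<rho> (x - y) \<bullet> (z - x)) * U y"
        by (simp add: algebra_simps)
      show "norm (?R y) \<le> (e' * norm (z - x)) * norm (indicator (cball x (r + 1)) y *\<^sub>R U y)"
      proof (cases "y \<in> cball x (r + 1)")
        case True
        have "norm (?R y) \<le> (e' * norm (z - x)) * \<bar>U y\<bar>"
          unfolding * real_norm_def abs_mult using z by (intro mult_right_mono d) auto
        then show ?thesis using True by simp
      next
        case False
        then have "norm (x - y) > r + 1" by (simp add: dist_norm)
        moreover have "norm (x - y) \<le> norm (z - y) + norm (z - x)"
          using norm_triangle_ineq4[of "z - y" "z - x"] by simp
        ultimately have "x - y \<notin> K" "z - y \<notin> K" using r z by (auto simp: subset_eq)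
        then show ?thesis using False K by simp
      qed
    qed (use iR J in \<open>auto intro: integrable_norm\<close>)
    also have "\<dots> = (e' * J) * norm (z - x)" by (simp add: J_def)
    also have "\<dots> \<le> e * norm (z - x)" using e' by (intro mult_right_mono) auto
    finally show "norm (convolve \<rho> U z - convolve \<rho> U x - (LINT y|lebesgue. U y *\<^sub>R grad \<rho> (x - y)) \<bullet> (z - x)) \<le> e * norm (z - x)" .
  qed
qed

lemma grad_convolve:
  assumes "locally_integrable_on U UNIV" "\<rho> \<in> test_functions UNIV"
  shows "grad (convolve \<rho> U) x = (LINT y|lebesgue. U y *\<^sub>R grad \<rho> (x - y))"
  by (rule grad_eqI[OF convolve_has_derivative[OF assms]])

text \<open>Derivatives fall on the kernel, so the convolutions of a fixed \<open>U\<close> with all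
  test functions form a class closed under partial derivatives.\<close>

lemma smooth_convolve:
  assumes U: "locally_integrable_on U UNIV" and \<rho>: "\<rho> \<in> test_functions UNIV"
  shows "smooth (convolve \<rho> U)"
proof (rule smooth_coinduct[of _ "{convolve \<rho> U |\<rho>. \<rho> \<in> test_functions UNIV}"])
  show "partial i g \<in> {convolve \<rho> U |\<rho>. \<rho> \<in> test_functions UNIV}"
    if "g \<in> {convolve \<rho> U |\<rho>. \<rho> \<in> test_functions UNIV}" for g i
  proof -
    from that obtain \<rho> where g: "g = convolve \<rho> U" and \<rho>: "\<rho> \<in> test_functions UNIV" by auto
    have "partial i g x = convolve (partial i \<rho>) U x" for x
    proof -
      have "partial i g x = (LINT y|lebesgue. (U y *\<^sub>R grad \<rho> (x - y)) \<bullet> axis i 1)"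
        unfolding g partial_eqI[OF convolve_has_derivative[OF U \<rho>]]
        by (rule integral_inner_left[symmetric]) (use integrable_convolve(2)[OF U \<rho>] in auto)
      then show ?thesis by (simp add: convolve_def inner_axis partial_eq_grad mult.commute)
    qed
    then have "partial i g = convolve (partial i \<rho>) U" by auto
    then show ?thesis using test_functions_partial[OF \<rho>] by auto
  qed
qed (use \<rho> convolve_has_derivative[OF U] in \<open>auto intro: differentiableI\<close>)

section \<open>Mollifiers\<close>

lemma lborel_distr_reflect: "distr lborel borel (\<lambda>y. x - y) = (lborel :: 'a::euclidean_space measure)"
  by (subst lborel_affine[of "-1" x], auto simp: density_1)

lemma lborel_distr_translate: "distr lborel borel (\<lambda>y. y + x) = (lborel :: 'a::euclidean_space measure)"
  using lborel_distr_plus[of x] by (simp add: add.commute[of _ x])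

lemma nn_integral_lborel_translate:
  fixes f :: "'a::euclidean_space \<Rightarrow> ennreal"
  assumes "f \<in> borel_measurable borel"
  shows "(\<integral>\<^sup>+y. f (y + x) \<partial>lborel) = (\<integral>\<^sup>+y. f y \<partial>lborel)"
  using assms by (subst (2) lborel_distr_translate[of x, symmetric]) (simp add: nn_integral_distr)

lemma nn_integral_lborel_reflect:
  fixes f :: "'a::euclidean_space \<Rightarrow> ennreal"
  assumes "f \<in> borel_measurable borel"
  shows "(\<integral>\<^sup>+y. f (x - y) \<partial>lborel) = (\<integral>\<^sup>+y. f y \<partial>lborel)"
  using assms by (subst (2) lborel_distr_reflect[of x, symmetric]) (simp add: nn_integral_distr)

lemma integral_lborel_reflect:
  fixes f :: "'a::euclidean_space \<Rightarrow> 'b::euclidean_space"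
  assumes "f \<in> borel_measurable borel"
  shows "(LINT y|lborel. f (x - y)) = (LINT y|lborel. f y)"
  using assms by (subst (2) lborel_distr_reflect[of x, symmetric]) (simp add: integral_distr)

lemma integrable_lborel_reflect:
  fixes f :: "'a::euclidean_space \<Rightarrow> 'b::euclidean_space"
  assumes "integrable lborel f"
  shows "integrable lborel (\<lambda>y. f (x - y))"
proof -
  have "f \<in> borel_measurable borel" using borel_measurable_integrable[OF assms] by simp
  then show ?thesis
    using assms integrable_distr_eq[of "\<lambda>y. x - y" lborel borel f] by (simp add: lborel_distr_reflect)
qed

lemma locally_integrable_continuous:
  fixes f :: "real ^ 'n \<Rightarrow> 'b::euclidean_space"
  assumes "continuous_on UNIV f" shows "locally_integrable_on f D"
  unfolding locally_integrable_on_def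
proof (intro allI impI)
  fix K :: "(real ^ 'n) set" assume "compact K \<and> K \<subseteq> D"
  then have "integrable lborel (\<lambda>x. indicator K x *\<^sub>R f x)"
    using assms continuous_on_subset by (intro borel_integrable_compact) auto
  then have "integrable lebesgue (\<lambda>x. indicator K x *\<^sub>R f x)"
    by (simp add: integrable_completion)
  then show "integrable (lebesgue_on K) f"
    using \<open>compact K \<and> K \<subseteq> D\<close> by (simp add: integrable_restrict_space compact_imp_closed)
qed

lemma test_function_integrable:
  assumes "\<psi> \<in> test_functions D"
  shows "integrable lebesgue \<psi>" and "integrable lebesgue (grad \<psi>)"
proof -
  obtain K where K: "smooth \<psi>" "compact K" "K \<subseteq> D" "\<forall>x. x \<notin> K \<longrightarrow> \<psi> x = 0" "\<forall>x. x \<notin> K \<longrightarrow> grad \<psi> x = 0"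
    by (rule test_functionE[OF assms])
  have "integrable lebesgue (\<lambda>x. indicator K x *\<^sub>R \<psi> x)" "integrable lebesgue (\<lambda>x. indicator K x *\<^sub>R grad \<psi> x)"
    by (intro locally_integrable_onD[OF locally_integrable_continuous, of _ _ UNIV] smooth_continuous smooth_grad_continuous K subset_UNIV)+
  moreover have "(\<lambda>x. indicator K x *\<^sub>R \<psi> x) = \<psi>" "(\<lambda>x. indicator K x *\<^sub>R grad \<psi> x) = grad \<psi>"
    using K by (auto simp: fun_eq_iff indicator_def)
  ultimately show "integrable lebesgue \<psi>" "integrable lebesgue (grad \<psi>)" by simp_all
qed

text \<open>The convolution of \<open>\<psi>\<close> with the constant 1 is a constant function, so
  its gradient, which is the integral of \<open>grad \<psi>\<close>, is 0. This replaces integrating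
  out one coordinate at a time by Fubini.\<close>

lemma integral_grad_test_function:
  assumes "\<psi> \<in> test_functions D"
  shows "(LINT x|lebesgue. grad \<psi> x) = 0"
proof -
  have \<psi>: "\<psi> \<in> test_functions UNIV" using assms test_functions_mono by blast
  have one: "locally_integrable_on (\<lambda>x::real^'n. 1::real) UNIV" by (rule locally_integrable_continuous) simp
  have b: "\<psi> \<in> borel_measurable borel" "grad \<psi> \<in> borel_measurable borel"
    by (intro borel_measurable_continuous_onI smooth_continuous smooth_grad_continuous test_functions_smooth[OF \<psi>])+
  have m: "(\<lambda>y. x - y) \<in> borel \<rightarrow>\<^sub>M borel" for x :: "real ^ 'n" by simp
  have "convolve \<psi> (\<lambda>_. 1) x = (LINT y|lborel. \<psi> y)" for x
    using measurable_compose[OF m b(1), of x]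
    by (simp add: convolve_def integral_completion integral_lborel_reflect[OF b(1)])
  then have "convolve \<psi> (\<lambda>_. 1) = (\<lambda>_. (LINT y|lborel. \<psi> y))" by auto
  then have "grad (convolve \<psi> (\<lambda>_. 1)) 0 = 0" by (simp add: grad_eqI)
  then have "(LINT y|lebesgue. grad \<psi> (0 - y)) = 0" using grad_convolve[OF one \<psi>, of 0] by simp
  then show ?thesis
    using measurable_compose[OF m b(2), of 0] b(2) integral_lborel_reflect[OF b(2), of 0]
    by (simp add: integral_completion)
qed

lemma integration_by_parts:
  assumes f: "smooth f" and \<psi>: "\<psi> \<in> test_functions D"
  shows "(LINT x|lebesgue. f x *\<^sub>R grad \<psi> x) = - (LINT x|lebesgue. \<psi> x *\<^sub>R grad f x)"
proof -
  obtain K where K: "smooth \<psi>" "compact K" "K \<subseteq> D" "\<forall>x. x \<notin> K \<longrightarrow> \<psi> x = 0" "\<forall>x. x \<notin> K \<longrightarrow> grad \<psi> x = 0"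
    by (rule test_functionE[OF \<psi>])
  note K = K[rule_format]
  have "integrable lebesgue (\<lambda>x. f x *\<^sub>R grad \<psi> x)"
    by (rule integrable_mult_compact[where K = K and D = UNIV and h = "\<lambda>a b. b *\<^sub>R a" for b])
      (use K in \<open>auto intro: locally_integrable_continuous smooth_continuous[OF f] smooth_grad_continuous bounded_bilinear.flip[OF bounded_bilinear_scaleR]\<close>)
  moreover have "integrable lebesgue (\<lambda>x. \<psi> x *\<^sub>R grad f x)"
    by (rule integrable_mult_compact[where K = K and D = UNIV])
      (use K in \<open>auto intro: locally_integrable_continuous smooth_continuous smooth_grad_continuous[OF f] bounded_bilinear_scaleR\<close>)
  moreover have "(LINT x|lebesgue. f x *\<^sub>R grad \<psi> x + \<psi> x *\<^sub>R grad f x) = 0"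
    using integral_grad_test_function[OF test_functions_mult[OF f \<psi>]] by (simp add: grad_mult[OF f K(1)])
  ultimately show ?thesis by (simp add: add_eq_0_iff2)
qed

definition moll :: "real \<Rightarrow> real ^ 'n \<Rightarrow> real" where
  "moll \<epsilon> x = bump ((1 / \<epsilon>) *\<^sub>R x) / (LINT y|lebesgue. bump ((1 / \<epsilon>) *\<^sub>R (y :: real ^ 'n)))"

lemma scaled_bump_test_function: "\<epsilon> > 0 \<Longrightarrow> (\<lambda>x. bump ((1 / \<epsilon>) *\<^sub>R x)) \<in> test_functions UNIV"
  using smooth_affine[OF smooth_bump, of "1 / \<epsilon>" 0]
  by (intro test_functionsI[of _ "cball 0 \<epsilon>"]) (auto intro!: bump_eq_0 simp: field_simps)

text \<open>A lower bound of the right order in \<open>\<epsilon>\<close> takes the place of an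
  exact scaling formula; it justifies the normalisation of \<open>moll\<close> and bounds its
  gradient. On the ball of half radius 1 - |x|^2 is at least 3/4, so the bump is at least exp(-4/3)
  there.\<close>

lemma bump_mass:
  obtains c where "c > 0"
    "\<forall>\<epsilon>>0. c * \<epsilon> ^ CARD('n) \<le> (LINT y|lebesgue. bump ((1 / \<epsilon>) *\<^sub>R (y :: real ^ 'n)))"
proof -
  define b where "b = exp (- 4 / 3 :: real)"
  have b: "b \<le> bump x" if "norm x \<le> 1 / 2" for x :: "real ^ 'n"
  proof -
    have "x \<bullet> x \<le> 1 / 4" using power_mono[OF that, of 2] by (simp add: dot_square_norm power2_eq_square)
    moreover define t where "t = 1 - x \<bullet> x"
    ultimately have t: "3 / 4 \<le> t" by linarith
    then have "1 / t \<le> 4 / 3" by (simp add: divide_le_eq)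
    then show ?thesis using t by (simp add: bump_def bump_profile_def b_def flip: t_def)
  qed
  define c where "c = b * unit_ball_vol (real CARD('n)) / 2 ^ CARD('n)"
  show ?thesis
  proof (rule that)
    show "c > 0" by (simp add: c_def b_def)
    show "\<forall>\<epsilon>>0. c * \<epsilon> ^ CARD('n) \<le> (LINT y|lebesgue. bump ((1 / \<epsilon>) *\<^sub>R (y :: real ^ 'n)))"
    proof (intro allI impI)
      fix \<epsilon> :: real assume e: "\<epsilon> > 0"
      have "(LINT y|lebesgue. b * indicator (ball 0 (\<epsilon> / 2)) (y :: real ^ 'n)) \<le> (LINT y|lebesgue. bump ((1 / \<epsilon>) *\<^sub>R (y :: real ^ 'n)))"
      proof (rule integral_mono)
        show "integrable lebesgue (\<lambda>y. bump ((1 / \<epsilon>) *\<^sub>R (y :: real ^ 'n)))"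
          by (rule test_function_integrable(1)[OF scaled_bump_test_function[OF e]])
        show "b * indicator (ball 0 (\<epsilon> / 2)) y \<le> bump ((1 / \<epsilon>) *\<^sub>R y)" for y :: "real ^ 'n"
          using e bump_nonneg[of "(1 / \<epsilon>) *\<^sub>R y"] b[of "(1 / \<epsilon>) *\<^sub>R y"] by (auto simp: indicator_def field_simps)
        show "integrable lebesgue (\<lambda>y. b * indicator (ball 0 (\<epsilon> / 2)) (y :: real ^ 'n))"
          by (intro integrable_mult_right integrable_real_indicator) (use emeasure_bounded_finite[OF bounded_ball] in auto)
      qed
      also have "(LINT y|lebesgue. b * indicator (ball 0 (\<epsilon> / 2)) (y :: real ^ 'n)) = c * \<epsilon> ^ CARD('n)"
        using e by (simp add: c_def content_ball power_divide)
      finally show "c * \<epsilon> ^ CARD('n) \<le> (LINT y|lebesgue. bump ((1 / \<epsilon>) *\<^sub>R (y :: real ^ 'n)))" .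
    qed
  qed
qed

lemma moll_test_function:
  assumes "\<epsilon> > 0" shows "moll \<epsilon> \<in> test_functions UNIV"
  using test_functions_mult[OF smooth_const scaled_bump_test_function[OF assms], of "1 / (LINT y|lebesgue. bump ((1 / \<epsilon>) *\<^sub>R y))"]
  by (simp add: moll_def[abs_def])

lemma moll_nonneg: "0 \<le> moll \<epsilon> x"
  by (simp add: moll_def bump_nonneg)

lemma moll_eq_0: "\<epsilon> > 0 \<Longrightarrow> \<epsilon> \<le> norm x \<Longrightarrow> moll \<epsilon> x = 0"
  by (simp add: moll_def bump_eq_0)

lemma moll_integral:
  assumes "\<epsilon> > 0" shows "(LINT y|lebesgue. moll \<epsilon> (y :: real ^ 'n)) = 1"
proof -
  obtain c where "c > 0" "\<forall>\<epsilon>>0. c * \<epsilon> ^ CARD('n) \<le> (LINT y|lebesgue. bump ((1 / \<epsilon>) *\<^sub>R (y :: real ^ 'n)))"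
    by (rule bump_mass)
  then have "0 < (LINT y|lebesgue. bump ((1 / \<epsilon>) *\<^sub>R (y :: real ^ 'n)))"
    using assms by (meson less_le_trans mult_pos_pos zero_less_power)
  then show ?thesis by (simp add: moll_def)
qed

lemma moll_borel: "\<epsilon> > 0 \<Longrightarrow> moll \<epsilon> \<in> borel_measurable borel"
  by (intro borel_measurable_continuous_onI smooth_continuous test_functions_smooth[OF moll_test_function])

lemma moll_reflect_integral:
  fixes x :: "real ^ 'n"
  assumes "\<epsilon> > 0"
  shows "integrable lebesgue (\<lambda>y. moll \<epsilon> (x - y))" "(LINT y|lebesgue. moll \<epsilon> (x - y)) = 1"
    "(\<integral>\<^sup>+y. ennreal (moll \<epsilon> (x - y)) \<partial>lebesgue) = 1"
proof -
  note b = moll_borel[OF assms, where 'a = 'n]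
  have m: "(\<lambda>y. moll \<epsilon> (x - y)) \<in> borel_measurable borel"
    by (rule measurable_compose[OF _ b]) simp
  show 1: "integrable lebesgue (\<lambda>y. moll \<epsilon> (x - y))"
  proof -
    have "integrable lborel (moll \<epsilon> :: real ^ 'n \<Rightarrow> real)"
      using test_function_integrable(1)[OF moll_test_function[OF assms, where 'a = 'n]] integrable_completion[of "moll \<epsilon> :: real ^ 'n \<Rightarrow> real" lborel] b by simp
    then show ?thesis using integrable_lborel_reflect[of "moll \<epsilon>" x] integrable_completion[of "\<lambda>y. moll \<epsilon> (x - y)" lborel] m by simp
  qed
  show 2: "(LINT y|lebesgue. moll \<epsilon> (x - y)) = 1"
    using moll_integral[OF assms, where 'n = 'n] integral_lborel_reflect[OF b, of x] b m by (simp add: integral_completion)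
  show "(\<integral>\<^sup>+y. ennreal (moll \<epsilon> (x - y)) \<partial>lebesgue) = 1"
    using 2 by (subst nn_integral_eq_integral[OF 1]) (auto simp: moll_nonneg)
qed

text \<open>One factor \<open>\<epsilon>\<close> in the denominator comes from differentiating the
  scaled argument, the other \<open>CARD('n)\<close> from the normalising integral.\<close>

lemma moll_grad_bound:
  obtains C where "C > 0" "\<forall>\<epsilon>>0. \<forall>x. norm (grad (moll \<epsilon>) (x :: real ^ 'n)) \<le> C / (\<epsilon> * \<epsilon> ^ CARD('n))"
proof -
  obtain c where c: "c > 0" "\<forall>\<epsilon>>0. c * \<epsilon> ^ CARD('n) \<le> (LINT y|lebesgue. bump ((1 / \<epsilon>) *\<^sub>R (y :: real ^ 'n)))"
    by (rule bump_mass)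
  have "(bump :: real ^ 'n \<Rightarrow> real) \<in> test_functions UNIV" using scaled_bump_test_function[of 1] by simp
  then obtain B where B: "B > 0" "\<forall>x. \<bar>bump (x :: real ^ 'n)\<bar> \<le> B" "\<forall>x. norm (grad bump (x :: real ^ 'n)) \<le> B"
    by (rule test_function_bounded)
  show ?thesis
  proof (rule that)
    show "B / c > 0" using B c by simp
    show "\<forall>\<epsilon>>0. \<forall>x. norm (grad (moll \<epsilon>) (x :: real ^ 'n)) \<le> (B / c) / (\<epsilon> * \<epsilon> ^ CARD('n))"
    proof (intro allI impI)
      fix \<epsilon> :: real and x :: "real ^ 'n" assume e: "\<epsilon> > 0"
      define J where "J = (LINT y|lebesgue. bump ((1 / \<epsilon>) *\<^sub>R (y :: real ^ 'n)))"
      have J: "c * \<epsilon> ^ CARD('n) \<le> J" "J > 0" using c e less_le_trans[of 0 "c * \<epsilon> ^ CARD('n)" J] by (auto simp: J_def)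
      have "((\<lambda>x. bump ((1 / \<epsilon>) *\<^sub>R x)) has_derivative (\<lambda>h. grad bump ((1 / \<epsilon>) *\<^sub>R x) \<bullet> ((1 / \<epsilon>) *\<^sub>R h))) (at x)"
        by (rule has_derivative_compose[OF _ smooth_has_grad[OF smooth_bump]]) (auto intro!: derivative_eq_intros)
      then have "((\<lambda>x. bump ((1 / \<epsilon>) *\<^sub>R x) / J) has_derivative (\<lambda>h. (grad bump ((1 / \<epsilon>) *\<^sub>R x) \<bullet> ((1 / \<epsilon>) *\<^sub>R h)) / J)) (at x)"
        using J by (auto intro!: derivative_eq_intros)
      then have "grad (moll \<epsilon>) x = (1 / (\<epsilon> * J)) *\<^sub>R grad bump ((1 / \<epsilon>) *\<^sub>R x)"
        by (intro grad_eqI) (simp add: moll_def[abs_def] J_def)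
      then have "norm (grad (moll \<epsilon>) x) = norm (grad bump ((1 / \<epsilon>) *\<^sub>R x)) / (\<epsilon> * J)" using e J by simp
      also have "\<dots> \<le> B / (\<epsilon> * (c * \<epsilon> ^ CARD('n)))"
        using B c e J by (intro frac_le mult_left_mono) auto
      finally show "norm (grad (moll \<epsilon>) x) \<le> (B / c) / (\<epsilon> * \<epsilon> ^ CARD('n))"
        by (simp add: field_simps)
    qed
  qed
qed

text \<open>The indicator of \<open>A\<close> is mollified at scale \<open>\<epsilon>\<close>. The
  kernel gradient is of order eps^(-N-1) on a ball of volume of order eps^N, so the slope is at most
  C/eps with \<open>C\<close> independent of \<open>A\<close>; this uniformity is what the collar
  argument and the cutoffs at infinity use.\<close>

lemma smooth_cutoff:
  obtains C where "C > 0"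
    "\<forall>\<epsilon>>0. \<forall>A \<in> sets lebesgue. \<exists>\<eta>. smooth \<eta> \<and> (\<forall>x::real^'n. 0 \<le> \<eta> x \<and> \<eta> x \<le> 1 \<and> norm (grad \<eta> x) \<le> C / \<epsilon>
       \<and> (ball x \<epsilon> \<subseteq> A \<longrightarrow> \<eta> x = 1) \<and> (ball x \<epsilon> \<inter> A = {} \<longrightarrow> \<eta> x = 0))"
proof -
  obtain C where C: "C > 0" "\<forall>\<epsilon>>0. \<forall>x. norm (grad (moll \<epsilon>) (x :: real ^ 'n)) \<le> C / (\<epsilon> * \<epsilon> ^ CARD('n))"
    by (rule moll_grad_bound)
  define V where "V = unit_ball_vol (real CARD('n))"
  have "V > 0" by (simp add: V_def)
  show ?thesis
  proof (rule that)
    show "C * V > 0" using C \<open>V > 0\<close> by simp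
    show "\<forall>\<epsilon>>0. \<forall>A \<in> sets lebesgue. \<exists>\<eta>. smooth \<eta> \<and> (\<forall>x::real^'n. 0 \<le> \<eta> x \<and> \<eta> x \<le> 1 \<and> norm (grad \<eta> x) \<le> C * V / \<epsilon>
       \<and> (ball x \<epsilon> \<subseteq> A \<longrightarrow> \<eta> x = 1) \<and> (ball x \<epsilon> \<inter> A = {} \<longrightarrow> \<eta> x = 0))"
    proof (intro allI impI ballI)
      fix \<epsilon> :: real and A :: "(real ^ 'n) set" assume e: "\<epsilon> > 0" and A: "A \<in> sets lebesgue"
      define U where "U = (indicator A :: real ^ 'n \<Rightarrow> real)"
      have U: "locally_integrable_on U UNIV"
        unfolding locally_integrable_on_def
      proof (intro allI impI, elim conjE)
        fix K :: "(real ^ 'n) set" assume "compact K"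
        then have "integrable lebesgue (\<lambda>x. indicator (K \<inter> A) x :: real)"
          using A emeasure_mono[of "K \<inter> A" K lebesgue] emeasure_compact_finite[of K]
          by (intro integrable_real_indicator) (auto simp: compact_imp_closed)
        then show "integrable (lebesgue_on K) U"
          using \<open>compact K\<close> by (simp add: integrable_restrict_space compact_imp_closed U_def indicator_inter_arith)
      qed
      note t = moll_test_function[OF e, where 'a = 'n]
      let ?\<eta> = "convolve (moll \<epsilon>) U"
      note i = integrable_convolve[OF U t]
      note mi = moll_reflect_integral[OF e, where 'n = 'n]
      have out: "moll \<epsilon> (x - y) = 0" "grad (moll \<epsilon>) (x - y) = 0" if "y \<notin> ball x \<epsilon>" for x y :: "real ^ 'n"
      proof -
        have *: "moll \<epsilon> z = 0" if "z \<notin> ball 0 \<epsilon>" for z :: "real ^ 'n" using that by (intro moll_eq_0[OF e]) auto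
        have z: "x - y \<notin> ball 0 \<epsilon>" using that by (simp add: dist_norm norm_minus_commute)
        show "moll \<epsilon> (x - y) = 0" using *[OF z] .
        show "grad (moll \<epsilon>) (x - y) = 0"
        proof -
          have g: "grad (moll \<epsilon>) z = 0" if "z \<notin> cball 0 \<epsilon>" for z :: "real ^ 'n"
            by (rule grad_eq_0_outside[of "cball 0 \<epsilon>"]) (use that * in auto)
          \<comment> \<open>Vanishing of the kernel outside the open ball yields a zero gradient
            only off the closed ball; continuity of the gradient extends this to the sphere.\<close>
          have "closed {z. grad (moll \<epsilon>) z = (0::real^'n)}"
            using closed_vimage[of "{0}" "grad (moll \<epsilon>)"] smooth_grad_continuous[OF test_functions_smooth[OF t], of UNIV]
            by (simp add: vimage_def)
          moreover have "- cball 0 \<epsilon> \<subseteq> {z. grad (moll \<epsilon>) z = (0::real^'n)}" using g by auto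
          ultimately have "closure (- cball 0 \<epsilon>) \<subseteq> {z. grad (moll \<epsilon>) z = (0::real^'n)}" by (rule closure_minimal[rotated])
          moreover have "closure (- cball 0 \<epsilon>) = - ball (0::real^'n) \<epsilon>"
            using e by (simp add: closure_complement)
          ultimately show ?thesis using z by auto
        qed
      qed
      have "norm (grad ?\<eta> x) \<le> C * V / \<epsilon>" for x
      proof -
        have "norm (grad ?\<eta> x) \<le> (LINT y|lebesgue. C / (\<epsilon> * \<epsilon> ^ CARD('n)) * indicator (ball x \<epsilon>) y)"
          unfolding grad_convolve[OF U t]
        proof (rule order_trans[OF integral_norm_bound], rule integral_mono)
          show "integrable lebesgue (\<lambda>y. C / (\<epsilon> * \<epsilon> ^ CARD('n)) * indicator (ball x \<epsilon>) y)"
            by (intro integrable_mult_right integrable_real_indicator) (use emeasure_bounded_finite[OF bounded_ball] in auto)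
          show "norm (U y *\<^sub>R grad (moll \<epsilon>) (x - y)) \<le> C / (\<epsilon> * \<epsilon> ^ CARD('n)) * indicator (ball x \<epsilon>) y" for y
            using out(2)[of y x] C(2)[rule_format, OF e, of "x - y"] e C(1)
            by (cases "y \<in> ball x \<epsilon>") (auto simp: U_def indicator_def)
        qed (rule integrable_norm[OF i(2)])
        also have "\<dots> = C * V / \<epsilon>" using e by (simp add: content_ball V_def)
        finally show ?thesis .
      qed
      moreover have "0 \<le> ?\<eta> x" for x
        unfolding convolve_def by (intro integral_nonneg_AE always_eventually) (auto simp: moll_nonneg U_def)
      moreover have "?\<eta> x \<le> 1" for x
        unfolding convolve_def mi(2)[of x, symmetric]
        by (rule integral_mono) (use i mi in \<open>auto simp: U_def indicator_def moll_nonneg\<close>)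
      moreover have "?\<eta> x = 1" if "ball x \<epsilon> \<subseteq> A" for x
      proof -
        have "moll \<epsilon> (x - y) * U y = moll \<epsilon> (x - y)" for y
          using that out(1)[of y x] by (cases "y \<in> ball x \<epsilon>") (auto simp: U_def)
        then show ?thesis unfolding convolve_def using mi(2)[of x] by (simp only:)
      qed
      moreover have "?\<eta> x = 0" if "ball x \<epsilon> \<inter> A = {}" for x
      proof -
        have "moll \<epsilon> (x - y) * U y = 0" for y
          using that out(1)[of y x] by (cases "y \<in> ball x \<epsilon>") (auto simp: U_def indicator_def)
        then show ?thesis unfolding convolve_def by (simp only: Bochner_Integration.integral_zero)
      qed
      ultimately show "\<exists>\<eta>. smooth \<eta> \<and> (\<forall>x::real^'n. 0 \<le> \<eta> x \<and> \<eta> x \<le> 1 \<and> norm (grad \<eta> x) \<le> C * V / \<epsilon>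
       \<and> (ball x \<epsilon> \<subseteq> A \<longrightarrow> \<eta> x = 1) \<and> (ball x \<epsilon> \<inter> A = {} \<longrightarrow> \<eta> x = 0))"
        using smooth_convolve[OF U t] by blast
    qed
  qed
qed

section \<open>Continuity of translation and convergence of mollifications\<close>

text \<open>The error is spent in thirds: on an open superset, on a closed subset, and on cutting
  that subset by a large ball to make it compact.\<close>

lemma borel_approx_compact_open:
  fixes A :: "'a::euclidean_space set"
  assumes A: "A \<in> sets borel" "emeasure lborel A < \<infinity>" and "e > 0"
  obtains K U where "compact K" "open U" "K \<subseteq> A" "A \<subseteq> U" "emeasure lborel (U - K) \<le> ennreal e"
proof -
  obtain U where U: "open U" "A \<subseteq> U" "emeasure lborel (U - A) < ennreal (e / 3)"
    by (rule outer_regular_lborel[of A "e / 3"]) (use A \<open>e > 0\<close> in auto)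
  obtain T where T: "closed T" "T \<subseteq> A" "A - T \<in> lmeasurable" "emeasure lebesgue (A - T) < ennreal (e / 3)"
    by (rule sets_lebesgue_inner_closed[of A "e / 3"]) (use A \<open>e > 0\<close> in auto)
  have "(\<lambda>n. emeasure lborel (A - cball 0 (real n))) \<longlonglongrightarrow> emeasure lborel (\<Inter>n. A - cball 0 (real n))"
  proof (rule Lim_emeasure_decseq)
    show "emeasure lborel (A - cball 0 (real n)) \<noteq> \<infinity>" for n
      using emeasure_mono[of "A - cball 0 (real n)" A lborel] A by auto
  qed (use A in \<open>auto simp: decseq_def\<close>)
  moreover have "(\<Inter>n. A - cball 0 (real n)) = {}"
    using real_arch_simple by (fastforce simp: set_eq_iff)
  ultimately have "(\<lambda>n. emeasure lborel (A - cball 0 (real n))) \<longlonglongrightarrow> 0" by (simp only: emeasure_empty)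
  then have "\<forall>\<^sub>F n in sequentially. emeasure lborel (A - cball 0 (real n)) < ennreal (e / 3)"
    using \<open>e > 0\<close> by (intro order_tendstoD) auto
  then obtain n where n: "emeasure lborel (A - cball 0 (real n)) < ennreal (e / 3)"
    by (auto simp: eventually_sequentially)
  show ?thesis
  proof (rule that)
    show "compact (T \<inter> cball 0 (real n))" using T(1) by (simp add: closed_Int_compact)
    have "emeasure lborel (U - (T \<inter> cball 0 (real n)))
        \<le> emeasure lborel ((U - A) \<union> ((A - T) \<union> (A - cball 0 (real n))))"
      using A U T by (intro emeasure_mono) auto
    also have "\<dots> \<le> emeasure lborel (U - A) + (emeasure lborel (A - T) + emeasure lborel (A - cball 0 (real n)))"
      using A U T by (intro order_trans[OF emeasure_subadditive] add_left_mono emeasure_subadditive) auto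
    also have "\<dots> \<le> ennreal (e / 3) + (ennreal (e / 3) + ennreal (e / 3))"
      using U T n A by (intro add_mono) auto
    also have "\<dots> = ennreal e" using \<open>e > 0\<close> by (simp flip: ennreal_plus)
    finally show "emeasure lborel (U - (T \<inter> cball 0 (real n))) \<le> ennreal e" .
  qed (use U T in auto)
qed

text \<open>A translation shorter than the distance from \<open>K\<close> to the complement of
  \<open>U\<close> moves no point of \<open>K\<close> out of \<open>U\<close>. Hence the indicator
  can change only on \<open>U - K\<close> or on the translate of that set.\<close>

lemma L1_translate_indicator:
  fixes A :: "'a::euclidean_space set"
  assumes A: "A \<in> sets borel" "emeasure lborel A < \<infinity>" and "e > 0"
  shows "\<exists>d>0. \<forall>z. norm z < d \<longrightarrow> (\<integral>\<^sup>+x. ennreal \<bar>indicator A (x + z) - indicator A x\<bar> \<partial>lborel) \<le> ennreal e"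
proof -
  obtain K U where KU: "compact K" "open U" "K \<subseteq> A" "A \<subseteq> U" "emeasure lborel (U - K) \<le> ennreal (e / 2)"
    by (rule borel_approx_compact_open[OF A, of "e / 2"]) (use \<open>e > 0\<close> in auto)
  have mUK[measurable]: "U - K \<in> sets borel" using KU by (simp add: compact_imp_closed)
  obtain d where d: "d > 0" "\<forall>x\<in>K. \<forall>y\<in>- U. d \<le> dist x y"
    using separate_compact_closed[of K "- U"] KU by (auto simp: closed_Compl)
  show ?thesis
  proof (intro exI[of _ d] conjI allI impI d)
    fix z :: 'a assume z: "norm z < d"
    have "(\<integral>\<^sup>+x. ennreal \<bar>indicator A (x + z) - indicator A x\<bar> \<partial>lborel)
        \<le> (\<integral>\<^sup>+x. indicator (U - K) x + indicator (U - K) (x + z) \<partial>lborel)"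
    proof (rule nn_integral_mono)
      fix x :: 'a
      have 1: "x + z \<in> U" if "x \<in> K"
        using d(2)[rule_format, OF that, of "x + z"] z by (cases "x + z \<in> U") (auto simp: dist_norm)
      have 2: "x \<in> U" if "x + z \<in> K"
        using d(2)[rule_format, OF that, of "x"] z by (cases "x \<in> U") (auto simp: dist_norm)
      show "ennreal \<bar>indicator A (x + z) - indicator A x\<bar> \<le> indicator (U - K) x + indicator (U - K) (x + z)"
        using 1 2 KU(3,4) by (auto simp: indicator_def)
    qed
    also have "\<dots> = (\<integral>\<^sup>+x. indicator (U - K) x \<partial>lborel) + (\<integral>\<^sup>+x. indicator (U - K) (x + z) \<partial>lborel)"
      by (rule nn_integral_add) auto
    also have "\<dots> = emeasure lborel (U - K) + emeasure lborel (U - K)"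
      by (simp add: nn_integral_lborel_translate[of "indicator (U - K)"])
    also have "\<dots> \<le> ennreal (e / 2) + ennreal (e / 2)" by (intro add_mono KU)
    also have "\<dots> = ennreal e" using \<open>e > 0\<close> by (simp flip: ennreal_plus)
    finally show "(\<integral>\<^sup>+x. ennreal \<bar>indicator A (x + z) - indicator A x\<bar> \<partial>lborel) \<le> ennreal e" .
  qed
qed

text \<open>A density argument in the form of induction on integrable functions. In the limit case
  translation invariance makes the error of the translated approximation equal to that of the
  original one.\<close>

lemma L1_translate_continuous:
  fixes f :: "'a::euclidean_space \<Rightarrow> real"
  assumes "integrable lborel f" and "e > 0"
  shows "\<exists>d>0. \<forall>z. norm z < d \<longrightarrow> (\<integral>\<^sup>+x. ennreal \<bar>f (x + z) - f x\<bar> \<partial>lborel) \<le> ennreal e"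
  using assms
proof (induction arbitrary: e rule: integrable_induct)
  case (base A c)
  obtain d where d: "d > 0" "\<forall>z. norm z < d \<longrightarrow> (\<integral>\<^sup>+x. ennreal \<bar>indicator A (x + z) - indicator A x\<bar> \<partial>lborel) \<le> ennreal (e / (\<bar>c\<bar> + 1))"
  proof -
    have "A \<in> sets borel" "emeasure lborel A < \<infinity>" "0 < e / (\<bar>c\<bar> + 1)" using base by auto
    from L1_translate_indicator[OF this] show ?thesis using that by blast
  qed
  have [measurable]: "A \<in> sets borel" using base by simp
  show ?case
  proof (intro exI[of _ d] conjI allI impI d(1))
    fix z :: 'a assume z: "norm z < d"
    have "(\<integral>\<^sup>+x. ennreal \<bar>indicator A (x + z) *\<^sub>R c - indicator A x *\<^sub>R c\<bar> \<partial>lborel)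
       = (\<integral>\<^sup>+x. ennreal \<bar>c\<bar> * ennreal \<bar>indicator A (x + z) - indicator A x\<bar> \<partial>lborel)"
      by (intro nn_integral_cong) (auto simp: indicator_def)
    also have "\<dots> = ennreal \<bar>c\<bar> * (\<integral>\<^sup>+x. ennreal \<bar>indicator A (x + z) - indicator A x\<bar> \<partial>lborel)"
      by (rule nn_integral_cmult) measurable
    also have "\<dots> \<le> ennreal \<bar>c\<bar> * ennreal (e / (\<bar>c\<bar> + 1))" using d z by (intro mult_left_mono) auto
    also have "\<dots> = ennreal (\<bar>c\<bar> * (e / (\<bar>c\<bar> + 1)))" by (rule ennreal_mult'[symmetric]) simp
    also have "\<dots> \<le> ennreal e" using base by (intro ennreal_leI) (simp add: field_simps)
    finally show "(\<integral>\<^sup>+x. ennreal \<bar>indicator A (x + z) *\<^sub>R c - indicator A x *\<^sub>R c\<bar> \<partial>lborel) \<le> ennreal e" .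
  qed
next
  case (add f g)
  have [measurable]: "f \<in> borel_measurable borel" "g \<in> borel_measurable borel"
    using borel_measurable_integrable[OF add(1)] borel_measurable_integrable[OF add(2)] by simp_all
  obtain d1 where d1: "d1 > 0" "\<forall>z. norm z < d1 \<longrightarrow> (\<integral>\<^sup>+x. ennreal \<bar>f (x + z) - f x\<bar> \<partial>lborel) \<le> ennreal (e / 2)"
    using add(3)[OF half_gt_zero[OF add(5)]] by blast
  obtain d2 where d2: "d2 > 0" "\<forall>z. norm z < d2 \<longrightarrow> (\<integral>\<^sup>+x. ennreal \<bar>g (x + z) - g x\<bar> \<partial>lborel) \<le> ennreal (e / 2)"
    using add(4)[OF half_gt_zero[OF add(5)]] by blast
  show ?case
  proof (intro exI[of _ "min d1 d2"] conjI allI impI)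
    fix z :: 'a assume z: "norm z < min d1 d2"
    have "(\<integral>\<^sup>+x. ennreal \<bar>(f (x + z) + g (x + z)) - (f x + g x)\<bar> \<partial>lborel)
       \<le> (\<integral>\<^sup>+x. ennreal \<bar>f (x + z) - f x\<bar> + ennreal \<bar>g (x + z) - g x\<bar> \<partial>lborel)"
      by (intro nn_integral_mono) (auto simp flip: ennreal_plus intro!: ennreal_leI)
    also have "\<dots> = (\<integral>\<^sup>+x. ennreal \<bar>f (x + z) - f x\<bar> \<partial>lborel) + (\<integral>\<^sup>+x. ennreal \<bar>g (x + z) - g x\<bar> \<partial>lborel)"
      by (rule nn_integral_add) auto
    also have "\<dots> \<le> ennreal (e / 2) + ennreal (e / 2)" using d1 d2 z by (intro add_mono) auto
    also have "\<dots> = ennreal e" using add(5) by (simp flip: ennreal_plus)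
    finally show "(\<integral>\<^sup>+x. ennreal \<bar>(f (x + z) + g (x + z)) - (f x + g x)\<bar> \<partial>lborel) \<le> ennreal e" .
  qed (use d1 d2 in auto)
next
  case (lim f s)
  have [measurable]: "f \<in> borel_measurable borel" "\<And>i. s i \<in> borel_measurable borel"
    using borel_measurable_integrable[OF lim.hyps(4)] borel_measurable_integrable[OF lim.hyps(1)] by simp_all
  have "(\<lambda>i. (\<integral>\<^sup>+x. norm (f x - s i x) \<partial>lborel)) \<longlonglongrightarrow> 0"
  proof (rule nn_integral_dominated_convergence_norm[where w = "\<lambda>x. 2 * norm (f x)"])
    show "(\<integral>\<^sup>+x. ennreal (2 * norm (f x)) \<partial>lborel) < \<infinity>"
      using integrable_mult_right[OF integrable_norm[OF lim.hyps(4)], of 2] unfolding integrable_iff_bounded by (simp add: abs_mult)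
  qed (use lim.hyps in auto)
  then have "\<forall>\<^sub>F i in sequentially. (\<integral>\<^sup>+x. norm (f x - s i x) \<partial>lborel) < ennreal (e / 3)"
    using lim.prems(1) by (intro order_tendstoD) auto
  then obtain i where i: "(\<integral>\<^sup>+x. norm (f x - s i x) \<partial>lborel) < ennreal (e / 3)"
    by (auto simp: eventually_sequentially)
  obtain d where d: "d > 0" "\<forall>z. norm z < d \<longrightarrow> (\<integral>\<^sup>+x. ennreal \<bar>s i (x + z) - s i x\<bar> \<partial>lborel) \<le> ennreal (e / 3)"
  proof -
    have "0 < e / 3" using lim.prems(1) by simp
    from lim.IH[OF this] show ?thesis using that by blast
  qed
  show ?case
  proof (intro exI[of _ d] conjI allI impI d(1))
    fix z :: 'a assume z: "norm z < d"
    have "(\<integral>\<^sup>+x. ennreal \<bar>f (x + z) - f x\<bar> \<partial>lborel)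
       \<le> (\<integral>\<^sup>+x. ennreal \<bar>f (x + z) - s i (x + z)\<bar> + (ennreal \<bar>f x - s i x\<bar> + ennreal \<bar>s i (x + z) - s i x\<bar>) \<partial>lborel)"
      by (intro nn_integral_mono) (auto simp flip: ennreal_plus intro!: ennreal_leI)
    also have "\<dots> = (\<integral>\<^sup>+x. ennreal \<bar>f (x + z) - s i (x + z)\<bar> \<partial>lborel) + ((\<integral>\<^sup>+x. ennreal \<bar>f x - s i x\<bar> \<partial>lborel) + (\<integral>\<^sup>+x. ennreal \<bar>s i (x + z) - s i x\<bar> \<partial>lborel))"
      by (subst nn_integral_add, simp, simp, subst nn_integral_add, simp_all)
    also have "(\<integral>\<^sup>+x. ennreal \<bar>f (x + z) - s i (x + z)\<bar> \<partial>lborel) = (\<integral>\<^sup>+x. ennreal \<bar>f x - s i x\<bar> \<partial>lborel)"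
      by (rule nn_integral_lborel_translate) measurable
    also have "(\<integral>\<^sup>+x. ennreal \<bar>f x - s i x\<bar> \<partial>lborel) + ((\<integral>\<^sup>+x. ennreal \<bar>f x - s i x\<bar> \<partial>lborel) + (\<integral>\<^sup>+x. ennreal \<bar>s i (x + z) - s i x\<bar> \<partial>lborel))
       \<le> ennreal (e / 3) + (ennreal (e / 3) + ennreal (e / 3))" using d z i by (intro add_mono) auto
    also have "\<dots> = ennreal e" using lim.prems(1) by (simp flip: ennreal_plus)
    finally show "(\<integral>\<^sup>+x. ennreal \<bar>f (x + z) - f x\<bar> \<partial>lborel) \<le> ennreal e" .
  qed
qed

text \<open>Since the kernel has mass 1, the difference at \<open>x\<close> is an average of
  \<open>f (x - z) - f x\<close> over shifts \<open>z\<close> shorter than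
  \<open>\<epsilon>\<close>. Integrating over \<open>x\<close> first leaves only translation
  differences.\<close>

lemma convolve_moll_L1_bound:
  fixes f :: "real ^ 'n \<Rightarrow> real"
  assumes f: "integrable lborel f" and \<epsilon>: "\<epsilon> > 0"
    and d: "\<And>z. norm z < \<epsilon> \<Longrightarrow> (\<integral>\<^sup>+x. ennreal \<bar>f (x + z) - f x\<bar> \<partial>lborel) \<le> ennreal e"
  shows "(\<integral>\<^sup>+x. ennreal \<bar>convolve (moll \<epsilon>) f x - f x\<bar> \<partial>lborel) \<le> ennreal e"
proof -
  have fb[measurable]: "f \<in> borel_measurable borel"
    using borel_measurable_integrable[OF f] by simp
  have mb[measurable]: "moll \<epsilon> \<in> borel_measurable (borel :: (real ^ 'n) measure)" by (rule moll_borel[OF \<epsilon>])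
  have floc: "locally_integrable_on f UNIV"
    unfolding locally_integrable_on_def
  proof (intro allI impI, elim conjE)
    fix K :: "(real ^ 'n) set" assume K: "compact K"
    have "integrable lborel (\<lambda>x. indicator K x *\<^sub>R f x)"
      using f K by (intro integrable_mult_indicator) (auto simp: compact_imp_closed)
    then have "integrable lebesgue (\<lambda>x. indicator K x *\<^sub>R f x)"
      by (subst integrable_completion) (use K in \<open>auto simp: compact_imp_closed\<close>)
    then show "integrable (lebesgue_on K) f" using K by (simp add: integrable_restrict_space compact_imp_closed)
  qed
  note t = moll_test_function[OF \<epsilon>, where 'a = 'n]
  note mi = moll_reflect_integral[OF \<epsilon>, where 'n = 'n]
  have "(\<integral>\<^sup>+x. ennreal \<bar>convolve (moll \<epsilon>) f x - f x\<bar> \<partial>lborel)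
     \<le> (\<integral>\<^sup>+x. (\<integral>\<^sup>+z. ennreal (moll \<epsilon> z) * ennreal \<bar>f (x - z) - f x\<bar> \<partial>lborel) \<partial>lborel)"
  proof (rule nn_integral_mono)
    fix x
    have i1: "integrable lebesgue (\<lambda>y. moll \<epsilon> (x - y) * f y)" by (rule integrable_convolve(1)[OF floc t])
    have i2: "integrable lebesgue (\<lambda>y. moll \<epsilon> (x - y) * f x)" by (intro integrable_mult_left mi)
    have "convolve (moll \<epsilon>) f x - f x = (LINT y|lebesgue. moll \<epsilon> (x - y) * f y) - (LINT y|lebesgue. moll \<epsilon> (x - y) * f x)"
      by (simp add: convolve_def mi(2))
    also have "\<dots> = (LINT y|lebesgue. moll \<epsilon> (x - y) * f y - moll \<epsilon> (x - y) * f x)"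
      by (rule Bochner_Integration.integral_diff[symmetric, OF i1 i2])
    finally have "ennreal \<bar>convolve (moll \<epsilon>) f x - f x\<bar> = ennreal (norm (LINT y|lebesgue. moll \<epsilon> (x - y) * f y - moll \<epsilon> (x - y) * f x))"
      by simp
    also have "\<dots> \<le> (\<integral>\<^sup>+y. ennreal (norm (moll \<epsilon> (x - y) * f y - moll \<epsilon> (x - y) * f x)) \<partial>lebesgue)"
      by (intro integral_norm_bound_ennreal Bochner_Integration.integrable_diff i1 i2)
    also have "\<dots> = (\<integral>\<^sup>+y. ennreal (moll \<epsilon> (x - y)) * ennreal \<bar>f (x - (x - y)) - f x\<bar> \<partial>lborel)"
      by (simp add: nn_integral_completion right_diff_distrib[symmetric] abs_mult moll_nonneg ennreal_mult)
    also have "\<dots> = (\<integral>\<^sup>+z. ennreal (moll \<epsilon> z) * ennreal \<bar>f (x - z) - f x\<bar> \<partial>lborel)"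
      by (rule nn_integral_lborel_reflect) measurable
    finally show "ennreal \<bar>convolve (moll \<epsilon>) f x - f x\<bar> \<le> (\<integral>\<^sup>+z. ennreal (moll \<epsilon> z) * ennreal \<bar>f (x - z) - f x\<bar> \<partial>lborel)" .
  qed
  also have "\<dots> = (\<integral>\<^sup>+z. (\<integral>\<^sup>+x. ennreal (moll \<epsilon> z) * ennreal \<bar>f (x - z) - f x\<bar> \<partial>lborel) \<partial>lborel)"
    by (rule lborel_pair.Fubini') measurable
  also have "\<dots> \<le> (\<integral>\<^sup>+z. ennreal e * ennreal (moll \<epsilon> (z::real ^ 'n)) \<partial>lborel)"
  proof (rule nn_integral_mono)
    fix z :: "real ^ 'n"
    have "(\<integral>\<^sup>+x. ennreal (moll \<epsilon> z) * ennreal \<bar>f (x - z) - f x\<bar> \<partial>lborel) = ennreal (moll \<epsilon> z) * (\<integral>\<^sup>+x. ennreal \<bar>f (x - z) - f x\<bar> \<partial>lborel)"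
      by (rule nn_integral_cmult) measurable
    also have "\<dots> \<le> ennreal (moll \<epsilon> z) * ennreal e"
    proof (cases "norm z < \<epsilon>")
      case True then show ?thesis using d[of "- z"] by (intro mult_left_mono) auto
    qed (simp add: moll_eq_0[OF \<epsilon>])
    finally show "(\<integral>\<^sup>+x. ennreal (moll \<epsilon> z) * ennreal \<bar>f (x - z) - f x\<bar> \<partial>lborel) \<le> ennreal e * ennreal (moll \<epsilon> z)"
      by (simp add: mult.commute)
  qed
  also have "\<dots> = ennreal e * (\<integral>\<^sup>+z. ennreal (moll \<epsilon> (z::real ^ 'n)) \<partial>lborel)"
    by (rule nn_integral_cmult) measurable
  also have "(\<integral>\<^sup>+z. ennreal (moll \<epsilon> (z :: real ^ 'n)) \<partial>lborel) = 1"
    using mi(3)[of 0] nn_integral_lborel_reflect[of "\<lambda>z. ennreal (moll \<epsilon> (z :: real ^ 'n))" 0]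
    by (simp add: nn_integral_completion)
  finally show ?thesis by simp
qed

definition mollify :: "nat \<Rightarrow> (real ^ 'n \<Rightarrow> real) \<Rightarrow> real ^ 'n \<Rightarrow> real" where
  "mollify k = convolve (moll (inverse (real (Suc k))))"

lemma mollify_L1_global:
  fixes f :: "real ^ 'n \<Rightarrow> real"
  assumes f: "integrable lebesgue f"
  shows "(\<lambda>k. \<integral>\<^sup>+x. ennreal \<bar>mollify k f x - f x\<bar> \<partial>lebesgue) \<longlonglongrightarrow> 0"
proof -
  \<comment> \<open>The translation results concern \<open>lborel\<close>, so a Borel representative
    is taken; the convolution integral does not notice a change on a null set.\<close>
  obtain g where g: "g \<in> borel_measurable lborel" "AE x in lborel. f x = g x"
    using completion_ex_borel_measurable_real[of f lborel] borel_measurable_integrable[OF f] by auto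
  have ae: "AE x in lebesgue. f x = g x" using g by (intro AE_completion)
  have "integrable lebesgue g"
    using f ae measurable_completion[OF g(1)] borel_measurable_integrable[OF f] by (subst integrable_cong_AE[of g _ f]) auto
  then have gi: "integrable lborel g" using g by (simp add: integrable_completion)
  have eq: "mollify k f x = mollify k g x" for k x
  proof -
    have m: "moll (inverse (real (Suc k))) \<in> borel_measurable (borel :: (real ^ 'n) measure)"
      by (rule moll_borel) simp
    have "(\<lambda>y. moll (inverse (real (Suc k))) (x - y)) \<in> borel_measurable lborel"
      using measurable_compose[OF _ m, of "\<lambda>y. x - y" borel] by simp
    then have "(\<lambda>y. moll (inverse (real (Suc k))) (x - y)) \<in> borel_measurable lebesgue"
      by (rule measurable_completion)
    then show ?thesis unfolding mollify_def convolve_def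
      using ae borel_measurable_integrable[OF f] measurable_completion[OF g(1)]
      by (intro integral_cong_AE) auto
  qed
  show ?thesis
  proof (rule order_tendstoI)
    fix a :: ennreal assume "0 < a"
    obtain e where e: "e > 0" "ennreal e < a"
    proof (cases a)
      case (real r)
      then have "r > 0" using \<open>0 < a\<close> by simp
      then show ?thesis using real by (intro that[of "r / 2"]) (auto intro: ennreal_lessI)
    next
      case top
      then show ?thesis by (intro that[of 1]) auto
    qed
    obtain d where d: "d > 0" "\<forall>z. norm z < d \<longrightarrow> (\<integral>\<^sup>+x. ennreal \<bar>g (x + z) - g x\<bar> \<partial>lborel) \<le> ennreal e"
      using L1_translate_continuous[OF gi e(1)] by blast
    have "\<forall>\<^sub>F k in sequentially. inverse (real (Suc k)) < d"
      using LIMSEQ_inverse_real_of_nat d(1) by (rule order_tendstoD)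
    then show "\<forall>\<^sub>F k in sequentially. (\<integral>\<^sup>+x. ennreal \<bar>mollify k f x - f x\<bar> \<partial>lebesgue) < a"
    proof eventually_elim
      case (elim k)
      have "(\<integral>\<^sup>+x. ennreal \<bar>mollify k f x - f x\<bar> \<partial>lebesgue) = (\<integral>\<^sup>+x. ennreal \<bar>mollify k g x - g x\<bar> \<partial>lebesgue)"
        using ae by (intro nn_integral_cong_AE) (auto simp: eq)
      also have "\<dots> \<le> ennreal e"
        unfolding nn_integral_completion mollify_def
        by (rule convolve_moll_L1_bound[OF gi]) (use d elim in auto)
      finally show ?case using e(2) by simp
    qed
  qed simp
qed

lemma mollify_cong:
  assumes "\<And>y. norm (x - y) < inverse (real (Suc k)) \<Longrightarrow> f y = g y"
  shows "mollify k f x = mollify k g x"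
proof -
  have "moll (inverse (real (Suc k))) (x - y) * f y = moll (inverse (real (Suc k))) (x - y) * g y" for y
  proof (cases "norm (x - y) < inverse (real (Suc k))")
    case False
    then have "moll (inverse (real (Suc k))) (x - y) = 0" by (intro moll_eq_0) auto
    then show ?thesis by simp
  qed (simp add: assms)
  then show ?thesis unfolding mollify_def convolve_def by (simp only:)
qed

text \<open>The mollification scale is at most 1, so on the ball of radius \<open>R\<close> only the
  values within radius \<open>R + 1\<close> matter, and truncating there makes the function
  integrable.\<close>

lemma mollify_L1_local:
  fixes f :: "real ^ 'n \<Rightarrow> real"
  assumes f: "locally_integrable_on f UNIV"
  shows "(\<lambda>k. \<integral>\<^sup>+x. ennreal \<bar>mollify k f x - f x\<bar> * indicator (ball 0 R) x \<partial>lebesgue) \<longlonglongrightarrow> 0"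
proof -
  define g where "g = (\<lambda>x. indicator (cball 0 (R + 1)) x *\<^sub>R f x)"
  have "integrable lebesgue g" unfolding g_def by (intro locally_integrable_onD[OF f]) auto
  note lim = mollify_L1_global[OF this]
  show ?thesis
  proof (rule tendsto_sandwich[OF _ _ tendsto_const lim])
    show "\<forall>\<^sub>F k in sequentially. (\<integral>\<^sup>+x. ennreal \<bar>mollify k f x - f x\<bar> * indicator (ball 0 R) x \<partial>lebesgue)
        \<le> (\<integral>\<^sup>+x. ennreal \<bar>mollify k g x - g x\<bar> \<partial>lebesgue)"
    proof (intro always_eventually allI nn_integral_mono)
      fix k and x :: "real ^ 'n"
      show "ennreal \<bar>mollify k f x - f x\<bar> * indicator (ball 0 R) x \<le> ennreal \<bar>mollify k g x - g x\<bar>"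
      proof (cases "x \<in> ball 0 R")
        case True
        have "mollify k f x = mollify k g x"
        proof (rule mollify_cong)
          fix y assume "norm (x - y) < inverse (real (Suc k))"
          also have "\<dots> \<le> 1" by (simp add: inverse_le_1_iff)
          finally have "norm y \<le> R + 1" using True norm_triangle_ineq2[of y x] by (simp add: norm_minus_commute)
          then show "f y = g y" by (simp add: g_def)
        qed
        moreover have "g x = f x" using True by (simp add: g_def)
        ultimately show ?thesis using True by simp
      qed simp
    qed
  qed simp
qed

section \<open>Weak gradients and convergence in L^p\<close>

section \<open>Uniqueness of the weak gradient\<close>

lemma integral_lebesgue_on_indicator:
  fixes f :: "real ^ 'n \<Rightarrow> 'b::euclidean_space"
  assumes "D \<in> sets lebesgue"
  shows "(LINT x|lebesgue_on D. f x) = (LINT x|lebesgue. indicator D x *\<^sub>R f x)"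
  using assms by (subst integral_restrict_space) auto

text \<open>A mollifier centred at a point is a legitimate test function, so near each point of
  \<open>D\<close> the mollifications of a truncated \<open>G\<close> vanish; their L^1 limit is
  \<open>G\<close>. The local null sets are glued by a Lindelof argument, which is
  \<open>locally_negligible_alt\<close>.\<close>

lemma fundamental_lemma:
  fixes G :: "real ^ 'n \<Rightarrow> real"
  assumes D: "open D" and G: "locally_integrable_on G D"
    and zero: "\<And>\<psi>. \<psi> \<in> test_functions D \<Longrightarrow> (LINT x|lebesgue_on D. \<psi> x * G x) = 0"
  shows "AE x in lebesgue_on D. G x = 0"
proof -
  have local: "\<exists>U. openin (top_of_set {x\<in>D. G x \<noteq> 0}) U \<and> a \<in> U \<and> negligible U" if a: "a \<in> {x\<in>D. G x \<noteq> 0}" for a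
  proof -
    obtain r where r: "r > 0" "cball a r \<subseteq> D" using D a open_contains_cball by blast
    define U where "U = (\<lambda>x. indicator (cball a r) x *\<^sub>R G x)"
    have Ui: "integrable lebesgue U" unfolding U_def by (intro locally_integrable_onD[OF G] r) auto
    \<comment> \<open>Half of the radius is kept for the position of \<open>x\<close> and half for
      the kernel, so the support of the kernel stays in \<open>cball a r\<close>, where
      \<open>U\<close> equals \<open>G\<close>.\<close>
    have z: "mollify k U x = 0" if x: "x \<in> ball a (r / 2)" and k: "inverse (real (Suc k)) < r / 2" for k x
    proof -
      let ?e = "inverse (real (Suc k))" and ?\<psi> = "\<lambda>y. moll (inverse (real (Suc k))) (x - y)"
      have "?\<psi> \<in> test_functions D"
      proof (rule test_functionsI[of _ "cball x ?e"])
        have "smooth (moll ?e :: real ^ 'n \<Rightarrow> real)" by (rule test_functions_smooth[OF moll_test_function]) simp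
        from smooth_affine[OF this, of "- 1" x] show "smooth ?\<psi>" by simp
        show "cball x ?e \<subseteq> D"
        proof
          fix y assume "y \<in> cball x ?e"
          then have "dist a y \<le> r" using x k dist_triangle[of a y x] by simp
          then show "y \<in> D" using r(2) by auto
        qed
        show "?\<psi> y = 0" if "y \<notin> cball x ?e" for y using that by (intro moll_eq_0) (auto simp: dist_norm)
      qed simp
      from zero[OF this] have "0 = (LINT y|lebesgue. indicator D y *\<^sub>R (?\<psi> y * G y))"
        using D by (simp add: integral_lebesgue_on_indicator)
      also have "\<dots> = mollify k U x" unfolding mollify_def convolve_def
      proof (intro Bochner_Integration.integral_cong refl)
        fix y
        show "indicator D y *\<^sub>R (?\<psi> y * G y) = ?\<psi> y * U y"
        proof (cases "y \<in> cball a r")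
          case True then show ?thesis using r(2) by (auto simp: U_def)
        next
          case False
          have "?e \<le> norm (x - y)"
            using False x k dist_triangle[of a y x] by (simp add: dist_norm)
          then have "?\<psi> y = 0" by (intro moll_eq_0) auto
          then show ?thesis by simp
        qed
      qed
      finally show ?thesis by simp
    qed
    have "(\<integral>\<^sup>+x. ennreal \<bar>U x\<bar> * indicator (ball a (r / 2)) x \<partial>lebesgue) \<le> 0"
    proof (rule tendsto_le[OF _ mollify_L1_global[OF Ui] tendsto_const])
      have "\<forall>\<^sub>F k in sequentially. inverse (real (Suc k)) < r / 2"
        using LIMSEQ_inverse_real_of_nat r(1) by (intro order_tendstoD(2)[where y = 0]) auto
      then show "\<forall>\<^sub>F k in sequentially. (\<integral>\<^sup>+x. ennreal \<bar>U x\<bar> * indicator (ball a (r / 2)) x \<partial>lebesgue)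
          \<le> (\<integral>\<^sup>+x. ennreal \<bar>mollify k U x - U x\<bar> \<partial>lebesgue)"
      proof eventually_elim
        case (elim k)
        show ?case
        proof (rule nn_integral_mono)
          fix x
          show "ennreal \<bar>U x\<bar> * indicator (ball a (r / 2)) x \<le> ennreal \<bar>mollify k U x - U x\<bar>"
            using z[OF _ elim, of x] by (cases "x \<in> ball a (r / 2)") auto
        qed
      qed
    qed simp
    then have "AE x in lebesgue. ennreal \<bar>U x\<bar> * indicator (ball a (r / 2)) x = 0"
    proof (subst (asm) le_zero_eq, subst (asm) nn_integral_0_iff_AE)
      have [measurable]: "U \<in> borel_measurable lebesgue" "ball a (r / 2) \<in> sets lebesgue"
        using borel_measurable_integrable[OF Ui] by auto
      show "(\<lambda>x. ennreal \<bar>U x\<bar> * indicator (ball a (r / 2)) x) \<in> borel_measurable lebesgue"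
        by measurable
    qed
    then have "AE x in lebesgue. x \<notin> {x \<in> ball a (r / 2). G x \<noteq> 0}"
    proof eventually_elim
      case (elim x)
      show ?case
      proof
        assume x: "x \<in> {x \<in> ball a (r / 2). G x \<noteq> 0}"
        then have "dist a x < r / 2" by auto
        then have "dist a x \<le> r" using zero_le_dist[of a x] by linarith
        then show False using x elim by (simp add: U_def)
      qed
    qed
    then have "negligible {x \<in> ball a (r / 2). G x \<noteq> 0}"
      by (simp add: negligible_iff_null_sets completion.AE_iff_null_sets)
    then have "negligible ({x\<in>D. G x \<noteq> 0} \<inter> ball a (r / 2))"
      by (rule negligible_subset) auto
    moreover have "openin (top_of_set {x\<in>D. G x \<noteq> 0}) ({x\<in>D. G x \<noteq> 0} \<inter> ball a (r / 2))"
      by (simp add: openin_open_Int)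
    ultimately show ?thesis using a r(1) by (intro exI[of _ "{x\<in>D. G x \<noteq> 0} \<inter> ball a (r / 2)"]) auto
  qed
  have "negligible {x\<in>D. G x \<noteq> 0}"
    by (subst locally_negligible_alt) (use local in blast)
  then show ?thesis
    using D by (subst AE_restrict_space_iff) (auto simp: negligible_iff_null_sets intro: AE_I')
qed

section \<open>Convergence in the mean\<close>

lemma powr_add_le:
  fixes a b p :: real
  assumes "0 \<le> a" "0 \<le> b" "0 < p"
  shows "(a + b) powr p \<le> 2 powr p * (a powr p + b powr p)"
proof -
  have "(a + b) powr p \<le> (2 * max a b) powr p"
    using assms by (intro powr_mono2) auto
  also have "\<dots> = 2 powr p * (max a b powr p)" by (rule powr_mult)
  also have "\<dots> \<le> 2 powr p * (a powr p + b powr p)"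
    by (intro mult_left_mono) (auto simp: max_def)
  finally show ?thesis .
qed

text \<open>Values up to \<open>l\<close> are bounded by the first summand; beyond \<open>l\<close>
  one has t = t^(1-p) t^p with t^(1-p) <= l^(1-p). Integrated over a set of finite measure, this
  turns L^p smallness into L^1 smallness.\<close>

lemma le_plus_powr:
  fixes t l p :: real
  assumes "0 \<le> t" "0 < l" "1 \<le> p"
  shows "t \<le> l + l powr (1 - p) * t powr p"
proof (cases "t \<le> l")
  case True then show ?thesis by (simp add: add_increasing2)
next
  case False
  then have t: "t > 0" "t \<ge> l" using assms by auto
  then have "t = t powr (1 - p) * t powr p" by (simp flip: powr_add)
  also have "\<dots> \<le> l powr (1 - p) * t powr p"
    using powr_mono2'[of "1 - p" l t] t assms by (intro mult_right_mono) auto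
  finally show ?thesis using assms by simp
qed

text \<open>\<open>Lp_tendsto\<close> rewritten for the sequence of differences, so that null
  sequences can be added, bounded and restricted without carrying their limits along.\<close>

definition Lp_null :: "real \<Rightarrow> 'a measure \<Rightarrow> (nat \<Rightarrow> 'a \<Rightarrow> 'b::euclidean_space) \<Rightarrow> bool" where
  "Lp_null p M f \<longleftrightarrow> (\<lambda>k. \<integral>\<^sup>+x. ennreal (norm (f k x) powr p) \<partial>M) \<longlonglongrightarrow> 0"

lemma Lp_tendsto_iff_null: "Lp_tendsto p M f g \<longleftrightarrow> Lp_null p M (\<lambda>k x. f k x - g x)"
  by (simp add: Lp_tendsto_def Lp_null_def)

lemma Lp_null_mono:
  assumes g: "Lp_null p M g" and "0 < p" "0 \<le> C"
    and le: "\<And>k. AE x in M. norm (f k x) \<le> C * norm (g k x)"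
    and gm: "\<And>k. g k \<in> borel_measurable M"
  shows "Lp_null p M f"
  unfolding Lp_null_def
proof (rule tendsto_sandwich[OF _ _ tendsto_const])
  show "(\<lambda>k. ennreal (C powr p) * (\<integral>\<^sup>+x. ennreal (norm (g k x) powr p) \<partial>M)) \<longlonglongrightarrow> 0"
    using ennreal_tendsto_cmult[OF _ g[unfolded Lp_null_def], of "ennreal (C powr p)"] by simp
  show "\<forall>\<^sub>F k in sequentially. (\<integral>\<^sup>+x. ennreal (norm (f k x) powr p) \<partial>M) \<le> ennreal (C powr p) * (\<integral>\<^sup>+x. ennreal (norm (g k x) powr p) \<partial>M)"
  proof (intro always_eventually allI)
    fix k
    have [measurable]: "g k \<in> borel_measurable M" by (rule gm)
    have "(\<integral>\<^sup>+x. ennreal (norm (f k x) powr p) \<partial>M) \<le> (\<integral>\<^sup>+x. ennreal (C powr p) * ennreal (norm (g k x) powr p) \<partial>M)"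
    proof (rule nn_integral_mono_AE, use le[of k] in eventually_elim)
      case (elim x)
      then have "norm (f k x) powr p \<le> (C * norm (g k x)) powr p" using assms by (intro powr_mono2) auto
      also have "\<dots> = C powr p * norm (g k x) powr p" by (rule powr_mult)
      finally show ?case by (simp flip: ennreal_mult)
    qed
    also have "\<dots> = ennreal (C powr p) * (\<integral>\<^sup>+x. ennreal (norm (g k x) powr p) \<partial>M)"
      by (rule nn_integral_cmult) measurable
    finally show "(\<integral>\<^sup>+x. ennreal (norm (f k x) powr p) \<partial>M) \<le> ennreal (C powr p) * (\<integral>\<^sup>+x. ennreal (norm (g k x) powr p) \<partial>M)" .
  qed
qed simp

lemma nn_integral_powr_add_le:
  fixes f g :: "'a \<Rightarrow> 'b::euclidean_space"
  assumes [measurable]: "f \<in> borel_measurable M" "g \<in> borel_measurable M" and "0 < p"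
  shows "(\<integral>\<^sup>+x. ennreal (norm (f x + g x) powr p) \<partial>M)
    \<le> ennreal (2 powr p) * ((\<integral>\<^sup>+x. ennreal (norm (f x) powr p) \<partial>M) + (\<integral>\<^sup>+x. ennreal (norm (g x) powr p) \<partial>M))"
proof -
  have "(\<integral>\<^sup>+x. ennreal (norm (f x + g x) powr p) \<partial>M)
    \<le> (\<integral>\<^sup>+x. ennreal (2 powr p) * (ennreal (norm (f x) powr p) + ennreal (norm (g x) powr p)) \<partial>M)"
  proof (rule nn_integral_mono)
    fix x
    have "norm (f x + g x) powr p \<le> (norm (f x) + norm (g x)) powr p"
      using assms by (intro powr_mono2 norm_triangle_ineq) auto
    also have "\<dots> \<le> 2 powr p * (norm (f x) powr p + norm (g x) powr p)"
      using assms by (intro powr_add_le) auto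
    finally show "ennreal (norm (f x + g x) powr p) \<le> ennreal (2 powr p) * (ennreal (norm (f x) powr p) + ennreal (norm (g x) powr p))"
      by (simp flip: ennreal_mult ennreal_plus)
  qed
  also have "\<dots> = ennreal (2 powr p) * (\<integral>\<^sup>+x. ennreal (norm (f x) powr p) + ennreal (norm (g x) powr p) \<partial>M)"
    by (rule nn_integral_cmult) measurable
  also have "(\<integral>\<^sup>+x. ennreal (norm (f x) powr p) + ennreal (norm (g x) powr p) \<partial>M)
     = (\<integral>\<^sup>+x. ennreal (norm (f x) powr p) \<partial>M) + (\<integral>\<^sup>+x. ennreal (norm (g x) powr p) \<partial>M)"
    by (rule nn_integral_add) measurable
  finally show ?thesis .
qed

lemma Lp_null_add:
  assumes f: "Lp_null p M f" and g: "Lp_null p M g" and p: "0 < p"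
    and fm: "\<And>k. f k \<in> borel_measurable M" and gm: "\<And>k. g k \<in> borel_measurable M"
  shows "Lp_null p M (\<lambda>k x. f k x + g k x)"
  unfolding Lp_null_def
proof (rule tendsto_sandwich[OF _ _ tendsto_const])
  have "(\<lambda>k. (\<integral>\<^sup>+x. ennreal (norm (f k x) powr p) \<partial>M) + (\<integral>\<^sup>+x. ennreal (norm (g k x) powr p) \<partial>M)) \<longlonglongrightarrow> 0 + 0"
    using f g unfolding Lp_null_def by (rule tendsto_add)
  from ennreal_tendsto_cmult[OF _ this, of "ennreal (2 powr p)"]
  show "(\<lambda>k. ennreal (2 powr p) * ((\<integral>\<^sup>+x. ennreal (norm (f k x) powr p) \<partial>M) + (\<integral>\<^sup>+x. ennreal (norm (g k x) powr p) \<partial>M))) \<longlonglongrightarrow> 0"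
    by simp
qed (use nn_integral_powr_add_le[OF fm gm p] in auto)

lemma Lp_null_subseq: "Lp_null p M f \<Longrightarrow> strict_mono r \<Longrightarrow> Lp_null p M (\<lambda>k. f (r k))"
  unfolding Lp_null_def using LIMSEQ_subseq_LIMSEQ[of _ 0 r] by (auto simp: o_def)

lemma Lp_null_dct:
  fixes f :: "nat \<Rightarrow> 'a \<Rightarrow> 'b::euclidean_space"
  assumes fm[measurable]: "\<And>k. f k \<in> borel_measurable M" and [measurable]: "w \<in> borel_measurable M"
    and "0 < p" and lim: "AE x in M. (\<lambda>k. f k x) \<longlonglongrightarrow> 0"
    and le: "\<And>k. AE x in M. norm (f k x) \<le> w x"
    and fin: "(\<integral>\<^sup>+x. ennreal (w x powr p) \<partial>M) < \<infinity>"
  shows "Lp_null p M f"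
proof -
  have "(\<lambda>k. \<integral>\<^sup>+x. ennreal (norm (f k x) powr p) \<partial>M) \<longlonglongrightarrow> (\<integral>\<^sup>+x. 0 \<partial>M)"
  proof (rule nn_integral_dominated_convergence[where w = "\<lambda>x. ennreal (w x powr p)"])
    show "AE x in M. ennreal (norm (f k x) powr p) \<le> ennreal (w x powr p)" for k
      using le[of k] by eventually_elim (use assms in \<open>auto intro!: ennreal_leI powr_mono2\<close>)
    show "AE x in M. (\<lambda>k. ennreal (norm (f k x) powr p)) \<longlonglongrightarrow> 0"
      using lim
    proof eventually_elim
      case (elim x)
      then have "(\<lambda>k. norm (f k x)) \<longlonglongrightarrow> 0" by (rule tendsto_norm_zero)
      then have "(\<lambda>k. norm (f k x) powr p) \<longlonglongrightarrow> 0 powr p"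
        using \<open>0 < p\<close> by (intro tendsto_powr') auto
      then have "(\<lambda>k. norm (f k x) powr p) \<longlonglongrightarrow> 0" by simp
      from tendsto_ennrealI[OF this] show ?case by simp
    qed
  qed (use fin in auto)
  then show ?thesis by (simp add: Lp_null_def)
qed

lemma Lp_null_AE_subseq:
  fixes f :: "nat \<Rightarrow> 'a \<Rightarrow> 'b::euclidean_space"
  assumes f: "Lp_null p M f" and fm[measurable]: "\<And>k. f k \<in> borel_measurable M" and p: "0 < p"
  obtains r :: "nat \<Rightarrow> nat" where "strict_mono r" "AE x in M. (\<lambda>k. f (r k) x) \<longlonglongrightarrow> 0"
proof -
  have "\<forall>\<^sub>F k in sequentially. (\<integral>\<^sup>+x. ennreal (norm (f k x) powr p) \<partial>M) < 1"
    using f unfolding Lp_null_def by (rule order_tendstoD) simp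
  then obtain m where m: "\<And>k. k \<ge> m \<Longrightarrow> (\<integral>\<^sup>+x. ennreal (norm (f k x) powr p) \<partial>M) < 1"
    by (auto simp: eventually_sequentially)
  \<comment> \<open>The first terms may have infinite integral; after the shift by \<open>m\<close>
    all terms are Bochner integrable, as the subsequence theorem for L^1 requires.\<close>
  let ?u = "\<lambda>k x. norm (f (k + m) x) powr p"
  have i: "integrable M (?u k)" for k
    using m[of "k + m"] by (intro integrableI_bounded) (auto intro: order_less_trans simp: ennreal_one_less_top less_top[symmetric])
  have "(\<lambda>k. \<integral>\<^sup>+x. ennreal (norm (f (k + m) x) powr p) \<partial>M) \<longlonglongrightarrow> 0"
    using LIMSEQ_ignore_initial_segment[OF f[unfolded Lp_null_def], of m] .
  then have "(\<lambda>k. ennreal (\<integral>x. norm (?u k x) \<partial>M)) \<longlonglongrightarrow> 0"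
    using nn_integral_eq_integral[OF i] by simp
  then have "(\<lambda>k. \<integral>x. norm (?u k x) \<partial>M) \<longlonglongrightarrow> 0"
    by (simp flip: ennreal_0)
  from tendsto_L1_AE_subseq[OF i this] obtain r :: "nat \<Rightarrow> nat"
    where r: "strict_mono r" "AE x in M. (\<lambda>k. ?u (r k) x) \<longlonglongrightarrow> 0" by blast
  show ?thesis
  proof (rule that[of "\<lambda>k. r k + m"])
    show "strict_mono (\<lambda>k. r k + m)" using r(1) by (auto simp: strict_mono_def)
    show "AE x in M. (\<lambda>k. f (r k + m) x) \<longlonglongrightarrow> 0"
      using r(2)
    proof eventually_elim
      case (elim x)
      then have "(\<lambda>k. (norm (f (r k + m) x) powr p) powr (1 / p)) \<longlonglongrightarrow> 0 powr (1 / p)"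
        using p by (intro tendsto_powr') auto
      then have "(\<lambda>k. norm (f (r k + m) x)) \<longlonglongrightarrow> 0" using p by (simp add: powr_powr)
      then show ?case by (rule tendsto_norm_zero_cancel)
    qed
  qed
qed

lemma Lp_null_imp_L1:
  fixes f :: "nat \<Rightarrow> 'a \<Rightarrow> 'b::euclidean_space"
  assumes f: "Lp_null p M f" and fm[measurable]: "\<And>k. f k \<in> borel_measurable M" and p: "1 \<le> p"
    and K[measurable]: "K \<in> sets M" and fin: "emeasure M K < \<infinity>"
  shows "(\<lambda>k. \<integral>\<^sup>+x. ennreal (norm (f k x)) * indicator K x \<partial>M) \<longlonglongrightarrow> 0"
proof (rule order_tendstoI)
  fix a :: ennreal assume "0 < a"
  obtain m where m: "emeasure M K = ennreal m" "m \<ge> 0" using fin by (cases "emeasure M K") auto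
  obtain e where e: "e > 0" "ennreal (2 * e) < a"
  proof (cases a)
    case (real r)
    then have "r > 0" using \<open>0 < a\<close> by simp
    then show ?thesis using real by (intro that[of "r / 3"]) (auto intro: ennreal_lessI)
  next
    case top
    then show ?thesis by (intro that[of 1]) auto
  qed
  \<comment> \<open>With this threshold the small values contribute at most \<open>e\<close> over
    the set \<open>K\<close> of measure \<open>m\<close>; the summand 1 covers
    \<open>m = 0\<close>.\<close>
  define l where "l = e / (m + 1)"
  have l: "l > 0" "l * m \<le> e" using e m by (auto simp: l_def field_simps)
  have "(\<lambda>k. ennreal (l powr (1 - p)) * (\<integral>\<^sup>+x. ennreal (norm (f k x) powr p) \<partial>M)) \<longlonglongrightarrow> ennreal (l powr (1 - p)) * 0"
    using f unfolding Lp_null_def by (intro ennreal_tendsto_cmult) auto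
  then have "\<forall>\<^sub>F k in sequentially. ennreal (l powr (1 - p)) * (\<integral>\<^sup>+x. ennreal (norm (f k x) powr p) \<partial>M) < ennreal e"
    using e by (intro order_tendstoD) auto
  then show "\<forall>\<^sub>F k in sequentially. (\<integral>\<^sup>+x. ennreal (norm (f k x)) * indicator K x \<partial>M) < a"
  proof eventually_elim
    case (elim k)
    have "(\<integral>\<^sup>+x. ennreal (norm (f k x)) * indicator K x \<partial>M)
       \<le> (\<integral>\<^sup>+x. ennreal l * indicator K x + ennreal (l powr (1 - p)) * ennreal (norm (f k x) powr p) \<partial>M)"
    proof (rule nn_integral_mono)
      fix x
      show "ennreal (norm (f k x)) * indicator K x \<le> ennreal l * indicator K x + ennreal (l powr (1 - p)) * ennreal (norm (f k x) powr p)"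
        using le_plus_powr[of "norm (f k x)" l p] l p
        by (cases "x \<in> K") (auto simp flip: ennreal_mult ennreal_plus)
    qed
    also have "\<dots> = (\<integral>\<^sup>+x. ennreal l * indicator K x \<partial>M) + (\<integral>\<^sup>+x. ennreal (l powr (1 - p)) * ennreal (norm (f k x) powr p) \<partial>M)"
      by (rule nn_integral_add) measurable
    also have "(\<integral>\<^sup>+x. ennreal l * indicator K x \<partial>M) = ennreal (l * m)"
      using l m by (simp add: nn_integral_cmult_indicator ennreal_mult)
    also have "(\<integral>\<^sup>+x. ennreal (l powr (1 - p)) * ennreal (norm (f k x) powr p) \<partial>M) = ennreal (l powr (1 - p)) * (\<integral>\<^sup>+x. ennreal (norm (f k x) powr p) \<partial>M)"
      by (rule nn_integral_cmult) measurable
    also have "ennreal (l * m) + ennreal (l powr (1 - p)) * (\<integral>\<^sup>+x. ennreal (norm (f k x) powr p) \<partial>M) \<le> ennreal e + ennreal e"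
      using elim l by (intro add_mono ennreal_leI) auto
    also have "\<dots> = ennreal (2 * e)" using e by (simp flip: ennreal_plus)
    finally show ?case using e by simp
  qed
qed simp

lemma Lp_nn_integral_finite:
  assumes "f \<in> Lp p M"
  shows "f \<in> borel_measurable M" "(\<integral>\<^sup>+x. ennreal (norm (f x) powr p) \<partial>M) < \<infinity>"
  using assms by (auto simp: Lp_def integrable_iff_bounded)

lemma LpI:
  fixes f :: "'a \<Rightarrow> 'b::euclidean_space"
  assumes [measurable]: "f \<in> borel_measurable M" and "(\<integral>\<^sup>+x. ennreal (norm (f x) powr p) \<partial>M) < \<infinity>"
  shows "f \<in> Lp p M"
  using assms by (auto simp: Lp_def integrable_iff_bounded)

lemma Lp_add:
  fixes f g :: "'a \<Rightarrow> 'b::euclidean_space"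
  assumes "f \<in> Lp p M" "g \<in> Lp p M" "0 < p"
  shows "(\<lambda>x. f x + g x) \<in> Lp p M"
proof (rule LpI)
  note f = Lp_nn_integral_finite[OF assms(1)] and g = Lp_nn_integral_finite[OF assms(2)]
  show "(\<lambda>x. f x + g x) \<in> borel_measurable M" using f(1) g(1) by measurable
  have "ennreal (2 powr p) * ((\<integral>\<^sup>+x. ennreal (norm (f x) powr p) \<partial>M) + (\<integral>\<^sup>+x. ennreal (norm (g x) powr p) \<partial>M)) < \<infinity>"
    using f(2) g(2) by (auto simp: ennreal_mult_less_top)
  with nn_integral_powr_add_le[OF f(1) g(1) assms(3)]
  show "(\<integral>\<^sup>+x. ennreal (norm (f x + g x) powr p) \<partial>M) < \<infinity>" by (rule order_le_less_trans)
qed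

lemma Lp_bound:
  fixes f :: "'a \<Rightarrow> 'b::euclidean_space" and g :: "'a \<Rightarrow> 'c::euclidean_space"
  assumes g: "g \<in> Lp p M" and fm: "f \<in> borel_measurable M" and "0 < p" "0 \<le> C"
    and le: "AE x in M. norm (f x) \<le> C * norm (g x)"
  shows "f \<in> Lp p M"
proof (rule LpI[OF fm])
  note [measurable] = Lp_nn_integral_finite(1)[OF g]
  have "(\<integral>\<^sup>+x. ennreal (norm (f x) powr p) \<partial>M) \<le> (\<integral>\<^sup>+x. ennreal (C powr p) * ennreal (norm (g x) powr p) \<partial>M)"
  proof (rule nn_integral_mono_AE, use le in eventually_elim)
    case (elim x)
    then have "norm (f x) powr p \<le> (C * norm (g x)) powr p" using assms by (intro powr_mono2) auto
    also have "\<dots> = C powr p * norm (g x) powr p" by (rule powr_mult)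
    finally show ?case by (simp flip: ennreal_mult)
  qed
  also have "\<dots> = ennreal (C powr p) * (\<integral>\<^sup>+x. ennreal (norm (g x) powr p) \<partial>M)"
    by (rule nn_integral_cmult) measurable
  also have "\<dots> < \<infinity>" using Lp_nn_integral_finite(2)[OF g] by (simp add: ennreal_mult_less_top)
  finally show "(\<integral>\<^sup>+x. ennreal (norm (f x) powr p) \<partial>M) < \<infinity>" .
qed

lemma Lp_locally_integrable:
  fixes f :: "real ^ 'n \<Rightarrow> 'b::euclidean_space"
  assumes f: "f \<in> Lp p (lebesgue_on D)" and p: "1 \<le> p" and D: "D \<in> sets lebesgue"
  shows "locally_integrable_on f D"
  unfolding locally_integrable_on_def
proof (intro allI impI, elim conjE)
  fix K :: "(real ^ 'n) set" assume K: "compact K" "K \<subseteq> D"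
  have KL: "K \<in> sets lebesgue" using K by (simp add: compact_imp_closed)
  have m: "f \<in> borel_measurable (lebesgue_on K)"
    using Lp_nn_integral_finite(1)[OF f] K by (auto intro: measurable_restrict_mono)
  show "integrable (lebesgue_on K) f"
  proof (rule integrableI_bounded[OF m])
    note [measurable] = m
    have "(\<integral>\<^sup>+x. ennreal (norm (f x)) \<partial>lebesgue_on K) \<le> (\<integral>\<^sup>+x. 1 + ennreal (norm (f x) powr p) \<partial>lebesgue_on K)"
      using le_plus_powr[of _ 1 p] p by (intro nn_integral_mono) (auto simp flip: ennreal_plus ennreal_1)
    also have "\<dots> = (\<integral>\<^sup>+x. 1 \<partial>lebesgue_on K) + (\<integral>\<^sup>+x. ennreal (norm (f x) powr p) \<partial>lebesgue_on K)"
      by (rule nn_integral_add) measurable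
    also have "(\<integral>\<^sup>+x. ennreal (norm (f x) powr p) \<partial>lebesgue_on K) \<le> (\<integral>\<^sup>+x. ennreal (norm (f x) powr p) \<partial>lebesgue_on D)"
      using KL D K by (auto simp: nn_integral_restrict_space indicator_def intro!: nn_integral_mono)
    also have "(\<integral>\<^sup>+x. 1 \<partial>lebesgue_on K) = emeasure lebesgue K" using KL by (simp add: emeasure_restrict_space)
    finally have "(\<integral>\<^sup>+x. ennreal (norm (f x)) \<partial>lebesgue_on K) \<le> emeasure lebesgue K + (\<integral>\<^sup>+x. ennreal (norm (f x) powr p) \<partial>lebesgue_on D)"
      by (simp add: add_left_mono)
    also have "\<dots> < \<infinity>"
      using Lp_nn_integral_finite(2)[OF f] emeasure_compact_finite[OF K(1)] K by (simp add: compact_imp_closed)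
    finally show "(\<integral>\<^sup>+x. ennreal (norm (f x)) \<partial>lebesgue_on K) < \<infinity>" .
  qed
qed

section \<open>Weak gradients of limits\<close>

lemma locally_integrable_on_diff:
  "locally_integrable_on f D \<Longrightarrow> locally_integrable_on g D \<Longrightarrow> locally_integrable_on (\<lambda>x. f x - g x) D"
  by (auto simp: locally_integrable_on_def)

lemma integrable_test_mult:
  fixes G :: "real ^ 'n \<Rightarrow> 'b::euclidean_space"
  assumes "\<psi> \<in> test_functions D" "locally_integrable_on G D" "D \<in> sets lebesgue"
  shows "integrable (lebesgue_on D) (\<lambda>x. \<psi> x *\<^sub>R G x)"
proof -
  obtain K where K: "smooth \<psi>" "compact K" "K \<subseteq> D" "\<forall>x. x \<notin> K \<longrightarrow> \<psi> x = 0" "\<forall>x. x \<notin> K \<longrightarrow> grad \<psi> x = 0"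
    by (rule test_functionE[OF assms(1)])
  note K = K[rule_format]
  have "integrable lebesgue (\<lambda>x. \<psi> x *\<^sub>R G x)"
    by (rule integrable_mult_compact[OF assms(2) K(2,3) smooth_continuous[OF K(1)] K(4) bounded_bilinear_scaleR])
  moreover have "indicator D x *\<^sub>R \<psi> x *\<^sub>R G x = \<psi> x *\<^sub>R G x" for x
    using K by (cases "x \<in> D") auto
  ultimately show ?thesis using assms(3) by (simp add: integrable_restrict_space del: scaleR_scaleR)
qed

lemma integrable_grad_test_mult:
  fixes u :: "real ^ 'n \<Rightarrow> real"
  assumes "\<psi> \<in> test_functions D" "locally_integrable_on u D" "D \<in> sets lebesgue"
  shows "integrable (lebesgue_on D) (\<lambda>x. u x *\<^sub>R grad \<psi> x)"
proof -
  obtain K where K: "smooth \<psi>" "compact K" "K \<subseteq> D" "\<forall>x. x \<notin> K \<longrightarrow> \<psi> x = 0" "\<forall>x. x \<notin> K \<longrightarrow> grad \<psi> x = 0"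
    by (rule test_functionE[OF assms(1)])
  note K = K[rule_format]
  have "integrable lebesgue (\<lambda>x. u x *\<^sub>R grad \<psi> x)"
    by (rule integrable_mult_compact[OF assms(2) K(2,3) smooth_grad_continuous[OF K(1)] K(5) bounded_bilinear.flip[OF bounded_bilinear_scaleR]])
  moreover have "indicator D x *\<^sub>R u x *\<^sub>R grad \<psi> x = u x *\<^sub>R grad \<psi> x" for x
    using K by (cases "x \<in> D") auto
  ultimately show ?thesis using assms(3) by (simp add: integrable_restrict_space del: scaleR_scaleR)
qed

lemma weak_gradient_unique:
  assumes D: "open D" and G: "has_weak_gradient D u G" and H: "has_weak_gradient D u H"
  shows "AE x in lebesgue_on D. G x = H x"
proof -
  have DL: "D \<in> sets lebesgue" using D by auto
  have loc: "locally_integrable_on (\<lambda>x. G x - H x) D"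
    using G H by (auto simp: has_weak_gradient_def intro: locally_integrable_on_diff)
  have "AE x in lebesgue_on D. (G x - H x) $ i = 0" for i
  proof (rule fundamental_lemma[OF D])
    show "locally_integrable_on (\<lambda>x. (G x - H x) $ i) D"
      using loc unfolding locally_integrable_on_def by (auto simp: cart_eq_inner_axis intro: integrable_inner_left)
    fix \<psi> assume \<psi>: "\<psi> \<in> test_functions D"
    have eq: "(LINT x|lebesgue_on D. \<psi> x *\<^sub>R G x) = (LINT x|lebesgue_on D. \<psi> x *\<^sub>R H x)"
    proof -
      have "- (LINT x|lebesgue_on D. \<psi> x *\<^sub>R G x) = - (LINT x|lebesgue_on D. \<psi> x *\<^sub>R H x)"
        using G H \<psi> unfolding has_weak_gradient_def by simp
      then show ?thesis by simp
    qed
    have "(LINT x|lebesgue_on D. \<psi> x *\<^sub>R (G x - H x)) = 0"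
    proof -
      have "integrable (lebesgue_on D) (\<lambda>x. \<psi> x *\<^sub>R G x)" "integrable (lebesgue_on D) (\<lambda>x. \<psi> x *\<^sub>R H x)"
        using G H by (auto simp: has_weak_gradient_def intro!: integrable_test_mult[OF \<psi>] DL)
      from Bochner_Integration.integral_diff[OF this] eq show ?thesis by (simp add: scaleR_diff_right)
    qed
    moreover have "(LINT x|lebesgue_on D. \<psi> x * (G x - H x) $ i) = (LINT x|lebesgue_on D. \<psi> x *\<^sub>R (G x - H x)) \<bullet> axis i 1"
      using integral_inner_left[of "axis i 1" "lebesgue_on D" "\<lambda>x. \<psi> x *\<^sub>R (G x - H x)"] integrable_test_mult[OF \<psi> loc DL]
      by (simp add: cart_eq_inner_axis)
    ultimately show "(LINT x|lebesgue_on D. \<psi> x * (G x - H x) $ i) = 0" by simp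
  qed
  then have "AE x in lebesgue_on D. \<forall>i. (G x - H x) $ i = 0" by (simp add: AE_all_countable)
  then show ?thesis by eventually_elim (simp add: vec_eq_iff)
qed

lemma weak_grad_has_weak_gradient:
  "has_weak_gradient D u G \<Longrightarrow> has_weak_gradient D u (weak_grad D u)"
  unfolding weak_grad_def by (rule someI[of "has_weak_gradient D u"])

lemma weak_grad_AE:
  "open D \<Longrightarrow> has_weak_gradient D u G \<Longrightarrow> AE x in lebesgue_on D. weak_grad D u x = G x"
  using weak_gradient_unique weak_grad_has_weak_gradient by blast

lemma smooth_borel_measurable:
  assumes "smooth f"
  shows "f \<in> borel_measurable (lebesgue_on D)" "grad f \<in> borel_measurable (lebesgue_on D)"
  using assms by (auto intro!: measurable_restrict_space1 continuous_imp_lebesgue_measurable smooth_continuous smooth_grad_continuous)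

text \<open>For fixed \<open>\<psi>\<close> both sides of integration by parts are continuous under
  L^1 convergence on the compact support of \<open>\<psi>\<close>, because \<open>\<psi>\<close> and
  its gradient are bounded. It identifies the weak gradient of anything approximated by smooth
  functions.\<close>

lemma weak_gradient_limit:
  fixes w :: "nat \<Rightarrow> real ^ 'n \<Rightarrow> real"
  assumes D: "open D" and u: "locally_integrable_on u D" and G: "locally_integrable_on G D"
    and um: "u \<in> borel_measurable (lebesgue_on D)" and Gm: "G \<in> borel_measurable (lebesgue_on D)"
    and w: "\<And>k. smooth (w k)"
    and lim: "\<And>K. compact K \<Longrightarrow> K \<subseteq> D \<Longrightarrow> (\<lambda>k. \<integral>\<^sup>+x. ennreal (norm (w k x - u x)) * indicator K x \<partial>lebesgue_on D) \<longlonglongrightarrow> 0"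
    and glim: "\<And>K. compact K \<Longrightarrow> K \<subseteq> D \<Longrightarrow> (\<lambda>k. \<integral>\<^sup>+x. ennreal (norm (grad (w k) x - G x)) * indicator K x \<partial>lebesgue_on D) \<longlonglongrightarrow> 0"
  shows "has_weak_gradient D u G"
  unfolding has_weak_gradient_def
proof (intro conjI ballI u G)
  have DL: "D \<in> sets lebesgue" using D by auto
  fix \<psi> assume \<psi>: "\<psi> \<in> test_functions D"
  obtain K where K: "smooth \<psi>" "compact K" "K \<subseteq> D" "\<forall>x. x \<notin> K \<longrightarrow> \<psi> x = 0" "\<forall>x. x \<notin> K \<longrightarrow> grad \<psi> x = 0"
    by (rule test_functionE[OF \<psi>])
  note K = K[rule_format]
  obtain B where B: "B > 0" "\<forall>x. \<bar>\<psi> x\<bar> \<le> B" "\<forall>x. norm (grad \<psi> x) \<le> B" by (rule test_function_bounded[OF \<psi>])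
  have wloc: "locally_integrable_on (w k) D" "locally_integrable_on (grad (w k)) D" for k
    using w by (auto intro!: locally_integrable_continuous smooth_continuous smooth_grad_continuous)
  have null: "(\<lambda>k. \<integral>\<^sup>+x. ennreal B * (ennreal (h k x) * indicator K x) \<partial>lebesgue_on D) \<longlonglongrightarrow> 0"
    if "(\<lambda>k. \<integral>\<^sup>+x. ennreal (h k x) * indicator K x \<partial>lebesgue_on D) \<longlonglongrightarrow> 0"
      and m: "\<And>k. h k \<in> borel_measurable (lebesgue_on D)" for h :: "nat \<Rightarrow> real ^ 'n \<Rightarrow> real"
  proof -
    have "K \<in> sets (lebesgue_on D)" using K DL by (auto simp: sets_restrict_space_iff compact_imp_closed)
    then have "(\<lambda>x. ennreal (h k x) * indicator K x) \<in> borel_measurable (lebesgue_on D)" for k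
      using m[of k] by (intro borel_measurable_times_ennreal borel_measurable_indicator) auto
    then show ?thesis using ennreal_tendsto_cmult[OF _ that(1), of "ennreal B"] by (simp add: nn_integral_cmult)
  qed
  note sm = smooth_borel_measurable[OF w, of _ D]
  have "(\<lambda>k. LINT x|lebesgue_on D. w k x *\<^sub>R grad \<psi> x) \<longlonglongrightarrow> (LINT x|lebesgue_on D. u x *\<^sub>R grad \<psi> x)"
  proof (rule tendsto_L1_int)
    show "(\<lambda>k. \<integral>\<^sup>+x. ennreal (norm (w k x *\<^sub>R grad \<psi> x - u x *\<^sub>R grad \<psi> x)) \<partial>lebesgue_on D) \<longlonglongrightarrow> 0"
    proof (rule tendsto_sandwich[OF _ _ tendsto_const null[OF lim[OF K(2,3)]]])
      show "\<forall>\<^sub>F k in sequentially. (\<integral>\<^sup>+x. ennreal (norm (w k x *\<^sub>R grad \<psi> x - u x *\<^sub>R grad \<psi> x)) \<partial>lebesgue_on D)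
          \<le> (\<integral>\<^sup>+x. ennreal B * (ennreal (norm (w k x - u x)) * indicator K x) \<partial>lebesgue_on D)"
      proof (intro always_eventually allI nn_integral_mono)
        fix k x
        show "ennreal (norm (w k x *\<^sub>R grad \<psi> x - u x *\<^sub>R grad \<psi> x)) \<le> ennreal B * (ennreal (norm (w k x - u x)) * indicator K x)"
        proof (cases "x \<in> K")
          case True
          have "norm (w k x *\<^sub>R grad \<psi> x - u x *\<^sub>R grad \<psi> x) \<le> B * norm (w k x - u x)"
            using B mult_left_mono[of "norm (grad \<psi> x)" B "norm (w k x - u x)"] by (simp flip: scaleR_diff_left add: mult.commute)
          then show ?thesis using True B by (simp flip: ennreal_mult)
        qed (simp add: K)
      qed
    qed (use sm um in \<open>auto intro!: borel_measurable_norm borel_measurable_diff\<close>)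
  qed (use \<psi> u wloc DL in \<open>auto intro: integrable_grad_test_mult\<close>)
  moreover have "(\<lambda>k. LINT x|lebesgue_on D. \<psi> x *\<^sub>R grad (w k) x) \<longlonglongrightarrow> (LINT x|lebesgue_on D. \<psi> x *\<^sub>R G x)"
  proof (rule tendsto_L1_int)
    show "(\<lambda>k. \<integral>\<^sup>+x. ennreal (norm (\<psi> x *\<^sub>R grad (w k) x - \<psi> x *\<^sub>R G x)) \<partial>lebesgue_on D) \<longlonglongrightarrow> 0"
    proof (rule tendsto_sandwich[OF _ _ tendsto_const null[OF glim[OF K(2,3)]]])
      show "\<forall>\<^sub>F k in sequentially. (\<integral>\<^sup>+x. ennreal (norm (\<psi> x *\<^sub>R grad (w k) x - \<psi> x *\<^sub>R G x)) \<partial>lebesgue_on D)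
          \<le> (\<integral>\<^sup>+x. ennreal B * (ennreal (norm (grad (w k) x - G x)) * indicator K x) \<partial>lebesgue_on D)"
      proof (intro always_eventually allI nn_integral_mono)
        fix k x
        show "ennreal (norm (\<psi> x *\<^sub>R grad (w k) x - \<psi> x *\<^sub>R G x)) \<le> ennreal B * (ennreal (norm (grad (w k) x - G x)) * indicator K x)"
        proof (cases "x \<in> K")
          case True
          have "norm (\<psi> x *\<^sub>R grad (w k) x - \<psi> x *\<^sub>R G x) \<le> B * norm (grad (w k) x - G x)"
            using B by (simp flip: scaleR_diff_right add: mult_right_mono)
          then show ?thesis using True B by (simp flip: ennreal_mult)
        qed (simp add: K)
      qed
    qed (use sm Gm in \<open>auto intro!: borel_measurable_norm borel_measurable_diff\<close>)
  qed (use \<psi> G wloc DL in \<open>auto intro: integrable_test_mult\<close>)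
  moreover have "(LINT x|lebesgue_on D. w k x *\<^sub>R grad \<psi> x) = - (LINT x|lebesgue_on D. \<psi> x *\<^sub>R grad (w k) x)" for k
  proof -
    have "indicator D x *\<^sub>R w k x *\<^sub>R grad \<psi> x = w k x *\<^sub>R grad \<psi> x" "indicator D x *\<^sub>R \<psi> x *\<^sub>R grad (w k) x = \<psi> x *\<^sub>R grad (w k) x" for x
      using K by (cases "x \<in> D"; auto)+
    then show ?thesis using integration_by_parts[OF w \<psi>, of k] DL by (simp add: integral_lebesgue_on_indicator del: scaleR_scaleR)
  qed
  ultimately have "(\<lambda>k. - (LINT x|lebesgue_on D. \<psi> x *\<^sub>R grad (w k) x)) \<longlonglongrightarrow> (LINT x|lebesgue_on D. u x *\<^sub>R grad \<psi> x)"
    "(\<lambda>k. LINT x|lebesgue_on D. \<psi> x *\<^sub>R grad (w k) x) \<longlonglongrightarrow> (LINT x|lebesgue_on D. \<psi> x *\<^sub>R G x)" by simp_all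
  from LIMSEQ_unique[OF this(1) tendsto_minus[OF this(2)]]
  show "(LINT x|lebesgue_on D. u x *\<^sub>R grad \<psi> x) = - (LINT x|lebesgue_on D. \<psi> x *\<^sub>R G x)" .
qed

text \<open>\<open>W1p_0\<close> is phrased with the arbitrarily chosen \<open>weak_grad\<close>.
  Here any candidate \<open>H\<close> for the limit of the gradients may be used, and it is returned
  as the weak gradient up to a null set.\<close>

lemma W1p_0_limit:
  fixes w :: "nat \<Rightarrow> real ^ 'n \<Rightarrow> real"
  assumes D: "open D" and p: "1 \<le> p" and w: "\<And>k. w k \<in> test_functions D"
    and \<psi>: "\<psi> \<in> Lp p (lebesgue_on D)" and H: "H \<in> Lp p (lebesgue_on D)"
    and lim: "Lp_tendsto p (lebesgue_on D) w \<psi>"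
    and glim: "Lp_tendsto p (lebesgue_on D) (\<lambda>k. grad (w k)) H"
  shows "\<psi> \<in> W1p_0 p D" "AE x in lebesgue_on D. weak_grad D \<psi> x = H x"
proof -
  have DL: "D \<in> sets lebesgue" using D by auto
  have ws: "smooth (w k)" for k using w test_functions_smooth by blast
  note wm = smooth_borel_measurable[OF ws, of _ D]
  note \<psi>m = Lp_nn_integral_finite(1)[OF \<psi>] and Hm = Lp_nn_integral_finite(1)[OF H]
  have fin: "K \<in> sets (lebesgue_on D)" "emeasure (lebesgue_on D) K < \<infinity>" if "compact K" "K \<subseteq> D" for K
    using that DL emeasure_compact_finite[OF that(1)]
    by (auto simp: sets_restrict_space_iff emeasure_restrict_space compact_imp_closed)
  have wg: "has_weak_gradient D \<psi> H"
  proof (rule weak_gradient_limit[OF D _ _ \<psi>m Hm ws])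
    show "locally_integrable_on \<psi> D" by (rule Lp_locally_integrable[OF \<psi> p DL])
    show "locally_integrable_on H D" by (rule Lp_locally_integrable[OF H p DL])
    fix K :: "(real ^ 'n) set" assume K: "compact K" "K \<subseteq> D"
    show "(\<lambda>k. \<integral>\<^sup>+x. ennreal (norm (w k x - \<psi> x)) * indicator K x \<partial>lebesgue_on D) \<longlonglongrightarrow> 0"
      by (rule Lp_null_imp_L1[OF lim[unfolded Lp_tendsto_iff_null] _ p fin[OF K]]) (use wm \<psi>m in measurable)
    show "(\<lambda>k. \<integral>\<^sup>+x. ennreal (norm (grad (w k) x - H x)) * indicator K x \<partial>lebesgue_on D) \<longlonglongrightarrow> 0"
      by (rule Lp_null_imp_L1[OF glim[unfolded Lp_tendsto_iff_null] _ p fin[OF K]]) (use wm Hm in measurable)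
  qed
  show ae: "AE x in lebesgue_on D. weak_grad D \<psi> x = H x" by (rule weak_grad_AE[OF D wg])
  \<comment> \<open>The chosen gradient agrees almost everywhere with the measurable
    \<open>H\<close>; measurability transfers because Lebesgue measure is complete.\<close>
  have wgm: "weak_grad D \<psi> \<in> borel_measurable (lebesgue_on D)"
  proof -
    have "AE x in lebesgue. indicator D x *\<^sub>R H x = indicator D x *\<^sub>R weak_grad D \<psi> x"
      using ae DL by (simp add: AE_restrict_space_iff) (auto elim!: eventually_mono simp: indicator_def)
    moreover have "(\<lambda>x. indicator D x *\<^sub>R H x) \<in> borel_measurable lebesgue"
      using Hm DL by (simp add: borel_measurable_restrict_space_iff)
    ultimately have "(\<lambda>x. indicator D x *\<^sub>R weak_grad D \<psi> x) \<in> borel_measurable lebesgue"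
      by (rule borel_measurable_AE[rotated])
    then show ?thesis using DL by (simp add: borel_measurable_restrict_space_iff)
  qed
  have wgL: "weak_grad D \<psi> \<in> Lp p (lebesgue_on D)"
    by (rule Lp_bound[OF H wgm, of 1]) (use p ae in \<open>auto elim: eventually_mono\<close>)
  have "Lp_tendsto p (lebesgue_on D) (\<lambda>k. grad (w k)) (weak_grad D \<psi>)"
  proof -
    have "(\<integral>\<^sup>+x. ennreal (norm (grad (w k) x - weak_grad D \<psi> x) powr p) \<partial>lebesgue_on D)
        = (\<integral>\<^sup>+x. ennreal (norm (grad (w k) x - H x) powr p) \<partial>lebesgue_on D)" for k
      using ae by (intro nn_integral_cong_AE) (auto elim: eventually_mono)
    then show ?thesis using glim by (simp add: Lp_tendsto_def)
  qed
  then show "\<psi> \<in> W1p_0 p D"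
    using \<psi> wg wgL w lim by (auto simp: W1p_0_def sobolev_def)
qed

section \<open>Hausdorff measure and its comparison with Lebesgue measure\<close>

section \<open>The Hausdorff outer measure\<close>

definition hausdorff_pre :: "real \<Rightarrow> real \<Rightarrow> (real ^ 'n) set \<Rightarrow> ennreal" where
  "hausdorff_pre s \<delta> A =
     (INF C\<in>{C :: nat \<Rightarrow> (real ^ 'n) set. (\<forall>i. bounded (C i) \<and> diameter (C i) \<le> \<delta>) \<and> A \<subseteq> (\<Union>i. C i)}.
       (\<Sum>i. ennreal (unit_ball_vol s * (diameter (C i) / 2) powr s)))"

lemma hausdorff_outer_eq: "hausdorff_outer s A = (SUP \<delta>\<in>{0<..}. hausdorff_pre s \<delta> A)"
  by (simp add: hausdorff_outer_def hausdorff_pre_def)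

lemma hausdorff_pre_le:
  assumes "\<And>i. bounded (C i)" "\<And>i. diameter (C i) \<le> \<delta>" "A \<subseteq> (\<Union>i. C i)"
  shows "hausdorff_pre s \<delta> A \<le> (\<Sum>i. ennreal (unit_ball_vol s * (diameter (C i) / 2) powr s))"
  unfolding hausdorff_pre_def by (rule INF_lower) (use assms in auto)

lemma hausdorff_pre_less:
  assumes "hausdorff_pre s \<delta> A < x"
  obtains C where "\<forall>i. bounded (C i) \<and> diameter (C i) \<le> \<delta>" "A \<subseteq> (\<Union>i. C i)"
    "(\<Sum>i. ennreal (unit_ball_vol s * (diameter (C i) / 2) powr s)) < x"
  using assms unfolding hausdorff_pre_def INF_less_iff by blast

lemma hausdorff_pre_mono: "A \<subseteq> B \<Longrightarrow> hausdorff_pre s \<delta> A \<le> hausdorff_pre s \<delta> B"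
  unfolding hausdorff_pre_def by (rule INF_superset_mono) auto

lemma hausdorff_pre_antimono: "\<delta> \<le> \<delta>' \<Longrightarrow> hausdorff_pre s \<delta>' A \<le> hausdorff_pre s \<delta> A"
  unfolding hausdorff_pre_def by (rule INF_superset_mono) (auto intro: order_trans)

lemma hausdorff_pre_le_outer: "0 < \<delta> \<Longrightarrow> hausdorff_pre s \<delta> A \<le> hausdorff_outer s A"
  unfolding hausdorff_outer_eq by (rule SUP_upper) auto

lemma hausdorff_outer_mono: "A \<subseteq> B \<Longrightarrow> hausdorff_outer s A \<le> hausdorff_outer s B"
  unfolding hausdorff_outer_eq by (rule SUP_mono) (use hausdorff_pre_mono in blast)

lemma hausdorff_outer_empty: "hausdorff_outer s ({} :: (real ^ 'n) set) = 0"
proof -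
  have "hausdorff_pre s \<delta> ({} :: (real ^ 'n) set) \<le> 0" if "\<delta> > 0" for \<delta>
    using hausdorff_pre_le[of "\<lambda>i. {}" \<delta> "{}" s] that by simp
  then show ?thesis unfolding hausdorff_outer_eq by (intro antisym SUP_least) auto
qed

lemma hausdorff_outer_UN_le:
  fixes A :: "nat \<Rightarrow> (real ^ 'n) set"
  shows "hausdorff_outer s (\<Union>i. A i) \<le> (\<Sum>i. hausdorff_outer s (A i))"
proof (cases "(\<Sum>i. hausdorff_outer s (A i)) = top")
  case False
  have fin: "hausdorff_outer s (A i) < top" for i
  proof -
    have "hausdorff_outer s (A i) \<le> (\<Sum>i. hausdorff_outer s (A i))"
      using sum_le_suminf[of "\<lambda>i. hausdorff_outer s (A i)" "{i}"] by simp
    then show ?thesis using False by (metis less_top order_le_less_trans)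
  qed
  let ?m = "\<lambda>C. ennreal (unit_ball_vol s * (diameter C / 2) powr s)"
  show ?thesis unfolding hausdorff_outer_eq[of s "\<Union>i. A i"]
  proof (rule SUP_least)
    fix \<delta> :: real assume "\<delta> \<in> {0<..}"
    then have \<delta>: "\<delta> > 0" by simp
    show "hausdorff_pre s \<delta> (\<Union>i. A i) \<le> (\<Sum>i. hausdorff_outer s (A i))"
    proof (rule ennreal_le_epsilon)
      fix e :: real assume e: "e > 0"
      \<comment> \<open>Nearly optimal coverings, with errors that add up to \<open>e\<close>.
        Finiteness of each outer measure makes the strict inequality possible.\<close>
      have "\<forall>i. \<exists>C. (\<forall>j. bounded (C j) \<and> diameter (C j) \<le> \<delta>) \<and> A i \<subseteq> (\<Union>j. C j) \<and>
          (\<Sum>j. ?m (C j)) \<le> hausdorff_outer s (A i) + ennreal (e * (1/2) ^ Suc i)"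
      proof
        fix i
        have "hausdorff_pre s \<delta> (A i) \<le> hausdorff_outer s (A i)" by (rule hausdorff_pre_le_outer[OF \<delta>])
        also have "\<dots> < hausdorff_outer s (A i) + ennreal (e * (1/2) ^ Suc i)"
        proof (cases "hausdorff_outer s (A i)")
          case (real r)
          have "ennreal r < ennreal (r + e * (1/2) ^ Suc i)" using real e
            by (intro ennreal_lessI) (auto intro: add_nonneg_pos)
          then show ?thesis using real e by (simp add: ennreal_plus del: power_Suc)
        next
          case top
          then show ?thesis using fin[of i] by simp
        qed
        finally obtain C where "\<forall>j. bounded (C j) \<and> diameter (C j) \<le> \<delta>" "A i \<subseteq> (\<Union>j. C j)"
          "(\<Sum>j. ?m (C j)) < hausdorff_outer s (A i) + ennreal (e * (1/2) ^ Suc i)"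
          by (rule hausdorff_pre_less)
        then show "\<exists>C. (\<forall>j. bounded (C j) \<and> diameter (C j) \<le> \<delta>) \<and> A i \<subseteq> (\<Union>j. C j) \<and>
          (\<Sum>j. ?m (C j)) \<le> hausdorff_outer s (A i) + ennreal (e * (1/2) ^ Suc i)"
          by (intro exI[of _ C] conjI) (assumption, assumption, rule less_imp_le)
      qed
      then obtain C where "\<forall>i. (\<forall>j. bounded (C i j) \<and> diameter (C i j) \<le> \<delta>) \<and> A i \<subseteq> (\<Union>j. C i j) \<and>
          (\<Sum>j. ?m (C i j)) \<le> hausdorff_outer s (A i) + ennreal (e * (1/2) ^ Suc i)"
        by (rule choice[THEN exE])
      then have C: "bounded (C i j)" "diameter (C i j) \<le> \<delta>" "A i \<subseteq> (\<Union>j. C i j)"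
          "(\<Sum>j. ?m (C i j)) \<le> hausdorff_outer s (A i) + ennreal (e * (1/2) ^ Suc i)" for i j by blast+
      let ?D = "\<lambda>n. case prod_decode n of (i, j) \<Rightarrow> C i j"
      have "hausdorff_pre s \<delta> (\<Union>i. A i) \<le> (\<Sum>n. ?m (?D n))"
      proof (rule hausdorff_pre_le)
        show "(\<Union>i. A i) \<subseteq> (\<Union>n. ?D n)"
        proof
          fix x assume "x \<in> (\<Union>i. A i)"
          then obtain i where "x \<in> A i" by blast
          then have "x \<in> (\<Union>j. C i j)" by (rule subsetD[OF C(3)])
          then obtain j where "x \<in> C i j" by (rule UN_E)
          then have "x \<in> ?D (prod_encode (i, j))" by simp
          then show "x \<in> (\<Union>n. ?D n)" by (rule UN_I[OF UNIV_I])
        qed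
      qed (simp_all add: C(1,2) split: prod.split)
      also have "\<dots> = (\<Sum>n. (\<lambda>(i, j). ?m (C i j)) (prod_decode n))"
        by (intro suminf_cong) (auto split: prod.split)
      also have "\<dots> = (\<Sum>i. \<Sum>j. ?m (C i j))"
        by (rule suminf_ennreal_2dimen) simp
      also have "\<dots> \<le> (\<Sum>i. hausdorff_outer s (A i) + ennreal (e * (1/2) ^ Suc i))"
        by (intro suminf_le C(4)) auto
      also have "\<dots> = (\<Sum>i. hausdorff_outer s (A i)) + (\<Sum>i. ennreal (e * (1/2) ^ Suc i))"
        by (rule suminf_add[symmetric]) auto
      also have "(\<Sum>i. ennreal (e * (1/2) ^ Suc i)) = ennreal e"
      proof (rule suminf_ennreal_eq)
        show "(\<lambda>i. e * (1/2) ^ Suc i) sums e" using sums_mult[OF power_half_series, of e] by simp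
      qed (use e in auto)
      finally show "hausdorff_pre s \<delta> (\<Union>i. A i) \<le> (\<Sum>i. hausdorff_outer s (A i)) + ennreal e" .
    qed
  qed
qed simp

lemma hausdorff_outer_measure_space: "outer_measure_space UNIV (hausdorff_outer s :: (real ^ 'n) set \<Rightarrow> ennreal)"
  unfolding outer_measure_space_def positive_def increasing_def countably_subadditive_def
  by (auto simp: hausdorff_outer_empty intro: hausdorff_outer_mono hausdorff_outer_UN_le)

text \<open>A covering set of diameter below \<open>d\<close> cannot meet both \<open>A\<close> and
  \<open>B\<close>, so every fine covering of the union splits into separate coverings of the two.
  Only fine scales matter, since the premeasures increase as the scale shrinks.\<close>

lemma hausdorff_outer_metric:
  fixes A B :: "(real ^ 'n) set"
  assumes d: "d > 0" "\<And>x y. x \<in> A \<Longrightarrow> y \<in> B \<Longrightarrow> d \<le> dist x y"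
  shows "hausdorff_outer s A + hausdorff_outer s B \<le> hausdorff_outer s (A \<union> B)"
proof -
  let ?m = "\<lambda>C. ennreal (unit_ball_vol s * (diameter C / 2) powr s)"
  have small: "hausdorff_pre s \<delta> A + hausdorff_pre s \<delta> B \<le> hausdorff_pre s \<delta> (A \<union> B)" if \<delta>: "0 < \<delta>" "\<delta> < d" for \<delta>
    unfolding hausdorff_pre_def[of s \<delta> "A \<union> B"]
  proof (rule INF_greatest)
    fix C assume "C \<in> {C :: nat \<Rightarrow> (real ^ 'n) set. (\<forall>i. bounded (C i) \<and> diameter (C i) \<le> \<delta>) \<and> A \<union> B \<subseteq> (\<Union>i. C i)}"
    then have C: "\<And>i. bounded (C i)" "\<And>i. diameter (C i) \<le> \<delta>" "A \<union> B \<subseteq> (\<Union>i. C i)" by auto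
    define CA where "CA = (\<lambda>i. if C i \<inter> A \<noteq> {} then C i else {})"
    define CB where "CB = (\<lambda>i. if C i \<inter> B \<noteq> {} then C i else {})"
    have "hausdorff_pre s \<delta> A \<le> (\<Sum>i. ?m (CA i))"
      by (rule hausdorff_pre_le) (use C \<delta> in \<open>auto simp: CA_def\<close>, blast)
    moreover have "hausdorff_pre s \<delta> B \<le> (\<Sum>i. ?m (CB i))"
      by (rule hausdorff_pre_le) (use C \<delta> in \<open>auto simp: CB_def\<close>, blast)
    ultimately have "hausdorff_pre s \<delta> A + hausdorff_pre s \<delta> B \<le> (\<Sum>i. ?m (CA i)) + (\<Sum>i. ?m (CB i))"
      by (rule add_mono)
    also have "\<dots> = (\<Sum>i. ?m (CA i) + ?m (CB i))" by (rule suminf_add) auto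
    also have "\<dots> \<le> (\<Sum>i. ?m (C i))"
    proof (intro suminf_le)
      fix i
      have "C i \<inter> A = {} \<or> C i \<inter> B = {}"
      proof (rule ccontr)
        assume "\<not> ?thesis"
        then obtain x y where "x \<in> C i" "x \<in> A" "y \<in> C i" "y \<in> B" by auto
        then show False using diameter_bounded_bound[OF C(1), of x i y] C(2)[of i] d(2)[of x y] \<delta> by simp
      qed
      then show "?m (CA i) + ?m (CB i) \<le> ?m (C i)" by (auto simp: CA_def CB_def)
    qed auto
    finally show "hausdorff_pre s \<delta> A + hausdorff_pre s \<delta> B \<le> (\<Sum>i. ?m (C i))" .
  qed
  \<comment> \<open>Independent scales for the two summands allow the two suprema to be taken one
    after the other.\<close>
  have le: "hausdorff_pre s \<delta>1 A + hausdorff_pre s \<delta>2 B \<le> hausdorff_outer s (A \<union> B)" if "0 < \<delta>1" "0 < \<delta>2" for \<delta>1 \<delta>2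
  proof -
    define \<delta> where "\<delta> = min (min \<delta>1 \<delta>2) (d / 2)"
    have \<delta>: "0 < \<delta>" "\<delta> < d" "\<delta> \<le> \<delta>1" "\<delta> \<le> \<delta>2" using that d(1) by (auto simp: \<delta>_def)
    have "hausdorff_pre s \<delta>1 A + hausdorff_pre s \<delta>2 B \<le> hausdorff_pre s \<delta> A + hausdorff_pre s \<delta> B"
      using \<delta> by (intro add_mono hausdorff_pre_antimono)
    also have "\<dots> \<le> hausdorff_outer s (A \<union> B)"
      using small[OF \<delta>(1,2)] hausdorff_pre_le_outer[OF \<delta>(1)] by (rule order_trans)
    finally show ?thesis .
  qed
  have "hausdorff_outer s A + hausdorff_pre s \<delta>2 B \<le> hausdorff_outer s (A \<union> B)" if "0 < \<delta>2" for \<delta>2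
    unfolding hausdorff_outer_eq[of s A]
    by (subst ennreal_SUP_add_left[symmetric]) (use le that in \<open>auto intro!: SUP_least\<close>)
  then have "hausdorff_pre s \<delta>2 B + hausdorff_outer s A \<le> hausdorff_outer s (A \<union> B)" if "0 < \<delta>2" for \<delta>2
    using that by (simp add: add.commute)
  then have "hausdorff_outer s B + hausdorff_outer s A \<le> hausdorff_outer s (A \<union> B)"
    unfolding hausdorff_outer_eq[of s B]
    by (subst ennreal_SUP_add_left[symmetric]) (auto intro!: SUP_least)
  then show ?thesis by (simp add: add.commute)
qed

lemma suminf_ennreal_tail_tendsto_0:
  fixes f :: "nat \<Rightarrow> ennreal"
  assumes "(\<Sum>i. f i) < top"
  shows "(\<lambda>n. \<Sum>i. f (i + n)) \<longlonglongrightarrow> 0"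
proof -
  have fin: "f i < top" for i
    using sum_le_suminf[of f "{i}"] assms by (simp add: order_le_less_trans)
  define g where "g = (\<lambda>i. enn2real (f i))"
  have fg: "f i = ennreal (g i)" "0 \<le> g i" for i using fin[of i] by (auto simp: g_def)
  have sg: "summable g"
    using assms by (intro summable_suminf_not_top) (auto simp: fg)
  have "(\<Sum>i. f (i + n)) = ennreal (suminf g - sum g {..<n})" for n
  proof -
    have "(\<Sum>i. f (i + n)) = ennreal (\<Sum>i. g (i + n))"
      unfolding fg(1) using sg by (intro suminf_ennreal2) (auto simp: fg(2) summable_iff_shift)
    then show ?thesis using suminf_minus_initial_segment[OF sg, of n] by simp
  qed
  moreover have "(\<lambda>n. ennreal (suminf g - sum g {..<n})) \<longlonglongrightarrow> ennreal (suminf g - suminf g)"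
    by (intro tendsto_ennrealI tendsto_diff tendsto_const summable_LIMSEQ sg)
  ultimately show ?thesis by simp
qed

text \<open>The Caratheodory criterion: \<open>A - F\<close> is exhausted by the sets \<open>R n\<close> at distance at least
  \<open>1 / (n + 1)\<close> from \<open>F\<close>, and the shells \<open>R (k + 1) - R k\<close> of equal parity are at positive
  distance from each other.\<close>

lemma hausdorff_outer_caratheodory:
  fixes A F :: "(real ^ 'n) set"
  assumes F: "closed F"
  shows "hausdorff_outer s (A \<inter> F) + hausdorff_outer s (A - F) \<le> hausdorff_outer s A"
\<comment> \<open>The distance \<open>infdist\<close> to the empty set is 0 by default, so the
  exhaustion by distance would fail there; an infinite right-hand side is trivial.\<close>
proof (cases "F = {} \<or> hausdorff_outer s A = top")
  case False
  let ?H = "hausdorff_outer s :: (real ^ 'n) set \<Rightarrow> ennreal"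
  from False have ne: "F \<noteq> {}" and fin: "?H A < top" by (auto simp: less_top)
  define R where "R n = {x \<in> A. inverse (real (Suc n)) \<le> infdist x F}" for n
  define S where "S n = R (Suc n) - R n" for n
  have Rmono: "R m \<subseteq> R n" if "m \<le> n" for m n
  proof
    fix x assume "x \<in> R m"
    moreover have "inverse (real (Suc n)) \<le> inverse (real (Suc m))" using that by simp
    ultimately show "x \<in> R n" unfolding R_def using order_trans by blast
  qed
  \<comment> \<open>Points of \<open>S m\<close> lie outside \<open>R m\<close>, hence closer to
    \<open>F\<close> than \<open>1 / (m + 1)\<close>, while points of \<open>R n\<close> are at
    distance at least \<open>1 / (n + 1)\<close>; the gap between these two distances separates the
    sets.\<close>
  have sep: "\<exists>d>0. \<forall>x\<in>S m. \<forall>y\<in>R n. d \<le> dist x y" if "n < m" for m n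
  proof (intro exI conjI ballI)
    show "0 < inverse (real (Suc n)) - inverse (real (Suc m))" using that by simp
    fix x y assume "x \<in> S m" "y \<in> R n"
    then have "infdist x F < inverse (real (Suc m))" "inverse (real (Suc n)) \<le> infdist y F"
      by (auto simp: S_def R_def)
    moreover have "infdist y F \<le> infdist x F + dist x y" using infdist_triangle[of y F x] by (simp add: dist_commute)
    ultimately show "inverse (real (Suc n)) - inverse (real (Suc m)) \<le> dist x y" by linarith
  qed
  have SR: "S n \<subseteq> R (Suc n)" for n by (auto simp: S_def)
  have SA: "S n \<subseteq> A" "R n \<subseteq> A" for n by (auto simp: S_def R_def)
  have par: "(\<Sum>k<n. ?H (S (2 * k + j))) \<le> ?H (\<Union>k<n. S (2 * k + j))" for n j
  proof (induction n)
    case (Suc n)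
    have sub: "(\<Union>k<n. S (2 * k + j)) \<subseteq> R (2 * n + j - 1)" if "n > 0"
    proof (rule UN_least)
      fix k assume k: "k \<in> {..<n}"
      have "S (2 * k + j) \<subseteq> R (Suc (2 * k + j))" by (rule SR)
      also have "\<dots> \<subseteq> R (2 * n + j - 1)" using k by (intro Rmono) auto
      finally show "S (2 * k + j) \<subseteq> R (2 * n + j - 1)" .
    qed
    have "\<exists>d>0. \<forall>x\<in>S (2 * n + j). \<forall>y\<in>(\<Union>k<n. S (2 * k + j)). d \<le> dist x y"
    proof (cases "n = 0")
      case True then show ?thesis by (intro exI[of _ 1]) auto
    next
      case False
      then have "2 * n + j - 1 < 2 * n + j" by simp
      from sep[OF this] obtain d where "d > 0" "\<forall>x\<in>S (2 * n + j). \<forall>y\<in>R (2 * n + j - 1). d \<le> dist x y" by blast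
      then show ?thesis using sub False by (intro exI[of _ d]) auto
    qed
    then obtain d where "d > 0" "\<forall>x\<in>S (2 * n + j). \<forall>y\<in>(\<Union>k<n. S (2 * k + j)). d \<le> dist x y" by blast
    then have "?H (S (2 * n + j)) + ?H (\<Union>k<n. S (2 * k + j)) \<le> ?H (S (2 * n + j) \<union> (\<Union>k<n. S (2 * k + j)))"
      by (intro hausdorff_outer_metric) auto
    then show ?case using Suc by (simp add: lessThan_Suc add.commute) (meson add_left_mono order_trans)
  qed (simp add: hausdorff_outer_empty)
  have "(\<Sum>k. ?H (S (2 * k + j))) \<le> ?H A" for j
  proof (rule suminf_le_const)
    show "(\<Sum>k<n. ?H (S (2 * k + j))) \<le> ?H A" for n
      using par[where n = n and j = j] by (rule order_trans) (use SA in \<open>auto intro!: hausdorff_outer_mono\<close>)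
  qed simp
  note parts = this
  \<comment> \<open>The even and the odd shells each contribute at most \<open>?H A\<close>, so the
    whole series is finite and its tails tend to 0.\<close>
  have "(\<Sum>k<n. ?H (S k)) \<le> ?H A + ?H A" for n
  proof -
    have "(\<Sum>k<n. ?H (S k)) \<le> (\<Sum>k<2 * n. ?H (S k))" by (rule sum_mono2) auto
    also have "\<dots> = (\<Sum>k<n. ?H (S (2 * k + 0))) + (\<Sum>k<n. ?H (S (2 * k + 1)))"
      by (induction n) (auto simp: algebra_simps)
    also have "\<dots> \<le> (\<Sum>k. ?H (S (2 * k + 0))) + (\<Sum>k. ?H (S (2 * k + 1)))"
      by (intro add_mono sum_le_suminf) auto
    also have "\<dots> \<le> ?H A + ?H A" by (intro add_mono parts)
    finally show ?thesis .
  qed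
  then have "(\<Sum>k. ?H (S k)) \<le> ?H A + ?H A" by (intro suminf_le_const) auto
  also have "\<dots> < top" using fin by simp
  finally have tail: "(\<lambda>n. \<Sum>k. ?H (S (k + n))) \<longlonglongrightarrow> 0" by (rule suminf_ennreal_tail_tendsto_0)
  have cover: "A - F \<subseteq> R n \<union> (\<Union>k. S (k + n))" for n
  proof
    fix x assume x: "x \<in> A - F"
    then have "infdist x F > 0" using F ne by (simp add: infdist_pos_not_in_closed)
    then obtain m where m: "inverse (real (Suc m)) < infdist x F" using reals_Archimedean by blast
    then have "x \<in> R m" using x by (simp add: R_def)
    then have ex: "\<exists>m. x \<in> R m" by blast
    define l where "l = (LEAST m. x \<in> R m)"
    have l: "x \<in> R l" unfolding l_def by (rule LeastI_ex[OF ex])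
    show "x \<in> R n \<union> (\<Union>k. S (k + n))"
    proof (cases "l \<le> n")
      case True then show ?thesis using l Rmono by blast
    next
      case False
      then obtain k where k: "l = Suc (k + n)" by (metis add.commute less_imp_Suc_add not_le add_Suc_right)
      have "x \<notin> R (k + n)" using not_less_Least[of "k + n" "\<lambda>m. x \<in> R m"] k by (auto simp: l_def)
      then show ?thesis using l k by (auto simp: S_def)
    qed
  qed
  \<comment> \<open>\<open>R n\<close> keeps a positive distance from \<open>F\<close>, so metric
    additivity applies to it; the shells beyond \<open>n\<close> cost only a tail of the
    series.\<close>
  have bound: "?H (A \<inter> F) + ?H (A - F) \<le> ?H A + (\<Sum>k. ?H (S (k + n)))" for n
  proof -
    have "?H (A - F) \<le> ?H (R n \<union> (\<Union>k. S (k + n)))" by (rule hausdorff_outer_mono[OF cover])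
    also have "\<dots> \<le> ?H (R n) + (\<Sum>k. ?H (S (k + n)))"
    proof -
      let ?T = "\<lambda>k. case k of 0 \<Rightarrow> R n | Suc k \<Rightarrow> S (k + n)"
      have "R n \<union> (\<Union>k. S (k + n)) = (\<Union>k. ?T k)"
        by (auto split: nat.splits)
      then have "?H (R n \<union> (\<Union>k. S (k + n))) \<le> (\<Sum>k. ?H (?T k))" using hausdorff_outer_UN_le[of s ?T] by simp
      also have "\<dots> = ?H (R n) + (\<Sum>k. ?H (S (k + n)))"
        using suminf_offset[of "\<lambda>k. ?H (?T k)" 1] by simp
      finally show ?thesis .
    qed
    finally have "?H (A \<inter> F) + ?H (A - F) \<le> (?H (A \<inter> F) + ?H (R n)) + (\<Sum>k. ?H (S (k + n)))"
      by (simp add: add.assoc add_left_mono)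
    also have "?H (A \<inter> F) + ?H (R n) \<le> ?H ((A \<inter> F) \<union> R n)"
    proof (rule hausdorff_outer_metric)
      show "0 < inverse (real (Suc n))" by simp
      fix x y assume "x \<in> A \<inter> F" "y \<in> R n"
      then show "inverse (real (Suc n)) \<le> dist x y"
        using infdist_le[of x F y] by (auto simp: R_def dist_commute)
    qed
    also have "\<dots> \<le> ?H A" by (rule hausdorff_outer_mono) (use SA in auto)
    finally show ?thesis by (simp add: add_right_mono)
  qed
  have "(\<lambda>n. ?H A + (\<Sum>k. ?H (S (k + n)))) \<longlonglongrightarrow> ?H A + 0" by (intro tendsto_add tendsto_const tail)
  from tendsto_lowerbound[OF this always_eventually] bound show ?thesis by simp
qed (auto simp: hausdorff_outer_empty)

text \<open>\<open>measure_of\<close> yields the zero measure unless its set function is countably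
  additive on the given sets. Closed sets satisfy the Caratheodory criterion and generate the Borel
  sets, so additivity holds and the surface measure is the intended one.\<close>

lemma emeasure_hausdorff:
  assumes A: "A \<in> sets (borel :: (real ^ 'n) measure)"
  shows "emeasure (measure_of UNIV (sets borel) (hausdorff_outer s :: (real ^ 'n) set \<Rightarrow> ennreal)) A = hausdorff_outer s A"
proof -
  let ?H = "hausdorff_outer s :: (real ^ 'n) set \<Rightarrow> ennreal"
  interpret U: sigma_algebra UNIV "UNIV :: (real ^ 'n) set set" using sigma_algebra_Pow[of UNIV] by simp
  have ms: "measure_space UNIV (lambda_system UNIV UNIV ?H) ?H"
    using U.caratheodory_lemma[OF hausdorff_outer_measure_space] .
  then interpret L: sigma_algebra UNIV "lambda_system UNIV UNIV ?H" by (simp add: measure_space_def)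
  have "F \<in> lambda_system UNIV UNIV ?H" if F: "closed F" for F
  proof -
    have "?H (F \<inter> X) + ?H ((UNIV - F) \<inter> X) = ?H X" for X
    proof (rule antisym)
      show "?H (F \<inter> X) + ?H ((UNIV - F) \<inter> X) \<le> ?H X"
        using hausdorff_outer_caratheodory[OF F, of s X] by (simp add: Int_commute Diff_eq)
      let ?T = "\<lambda>k::nat. if k = 0 then F \<inter> X else if k = 1 then (UNIV - F) \<inter> X else {}"
      have "?H X \<le> ?H (\<Union>k. ?T k)"
      proof (rule hausdorff_outer_mono, rule subsetI)
        fix x assume "x \<in> X"
        then have "x \<in> ?T 0 \<or> x \<in> ?T 1" by auto
        then show "x \<in> (\<Union>k. ?T k)" by blast
      qed
      also have "\<dots> \<le> (\<Sum>k. ?H (?T k))" by (rule hausdorff_outer_UN_le)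
      also have "\<dots> = (\<Sum>k\<in>{0,1}. ?H (?T k))" by (rule suminf_finite) (auto simp: hausdorff_outer_empty)
      finally show "?H X \<le> ?H (F \<inter> X) + ?H ((UNIV - F) \<inter> X)" by simp
    qed
    then show ?thesis by (simp add: lambda_system_def)
  qed
  then have "sigma_sets UNIV (Collect closed) \<subseteq> lambda_system UNIV UNIV ?H"
    by (intro L.sigma_sets_subset) auto
  then have "sets borel \<subseteq> lambda_system UNIV UNIV ?H" by (simp add: borel_eq_closed)
  then have "measure_space UNIV (sets borel) ?H"
    by (rule measure_down[OF ms sets.sigma_algebra_axioms[of borel, simplified]])
  then show ?thesis
    using A unfolding measure_space_def
    by (intro emeasure_measure_of_sigma) auto
qed

lemma emeasure_surface_measure:
  assumes "A \<in> sets borel" "A \<subseteq> frontier \<Omega>"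
  shows "emeasure (surface_measure \<Omega>) A = hausdorff_outer (real CARD('n) - 1) (A :: (real ^ 'n) set)"
  using assms by (simp add: surface_measure_def emeasure_restrict_space emeasure_hausdorff sets_restrict_space_iff frontier_closed borel_closed)

section \<open>Slabs over the boundary\<close>

text \<open>Sweeping a set of diameter at most \<open>d\<close> along \<open>e\<close> over length
  \<open>\<tau>\<close> gives a tube covered by about tau/d balls of radius comparable to
  \<open>d\<close>, of total volume comparable to tau d^(N-1). This exchanges the exponent N - 1 of
  the surface for a volume.\<close>

lemma slab_cover:
  fixes C :: "(real ^ 'n) set" and e :: "real ^ 'n"
  assumes e: "norm e = 1" and C: "bounded C" "diameter C \<le> d" and d: "0 < d" "d \<le> \<tau>" and N: "2 \<le> CARD('n)"
  shows "\<exists>B\<in>sets borel. {x. \<exists>t\<in>{0..\<tau>}. x - t *\<^sub>R e \<in> C} \<subseteq> B \<and>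
    emeasure lborel B \<le> ennreal (2 * 3 ^ CARD('n) * unit_ball_vol (real CARD('n)) * \<tau> * d powr (real CARD('n) - 1))"
proof (cases "C = {}")
  case False
  then obtain c where c: "c \<in> C" by auto
  define m where "m = nat \<lfloor>\<tau> / d\<rfloor>"
  have m: "real m \<le> \<tau> / d" "\<tau> / d < real m + 1" using d by (auto simp: m_def)
  \<comment> \<open>One \<open>d\<close> accounts for the diameter of \<open>C\<close> and one for
    rounding the shift to a multiple of \<open>d\<close>; the third makes the inequality strict for
    open balls.\<close>
  let ?b = "\<lambda>j. ball (c + (real j * d) *\<^sub>R e) (3 * d)"
  let ?B = "\<Union>j\<in>{..m}. ?b j"
  let ?V = "unit_ball_vol (real CARD('n))"
  have "{x. \<exists>t\<in>{0..\<tau>}. x - t *\<^sub>R e \<in> C} \<subseteq> ?B"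
  proof safe
    fix x t assume t: "t \<in> {0..\<tau>}" "x - t *\<^sub>R e \<in> C"
    define j where "j = nat \<lfloor>t / d\<rfloor>"
    have j: "real j \<le> t / d" "t / d < real j + 1" using d t by (auto simp: j_def)
    have "t / d \<le> \<tau> / d" using t d by (simp add: divide_right_mono)
    then have "j \<le> m" unfolding j_def m_def by (intro nat_mono floor_mono)
    have "norm (x - t *\<^sub>R e - c) \<le> d"
      using diameter_bounded_bound[OF C(1) t(2) c] C(2) by (simp add: dist_norm)
    moreover have "norm ((t - real j * d) *\<^sub>R e) \<le> d"
    proof -
      have "\<bar>t - real j * d\<bar> \<le> d" using j d by (simp add: field_simps abs_le_iff)
      then show ?thesis by (simp add: e)
    qed
    ultimately have "norm ((x - t *\<^sub>R e - c) + (t - real j * d) *\<^sub>R e) \<le> d + d" by (rule norm_triangle_mono)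
    also have "(x - t *\<^sub>R e - c) + (t - real j * d) *\<^sub>R e = x - (c + (real j * d) *\<^sub>R e)" by (simp add: algebra_simps)
    finally have "x \<in> ?b j" using d by (simp add: dist_norm norm_minus_commute)
    then show "x \<in> ?B" using \<open>j \<le> m\<close> by blast
  qed
  moreover have "emeasure lborel ?B \<le> ennreal (2 * 3 ^ CARD('n) * ?V * \<tau> * d powr (real CARD('n) - 1))"
  proof -
    have "emeasure lborel ?B \<le> (\<Sum>j\<in>{..m}. emeasure lborel (?b j))" by (rule emeasure_subadditive_finite) auto
    also have "\<dots> = ennreal (real (Suc m) * (?V * (3 * d) ^ CARD('n)))"
      using d by (simp add: emeasure_ball ennreal_of_nat_eq_real_of_nat ennreal_mult'')
    also have "\<dots> \<le> ennreal (2 * 3 ^ CARD('n) * ?V * \<tau> * d powr (real CARD('n) - 1))"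
    proof (rule ennreal_leI)
      have "d \<noteq> 0" using d by simp
      have dn: "d ^ CARD('n) = d * d powr (real CARD('n) - 1)"
        using d N by (simp add: powr_diff powr_realpow)
      \<comment> \<open>\<open>d \<le> \<tau>\<close> lets the extra ball be absorbed by the factor
        2.\<close>
      have "real (Suc m) \<le> 2 * (\<tau> / d)"
      proof -
        have "1 \<le> \<tau> / d" using d by (simp add: le_divide_eq)
        then show ?thesis using m(1) by simp
      qed
      then have "real (Suc m) * (?V * (3 * d) ^ CARD('n)) \<le> (2 * (\<tau> / d)) * (?V * (3 * d) ^ CARD('n))"
        using d by (intro mult_right_mono) auto
      also have "\<dots> = 2 * 3 ^ CARD('n) * ?V * \<tau> * d powr (real CARD('n) - 1)"
        unfolding power_mult_distrib dn using \<open>d \<noteq> 0\<close> by simp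
      finally show "real (Suc m) * (?V * (3 * d) ^ CARD('n)) \<le> 2 * 3 ^ CARD('n) * ?V * \<tau> * d powr (real CARD('n) - 1)" .
    qed
    finally show ?thesis .
  qed
  ultimately show ?thesis by (intro bexI[of _ ?B] conjI) auto
qed (intro bexI[of _ "{}"], auto)

lemma ennreal_mult_plus:
  fixes a x y :: real
  assumes "0 \<le> a" "0 \<le> x" "0 \<le> y"
  shows "ennreal (a * x + y) = ennreal a * ennreal x + ennreal y"
  using assms by (simp add: ennreal_mult ennreal_plus)

text \<open>\<open>slab_cover\<close> is applied to each member of an efficient covering of
  \<open>A\<close> at scale \<open>\<tau>\<close> and the volumes are summed. \<open>K\<close> is
  obtained before \<open>e\<close>, \<open>\<tau>\<close>, \<open>T\<close> and \<open>A\<close>, so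
  it depends on the dimension alone.\<close>

lemma slab_measure:
  assumes N: "2 \<le> CARD('n)"
  obtains K where "K > 0"
    "\<forall>e \<tau> T A. norm (e :: real ^ 'n) = 1 \<longrightarrow> 0 < \<tau> \<longrightarrow> T \<in> sets borel \<longrightarrow> (\<forall>x\<in>T. \<exists>t\<in>{0..\<tau>}. x - t *\<^sub>R e \<in> A) \<longrightarrow>
      emeasure lborel T \<le> ennreal (K * \<tau>) * hausdorff_outer (real CARD('n) - 1) A"
proof -
  define s where "s = real CARD('n) - 1"
  have s: "s \<ge> 1" using N by (simp add: s_def)
  define W where "W = 2 * 3 ^ CARD('n) * unit_ball_vol (real CARD('n))"
  have W: "W > 0" by (simp add: W_def)
  define v where "v = unit_ball_vol s / 2 powr s"
  have v: "v > 0" using s by (simp add: v_def)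
  have m: "unit_ball_vol s * (x / 2) powr s = v * x powr s" if "x \<ge> 0" for x
    using that by (simp add: v_def powr_divide)
  show ?thesis
  proof (rule that[of "W / v"], use W v in simp, intro allI impI)
    fix e :: "real ^ 'n" and \<tau> :: real and T A
    assume e: "norm e = 1" and \<tau>: "0 < \<tau>" and T: "T \<in> sets borel" and cov: "\<forall>x\<in>T. \<exists>t\<in>{0..\<tau>}. x - t *\<^sub>R e \<in> A"
    let ?h = "hausdorff_pre s \<tau> A"
    have main: "emeasure lborel T \<le> ennreal (W / v * \<tau>) * y + ennreal \<epsilon>"
      if y: "?h < y" and \<epsilon>: "\<epsilon> > 0" for y \<epsilon>
    proof -
      obtain C where C: "\<forall>i. bounded (C i) \<and> diameter (C i) \<le> \<tau>" "A \<subseteq> (\<Union>i. C i)"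
        "(\<Sum>i. ennreal (unit_ball_vol s * (diameter (C i) / 2) powr s)) < y"
        by (rule hausdorff_pre_less[OF y])
      define \<eta> where "\<eta> = \<epsilon> / (W * \<tau>)"
      have \<eta>: "\<eta> > 0" using \<epsilon> W \<tau> by (simp add: \<eta>_def)
      \<comment> \<open>Covering sets of diameter 0 contribute nothing to the Hausdorff sum, but the
        segments they sweep out need balls of positive radius. The substitute radii are at most 1,
        hence not increased by the power \<open>s \<ge> 1\<close>, and their tubes have total volume
        at most \<open>\<epsilon>\<close>.\<close>
      define d where "d i = (if diameter (C i) > 0 then diameter (C i) else min \<tau> (min 1 (\<eta> * (1/2) ^ Suc i)))" for i :: nat
      have dpos: "0 < d i" "d i \<le> \<tau>" "diameter (C i) \<le> d i" for i
      proof -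
        have "0 \<le> diameter (C i)" using C(1) by (intro diameter_ge_0) auto
        moreover have "0 < \<eta> * (1/2) ^ Suc i" using \<eta> by simp
        ultimately show "0 < d i" "d i \<le> \<tau>" "diameter (C i) \<le> d i"
          using C(1) \<tau> by (auto simp: d_def simp del: power_Suc)
      qed
      have dle: "d i powr s \<le> diameter (C i) powr s + \<eta> * (1/2) ^ Suc i" for i
      proof (cases "diameter (C i) > 0")
        case True then show ?thesis using \<eta> by (simp add: d_def)
      next
        case False
        then have "d i \<le> 1" "d i \<le> \<eta> * (1/2) ^ Suc i" by (auto simp: d_def)
        moreover have "d i powr s \<le> d i powr 1" using \<open>d i \<le> 1\<close> dpos(1)[of i] s by (intro powr_mono') auto
        ultimately show ?thesis using dpos(1)[of i] by (simp add: add_increasing)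
      qed
      have "\<forall>i. \<exists>B\<in>sets borel. {x. \<exists>t\<in>{0..\<tau>}. x - t *\<^sub>R e \<in> C i} \<subseteq> B \<and> emeasure lborel B \<le> ennreal (W * \<tau> * d i powr s)"
        unfolding W_def s_def by (intro allI slab_cover[OF e _ dpos(3) dpos(1,2) N]) (use C in auto)
      then obtain B where B: "\<forall>i. B i \<in> sets borel \<and> {x. \<exists>t\<in>{0..\<tau>}. x - t *\<^sub>R e \<in> C i} \<subseteq> B i \<and> emeasure lborel (B i) \<le> ennreal (W * \<tau> * d i powr s)"
        unfolding Bex_def by (rule choice[THEN exE]) 
      then have B: "B i \<in> sets borel" "{x. \<exists>t\<in>{0..\<tau>}. x - t *\<^sub>R e \<in> C i} \<subseteq> B i" "emeasure lborel (B i) \<le> ennreal (W * \<tau> * d i powr s)" for i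
        by blast+
      have "T \<subseteq> (\<Union>i. B i)"
      proof
        fix x assume "x \<in> T"
        then obtain t where t: "t \<in> {0..\<tau>}" "x - t *\<^sub>R e \<in> A" using cov by blast
        then obtain i where "x - t *\<^sub>R e \<in> C i" using C(2) by blast
        then have "x \<in> B i" using t(1) B(2)[of i] by blast
        then show "x \<in> (\<Union>i. B i)" by (rule UN_I[OF UNIV_I])
      qed
      then have "emeasure lborel T \<le> emeasure lborel (\<Union>i. B i)" by (intro emeasure_mono) (use B(1) in auto)
      also have "\<dots> \<le> (\<Sum>i. emeasure lborel (B i))" by (intro emeasure_subadditive_countably) (use B(1) in auto)
      also have "\<dots> \<le> (\<Sum>i. ennreal (W / v * \<tau>) * ennreal (unit_ball_vol s * (diameter (C i) / 2) powr s) + ennreal (\<epsilon> * (1/2) ^ Suc i))"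
      proof (intro suminf_le)
        fix i
        have "W * \<tau> * d i powr s \<le> W * \<tau> * (diameter (C i) powr s + \<eta> * (1/2) ^ Suc i)"
          using W \<tau> by (intro mult_left_mono dle) auto
        also have "\<dots> = W / v * \<tau> * (unit_ball_vol s * (diameter (C i) / 2) powr s) + \<epsilon> * (1/2) ^ Suc i"
          using W \<tau> v C(1) m[OF diameter_ge_0, of "C i"] by (simp add: \<eta>_def distrib_left)
        finally have "ennreal (W * \<tau> * d i powr s) \<le> ennreal (W / v * \<tau> * (unit_ball_vol s * (diameter (C i) / 2) powr s) + \<epsilon> * (1/2) ^ Suc i)"
          by (rule ennreal_leI)
        also have "\<dots> = ennreal (W / v * \<tau>) * ennreal (unit_ball_vol s * (diameter (C i) / 2) powr s) + ennreal (\<epsilon> * (1/2) ^ Suc i)"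
          using W \<tau> v s \<epsilon> by (intro ennreal_mult_plus) auto
        finally show "emeasure lborel (B i) \<le> ennreal (W / v * \<tau>) * ennreal (unit_ball_vol s * (diameter (C i) / 2) powr s) + ennreal (\<epsilon> * (1/2) ^ Suc i)"
          using B(3)[of i] by (rule order_trans[rotated])
      qed auto
      also have "\<dots> = ennreal (W / v * \<tau>) * (\<Sum>i. ennreal (unit_ball_vol s * (diameter (C i) / 2) powr s)) + (\<Sum>i. ennreal (\<epsilon> * (1/2) ^ Suc i))"
        by (subst suminf_add[symmetric]) (auto simp: ennreal_suminf_cmult simp del: power_Suc)
      also have "(\<Sum>i. ennreal (\<epsilon> * (1/2) ^ Suc i)) = ennreal \<epsilon>"
      proof (rule suminf_ennreal_eq)
        show "(\<lambda>i. \<epsilon> * (1/2) ^ Suc i) sums \<epsilon>" using sums_mult[OF power_half_series, of \<epsilon>] by simp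
      qed (use \<epsilon> in auto)
      also have "ennreal (W / v * \<tau>) * (\<Sum>i. ennreal (unit_ball_vol s * (diameter (C i) / 2) powr s)) \<le> ennreal (W / v * \<tau>) * y"
        using C(3) by (intro mult_left_mono) auto
      finally show ?thesis by (simp add: add_right_mono)
    qed
    have "emeasure lborel T \<le> ennreal (W / v * \<tau>) * ?h"
    proof (cases ?h)
      case top
      then show ?thesis using W v \<tau> by (simp add: ennreal_mult_top)
    next
      case (real r)
      show ?thesis
      proof (rule ennreal_le_epsilon)
        fix \<epsilon> :: real assume \<epsilon>: "\<epsilon> > 0"
        \<comment> \<open>Half of the error pays for exceeding the premeasure strictly, the other
          half for the covering sets of diameter 0.\<close>
        define \<delta> where "\<delta> = \<epsilon> / 2 / (W / v * \<tau>)"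
        have \<delta>: "\<delta> > 0" "W / v * \<tau> * \<delta> = \<epsilon> / 2" using \<epsilon> W v \<tau> by (auto simp: \<delta>_def)
        have "?h < ennreal (r + \<delta>)" using real \<delta> by (auto intro: ennreal_lessI)
        from main[OF this, of "\<epsilon> / 2"] \<epsilon>
        have "emeasure lborel T \<le> ennreal (W / v * \<tau>) * ennreal (r + \<delta>) + ennreal (\<epsilon> / 2)" by simp
        also have "\<dots> = ennreal (W / v * \<tau> * (r + \<delta>) + \<epsilon> / 2)"
          using W v \<tau> \<delta> real \<epsilon> by (subst ennreal_mult[symmetric]) (auto simp: ennreal_plus[symmetric] simp del: ennreal_plus)
        also have "W / v * \<tau> * (r + \<delta>) + \<epsilon> / 2 = W / v * \<tau> * r + \<epsilon>" by (simp only: distrib_left \<delta>(2))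
        also have "ennreal (W / v * \<tau> * r + \<epsilon>) = ennreal (W / v * \<tau>) * ?h + ennreal \<epsilon>"
          unfolding real(2) using W v \<tau> real(1) \<epsilon> by (intro ennreal_mult_plus) auto
        finally show "emeasure lborel T \<le> ennreal (W / v * \<tau>) * ?h + ennreal \<epsilon>" .
      qed
    qed
    also have "\<dots> \<le> ennreal (W / v * \<tau>) * hausdorff_outer s A"
      by (intro mult_left_mono hausdorff_pre_le_outer \<tau>) auto
    finally show "emeasure lborel T \<le> ennreal (W / v * \<tau>) * hausdorff_outer (real CARD('n) - 1) A"
      by (simp add: s_def)
  qed
qed

section \<open>From vanishing trace to approximation from inside the domain\<close>

section \<open>Differences along segments\<close>

text \<open>The convex function t^p lies above its tangent at \<open>a\<close>; as a product bound
  this is Young's inequality for the exponents p and p/(p-1).\<close>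

lemma powr_tangent:
  fixes t a p :: real
  assumes "0 \<le> t" "0 < a" "1 \<le> p"
  shows "p * t * a powr (p - 1) \<le> t powr p + (p - 1) * a powr p"
proof (cases "p = 1")
  case True then show ?thesis using assms by simp
next
  case False
  then have p: "p > 1" using assms by simp
  define q where "q = p / (p - 1)"
  have q: "q > 1" "1 / p + 1 / q = 1" "(p - 1) * q = p" using p by (auto simp: q_def field_simps)
  have "t * a powr (p - 1) \<le> t powr p / p + (a powr (p - 1)) powr q / q"
    using p q assms by (intro Youngs_inequality) auto
  also have "(a powr (p - 1)) powr q = a powr p" by (simp add: powr_powr q)
  finally have "p * (t * a powr (p - 1)) \<le> p * (t powr p / p + a powr p / q)"
    using p by (intro mult_left_mono) auto
  also have "\<dots> = t powr p + (p - 1) * a powr p" using p by (simp add: q_def distrib_left)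
  finally show ?thesis by (simp add: mult.assoc)
qed

text \<open>The fundamental theorem of calculus along the segment bounds the difference by the
  integral of |grad g|; Jensen's inequality moves the power inside and produces the factor
  b^(p-1).\<close>

lemma segment_powr_bound:
  fixes g :: "real ^ 'n \<Rightarrow> real"
  assumes g: "smooth g" and e: "norm e = 1" and b: "0 \<le> b" and p: "1 \<le> p"
  shows "ennreal (\<bar>g x - g (x - b *\<^sub>R e)\<bar> powr p)
    \<le> ennreal (b powr (p - 1)) * (\<integral>\<^sup>+s. ennreal (norm (grad g (x - s *\<^sub>R e)) powr p) * indicator {0..b} s \<partial>lborel)"
proof (cases "b = 0")
  case False
  then have b: "b > 0" using b by simp
  define n where "n s = norm (grad g (x - s *\<^sub>R e))" for s :: real
  have gc: "continuous_on UNIV (\<lambda>s. grad g (x - s *\<^sub>R e))"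
    by (intro continuous_on_compose2[OF smooth_grad_continuous[OF g, of UNIV]] continuous_intros) auto
  then have nc: "continuous_on UNIV n" unfolding n_def by (intro continuous_intros)
  have npc: "continuous_on UNIV (\<lambda>s. n s powr p)"
    using nc p by (intro continuous_on_powr') (auto simp: n_def)
  have int: "integrable lborel (\<lambda>s. indicator {0..b} s *\<^sub>R f s)" if "continuous_on UNIV f" for f :: "real \<Rightarrow> real"
    using that by (intro borel_integrable_compact) (auto intro: continuous_on_subset)
  have der: "((\<lambda>s. g (x - s *\<^sub>R e)) has_vector_derivative - (grad g (x - s *\<^sub>R e) \<bullet> e)) (at s within {0..b})" for s
  proof -
    have "((\<lambda>s. g (x - s *\<^sub>R e)) has_derivative (\<lambda>h. grad g (x - s *\<^sub>R e) \<bullet> (- (h *\<^sub>R e)))) (at s)"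
      by (rule has_derivative_compose[OF _ smooth_has_grad[OF g], of "\<lambda>s. x - s *\<^sub>R e"]) (auto intro!: derivative_eq_intros)
    moreover have "(\<lambda>h. grad g (x - s *\<^sub>R e) \<bullet> (- (h *\<^sub>R e))) = (\<lambda>h. h *\<^sub>R - (grad g (x - s *\<^sub>R e) \<bullet> e))"
      by (simp add: fun_eq_iff)
    ultimately show ?thesis
      unfolding has_vector_derivative_def by (metis has_derivative_at_withinI)
  qed
  have "(LINT s|lborel. indicator {0..b} s *\<^sub>R (- (grad g (x - s *\<^sub>R e) \<bullet> e))) = g (x - b *\<^sub>R e) - g (x - 0 *\<^sub>R e)"
    using b der by (intro integral_FTC_Icc continuous_intros continuous_on_subset[OF gc]) auto
  then have "\<bar>g x - g (x - b *\<^sub>R e)\<bar> = norm (LINT s|lborel. indicator {0..b} s *\<^sub>R (- (grad g (x - s *\<^sub>R e) \<bullet> e)))"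
    by simp
  also have "\<dots> \<le> (LINT s|lborel. indicator {0..b} s *\<^sub>R n s)"
  proof (rule order_trans[OF integral_norm_bound], rule integral_mono)
    show "integrable lborel (\<lambda>s. norm (indicator {0..b} s *\<^sub>R (- (grad g (x - s *\<^sub>R e) \<bullet> e))))"
      by (rule integrable_norm[OF int]) (intro continuous_intros gc)
    show "integrable lborel (\<lambda>s. indicator {0..b} s *\<^sub>R n s)" by (rule int[OF nc])
    show "norm (indicator {0..b} s *\<^sub>R (- (grad g (x - s *\<^sub>R e) \<bullet> e))) \<le> indicator {0..b} s *\<^sub>R n s" for s
      using Cauchy_Schwarz_ineq2[of "grad g (x - s *\<^sub>R e)" e] by (simp add: n_def e indicator_def)
  qed
  finally have le: "\<bar>g x - g (x - b *\<^sub>R e)\<bar> \<le> (LINT s|lborel. indicator {0..b} s *\<^sub>R n s)" (is "_ \<le> ?I") .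
  have I0: "0 \<le> ?I" by (intro integral_nonneg_AE always_eventually) (auto simp: n_def)
  let ?J = "LINT s|lborel. indicator {0..b} s *\<^sub>R (n s powr p)"
  have IJ: "?I powr p \<le> b powr (p - 1) * ?J"
  proof (cases "?I = 0")
    case True
    have "0 \<le> ?J" by (intro integral_nonneg_AE always_eventually) auto
    then show ?thesis using True by simp
  next
    case False
    \<comment> \<open>The mean of \<open>n\<close> over the segment: integrating the tangent
      inequality at the mean is the proof of Jensen's inequality.\<close>
    define A where "A = ?I / b"
    have A: "A > 0" "?I = b * A" using False I0 b by (auto simp: A_def)
    have "(LINT s|lborel. (p * A powr (p - 1)) * (indicator {0..b} s *\<^sub>R n s))
       \<le> (LINT s|lborel. indicator {0..b} s *\<^sub>R (n s powr p) + (p - 1) * A powr p * indicator {0..b} s)"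
    proof (rule integral_mono)
      show "(p * A powr (p - 1)) * (indicator {0..b} s *\<^sub>R n s) \<le> indicator {0..b} s *\<^sub>R (n s powr p) + (p - 1) * A powr p * indicator {0..b} s" for s
        using powr_tangent[of "n s" A p] A p by (simp add: indicator_def n_def mult_ac)
      show "integrable lborel (\<lambda>s. (p * A powr (p - 1)) * (indicator {0..b} s *\<^sub>R n s))"
        by (rule integrable_mult_right[OF int[OF nc]])
      show "integrable lborel (\<lambda>s. indicator {0..b} s *\<^sub>R (n s powr p) + (p - 1) * A powr p * indicator {0..b} s)"
        using b by (intro Bochner_Integration.integrable_add int[OF npc] integrable_mult_right integrable_real_indicator)
          (auto simp: emeasure_lborel_Icc)
    qed
    also have "\<dots> = ?J + (p - 1) * A powr p * b"
      using int[OF npc] b by (subst Bochner_Integration.integral_add) auto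
    also have "(LINT s|lborel. (p * A powr (p - 1)) * (indicator {0..b} s *\<^sub>R n s)) = p * A powr (p - 1) * ?I" by simp
    also have "p * A powr (p - 1) * ?I = p * A powr p * b"
      using A by (simp add: powr_mult_base mult_ac powr_diff)
    finally have "b * A powr p \<le> ?J" by (simp add: algebra_simps)
    then have "b powr (p - 1) * (b * A powr p) \<le> b powr (p - 1) * ?J" by (intro mult_left_mono) auto
    also have "b powr (p - 1) * (b * A powr p) = ?I powr p"
      using A b by (simp add: powr_mult powr_diff)
    finally show ?thesis .
  qed
  have "\<bar>g x - g (x - b *\<^sub>R e)\<bar> powr p \<le> ?I powr p" using le p by (intro powr_mono2) auto
  also note IJ
  finally have "ennreal (\<bar>g x - g (x - b *\<^sub>R e)\<bar> powr p) \<le> ennreal (b powr (p - 1) * ?J)" by (rule ennreal_leI)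
  also have "\<dots> = ennreal (b powr (p - 1)) * ennreal ?J" by (rule ennreal_mult') simp
  also have "ennreal ?J = (\<integral>\<^sup>+s. ennreal (indicator {0..b} s *\<^sub>R (n s powr p)) \<partial>lborel)"
    by (rule nn_integral_eq_integral[symmetric, OF int[OF npc]]) auto
  also have "\<dots> = (\<integral>\<^sup>+s. ennreal (norm (grad g (x - s *\<^sub>R e)) powr p) * indicator {0..b} s \<partial>lborel)"
    by (intro nn_integral_cong) (auto simp: n_def indicator_def)
  finally show ?thesis .
qed simp

text \<open>After exchanging the integrals, for each \<open>s\<close> the inner one is a translate
  of the integral over \<open>V\<close>. The endpoint \<open>s = c x\<close> is exempted as a null
  set because in the application the segment ends there on the boundary, outside
  \<open>V\<close>.\<close>

lemma nn_integral_segment_le: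
  fixes G :: "real ^ 'n \<Rightarrow> ennreal"
  assumes [measurable]: "G \<in> borel_measurable borel" "V \<in> sets borel" and U[measurable]: "U \<in> sets borel"
    and b: "0 \<le> b" and UV: "\<And>x s. x \<in> U \<Longrightarrow> s \<in> {0..c x} \<Longrightarrow> s \<le> b \<and> (s < c x \<longrightarrow> x - s *\<^sub>R e \<in> V)"
  shows "(\<integral>\<^sup>+x. (\<integral>\<^sup>+s. G (x - s *\<^sub>R e) * indicator {0..c x} s \<partial>lborel) * indicator U x \<partial>lborel)
     \<le> ennreal b * (\<integral>\<^sup>+x. G x * indicator V x \<partial>lborel)"
proof -
  have "(\<integral>\<^sup>+x. (\<integral>\<^sup>+s. G (x - s *\<^sub>R e) * indicator {0..c x} s \<partial>lborel) * indicator U x \<partial>lborel)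
     \<le> (\<integral>\<^sup>+x. (\<integral>\<^sup>+s. G (x - s *\<^sub>R e) * indicator V (x - s *\<^sub>R e) * indicator {0..b} s \<partial>lborel) \<partial>lborel)"
  proof (rule nn_integral_mono)
    fix x
    show "(\<integral>\<^sup>+s. G (x - s *\<^sub>R e) * indicator {0..c x} s \<partial>lborel) * indicator U x
        \<le> (\<integral>\<^sup>+s. G (x - s *\<^sub>R e) * indicator V (x - s *\<^sub>R e) * indicator {0..b} s \<partial>lborel)"
    proof (cases "x \<in> U")
      case True
      have "AE s in lborel. s \<noteq> c x" using AE_lborel_singleton[of "c x"] by simp
      then have "AE s in lborel. G (x - s *\<^sub>R e) * indicator {0..c x} s \<le> G (x - s *\<^sub>R e) * indicator V (x - s *\<^sub>R e) * indicator {0..b} s"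
      proof eventually_elim
        case (elim s)
        then show ?case using UV[OF True, of s] by (auto simp: indicator_def)
      qed
      then show ?thesis using True by (simp add: nn_integral_mono_AE)
    qed simp
  qed
  also have "\<dots> = (\<integral>\<^sup>+s. (\<integral>\<^sup>+x. G (x - s *\<^sub>R e) * indicator V (x - s *\<^sub>R e) * indicator {0..b} s \<partial>lborel) \<partial>lborel)"
    by (rule lborel_pair.Fubini') measurable
  also have "\<dots> = (\<integral>\<^sup>+s. (\<integral>\<^sup>+x. G x * indicator V x \<partial>lborel) * indicator {0..b} s \<partial>lborel)"
  proof (rule nn_integral_cong)
    fix s
    have "(\<integral>\<^sup>+x. G (x - s *\<^sub>R e) * indicator V (x - s *\<^sub>R e) * indicator {0..b} s \<partial>lborel)
       = (\<integral>\<^sup>+x. G (x - s *\<^sub>R e) * indicator V (x - s *\<^sub>R e) \<partial>lborel) * indicator {0..b} s"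
      by (rule nn_integral_multc) measurable
    also have "(\<integral>\<^sup>+x. G (x - s *\<^sub>R e) * indicator V (x - s *\<^sub>R e) \<partial>lborel) = (\<integral>\<^sup>+x. G x * indicator V x \<partial>lborel)"
      using nn_integral_lborel_translate[of "\<lambda>x. G x * indicator V x" "- (s *\<^sub>R e)"] by simp
    finally show "(\<integral>\<^sup>+x. G (x - s *\<^sub>R e) * indicator V (x - s *\<^sub>R e) * indicator {0..b} s \<partial>lborel)
       = (\<integral>\<^sup>+x. G x * indicator V x \<partial>lborel) * indicator {0..b} s" .
  qed
  also have "\<dots> = (\<integral>\<^sup>+x. G x * indicator V x \<partial>lborel) * ennreal b"
    using b by (subst nn_integral_cmult_indicator) auto
  finally show ?thesis by (simp add: mult.commute)
qed

section \<open>Lipschitz charts and the collar estimate\<close>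

text \<open>The function \<open>\<beta>\<close> is the signed height above the graph that bounds \<open>D\<close> near \<open>x\<close>; the
  exterior of a domain has the chart \<open>- \<beta>\<close>, \<open>- e\<close>.\<close>

definition lipschitz_chart ::
    "(real ^ 'n) set \<Rightarrow> (real ^ 'n) set \<Rightarrow> real ^ 'n \<Rightarrow> real \<Rightarrow> real ^ 'n \<Rightarrow> (real ^ 'n \<Rightarrow> real) \<Rightarrow> real \<Rightarrow> bool" where
  "lipschitz_chart D S x r e \<beta> L \<longleftrightarrow> 0 < r \<and> norm e = 1 \<and> 0 < L \<and>
     (\<forall>y z. \<bar>\<beta> y - \<beta> z\<bar> \<le> L * norm (y - z)) \<and> (\<forall>y t. \<beta> (y + t *\<^sub>R e) = \<beta> y + t) \<and>
     (\<forall>y\<in>ball x r. (y \<in> D \<longleftrightarrow> 0 < \<beta> y) \<and> (y \<in> S \<longleftrightarrow> \<beta> y = 0))"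

lemma lipschitz_chart_continuous:
  assumes "lipschitz_chart D S x r e \<beta> L" shows "continuous_on UNIV \<beta>"
proof -
  have "L-lipschitz_on UNIV \<beta>"
    using assms by (auto simp: lipschitz_chart_def lipschitz_on_def dist_norm)
  then show ?thesis by (rule lipschitz_on_continuous_on)
qed

lemma borel_measurable_surface:
  fixes h :: "real ^ 'n \<Rightarrow> 'b::topological_space"
  assumes "h \<in> borel_measurable borel"
  shows "h \<in> borel_measurable (surface_measure \<Omega>)"
proof -
  let ?\<mu> = "measure_of UNIV (sets borel) (hausdorff_outer (real CARD('n) - 1) :: (real ^ 'n) set \<Rightarrow> ennreal)"
  have "sets ?\<mu> = sets borel" using sets.sigma_sets_eq[of "borel :: (real ^ 'n) measure"] by simp
  then have "borel_measurable ?\<mu> = (borel_measurable borel :: (real ^ 'n \<Rightarrow> 'b) set)"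
    by (rule measurable_cong_sets[OF _ refl])
  then have "h \<in> borel_measurable ?\<mu>" using assms by (simp only:)
  then show ?thesis
    unfolding surface_measure_def by (intro measurable_completion measurable_restrict_space1)
qed

text \<open>\<open>x - \<beta> x *\<^sub>R e\<close> is the foot of \<open>x\<close> on the boundary
  in direction \<open>e\<close>. For indicators the claim is the slab estimate; the standard
  induction over Borel functions carries it to all \<open>f\<close>.\<close>

lemma surface_integral_slab:
  fixes \<Omega> :: "(real ^ 'n) set" and f :: "real ^ 'n \<Rightarrow> ennreal"
  assumes N: "2 \<le> CARD('n)"
    and K: "\<forall>e \<tau> T A. norm (e :: real ^ 'n) = 1 \<longrightarrow> 0 < \<tau> \<longrightarrow> T \<in> sets borel \<longrightarrow> (\<forall>x\<in>T. \<exists>t\<in>{0..\<tau>}. x - t *\<^sub>R e \<in> A) \<longrightarrow>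
      emeasure lborel T \<le> ennreal (K * \<tau>) * hausdorff_outer (real CARD('n) - 1) A"
    and c: "lipschitz_chart D (frontier \<Omega>) x0 r e \<beta> L" and \<tau>: "0 < \<tau>" "\<tau> \<le> r / 4"
    and f: "f \<in> borel_measurable borel"
  shows "(\<integral>\<^sup>+x. f (x - \<beta> x *\<^sub>R e) * indicator {x \<in> ball x0 (r / 4). 0 < \<beta> x \<and> \<beta> x < \<tau>} x \<partial>lborel)
    \<le> ennreal (K * \<tau>) * (\<integral>\<^sup>+x. f x \<partial>surface_measure \<Omega>)"
proof -
  define U where "U = {x \<in> ball x0 (r / 4). 0 < \<beta> x \<and> \<beta> x < \<tau>}"
  note bc = lipschitz_chart_continuous[OF c]
  have bm[measurable]: "\<beta> \<in> borel_measurable borel" by (rule borel_measurable_continuous_onI[OF bc])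
  have U[measurable]: "U \<in> sets borel" unfolding U_def by measurable
  have proj: "x - \<beta> x *\<^sub>R e \<in> frontier \<Omega>" if "x \<in> U" for x
  proof -
    have "dist x0 (x - \<beta> x *\<^sub>R e) \<le> dist x0 x + norm (\<beta> x *\<^sub>R e)"
      using dist_triangle[of x0 "x - \<beta> x *\<^sub>R e" x] by (simp add: dist_norm)
    also have "\<dots> < r" using that c \<tau> by (simp add: U_def lipschitz_chart_def)
    finally have "x - \<beta> x *\<^sub>R e \<in> ball x0 r" by simp
    moreover have "\<beta> (x + (- \<beta> x) *\<^sub>R e) = \<beta> x + (- \<beta> x)" using c unfolding lipschitz_chart_def by blast
    then have "\<beta> (x - \<beta> x *\<^sub>R e) = 0" by simp
    ultimately show ?thesis using c unfolding lipschitz_chart_def by blast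
  qed
  have fr: "frontier \<Omega> \<in> sets borel" by (simp add: frontier_closed)
  have sb: "space (surface_measure \<Omega>) = frontier \<Omega>"
    by (simp add: surface_measure_def space_restrict_space)
  note meas = borel_measurable_surface[where \<Omega> = \<Omega> and 'b = ennreal]
  have hm: "(\<lambda>x. h (x - \<beta> x *\<^sub>R e) * indicator U x) \<in> borel_measurable lborel" if [measurable]: "h \<in> borel_measurable borel" for h :: "real ^ 'n \<Rightarrow> ennreal"
    by measurable
  have "(\<integral>\<^sup>+x. f (x - \<beta> x *\<^sub>R e) * indicator U x \<partial>lborel) \<le> ennreal (K * \<tau>) * (\<integral>\<^sup>+x. f x \<partial>surface_measure \<Omega>)"
    using f
  proof (induction rule: borel_measurable_induct)
    case (cong f g) then show ?case by (simp cong: nn_integral_cong)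
  next
    case (set A)
    then have A[measurable]: "A \<in> sets borel" by simp
    define T where "T = {x \<in> U. x - \<beta> x *\<^sub>R e \<in> A}"
    have T[measurable]: "T \<in> sets borel" unfolding T_def by measurable
    have "(\<integral>\<^sup>+x. indicator A (x - \<beta> x *\<^sub>R e) * indicator U x \<partial>lborel) = (\<integral>\<^sup>+x. indicator T x \<partial>lborel)"
      by (intro nn_integral_cong) (auto simp: T_def indicator_def)
    also have "\<dots> = emeasure lborel T" by simp
    also have "\<dots> \<le> ennreal (K * \<tau>) * hausdorff_outer (real CARD('n) - 1) (A \<inter> frontier \<Omega>)"
    proof (rule K[rule_format])
      show "norm e = 1" "0 < \<tau>" using c \<tau> by (auto simp: lipschitz_chart_def)
      show "\<exists>t\<in>{0..\<tau>}. x - t *\<^sub>R e \<in> A \<inter> frontier \<Omega>" if "x \<in> T" for x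
        using that proj[of x] by (intro bexI[of _ "\<beta> x"]) (auto simp: T_def U_def)
    qed (rule T)
    also have "hausdorff_outer (real CARD('n) - 1) (A \<inter> frontier \<Omega>) = emeasure (surface_measure \<Omega>) (A \<inter> frontier \<Omega>)"
      using A fr by (intro emeasure_surface_measure[symmetric]) auto
    also have "\<dots> = (\<integral>\<^sup>+x. indicator (A \<inter> frontier \<Omega>) x \<partial>surface_measure \<Omega>)"
      using A fr meas[of "indicator (A \<inter> frontier \<Omega>)"]
      by (subst nn_integral_indicator) (auto simp: borel_measurable_indicator_iff sb Int_absorb2 intro: sets.sets_into_space)
    also have "\<dots> = (\<integral>\<^sup>+x. indicator A x \<partial>surface_measure \<Omega>)"
      by (intro nn_integral_cong) (auto simp: sb indicator_def)
    finally show ?case .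
  next
    case (mult u c)
    have "(\<integral>\<^sup>+x. c * u (x - \<beta> x *\<^sub>R e) * indicator U x \<partial>lborel) = c * (\<integral>\<^sup>+x. u (x - \<beta> x *\<^sub>R e) * indicator U x \<partial>lborel)"
      unfolding mult.assoc by (rule nn_integral_cmult[OF hm[OF mult(2)]])
    also have "\<dots> \<le> c * (ennreal (K * \<tau>) * (\<integral>\<^sup>+x. u x \<partial>surface_measure \<Omega>))" by (intro mult_left_mono mult) auto
    also have "\<dots> = ennreal (K * \<tau>) * (\<integral>\<^sup>+x. c * u x \<partial>surface_measure \<Omega>)"
      using meas[OF mult(2)] by (simp add: nn_integral_cmult mult_ac)
    finally show ?case .
  next
    case (add u v)
    have "(\<integral>\<^sup>+x. (v (x - \<beta> x *\<^sub>R e) + u (x - \<beta> x *\<^sub>R e)) * indicator U x \<partial>lborel)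
       = (\<integral>\<^sup>+x. v (x - \<beta> x *\<^sub>R e) * indicator U x \<partial>lborel) + (\<integral>\<^sup>+x. u (x - \<beta> x *\<^sub>R e) * indicator U x \<partial>lborel)"
      unfolding distrib_right using add by (intro nn_integral_add hm)
    also have "\<dots> \<le> ennreal (K * \<tau>) * (\<integral>\<^sup>+x. v x \<partial>surface_measure \<Omega>) + ennreal (K * \<tau>) * (\<integral>\<^sup>+x. u x \<partial>surface_measure \<Omega>)"
      using add by (intro add_mono) auto
    also have "\<dots> = ennreal (K * \<tau>) * (\<integral>\<^sup>+x. v x + u x \<partial>surface_measure \<Omega>)"
    proof -
      have "u \<in> borel_measurable borel" "v \<in> borel_measurable borel" using add by auto
      then show ?thesis by (simp add: nn_integral_add[OF meas meas] distrib_left)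
    qed
    finally show ?case .
  next
    case (seq F)
    have inc: "incseq (\<lambda>i x. F i (x - \<beta> x *\<^sub>R e) * indicator U x)"
      using seq(3) by (auto simp: incseq_def le_fun_def intro!: mult_right_mono)
    have "(\<integral>\<^sup>+x. (SUP i. F i) (x - \<beta> x *\<^sub>R e) * indicator U x \<partial>lborel) = (\<integral>\<^sup>+x. (SUP i. F i (x - \<beta> x *\<^sub>R e) * indicator U x) \<partial>lborel)"
      by (intro nn_integral_cong) (simp add: image_comp SUP_mult_right_ennreal)
    also have "\<dots> = (SUP i. \<integral>\<^sup>+x. F i (x - \<beta> x *\<^sub>R e) * indicator U x \<partial>lborel)"
      by (rule nn_integral_monotone_convergence_SUP[OF inc hm[OF seq(1)]])
    also have "\<dots> \<le> ennreal (K * \<tau>) * (\<integral>\<^sup>+x. (SUP i. F i) x \<partial>surface_measure \<Omega>)"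
    proof (rule SUP_least)
      fix i
      have "(\<integral>\<^sup>+x. F i x \<partial>surface_measure \<Omega>) \<le> (\<integral>\<^sup>+x. (SUP i. F i) x \<partial>surface_measure \<Omega>)"
        by (intro nn_integral_mono) (auto simp: image_comp intro: SUP_upper)
      then show "(\<integral>\<^sup>+x. F i (x - \<beta> x *\<^sub>R e) * indicator U x \<partial>lborel) \<le> ennreal (K * \<tau>) * (\<integral>\<^sup>+x. (SUP i. F i) x \<partial>surface_measure \<Omega>)"
      proof -
        assume le: "(\<integral>\<^sup>+x. F i x \<partial>surface_measure \<Omega>) \<le> (\<integral>\<^sup>+x. (SUP i. F i) x \<partial>surface_measure \<Omega>)"
        have "(\<integral>\<^sup>+x. F i (x - \<beta> x *\<^sub>R e) * indicator U x \<partial>lborel) \<le> ennreal (K * \<tau>) * (\<integral>\<^sup>+x. F i x \<partial>surface_measure \<Omega>)"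
          using seq by blast
        also have "\<dots> \<le> ennreal (K * \<tau>) * (\<integral>\<^sup>+x. (SUP i. F i) x \<partial>surface_measure \<Omega>)"
          using le by (rule mult_left_mono) simp
        finally show ?thesis .
      qed
    qed
    finally show ?case .
  qed
  then show ?thesis by (simp add: U_def)
qed

text \<open>\<open>g x\<close> is its value at the foot of \<open>x\<close> plus the difference
  along the segment. The first part costs \<open>\<tau>\<close> times a surface integral; the second
  costs tau^(p-1) by the segment bound and another \<open>\<tau>\<close> for integrating along the
  length, against the gradient in the collar alone.\<close>

lemma collar_smooth:
  fixes \<Omega> :: "(real ^ 'n) set" and g :: "real ^ 'n \<Rightarrow> real"
  assumes N: "2 \<le> CARD('n)" and p: "1 \<le> p"
    and K: "\<forall>e \<tau> T A. norm (e :: real ^ 'n) = 1 \<longrightarrow> 0 < \<tau> \<longrightarrow> T \<in> sets borel \<longrightarrow> (\<forall>x\<in>T. \<exists>t\<in>{0..\<tau>}. x - t *\<^sub>R e \<in> A) \<longrightarrow>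
      emeasure lborel T \<le> ennreal (K * \<tau>) * hausdorff_outer (real CARD('n) - 1) A"
    and c: "lipschitz_chart D (frontier \<Omega>) x0 r e \<beta> L" and \<tau>: "0 < \<tau>" "\<tau> \<le> r / 4"
    and g: "smooth g"
  shows "(\<integral>\<^sup>+x. ennreal (\<bar>g x\<bar> powr p) * indicator {x \<in> ball x0 (r / 4). 0 < \<beta> x \<and> \<beta> x < \<tau>} x \<partial>lborel)
    \<le> ennreal (2 powr p) * (ennreal (K * \<tau>) * (\<integral>\<^sup>+x. ennreal (\<bar>g x\<bar> powr p) \<partial>surface_measure \<Omega>)
       + ennreal (\<tau> powr p) * (\<integral>\<^sup>+x. ennreal (norm (grad g x) powr p) * indicator {x \<in> ball x0 r. 0 < \<beta> x \<and> \<beta> x < \<tau>} x \<partial>lborel))"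
proof -
  define U where "U = {x \<in> ball x0 (r / 4). 0 < \<beta> x \<and> \<beta> x < \<tau>}"
  define V where "V = {x \<in> ball x0 r. 0 < \<beta> x \<and> \<beta> x < \<tau>}"
  note bc = lipschitz_chart_continuous[OF c]
  have bm[measurable]: "\<beta> \<in> borel_measurable borel" by (rule borel_measurable_continuous_onI[OF bc])
  have U[measurable]: "U \<in> sets borel" and V[measurable]: "V \<in> sets borel" unfolding U_def V_def by measurable
  have gm[measurable]: "g \<in> borel_measurable borel" "grad g \<in> borel_measurable borel"
    by (intro borel_measurable_continuous_onI smooth_continuous smooth_grad_continuous g)+
  have e: "norm e = 1" using c by (simp add: lipschitz_chart_def)
  let ?P = "\<lambda>x. ennreal (\<bar>g (x - \<beta> x *\<^sub>R e)\<bar> powr p) * indicator U x"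
  let ?Q = "\<lambda>x. (\<integral>\<^sup>+s. ennreal (norm (grad g (x - s *\<^sub>R e)) powr p) * indicator {0..\<beta> x} s \<partial>lborel) * indicator U x"
  have Qm: "?Q \<in> borel_measurable borel"
  proof -
    have "(\<lambda>(x, s). ennreal (norm (grad g (x - s *\<^sub>R e)) powr p) * indicator {z. 0 \<le> snd z \<and> snd z \<le> \<beta> (fst z)} (x, s)) \<in> borel_measurable (borel \<Otimes>\<^sub>M lborel)"
      by measurable
    from lborel.borel_measurable_nn_integral[OF this]
    have "(\<lambda>x. \<integral>\<^sup>+s. ennreal (norm (grad g (x - s *\<^sub>R e)) powr p) * indicator {0..\<beta> x} s \<partial>lborel) \<in> borel_measurable borel"
      by (simp add: indicator_def atLeastAtMost_def)
    then show ?thesis by measurable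
  qed
  have "(\<integral>\<^sup>+x. ennreal (\<bar>g x\<bar> powr p) * indicator U x \<partial>lborel)
     \<le> (\<integral>\<^sup>+x. ennreal (2 powr p) * (?P x + ennreal (\<tau> powr (p - 1)) * ?Q x) \<partial>lborel)"
  proof (rule nn_integral_mono)
    fix x
    show "ennreal (\<bar>g x\<bar> powr p) * indicator U x \<le> ennreal (2 powr p) * (?P x + ennreal (\<tau> powr (p - 1)) * ?Q x)"
    proof (cases "x \<in> U")
      case True
      then have b: "0 \<le> \<beta> x" "\<beta> x \<le> \<tau>" by (auto simp: U_def)
      have "\<bar>g x\<bar> powr p \<le> (\<bar>g (x - \<beta> x *\<^sub>R e)\<bar> + \<bar>g x - g (x - \<beta> x *\<^sub>R e)\<bar>) powr p"
        using p by (intro powr_mono2) auto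
      also have "\<dots> \<le> 2 powr p * (\<bar>g (x - \<beta> x *\<^sub>R e)\<bar> powr p + \<bar>g x - g (x - \<beta> x *\<^sub>R e)\<bar> powr p)"
        using p by (intro powr_add_le) auto
      finally have "ennreal (\<bar>g x\<bar> powr p) \<le> ennreal (2 powr p) * (ennreal (\<bar>g (x - \<beta> x *\<^sub>R e)\<bar> powr p) + ennreal (\<bar>g x - g (x - \<beta> x *\<^sub>R e)\<bar> powr p))"
        by (simp flip: ennreal_mult ennreal_plus)
      also have "ennreal (\<bar>g x - g (x - \<beta> x *\<^sub>R e)\<bar> powr p)
         \<le> ennreal (\<beta> x powr (p - 1)) * (\<integral>\<^sup>+s. ennreal (norm (grad g (x - s *\<^sub>R e)) powr p) * indicator {0..\<beta> x} s \<partial>lborel)"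
        by (rule segment_powr_bound[OF g e b(1) p])
      also have "ennreal (\<beta> x powr (p - 1)) \<le> ennreal (\<tau> powr (p - 1))"
        using b p by (intro ennreal_leI powr_mono2) auto
      finally show ?thesis using True by (simp add: mult_left_mono add_left_mono mult_right_mono)
    qed simp
  qed
  also have "\<dots> = ennreal (2 powr p) * ((\<integral>\<^sup>+x. ?P x \<partial>lborel) + ennreal (\<tau> powr (p - 1)) * (\<integral>\<^sup>+x. ?Q x \<partial>lborel))"
    using Qm by (subst nn_integral_cmult, simp, subst nn_integral_add) (auto simp: nn_integral_cmult)
  also have "(\<integral>\<^sup>+x. ?P x \<partial>lborel) \<le> ennreal (K * \<tau>) * (\<integral>\<^sup>+x. ennreal (\<bar>g x\<bar> powr p) \<partial>surface_measure \<Omega>)"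
    unfolding U_def by (rule surface_integral_slab[OF N K c \<tau>, of "\<lambda>x. ennreal (\<bar>g x\<bar> powr p)"]) measurable
  also have "(\<integral>\<^sup>+x. ?Q x \<partial>lborel) \<le> ennreal \<tau> * (\<integral>\<^sup>+x. ennreal (norm (grad g x) powr p) * indicator V x \<partial>lborel)"
  proof (rule nn_integral_segment_le[OF _ V U])
    show "0 \<le> \<tau>" using \<tau> by simp
    fix x s assume x: "x \<in> U" and s: "s \<in> {0..\<beta> x}"
    have "dist x0 (x - s *\<^sub>R e) \<le> dist x0 x + norm (s *\<^sub>R e)"
      using dist_triangle[of x0 "x - s *\<^sub>R e" x] by (simp add: dist_norm)
    also have "\<dots> < r" using x s c \<tau> by (simp add: U_def lipschitz_chart_def)
    finally have 1: "x - s *\<^sub>R e \<in> ball x0 r" by simp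
    have "\<beta> (x + (- s) *\<^sub>R e) = \<beta> x + (- s)" using c unfolding lipschitz_chart_def by blast
    then have "\<beta> (x - s *\<^sub>R e) = \<beta> x - s" by simp
    then show "s \<le> \<tau> \<and> (s < \<beta> x \<longrightarrow> x - s *\<^sub>R e \<in> V)" using 1 x s by (auto simp: V_def U_def)
  qed measurable
  also have "ennreal (\<tau> powr (p - 1)) * (ennreal \<tau> * (\<integral>\<^sup>+x. ennreal (norm (grad g x) powr p) * indicator V x \<partial>lborel))
     = ennreal (\<tau> powr p) * (\<integral>\<^sup>+x. ennreal (norm (grad g x) powr p) * indicator V x \<partial>lborel)"
    using \<tau> by (simp add: mult.assoc[symmetric] ennreal_mult[symmetric] powr_diff)
  finally show ?thesis by (simp add: U_def V_def mult_left_mono add_mono)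
qed

text \<open>\<open>\<beta> y\<close> is the height of \<open>y\<close> along \<open>e\<close> minus
  the graph function at the projection of \<open>y\<close>. Its sign separates the domain from the
  exterior, which is why one chart serves both sides.\<close>

lemma lipschitz_domain_chart:
  fixes \<Omega> :: "(real ^ 'n) set"
  assumes \<Omega>: "lipschitz_domain \<Omega>" and x: "x \<in> frontier \<Omega>"
  obtains r e \<beta> L where "lipschitz_chart \<Omega> (frontier \<Omega>) x r e \<beta> L"
    "lipschitz_chart (- closure \<Omega>) (frontier \<Omega>) x r (- e) (\<lambda>y. - \<beta> y) L"
proof -
  have o: "open \<Omega>" using \<Omega> by (simp add: lipschitz_domain_def)
  obtain r e \<gamma> L where c: "r > 0" "norm e = 1" "L-lipschitz_on {y. y \<bullet> e = 0} \<gamma>"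
    "\<Omega> \<inter> ball x r = {y \<in> ball x r. \<gamma> (y - (y \<bullet> e) *\<^sub>R e) < y \<bullet> e}"
    using \<Omega> x unfolding lipschitz_domain_def by blast
  have ee: "e \<bullet> e = 1" using c(2) by (simp add: dot_square_norm)
  have L: "L \<ge> 0" using c(3) by (rule lipschitz_on_nonneg)
  define \<pi> where "\<pi> y = y - (y \<bullet> e) *\<^sub>R e" for y
  define \<beta> where "\<beta> y = y \<bullet> e - \<gamma> (\<pi> y)" for y
  have \<pi>: "\<pi> y \<bullet> e = 0" "\<pi> (y + t *\<^sub>R e) = \<pi> y" "norm (\<pi> y - \<pi> z) \<le> 2 * norm (y - z)" for y z t
  proof -
    show "\<pi> y \<bullet> e = 0" "\<pi> (y + t *\<^sub>R e) = \<pi> y" by (simp_all add: \<pi>_def inner_diff_left inner_add_left ee algebra_simps)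
    have "norm (\<pi> y - \<pi> z) = norm ((y - z) - ((y - z) \<bullet> e) *\<^sub>R e)" by (simp add: \<pi>_def inner_diff_left algebra_simps)
    also have "\<dots> \<le> norm (y - z) + norm (((y - z) \<bullet> e) *\<^sub>R e)" by (rule norm_triangle_ineq4)
    also have "\<dots> \<le> 2 * norm (y - z)" using Cauchy_Schwarz_ineq2[of "y - z" e] c(2) by simp
    finally show "norm (\<pi> y - \<pi> z) \<le> 2 * norm (y - z)" .
  qed
  \<comment> \<open>The height contributes 1, and the projection stretches differences by at most 2.
    The constant is positive even for a constant graph function, as \<open>lipschitz_chart\<close>
    demands.\<close>
  have lip: "\<bar>\<beta> y - \<beta> z\<bar> \<le> (1 + 2 * L) * norm (y - z)" for y z
  proof -
    have "\<bar>\<gamma> (\<pi> y) - \<gamma> (\<pi> z)\<bar> \<le> L * norm (\<pi> y - \<pi> z)"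
      using lipschitz_onD[OF c(3), of "\<pi> y" "\<pi> z"] \<pi>(1) by (simp add: dist_norm)
    also have "\<dots> \<le> L * (2 * norm (y - z))" using \<pi>(3) L by (intro mult_left_mono) auto
    finally have 1: "\<bar>\<gamma> (\<pi> y) - \<gamma> (\<pi> z)\<bar> \<le> 2 * L * norm (y - z)" by simp
    have 2: "\<bar>y \<bullet> e - z \<bullet> e\<bar> \<le> norm (y - z)"
      using Cauchy_Schwarz_ineq2[of "y - z" e] c(2) by (simp add: inner_diff_left)
    have "\<beta> y - \<beta> z = (y \<bullet> e - z \<bullet> e) - (\<gamma> (\<pi> y) - \<gamma> (\<pi> z))" by (simp add: \<beta>_def)
    then have "\<bar>\<beta> y - \<beta> z\<bar> \<le> \<bar>y \<bullet> e - z \<bullet> e\<bar> + \<bar>\<gamma> (\<pi> y) - \<gamma> (\<pi> z)\<bar>" by linarith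
    with 1 2 show ?thesis by (simp add: distrib_right)
  qed
  have tr: "\<beta> (y + t *\<^sub>R e) = \<beta> y + t" for y t
    unfolding \<beta>_def \<pi>(2) by (simp add: inner_add_left ee)
  have dom: "y \<in> \<Omega> \<longleftrightarrow> 0 < \<beta> y" if "y \<in> ball x r" for y
    using c(4) that by (auto simp: \<beta>_def \<pi>_def set_eq_iff)
  have "continuous_on UNIV \<beta>"
  proof -
    have "(1 + 2 * L)-lipschitz_on UNIV \<beta>" using lip L by (auto simp: lipschitz_on_def dist_norm)
    then show ?thesis by (rule lipschitz_on_continuous_on)
  qed
  have cl: "y \<in> closure \<Omega> \<longleftrightarrow> 0 \<le> \<beta> y" if y: "y \<in> ball x r" for y
  proof
    assume "y \<in> closure \<Omega>"
    show "0 \<le> \<beta> y"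
    proof (rule ccontr)
      assume "\<not> 0 \<le> \<beta> y"
      define W where "W = {z. \<beta> z < 0} \<inter> ball x r"
      have "open W" unfolding W_def
        by (intro open_Int open_ball open_Collect_less \<open>continuous_on UNIV \<beta>\<close> continuous_on_const)
      moreover have "y \<in> W" using y \<open>\<not> 0 \<le> \<beta> y\<close> by (simp add: W_def)
      ultimately have "W \<inter> \<Omega> \<noteq> {}" using \<open>y \<in> closure \<Omega>\<close> by (auto simp: closure_iff_nhds_not_empty)
      then show False using dom by (auto simp: W_def)
    qed
  next
    assume b: "0 \<le> \<beta> y"
    show "y \<in> closure \<Omega>" unfolding closure_approachable
    proof (intro allI impI)
      fix \<epsilon> :: real assume "\<epsilon> > 0"
      \<comment> \<open>Raising \<open>y\<close> along \<open>e\<close> by \<open>t > 0\<close>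
        makes the height positive, so the new point is in the domain; \<open>t\<close> is small
        enough to stay within \<open>\<epsilon>\<close> and inside the ball of the chart.\<close>
      define t where "t = min (\<epsilon> / 2) ((r - dist x y) / 2)"
      have "t \<le> \<epsilon> / 2" "t \<le> (r - dist x y) / 2" unfolding t_def by (rule min.cobounded1, rule min.cobounded2)
      moreover have "dist x y < r" using y by simp
      moreover have "t > 0" using calculation(3) \<open>\<epsilon> > 0\<close> by (simp add: t_def)
      ultimately have t: "t > 0" "t < \<epsilon>" "dist x y + t < r" using \<open>\<epsilon> > 0\<close> by (simp_all add: field_simps)
      have "dist x (y + t *\<^sub>R e) \<le> dist x y + norm (t *\<^sub>R e)"
        using dist_triangle[of x "y + t *\<^sub>R e" y] by (simp add: dist_norm)
      then have "y + t *\<^sub>R e \<in> ball x r" using t c(2) by simp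
      then have "y + t *\<^sub>R e \<in> \<Omega>" using dom tr[of y t] b t by simp
      then show "\<exists>z\<in>\<Omega>. dist z y < \<epsilon>" using t c(2) by (intro bexI[of _ "y + t *\<^sub>R e"]) (auto simp: dist_norm)
    qed
  qed
  have fr: "y \<in> frontier \<Omega> \<longleftrightarrow> \<beta> y = 0" if y: "y \<in> ball x r" for y
    using cl[OF y] dom[OF y] o by (auto simp: frontier_def interior_open)
  show ?thesis
  proof (rule that)
    show "lipschitz_chart \<Omega> (frontier \<Omega>) x r e \<beta> (1 + 2 * L)"
      unfolding lipschitz_chart_def using c(1,2) L lip tr dom fr by auto
    have "- \<beta> (y + t *\<^sub>R - e) = - \<beta> y + t" for y t using tr[of y "- t"] by simp
    then show "lipschitz_chart (- closure \<Omega>) (frontier \<Omega>) x r (- e) (\<lambda>y. - \<beta> y) (1 + 2 * L)"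
      unfolding lipschitz_chart_def using c(1,2) L lip cl fr by (auto simp: abs_minus_commute not_le)
  qed
qed

lemma nn_integral_lebesgue_on_subset:
  fixes f :: "real ^ 'n \<Rightarrow> ennreal"
  assumes "D \<in> sets lebesgue" "U \<subseteq> D"
  shows "(\<integral>\<^sup>+x. f x * indicator U x \<partial>lebesgue_on D) = (\<integral>\<^sup>+x. f x * indicator U x \<partial>lborel)"
proof -
  have "f x * indicator U x * indicator D x = f x * indicator U x" for x
    using assms(2) by (auto simp: indicator_def)
  then show ?thesis using assms(1) by (simp add: nn_integral_restrict_space nn_integral_completion)
qed

lemma nn_integral_powr_split:
  fixes f g :: "'a \<Rightarrow> 'b::euclidean_space"
  assumes [measurable]: "f \<in> borel_measurable M" "g \<in> borel_measurable M" "U \<in> sets M" and "0 < p"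
  shows "(\<integral>\<^sup>+x. ennreal (norm (f x) powr p) * indicator U x \<partial>M)
    \<le> ennreal (2 powr p) * ((\<integral>\<^sup>+x. ennreal (norm (f x - g x) powr p) \<partial>M) + (\<integral>\<^sup>+x. ennreal (norm (g x) powr p) * indicator U x \<partial>M))"
proof -
  have "(\<integral>\<^sup>+x. ennreal (norm (f x) powr p) * indicator U x \<partial>M)
     \<le> (\<integral>\<^sup>+x. ennreal (2 powr p) * (ennreal (norm (f x - g x) powr p) + ennreal (norm (g x) powr p) * indicator U x) \<partial>M)"
  proof (rule nn_integral_mono)
    fix x
    have "norm (f x) powr p \<le> (norm (f x - g x) + norm (g x)) powr p"
      using norm_triangle_ineq[of "f x - g x" "g x"] assms by (intro powr_mono2) auto
    also have "\<dots> \<le> 2 powr p * (norm (f x - g x) powr p + norm (g x) powr p)"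
      using assms by (intro powr_add_le) auto
    finally have "ennreal (norm (f x) powr p) \<le> ennreal (2 powr p) * (ennreal (norm (f x - g x) powr p) + ennreal (norm (g x) powr p))"
      by (simp flip: ennreal_mult ennreal_plus)
    then show "ennreal (norm (f x) powr p) * indicator U x
      \<le> ennreal (2 powr p) * (ennreal (norm (f x - g x) powr p) + ennreal (norm (g x) powr p) * indicator U x)"
      by (cases "x \<in> U") auto
  qed
  also have "\<dots> = ennreal (2 powr p) * (\<integral>\<^sup>+x. ennreal (norm (f x - g x) powr p) + ennreal (norm (g x) powr p) * indicator U x \<partial>M)"
    by (rule nn_integral_cmult) measurable
  also have "(\<integral>\<^sup>+x. ennreal (norm (f x - g x) powr p) + ennreal (norm (g x) powr p) * indicator U x \<partial>M)
     = (\<integral>\<^sup>+x. ennreal (norm (f x - g x) powr p) \<partial>M) + (\<integral>\<^sup>+x. ennreal (norm (g x) powr p) * indicator U x \<partial>M)"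
    by (rule nn_integral_add) measurable
  finally show ?thesis .
qed

lemma nn_integral_shrinking_tendsto_0:
  assumes f: "f \<in> borel_measurable M" "(\<integral>\<^sup>+x. f x \<partial>M) < \<infinity>"
    and A: "\<And>n. A n \<in> sets M" "\<And>x. \<forall>\<^sub>F n in sequentially. x \<notin> A n"
  shows "(\<lambda>n::nat. \<integral>\<^sup>+x. f x * indicator (A n) x \<partial>M) \<longlonglongrightarrow> 0"
proof -
  have "(\<lambda>n. \<integral>\<^sup>+x. f x * indicator (A n) x \<partial>M) \<longlonglongrightarrow> (\<integral>\<^sup>+x. 0 \<partial>M)"
  proof (rule nn_integral_dominated_convergence[where w = f])
    show "(\<lambda>x. f x * indicator (A n) x) \<in> borel_measurable M" for n
      using f(1) A(1)[of n] by measurable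
    show "AE x in M. (\<lambda>n. f x * indicator (A n) x) \<longlonglongrightarrow> 0"
    proof (rule AE_I2)
      fix x
      have "\<forall>\<^sub>F n in sequentially. f x * indicator (A n) x = 0"
        using A(2)[of x] by eventually_elim simp
      then show "(\<lambda>n. f x * indicator (A n) x) \<longlonglongrightarrow> 0" by (rule tendsto_eventually)
    qed
  qed (use f in \<open>auto simp: indicator_def\<close>)
  then show ?thesis by simp
qed

text \<open>In the limit of \<open>collar_smooth\<close> the surface term disappears because the
  trace is 0. What remains is tau^p times the energy of \<open>H\<close> in a collar shrinking to
  the empty set, so every constant \<open>c\<close> is eventually admissible. This smallness beyond
  order tau^p is the point.\<close>

lemma collar_chart:
  fixes \<Omega> :: "(real ^ 'n) set" and m :: "nat \<Rightarrow> real ^ 'n \<Rightarrow> real"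
  assumes N: "2 \<le> CARD('n)" and p: "1 \<le> p" and D: "open D"
    and ch: "lipschitz_chart D (frontier \<Omega>) x0 r e \<beta> L"
    and m: "\<And>k. smooth (m k)"
    and \<psi>: "\<psi> \<in> Lp p (lebesgue_on D)" and H: "H \<in> Lp p (lebesgue_on D)"
    and lim: "Lp_null p (lebesgue_on D) (\<lambda>k x. m k x - \<psi> x)"
    and glim: "Lp_null p (lebesgue_on D) (\<lambda>k x. grad (m k) x - H x)"
    and tr: "(\<lambda>k. \<integral>\<^sup>+x. ennreal (\<bar>m k x\<bar> powr p) \<partial>surface_measure \<Omega>) \<longlonglongrightarrow> 0"
    and c: "0 < c"
  shows "\<exists>\<tau>0>0. \<forall>\<tau>. 0 < \<tau> \<and> \<tau> < \<tau>0 \<longrightarrow>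
    (\<integral>\<^sup>+x. ennreal (\<bar>\<psi> x\<bar> powr p) * indicator {x \<in> ball x0 (r / 4). 0 < \<beta> x \<and> \<beta> x < \<tau>} x \<partial>lebesgue_on D) \<le> ennreal (c * \<tau> powr p)"
proof -
  obtain K where K: "K > 0" "\<forall>e \<tau> T A. norm (e :: real ^ 'n) = 1 \<longrightarrow> 0 < \<tau> \<longrightarrow> T \<in> sets borel \<longrightarrow> (\<forall>x\<in>T. \<exists>t\<in>{0..\<tau>}. x - t *\<^sub>R e \<in> A) \<longrightarrow>
      emeasure lborel T \<le> ennreal (K * \<tau>) * hausdorff_outer (real CARD('n) - 1) A"
    by (rule slab_measure[OF N])
  have r: "r > 0" using ch by (simp add: lipschitz_chart_def)
  have DL: "D \<in> sets lebesgue" using D by auto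
  have bm[measurable]: "\<beta> \<in> borel_measurable borel"
    by (rule borel_measurable_continuous_onI[OF lipschitz_chart_continuous[OF ch]])
  define U where "U \<tau> = {x \<in> ball x0 (r / 4). 0 < \<beta> x \<and> \<beta> x < \<tau>}" for \<tau>
  define V where "V \<tau> = {x \<in> ball x0 r. 0 < \<beta> x \<and> \<beta> x < \<tau>}" for \<tau>
  have "ball x0 (r / 4) \<subseteq> ball x0 r" using r by (intro subset_ball) auto
  then have UV: "U \<tau> \<subseteq> D" "V \<tau> \<subseteq> D" for \<tau>
    using ch unfolding U_def V_def lipschitz_chart_def by blast+
  have UVm: "U \<tau> \<in> sets (lebesgue_on D)" "V \<tau> \<in> sets (lebesgue_on D)" for \<tau>
  proof -
    have "U \<tau> \<in> sets borel" "V \<tau> \<in> sets borel" unfolding U_def V_def by measurable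
    then show "U \<tau> \<in> sets (lebesgue_on D)" "V \<tau> \<in> sets (lebesgue_on D)"
      using UV DL by (auto simp: sets_restrict_space_iff)
  qed
  note mm = smooth_borel_measurable[OF m, of _ D]
  note \<psi>m = Lp_nn_integral_finite[OF \<psi>] and Hm = Lp_nn_integral_finite[OF H]
  define \<omega> where "\<omega> \<tau> = (\<integral>\<^sup>+x. ennreal (norm (H x) powr p) * indicator (V \<tau>) x \<partial>lebesgue_on D)" for \<tau>
  let ?q = "ennreal (2 powr p)"
  have main: "(\<integral>\<^sup>+x. ennreal (\<bar>\<psi> x\<bar> powr p) * indicator (U \<tau>) x \<partial>lebesgue_on D) \<le> ?q * (?q * (ennreal (\<tau> powr p) * (?q * \<omega> \<tau>)))"
    if \<tau>: "0 < \<tau>" "\<tau> \<le> r / 4" for \<tau>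
  proof -
    have le: "(\<integral>\<^sup>+x. ennreal (\<bar>\<psi> x\<bar> powr p) * indicator (U \<tau>) x \<partial>lebesgue_on D)
      \<le> ?q * ((\<integral>\<^sup>+x. ennreal (norm (m k x - \<psi> x) powr p) \<partial>lebesgue_on D)
        + ?q * (ennreal (K * \<tau>) * (\<integral>\<^sup>+x. ennreal (\<bar>m k x\<bar> powr p) \<partial>surface_measure \<Omega>)
        + ennreal (\<tau> powr p) * (?q * ((\<integral>\<^sup>+x. ennreal (norm (grad (m k) x - H x) powr p) \<partial>lebesgue_on D) + \<omega> \<tau>))))" for k
    proof -
      have "(\<integral>\<^sup>+x. ennreal (\<bar>\<psi> x\<bar> powr p) * indicator (U \<tau>) x \<partial>lebesgue_on D)
         \<le> ?q * ((\<integral>\<^sup>+x. ennreal (norm (\<psi> x - m k x) powr p) \<partial>lebesgue_on D) + (\<integral>\<^sup>+x. ennreal (\<bar>m k x\<bar> powr p) * indicator (U \<tau>) x \<partial>lebesgue_on D))"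
        using nn_integral_powr_split[OF \<psi>m(1) mm(1)[of k] UVm(1)[of \<tau>], of p] p by simp
      also have "(\<integral>\<^sup>+x. ennreal (norm (\<psi> x - m k x) powr p) \<partial>lebesgue_on D) = (\<integral>\<^sup>+x. ennreal (norm (m k x - \<psi> x) powr p) \<partial>lebesgue_on D)"
        by (simp add: abs_minus_commute)
      also have "(\<integral>\<^sup>+x. ennreal (\<bar>m k x\<bar> powr p) * indicator (U \<tau>) x \<partial>lebesgue_on D) = (\<integral>\<^sup>+x. ennreal (\<bar>m k x\<bar> powr p) * indicator (U \<tau>) x \<partial>lborel)"
        by (rule nn_integral_lebesgue_on_subset[OF DL UV(1)])
      also have "\<dots> \<le> ?q * (ennreal (K * \<tau>) * (\<integral>\<^sup>+x. ennreal (\<bar>m k x\<bar> powr p) \<partial>surface_measure \<Omega>)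
         + ennreal (\<tau> powr p) * (\<integral>\<^sup>+x. ennreal (norm (grad (m k) x) powr p) * indicator (V \<tau>) x \<partial>lborel))"
        unfolding U_def V_def by (rule collar_smooth[OF N p K(2) ch \<tau> m])
      also have "(\<integral>\<^sup>+x. ennreal (norm (grad (m k) x) powr p) * indicator (V \<tau>) x \<partial>lborel) = (\<integral>\<^sup>+x. ennreal (norm (grad (m k) x) powr p) * indicator (V \<tau>) x \<partial>lebesgue_on D)"
        by (rule nn_integral_lebesgue_on_subset[OF DL UV(2), symmetric])
      also have "\<dots> \<le> ?q * ((\<integral>\<^sup>+x. ennreal (norm (grad (m k) x - H x) powr p) \<partial>lebesgue_on D) + \<omega> \<tau>)"
        unfolding \<omega>_def using nn_integral_powr_split[OF mm(2)[of k] Hm(1) UVm(2)[of \<tau>], of p] p by simp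
      finally show ?thesis by (simp add: mult_left_mono add_left_mono)
    qed
    have "(\<lambda>k. ?q * ((\<integral>\<^sup>+x. ennreal (norm (m k x - \<psi> x) powr p) \<partial>lebesgue_on D)
        + ?q * (ennreal (K * \<tau>) * (\<integral>\<^sup>+x. ennreal (\<bar>m k x\<bar> powr p) \<partial>surface_measure \<Omega>)
        + ennreal (\<tau> powr p) * (?q * ((\<integral>\<^sup>+x. ennreal (norm (grad (m k) x - H x) powr p) \<partial>lebesgue_on D) + \<omega> \<tau>)))))
      \<longlonglongrightarrow> ?q * (0 + ?q * (ennreal (K * \<tau>) * 0 + ennreal (\<tau> powr p) * (?q * (0 + \<omega> \<tau>))))"
      by (intro ennreal_tendsto_cmult tendsto_add tendsto_const tr
          lim[unfolded Lp_null_def] glim[unfolded Lp_null_def]) auto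
    from tendsto_lowerbound[OF this always_eventually] le show ?thesis by simp
  qed
  \<comment> \<open>\<open>V\<close> contains only points with \<open>\<beta> x > 0\<close>, so each
    point eventually leaves the shrinking collars and dominated convergence applies.\<close>
  have \<omega>lim: "(\<lambda>n. \<omega> (inverse (real (Suc n)))) \<longlonglongrightarrow> 0"
    unfolding \<omega>_def
  proof (rule nn_integral_shrinking_tendsto_0)
    show "(\<lambda>x. ennreal (norm (H x) powr p)) \<in> borel_measurable (lebesgue_on D)" using Hm(1) by measurable
    show "\<forall>\<^sub>F n in sequentially. x \<notin> V (inverse (real (Suc n)))" for x
    proof (cases "0 < \<beta> x")
      case True
      have "\<forall>\<^sub>F n in sequentially. inverse (real (Suc n)) < \<beta> x"
        using LIMSEQ_inverse_real_of_nat True by (rule order_tendstoD)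
      then show ?thesis by eventually_elim (auto simp: V_def)
    qed (simp add: V_def)
  qed (use Hm UVm in auto)
  \<comment> \<open>One factor 2^p comes from \<open>collar_smooth\<close>, and one from each of the
    two triangle splittings in \<open>main\<close>, for \<open>\<psi>\<close> and for
    \<open>H\<close>.\<close>
  define c' where "c' = c / (2 powr p * 2 powr p * 2 powr p)"
  have c': "c' > 0" "2 powr p * 2 powr p * 2 powr p * c' = c" using c by (auto simp: c'_def)
  have "\<forall>\<^sub>F n in sequentially. \<omega> (inverse (real (Suc n))) < ennreal c'"
    using \<omega>lim c' by (intro order_tendstoD) auto
  then obtain n where n: "\<omega> (inverse (real (Suc n))) < ennreal c'" by (auto simp: eventually_sequentially)
  show ?thesis
  proof (intro exI[of _ "min (r / 4) (inverse (real (Suc n)))"] conjI allI impI)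
    show "0 < min (r / 4) (inverse (real (Suc n)))" using r by simp
    fix \<tau> assume \<tau>: "0 < \<tau> \<and> \<tau> < min (r / 4) (inverse (real (Suc n)))"
    have "V \<tau> \<subseteq> V (inverse (real (Suc n)))" using \<tau> by (auto simp: V_def)
    then have "\<omega> \<tau> \<le> \<omega> (inverse (real (Suc n)))"
      unfolding \<omega>_def by (intro nn_integral_mono mult_left_mono) (auto simp: indicator_def)
    then have \<omega>: "\<omega> \<tau> \<le> ennreal c'" using n by (meson less_imp_le order_trans)
    have "(\<integral>\<^sup>+x. ennreal (\<bar>\<psi> x\<bar> powr p) * indicator (U \<tau>) x \<partial>lebesgue_on D) \<le> ?q * (?q * (ennreal (\<tau> powr p) * (?q * \<omega> \<tau>)))"
      using \<tau> by (intro main) auto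
    also have "\<dots> \<le> ?q * (?q * (ennreal (\<tau> powr p) * (?q * ennreal c')))"
      by (intro mult_left_mono \<omega>) auto
    also have "\<dots> = ennreal (2 powr p * 2 powr p * 2 powr p * c' * \<tau> powr p)"
      using c'(1) by (simp add: ennreal_mult[symmetric] mult_ac del: mult_eq_0_iff)
    finally show "(\<integral>\<^sup>+x. ennreal (\<bar>\<psi> x\<bar> powr p) * indicator {x \<in> ball x0 (r / 4). 0 < \<beta> x \<and> \<beta> x < \<tau>} x \<partial>lebesgue_on D) \<le> ennreal (c * \<tau> powr p)"
      unfolding c'(2) U_def .
  qed
qed

text \<open>The hypotheses under which a function with vanishing trace is approximated from inside \<open>D\<close>.\<close>

definition chart_boundary :: "(real ^ 'n) set \<Rightarrow> (real ^ 'n) set \<Rightarrow> bool" where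
  "chart_boundary D S \<longleftrightarrow> open D \<and> compact S \<and> S \<noteq> {} \<and> frontier D \<subseteq> S \<and>
     (\<forall>x\<in>S. \<exists>r e \<beta> L. lipschitz_chart D S x r e \<beta> L)"

lemma chart_boundary_lipschitz_domain:
  fixes \<Omega> :: "(real ^ 'n) set"
  assumes \<Omega>: "lipschitz_domain \<Omega>" and b: "bounded \<Omega>"
  shows "chart_boundary \<Omega> (frontier \<Omega>)" "chart_boundary (- closure \<Omega>) (frontier \<Omega>)"
proof -
  have o: "open \<Omega>" "\<Omega> \<noteq> {}" using \<Omega> by (auto simp: lipschitz_domain_def)
  have ne: "frontier \<Omega> \<noteq> {}"
    using o(2) b not_bounded_UNIV[where 'a = "real ^ 'n"] by (auto simp: frontier_eq_empty)
  have cp: "compact (frontier \<Omega>)" using b by (rule compact_frontier_bounded)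
  have "frontier (- closure \<Omega>) \<subseteq> frontier \<Omega>"
  proof -
    have "frontier (- closure \<Omega>) = closure \<Omega> - interior (closure \<Omega>)"
      by (simp add: frontier_complement) (simp add: frontier_def)
    then show ?thesis using interior_mono[OF closure_subset[of \<Omega>]] by (auto simp: frontier_def)
  qed
  then show "chart_boundary \<Omega> (frontier \<Omega>)" "chart_boundary (- closure \<Omega>) (frontier \<Omega>)"
    unfolding chart_boundary_def using o ne cp lipschitz_domain_chart[OF \<Omega>]
    by (simp_all add: open_Compl) (metis, metis)
qed

text \<open>Compactness of the boundary reduces to finitely many charts. A point within
  \<open>\<epsilon>\<close> of the boundary has height at most \<open>L x * \<epsilon>\<close> in a
  chart around its nearest boundary point, so it is caught by the collar of width
  \<open>2 * L x * \<epsilon>\<close>.\<close>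

lemma collar:
  fixes \<Omega> :: "(real ^ 'n) set" and m :: "nat \<Rightarrow> real ^ 'n \<Rightarrow> real"
  assumes N: "2 \<le> CARD('n)" and p: "1 \<le> p" and D: "chart_boundary D (frontier \<Omega>)"
    and m: "\<And>k. smooth (m k)"
    and \<psi>: "\<psi> \<in> Lp p (lebesgue_on D)" and H: "H \<in> Lp p (lebesgue_on D)"
    and lim: "Lp_null p (lebesgue_on D) (\<lambda>k x. m k x - \<psi> x)"
    and glim: "Lp_null p (lebesgue_on D) (\<lambda>k x. grad (m k) x - H x)"
    and tr: "(\<lambda>k. \<integral>\<^sup>+x. ennreal (\<bar>m k x\<bar> powr p) \<partial>surface_measure \<Omega>) \<longlonglongrightarrow> 0"
    and c: "0 < c"
  shows "\<exists>\<epsilon>0>0. \<forall>\<epsilon>. 0 < \<epsilon> \<and> \<epsilon> < \<epsilon>0 \<longrightarrow>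
    (\<integral>\<^sup>+x. ennreal (\<bar>\<psi> x\<bar> powr p) * indicator {x \<in> D. infdist x (frontier \<Omega>) < \<epsilon>} x \<partial>lebesgue_on D) \<le> ennreal (c * \<epsilon> powr p)"
proof -
  let ?S = "frontier \<Omega>"
  have oD: "open D" and cS: "compact ?S" and Sne: "?S \<noteq> {}" and fr: "frontier D \<subseteq> ?S"
    and "\<forall>x\<in>?S. \<exists>r e \<beta> L. lipschitz_chart D ?S x r e \<beta> L" using D by (auto simp: chart_boundary_def)
  then have "\<forall>x\<in>?S. \<exists>y. lipschitz_chart D ?S x (fst y) (fst (snd y)) (fst (snd (snd y))) (snd (snd (snd y)))"
    by (metis fst_conv snd_conv)
  then obtain F where F: "\<forall>x\<in>?S. lipschitz_chart D ?S x (fst (F x)) (fst (snd (F x))) (fst (snd (snd (F x)))) (snd (snd (snd (F x))))"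
    by (rule bchoice[THEN exE])
  define r where "r x = fst (F x)" for x
  define e where "e x = fst (snd (F x))" for x
  define \<beta> where "\<beta> x = fst (snd (snd (F x)))" for x
  define L where "L x = snd (snd (snd (F x)))" for x
  have ch: "lipschitz_chart D ?S x (r x) (e x) (\<beta> x) (L x)" if "x \<in> ?S" for x
    using F that by (simp add: r_def e_def \<beta>_def L_def)
  have r: "0 < r x" and L: "0 < L x" if "x \<in> ?S" for x using ch[OF that] by (auto simp: lipschitz_chart_def)
  have "\<exists>T\<subseteq>?S. finite T \<and> ?S \<subseteq> (\<Union>x\<in>T. ball x (r x / 8))"
    using compactE_image[OF cS, of ?S "\<lambda>x. ball x (r x / 8)"] r
    by (metis (no_types, lifting) UN_I centre_in_ball open_ball subsetI zero_less_divide_iff zero_less_numeral)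
  then obtain T where T: "T \<subseteq> ?S" "finite T" "?S \<subseteq> (\<Union>x\<in>T. ball x (r x / 8))" by blast
  have Tne: "T \<noteq> {}" using T Sne by auto
  define n where "n = real (card T)"
  have n: "n > 0" using T Tne by (simp add: n_def card_gt_0_iff)
  have "\<forall>x\<in>T. \<exists>\<tau>0>0. \<forall>\<tau>. 0 < \<tau> \<and> \<tau> < \<tau>0 \<longrightarrow>
    (\<integral>\<^sup>+y. ennreal (\<bar>\<psi> y\<bar> powr p) * indicator {y \<in> ball x (r x / 4). 0 < \<beta> x y \<and> \<beta> x y < \<tau>} y \<partial>lebesgue_on D)
      \<le> ennreal (c / n / (2 * L x) powr p * \<tau> powr p)"
  proof
    fix x assume "x \<in> T"
    then have xS: "x \<in> ?S" using T by blast
    \<comment> \<open>Each of the \<open>n\<close> charts may contribute \<open>c / n\<close>; the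
      division by \<open>(2 * L x) powr p\<close> compensates for using the width
      \<open>2 * L x * \<epsilon>\<close>.\<close>
    have "0 < c / n / (2 * L x) powr p" using c n L[OF xS] by simp
    from collar_chart[OF N p oD ch[OF xS] m \<psi> H lim glim tr this]
    show "\<exists>\<tau>0>0. \<forall>\<tau>. 0 < \<tau> \<and> \<tau> < \<tau>0 \<longrightarrow>
      (\<integral>\<^sup>+y. ennreal (\<bar>\<psi> y\<bar> powr p) * indicator {y \<in> ball x (r x / 4). 0 < \<beta> x y \<and> \<beta> x y < \<tau>} y \<partial>lebesgue_on D)
      \<le> ennreal (c / n / (2 * L x) powr p * \<tau> powr p)" .
  qed
  then obtain \<tau>0 where \<tau>0: "\<forall>x\<in>T. 0 < \<tau>0 x \<and> (\<forall>\<tau>. 0 < \<tau> \<and> \<tau> < \<tau>0 x \<longrightarrow>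
    (\<integral>\<^sup>+y. ennreal (\<bar>\<psi> y\<bar> powr p) * indicator {y \<in> ball x (r x / 4). 0 < \<beta> x y \<and> \<beta> x y < \<tau>} y \<partial>lebesgue_on D)
      \<le> ennreal (c / n / (2 * L x) powr p * \<tau> powr p))"
    by (rule bchoice[THEN exE])
  \<comment> \<open>Boundary points are covered by balls of radius \<open>r x / 8\<close>; a further
    \<open>r x / 8\<close> keeps nearby points in the ball of radius \<open>r x / 4\<close>, where
    the chart estimate applies. The second bound makes the collar width smaller than
    \<open>\<tau>0 x\<close>.\<close>
  define \<epsilon>0 where "\<epsilon>0 = Min ((\<lambda>x. min (r x / 8) (\<tau>0 x / (2 * L x))) ` T)"
  have \<epsilon>0: "0 < \<epsilon>0" "\<And>x. x \<in> T \<Longrightarrow> \<epsilon>0 \<le> r x / 8 \<and> \<epsilon>0 \<le> \<tau>0 x / (2 * L x)"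
  proof -
    show "0 < \<epsilon>0" unfolding \<epsilon>0_def using T Tne r L \<tau>0 by (subst Min_gr_iff) auto
    have "\<epsilon>0 \<le> min (r x / 8) (\<tau>0 x / (2 * L x))" if "x \<in> T" for x
      unfolding \<epsilon>0_def using T that by (intro Min_le) auto
    then show "\<epsilon>0 \<le> r x / 8 \<and> \<epsilon>0 \<le> \<tau>0 x / (2 * L x)" if "x \<in> T" for x using that by simp
  qed
  note [measurable] = Lp_nn_integral_finite(1)[OF \<psi>]
  show ?thesis
  proof (intro exI[of _ \<epsilon>0] conjI allI impI \<epsilon>0(1))
    fix \<epsilon> assume \<epsilon>: "0 < \<epsilon> \<and> \<epsilon> < \<epsilon>0"
    let ?U = "\<lambda>x. {y \<in> ball x (r x / 4). 0 < \<beta> x y \<and> \<beta> x y < 2 * L x * \<epsilon>}"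
    have cover: "{x \<in> D. infdist x ?S < \<epsilon>} \<subseteq> (\<Union>x\<in>T. ?U x)"
    proof
      fix y assume y: "y \<in> {x \<in> D. infdist x ?S < \<epsilon>}"
      obtain b where b: "b \<in> ?S" "infdist y ?S = dist y b"
        using infdist_attains_inf[of ?S y] cS Sne by (auto simp: compact_imp_closed)
      obtain x where x: "x \<in> T" "b \<in> ball x (r x / 8)" using T(3) b(1) by blast
      then have xS: "x \<in> ?S" using T by blast
      have db: "dist y b < \<epsilon>" using y b by simp
      have "dist x y < r x / 4"
        using dist_triangle[of x y b] x(2) db \<epsilon> \<epsilon>0(2)[OF x(1)] by (simp add: dist_commute)
      moreover have "b \<in> ball x (r x)" "y \<in> ball x (r x)" using x(2) r[OF xS] calculation by auto
      then have "\<beta> x b = 0" "0 < \<beta> x y"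
        using ch[OF xS] b(1) y unfolding lipschitz_chart_def by blast+
      moreover have "\<bar>\<beta> x y - \<beta> x b\<bar> \<le> L x * norm (y - b)" using ch[OF xS] unfolding lipschitz_chart_def by blast
      moreover have "L x * norm (y - b) < 2 * L x * \<epsilon>"
      proof -
        have "L x * norm (y - b) \<le> L x * \<epsilon>" using db L[OF xS] by (intro mult_left_mono) (auto simp: dist_norm)
        also have "\<dots> < 2 * L x * \<epsilon>" using L[OF xS] \<epsilon> by simp
        finally show ?thesis .
      qed
      ultimately have "y \<in> ?U x" by auto
      then show "y \<in> (\<Union>x\<in>T. ?U x)" using x(1) by blast
    qed
    have Um: "?U x \<in> sets (lebesgue_on D)" if "x \<in> T" for x
    proof -
      have xS: "x \<in> ?S" using T that by blast
      have [measurable]: "\<beta> x \<in> borel_measurable borel"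
        by (rule borel_measurable_continuous_onI[OF lipschitz_chart_continuous[OF ch[OF xS]]])
      have "?U x \<in> sets borel" by measurable
      moreover have "ball x (r x / 4) \<subseteq> ball x (r x)" using r[OF xS] by (intro subset_ball) auto
      then have "?U x \<subseteq> D" using ch[OF xS] unfolding lipschitz_chart_def by blast
      ultimately show ?thesis using oD by (auto simp: sets_restrict_space_iff)
    qed
    have "(\<integral>\<^sup>+y. ennreal (\<bar>\<psi> y\<bar> powr p) * indicator {x \<in> D. infdist x ?S < \<epsilon>} y \<partial>lebesgue_on D)
       \<le> (\<integral>\<^sup>+y. (\<Sum>x\<in>T. ennreal (\<bar>\<psi> y\<bar> powr p) * indicator (?U x) y) \<partial>lebesgue_on D)"
    proof (rule nn_integral_mono)
      fix y
      show "ennreal (\<bar>\<psi> y\<bar> powr p) * indicator {x \<in> D. infdist x ?S < \<epsilon>} y \<le> (\<Sum>x\<in>T. ennreal (\<bar>\<psi> y\<bar> powr p) * indicator (?U x) y)"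
      proof (cases "y \<in> {x \<in> D. infdist x ?S < \<epsilon>}")
        case True
        then obtain x where x: "x \<in> T" "y \<in> ?U x" using cover by blast
        have "ennreal (\<bar>\<psi> y\<bar> powr p) * indicator (?U x) y \<le> (\<Sum>x\<in>T. ennreal (\<bar>\<psi> y\<bar> powr p) * indicator (?U x) y)"
          using T(2) x(1) by (intro member_le_sum) auto
        then show ?thesis using True x(2) by simp
      qed simp
    qed
    also have "\<dots> = (\<Sum>x\<in>T. \<integral>\<^sup>+y. ennreal (\<bar>\<psi> y\<bar> powr p) * indicator (?U x) y \<partial>lebesgue_on D)"
      using Um by (intro nn_integral_sum) (auto intro!: borel_measurable_times_ennreal borel_measurable_indicator)
    also have "\<dots> \<le> (\<Sum>x\<in>T. ennreal (c / n * \<epsilon> powr p))"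
    proof (rule sum_mono)
      fix x assume x: "x \<in> T"
      then have xS: "x \<in> ?S" using T by blast
      have "2 * L x * \<epsilon> < 2 * L x * \<epsilon>0" using \<epsilon> L[OF xS] by (intro mult_strict_left_mono) auto
      also have "\<dots> \<le> \<tau>0 x" using \<epsilon>0(2)[OF x] L[OF xS] by (simp add: field_simps)
      finally have "2 * L x * \<epsilon> < \<tau>0 x" .
      moreover have "0 < 2 * L x * \<epsilon>" using \<epsilon> L[OF xS] by simp
      ultimately have "(\<integral>\<^sup>+y. ennreal (\<bar>\<psi> y\<bar> powr p) * indicator (?U x) y \<partial>lebesgue_on D) \<le> ennreal (c / n / (2 * L x) powr p * (2 * L x * \<epsilon>) powr p)"
        using \<tau>0 x by blast
      also have "c / n / (2 * L x) powr p * (2 * L x * \<epsilon>) powr p = c / n * \<epsilon> powr p"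
        using L[OF xS] \<epsilon> by (simp add: powr_mult)
      finally show "(\<integral>\<^sup>+y. ennreal (\<bar>\<psi> y\<bar> powr p) * indicator (?U x) y \<partial>lebesgue_on D) \<le> ennreal (c / n * \<epsilon> powr p)" .
    qed
    also have "\<dots> = ennreal (n * (c / n * \<epsilon> powr p))"
    proof -
      have "(\<Sum>x\<in>T. ennreal (c / n * \<epsilon> powr p)) = ennreal n * ennreal (c / n * \<epsilon> powr p)"
        by (simp add: n_def ennreal_of_nat_eq_real_of_nat)
      also have "\<dots> = ennreal (n * (c / n * \<epsilon> powr p))" using n c by (intro ennreal_mult[symmetric]) auto
      finally show ?thesis .
    qed
    also have "n * (c / n * \<epsilon> powr p) = c * \<epsilon> powr p" using n by simp
    finally show "(\<integral>\<^sup>+y. ennreal (\<bar>\<psi> y\<bar> powr p) * indicator {x \<in> D. infdist x ?S < \<epsilon>} y \<partial>lebesgue_on D) \<le> ennreal (c * \<epsilon> powr p)" .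
  qed
qed

section \<open>Vanishing trace\<close>

lemma powr_sum4_le:
  fixes a b c d p :: real
  assumes "0 \<le> a" "0 \<le> b" "0 \<le> c" "0 \<le> d" "0 < p" "0 \<le> t" "t \<le> a + b + c + d"
  shows "t powr p \<le> 4 powr p * (a powr p + b powr p + c powr p + d powr p)"
proof -
  define m where "m = max (max a b) (max c d)"
  have "m = a \<or> m = b \<or> m = c \<or> m = d" by (auto simp: m_def max_def)
  then have m: "m powr p \<le> a powr p + b powr p + c powr p + d powr p"
    by (elim disjE) (auto intro: add_increasing add_increasing2)
  have "t \<le> 4 * m" using assms by (simp add: m_def max_def)
  then have "t powr p \<le> (4 * m) powr p" using assms by (intro powr_mono2) auto
  also have "\<dots> = 4 powr p * m powr p" by (rule powr_mult)
  also have "\<dots> \<le> 4 powr p * (a powr p + b powr p + c powr p + d powr p)" using m by (intro mult_left_mono) auto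
  finally show ?thesis .
qed

text \<open>A ball is connected, so it cannot leave \<open>D\<close> without meeting its
  frontier.\<close>

lemma ball_subset_of_infdist:
  fixes D S :: "(real ^ 'n) set"
  assumes "frontier D \<subseteq> S" "S \<noteq> {}" "a \<in> D" "\<epsilon> \<le> infdist a S"
  shows "ball a \<epsilon> \<subseteq> D"
proof (cases "\<epsilon> > 0")
  case True
  have "ball a \<epsilon> \<inter> S = {}"
  proof (rule ccontr)
    assume "ball a \<epsilon> \<inter> S \<noteq> {}"
    then obtain b where "b \<in> S" "dist a b < \<epsilon>" by auto
    then show False using infdist_le[of b S a] assms(4) by simp
  qed
  then have "ball a \<epsilon> \<inter> frontier D = {}" using assms(1) by blast
  moreover have "ball a \<epsilon> \<inter> D \<noteq> {}" using True assms(3) by (metis IntI centre_in_ball empty_iff)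
  ultimately show ?thesis using connected_Int_frontier[OF connected_ball, of a \<epsilon> D] by blast
qed (simp add: not_less ball_empty)

text \<open>The approximation \<open>m k\<close> is multiplied by a cutoff \<open>\<eta>\<close>
  that vanishes near the boundary. The dangerous term m_k grad eta, of slope 1/eps, is split into
  (m_k - psi) grad eta, which is small once \<open>k\<close> is large, and psi grad eta, which is
  small by the collar estimate.\<close>

lemma zero_trace_approx:
  fixes \<Omega> :: "(real ^ 'n) set" and m :: "nat \<Rightarrow> real ^ 'n \<Rightarrow> real"
  assumes N: "2 \<le> CARD('n)" and p: "1 \<le> p" and D: "chart_boundary D (frontier \<Omega>)"
    and m: "\<And>k. m k \<in> test_functions UNIV"
    and supp: "\<And>k x. R \<le> norm x \<Longrightarrow> m k x = 0"
    and \<psi>: "\<psi> \<in> Lp p (lebesgue_on D)" and H: "H \<in> Lp p (lebesgue_on D)"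
    and lim: "Lp_null p (lebesgue_on D) (\<lambda>k x. m k x - \<psi> x)"
    and glim: "Lp_null p (lebesgue_on D) (\<lambda>k x. grad (m k) x - H x)"
    and tr: "(\<lambda>k. \<integral>\<^sup>+x. ennreal (\<bar>m k x\<bar> powr p) \<partial>surface_measure \<Omega>) \<longlonglongrightarrow> 0"
    and \<delta>: "0 < \<delta>"
  shows "\<exists>\<theta>\<in>test_functions D. (\<integral>\<^sup>+x. ennreal (norm (\<theta> x - \<psi> x) powr p) \<partial>lebesgue_on D) \<le> ennreal \<delta> \<and>
     (\<integral>\<^sup>+x. ennreal (norm (grad \<theta> x - H x) powr p) \<partial>lebesgue_on D) \<le> ennreal \<delta>"
proof -
  let ?S = "frontier \<Omega>" and ?M = "lebesgue_on D"
  have oD: "open D" and cS: "compact ?S" and Sne: "?S \<noteq> {}" and fr: "frontier D \<subseteq> ?S"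
    using D by (auto simp: chart_boundary_def)
  have DL: "D \<in> sets lebesgue" using oD by auto
  \<comment> \<open>Otherwise \<open>x\<close> would be the centre of a chart whose height there is
    both positive and 0.\<close>
  have disj: "x \<notin> ?S" if "x \<in> D" for x
  proof
    assume x: "x \<in> ?S"
    obtain r e \<beta> L where "lipschitz_chart D ?S x r e \<beta> L" using D x unfolding chart_boundary_def by blast
    then show False using x that unfolding lipschitz_chart_def by (metis centre_in_ball less_irrefl)
  qed
  have ms: "smooth (m k)" for k using m test_functions_smooth by blast
  note mm[measurable] = smooth_borel_measurable[OF ms, of _ D]
  note \<psi>m = Lp_nn_integral_finite[OF \<psi>] and Hm = Lp_nn_integral_finite[OF H]
  note [measurable] = \<psi>m(1) Hm(1)
  obtain C where C: "C > 0"
    "\<forall>\<epsilon>>0. \<forall>A \<in> sets lebesgue. \<exists>\<eta>. smooth \<eta> \<and> (\<forall>x::real^'n. 0 \<le> \<eta> x \<and> \<eta> x \<le> 1 \<and> norm (grad \<eta> x) \<le> C / \<epsilon>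
       \<and> (ball x \<epsilon> \<subseteq> A \<longrightarrow> \<eta> x = 1) \<and> (ball x \<epsilon> \<inter> A = {} \<longrightarrow> \<eta> x = 0))"
    by (rule smooth_cutoff)
  \<comment> \<open>The gradient error has four terms, and raising a sum of four to the power
    \<open>p\<close> costs 4^p.\<close>
  define \<delta>' where "\<delta>' = \<delta> / (4 * 4 powr p)"
  have \<delta>': "\<delta>' > 0" "4 powr p * (\<delta>' + \<delta>' + \<delta>' + \<delta>') = \<delta>" using \<delta> by (auto simp: \<delta>'_def)
  \<comment> \<open>Chosen against the slope of the cutoff: (4 C / eps)^p times the collar mass c
    eps^p equals \<open>\<delta>'\<close>.\<close>
  define c where "c = \<delta>' / (4 * C) powr p"
  have c: "c > 0" "(4 * C) powr p * c = \<delta>'" using \<delta>' C by (auto simp: c_def)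
  obtain \<epsilon>0 where \<epsilon>0: "\<epsilon>0 > 0" "\<forall>\<epsilon>. 0 < \<epsilon> \<and> \<epsilon> < \<epsilon>0 \<longrightarrow>
    (\<integral>\<^sup>+x. ennreal (\<bar>\<psi> x\<bar> powr p) * indicator {x \<in> D. infdist x ?S < \<epsilon>} x \<partial>?M) \<le> ennreal (c * \<epsilon> powr p)"
    using collar[OF N p D ms \<psi> H lim glim tr c(1)] by blast
  have idm[measurable]: "(\<lambda>x. infdist x ?S) \<in> borel_measurable borel"
    by (intro borel_measurable_continuous_onI continuous_intros)
  have colm: "{x \<in> D. infdist x ?S < \<epsilon>} \<in> sets ?M" for \<epsilon>
  proof -
    have "{x \<in> D. infdist x ?S < \<epsilon>} = D \<inter> {x. infdist x ?S < \<epsilon>}" by auto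
    moreover have "{x. infdist x ?S < \<epsilon>} \<in> sets borel" by measurable
    ultimately show ?thesis using oD by (auto simp: sets_restrict_space_iff)
  qed
  have ev: "\<forall>\<^sub>F n in sequentially. x \<notin> {x \<in> D. infdist x ?S < inverse (real (Suc n))}" for x
  proof (cases "x \<in> D")
    case True
    then have "infdist x ?S > 0"
      using disj[OF True] Sne cS by (intro infdist_pos_not_in_closed) (auto simp: compact_imp_closed)
    then have "\<forall>\<^sub>F n in sequentially. inverse (real (Suc n)) < infdist x ?S"
      using LIMSEQ_inverse_real_of_nat by (rule order_tendstoD[rotated])
    then show ?thesis by eventually_elim auto
  qed simp
  have "(\<lambda>n. \<integral>\<^sup>+x. ennreal (norm (\<psi> x) powr p) * indicator {x \<in> D. infdist x ?S < inverse (real (Suc n))} x \<partial>?M) \<longlonglongrightarrow> 0"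
    by (rule nn_integral_shrinking_tendsto_0[OF _ \<psi>m(2) colm ev]) measurable
  then have e1: "\<forall>\<^sub>F n in sequentially. (\<integral>\<^sup>+x. ennreal (norm (\<psi> x) powr p) * indicator {x \<in> D. infdist x ?S < inverse (real (Suc n))} x \<partial>?M) < ennreal \<delta>'"
    using \<delta>' by (intro order_tendstoD) auto
  have "(\<lambda>n. \<integral>\<^sup>+x. ennreal (norm (H x) powr p) * indicator {x \<in> D. infdist x ?S < inverse (real (Suc n))} x \<partial>?M) \<longlonglongrightarrow> 0"
    by (rule nn_integral_shrinking_tendsto_0[OF _ Hm(2) colm ev]) measurable
  then have e2: "\<forall>\<^sub>F n in sequentially. (\<integral>\<^sup>+x. ennreal (norm (H x) powr p) * indicator {x \<in> D. infdist x ?S < inverse (real (Suc n))} x \<partial>?M) < ennreal \<delta>'"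
    using \<delta>' by (intro order_tendstoD) auto
  have e3: "\<forall>\<^sub>F n in sequentially. inverse (real (Suc n)) < \<epsilon>0"
    using LIMSEQ_inverse_real_of_nat \<epsilon>0(1) by (rule order_tendstoD)
  obtain n where n: "(\<integral>\<^sup>+x. ennreal (norm (\<psi> x) powr p) * indicator {x \<in> D. infdist x ?S < inverse (real (Suc n))} x \<partial>?M) < ennreal \<delta>'"
    "(\<integral>\<^sup>+x. ennreal (norm (H x) powr p) * indicator {x \<in> D. infdist x ?S < inverse (real (Suc n))} x \<partial>?M) < ennreal \<delta>'"
    "inverse (real (Suc n)) < \<epsilon>0"
    using eventually_conj[OF e1 eventually_conj[OF e2 e3]] unfolding eventually_sequentially by blast
  define \<epsilon> where "\<epsilon> = inverse (real (Suc n))"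
  have \<epsilon>: "0 < \<epsilon>" "\<epsilon> < \<epsilon>0" using n(3) by (auto simp: \<epsilon>_def)
  define col where "col = {x \<in> D. infdist x ?S < \<epsilon>}"
  have [measurable]: "col \<in> sets ?M" unfolding col_def by (rule colm)
  define \<kappa> where "\<kappa> = 4 * C / \<epsilon>"
  have \<kappa>: "\<kappa> > 0" using C \<epsilon> by (simp add: \<kappa>_def)
  \<comment> \<open>Smoothing \<open>A\<close> at scale eps/4 gives a cutoff equal to 1 at distances
    beyond 3 eps/4 from the boundary and equal to 0 within distance eps/4 of it.\<close>
  define A where "A = {x \<in> D. \<epsilon> / 2 \<le> infdist x ?S}"
  have AL: "A \<in> sets lebesgue"
  proof -
    have "A = D \<inter> {x. \<epsilon> / 2 \<le> infdist x ?S}" by (auto simp: A_def)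
    moreover have "{x. \<epsilon> / 2 \<le> infdist x ?S} \<in> sets borel" by measurable
    ultimately show ?thesis using oD by auto
  qed
  have "0 < \<epsilon> / 4" using \<epsilon>(1) by simp
  from C(2)[rule_format, OF this AL]
  obtain \<eta> where \<eta>0: "smooth \<eta> \<and> (\<forall>x::real^'n. 0 \<le> \<eta> x \<and> \<eta> x \<le> 1 \<and> norm (grad \<eta> x) \<le> C / (\<epsilon> / 4)
       \<and> (ball x (\<epsilon> / 4) \<subseteq> A \<longrightarrow> \<eta> x = 1) \<and> (ball x (\<epsilon> / 4) \<inter> A = {} \<longrightarrow> \<eta> x = 0))" by (rule exE)
  note \<eta>s = conjunct1[OF \<eta>0] and \<eta> = conjunct2[OF \<eta>0]
  have in_D: "x \<in> D" if x: "\<exists>a\<in>A. dist a x < \<epsilon> / 2" for x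
  proof -
    obtain a where a: "a \<in> A" "dist a x < \<epsilon> / 2" using x by blast
    then have "ball a (\<epsilon> / 2) \<subseteq> D" by (intro ball_subset_of_infdist[OF fr Sne]) (auto simp: A_def)
    with a(2) show ?thesis by (auto simp: subset_iff)
  qed
  have \<eta>1: "\<eta> x = 1" if x: "x \<in> D" "3 / 4 * \<epsilon> \<le> infdist x ?S" for x
  proof -
    have "ball x (\<epsilon> / 4) \<subseteq> A"
    proof
      fix y assume y: "y \<in> ball x (\<epsilon> / 4)"
      have "ball x (3 / 4 * \<epsilon>) \<subseteq> D" by (rule ball_subset_of_infdist[OF fr Sne x])
      moreover have "y \<in> ball x (3 / 4 * \<epsilon>)" using y \<epsilon> by auto
      moreover have "infdist x ?S \<le> infdist y ?S + dist x y" by (rule infdist_triangle)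
      ultimately show "y \<in> A" using x y by (auto simp: A_def)
    qed
    then show ?thesis using \<eta> by blast
  qed
  have \<eta>g: "grad \<eta> x = 0" if x: "x \<in> D" "x \<notin> col" for x
  proof (rule grad_eqI)
    define W where "W = D \<inter> {y. 3 / 4 * \<epsilon> < infdist y ?S}"
    have "open W" unfolding W_def by (intro open_Int oD open_Collect_less continuous_intros)
    moreover have "x \<in> W" using x \<epsilon> by (auto simp: W_def col_def)
    moreover have "1 = \<eta> y" if "y \<in> W" for y using that by (intro \<eta>1[symmetric]) (auto simp: W_def)
    moreover have "((\<lambda>_. 1) has_derivative (\<lambda>h. 0 \<bullet> h)) (at x)" by simp
    ultimately show "(\<eta> has_derivative (\<lambda>h. 0 \<bullet> h)) (at x)"
      using has_derivative_transform_within_open[of "\<lambda>_. 1" "\<lambda>h. 0 \<bullet> h" x UNIV W \<eta>] by blast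
  qed
  \<comment> \<open>The order of choices matters: \<open>\<epsilon>\<close>, and with it the slope
    \<open>\<kappa>\<close>, is already fixed, so \<open>k\<close> can be taken large enough to beat
    \<open>\<kappa> powr p\<close>.\<close>
  have l1: "\<forall>\<^sub>F k in sequentially. (\<integral>\<^sup>+x. ennreal (norm (m k x - \<psi> x) powr p) \<partial>?M) < ennreal (min \<delta>' (\<delta>' / \<kappa> powr p))"
    using lim \<delta>' \<kappa> unfolding Lp_null_def by (intro order_tendstoD) auto
  have l2: "\<forall>\<^sub>F k in sequentially. (\<integral>\<^sup>+x. ennreal (norm (grad (m k) x - H x) powr p) \<partial>?M) < ennreal \<delta>'"
    using glim \<delta>' unfolding Lp_null_def by (intro order_tendstoD) auto
  obtain k where k: "(\<integral>\<^sup>+x. ennreal (norm (m k x - \<psi> x) powr p) \<partial>?M) < ennreal (min \<delta>' (\<delta>' / \<kappa> powr p))"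
    "(\<integral>\<^sup>+x. ennreal (norm (grad (m k) x - H x) powr p) \<partial>?M) < ennreal \<delta>'"
    using eventually_conj[OF l1 l2] unfolding eventually_sequentially by blast
  define \<theta> where "\<theta> = (\<lambda>x. \<eta> x * m k x)"
  have \<theta>s: "smooth \<theta>" unfolding \<theta>_def by (intro smooth_mult \<eta>s ms)
  have \<theta>D: "\<theta> \<in> test_functions D"
  proof -
    have "closure {x. \<theta> x \<noteq> 0} \<subseteq> D"
    proof
      fix x assume "x \<in> closure {x. \<theta> x \<noteq> 0}"
      \<comment> \<open>The support must have its closure in \<open>D\<close>: eps/8 for passing to
        the closure and eps/4 for the smoothing still sum to less than eps/2, the distance of
        \<open>A\<close> from the boundary.\<close>
      then obtain y where y: "\<theta> y \<noteq> 0" "dist y x < \<epsilon> / 8"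
        using \<epsilon>(1) unfolding closure_approachable by (metis (mono_tags, lifting) mem_Collect_eq zero_less_divide_iff zero_less_numeral)
      then have "\<eta> y \<noteq> 0" by (auto simp: \<theta>_def)
      then have "ball y (\<epsilon> / 4) \<inter> A \<noteq> {}" using \<eta> by blast
      then obtain a where a: "a \<in> A" "dist y a < \<epsilon> / 4" by auto
      have "dist a x < \<epsilon> / 2" using dist_triangle[of a x y] y(2) a(2) \<epsilon>(1) by (simp add: dist_commute)
      then show "x \<in> D" using a(1) by (intro in_D bexI[of _ a])
    qed
    moreover have "{x. \<theta> x \<noteq> 0} \<subseteq> cball 0 R" using supp by (auto simp: \<theta>_def not_le) (meson less_imp_le not_le)
    then have "compact (closure {x. \<theta> x \<noteq> 0})"
      by (meson bounded_cball bounded_subset compact_closure)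
    ultimately show ?thesis using \<theta>s by (simp add: test_functions_def)
  qed
  let ?a = "\<integral>\<^sup>+x. ennreal (norm (m k x - \<psi> x) powr p) \<partial>?M"
  let ?b = "\<integral>\<^sup>+x. ennreal (norm (grad (m k) x - H x) powr p) \<partial>?M"
  let ?c = "\<integral>\<^sup>+x. ennreal (norm (\<psi> x) powr p) * indicator col x \<partial>?M"
  let ?d = "\<integral>\<^sup>+x. ennreal (norm (H x) powr p) * indicator col x \<partial>?M"
  have a: "?a \<le> ennreal \<delta>'" "ennreal (\<kappa> powr p) * ?a \<le> ennreal \<delta>'"
  proof -
    show "?a \<le> ennreal \<delta>'" using k(1) by (rule order_trans[OF less_imp_le]) (simp add: ennreal_leI)
    have "?a \<le> ennreal (\<delta>' / \<kappa> powr p)" using k(1) by (rule order_trans[OF less_imp_le]) (simp add: ennreal_leI)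
    then have "ennreal (\<kappa> powr p) * ?a \<le> ennreal (\<kappa> powr p) * ennreal (\<delta>' / \<kappa> powr p)" by (rule mult_left_mono) simp
    also have "\<dots> = ennreal \<delta>'" using \<kappa> \<delta>' by (simp add: ennreal_mult[symmetric])
    finally show "ennreal (\<kappa> powr p) * ?a \<le> ennreal \<delta>'" .
  qed
  have b: "?b \<le> ennreal \<delta>'" using k(2) by simp
  have cd: "?c \<le> ennreal \<delta>'" "?d \<le> ennreal \<delta>'" using n(1,2) by (auto simp: col_def \<epsilon>_def)
  have kc: "ennreal (\<kappa> powr p) * ?c \<le> ennreal \<delta>'"
  proof -
    have "?c \<le> ennreal (c * \<epsilon> powr p)" using \<epsilon>0(2) \<epsilon> unfolding col_def real_norm_def by blast
    then have "ennreal (\<kappa> powr p) * ?c \<le> ennreal (\<kappa> powr p) * ennreal (c * \<epsilon> powr p)" by (rule mult_left_mono) simp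
    also have "\<dots> = ennreal (\<kappa> powr p * (c * \<epsilon> powr p))" using c by (simp add: ennreal_mult)
    also have "\<kappa> powr p * (c * \<epsilon> powr p) = \<delta>'" using c(2) C \<epsilon> by (simp add: \<kappa>_def powr_divide mult.commute)
    finally show ?thesis .
  qed
  have "(\<integral>\<^sup>+x. ennreal (norm (\<theta> x - \<psi> x) powr p) \<partial>?M)
      \<le> (\<integral>\<^sup>+x. ennreal (4 powr p) * (ennreal (norm (m k x - \<psi> x) powr p) + ennreal (norm (\<psi> x) powr p) * indicator col x) \<partial>?M)"
  proof (rule nn_integral_mono)
    fix x assume "x \<in> space ?M"
    then have x: "x \<in> D" by simp
    let ?i = "indicator col x :: real"
    have "norm (\<theta> x - \<psi> x) \<le> norm (m k x - \<psi> x) + norm (?i * \<psi> x) + 0 + 0"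
    proof (cases "x \<in> col")
      case True
      have "\<theta> x - \<psi> x = \<eta> x * (m k x - \<psi> x) - (1 - \<eta> x) * \<psi> x" by (simp add: \<theta>_def algebra_simps)
      also have "norm \<dots> \<le> norm (\<eta> x * (m k x - \<psi> x)) + norm ((1 - \<eta> x) * \<psi> x)" by (rule norm_triangle_ineq4)
      also have "\<dots> \<le> norm (m k x - \<psi> x) + norm (\<psi> x)"
        using \<eta> by (intro add_mono) (auto simp: abs_mult intro!: mult_left_le_one_le)
      finally show ?thesis using True by simp
    next
      case False
      then have "3 / 4 * \<epsilon> \<le> infdist x ?S" using x \<epsilon> by (simp add: col_def not_less)
      then show ?thesis using \<eta>1[OF x] False by (simp add: \<theta>_def)
    qed
    then have "norm (\<theta> x - \<psi> x) powr p \<le> 4 powr p * (norm (m k x - \<psi> x) powr p + norm (?i * \<psi> x) powr p + 0 powr p + 0 powr p)"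
      using p by (intro powr_sum4_le) auto
    also have "\<dots> = 4 powr p * (norm (m k x - \<psi> x) powr p + norm (\<psi> x) powr p * ?i)"
      by (cases "x \<in> col") auto
    finally have "ennreal (norm (\<theta> x - \<psi> x) powr p) \<le> ennreal (4 powr p * (norm (m k x - \<psi> x) powr p + norm (\<psi> x) powr p * ?i))"
      by (rule ennreal_leI)
    then show "ennreal (norm (\<theta> x - \<psi> x) powr p) \<le> ennreal (4 powr p) * (ennreal (norm (m k x - \<psi> x) powr p) + ennreal (norm (\<psi> x) powr p) * indicator col x)"
      by (cases "x \<in> col") (simp_all add: ennreal_mult ennreal_plus)
  qed
  also have "\<dots> = ennreal (4 powr p) * (?a + ?c)"
    by (subst nn_integral_cmult, measurable, subst nn_integral_add) auto
  also have "\<dots> \<le> ennreal (4 powr p) * (ennreal \<delta>' + ennreal \<delta>')" by (intro mult_left_mono add_mono a cd) auto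
  also have "\<dots> = ennreal (4 powr p * (\<delta>' + \<delta>'))"
    using \<delta>'(1) by (subst ennreal_mult) (simp_all only: ennreal_plus add_nonneg_nonneg less_imp_le powr_ge_zero)
  also have "\<dots> \<le> ennreal \<delta>" unfolding \<delta>'(2)[symmetric] using \<delta>' by (intro ennreal_leI mult_left_mono) auto
  finally have 1: "(\<integral>\<^sup>+x. ennreal (norm (\<theta> x - \<psi> x) powr p) \<partial>?M) \<le> ennreal \<delta>" .
  have "(\<integral>\<^sup>+x. ennreal (norm (grad \<theta> x - H x) powr p) \<partial>?M)
      \<le> (\<integral>\<^sup>+x. ennreal (4 powr p) * (ennreal (norm (grad (m k) x - H x) powr p) + ennreal (norm (H x) powr p) * indicator col x
          + ennreal (\<kappa> powr p) * ennreal (norm (m k x - \<psi> x) powr p) + ennreal (\<kappa> powr p) * (ennreal (norm (\<psi> x) powr p) * indicator col x)) \<partial>?M)"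
  proof (rule nn_integral_mono)
    fix x assume "x \<in> space ?M"
    then have x: "x \<in> D" by simp
    let ?i = "indicator col x :: real"
    have g: "grad \<theta> x = \<eta> x *\<^sub>R grad (m k) x + m k x *\<^sub>R grad \<eta> x" unfolding \<theta>_def by (rule grad_mult[OF \<eta>s ms])
    have \<kappa>g: "norm (grad \<eta> x) \<le> \<kappa>" using \<eta> by (simp add: \<kappa>_def mult.commute)
    have "norm (grad \<theta> x - H x) \<le> norm (grad (m k) x - H x) + norm (?i *\<^sub>R H x) + \<kappa> * norm (m k x - \<psi> x) + \<kappa> * norm (?i * \<psi> x)"
    proof (cases "x \<in> col")
      case True
      have "grad \<theta> x - H x = (\<eta> x *\<^sub>R (grad (m k) x - H x) - (1 - \<eta> x) *\<^sub>R H x) + ((m k x - \<psi> x) *\<^sub>R grad \<eta> x + \<psi> x *\<^sub>R grad \<eta> x)"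
        unfolding g by (simp add: algebra_simps)
      also have "norm \<dots> \<le> (norm (\<eta> x *\<^sub>R (grad (m k) x - H x)) + norm ((1 - \<eta> x) *\<^sub>R H x))
          + (norm ((m k x - \<psi> x) *\<^sub>R grad \<eta> x) + norm (\<psi> x *\<^sub>R grad \<eta> x))"
        by (intro norm_triangle_mono norm_triangle_ineq4 norm_triangle_ineq)
      also have "\<dots> \<le> (norm (grad (m k) x - H x) + norm (H x)) + (norm (m k x - \<psi> x) * \<kappa> + norm (\<psi> x) * \<kappa>)"
        using \<eta> \<kappa>g by (intro add_mono) (auto intro!: mult_left_le_one_le mult_left_mono)
      finally show ?thesis using True by (simp add: mult.commute)
    next
      case False
      then have "3 / 4 * \<epsilon> \<le> infdist x ?S" using x \<epsilon> by (simp add: col_def not_less)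
      then show ?thesis using \<eta>1[OF x] \<eta>g[OF x False] False \<kappa> by (simp add: g)
    qed
    then have "norm (grad \<theta> x - H x) powr p \<le> 4 powr p * (norm (grad (m k) x - H x) powr p + norm (?i *\<^sub>R H x) powr p + (\<kappa> * norm (m k x - \<psi> x)) powr p + (\<kappa> * norm (?i * \<psi> x)) powr p)"
      using p \<kappa> by (intro powr_sum4_le) auto
    also have "\<dots> = 4 powr p * (norm (grad (m k) x - H x) powr p + norm (H x) powr p * ?i + \<kappa> powr p * norm (m k x - \<psi> x) powr p + \<kappa> powr p * (norm (\<psi> x) powr p * ?i))"
      by (cases "x \<in> col") (auto simp: powr_mult)
    finally have "ennreal (norm (grad \<theta> x - H x) powr p) \<le> ennreal (4 powr p * (norm (grad (m k) x - H x) powr p + norm (H x) powr p * ?i + \<kappa> powr p * norm (m k x - \<psi> x) powr p + \<kappa> powr p * (norm (\<psi> x) powr p * ?i)))"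
      by (rule ennreal_leI)
    then show "ennreal (norm (grad \<theta> x - H x) powr p) \<le> ennreal (4 powr p) * (ennreal (norm (grad (m k) x - H x) powr p) + ennreal (norm (H x) powr p) * indicator col x
          + ennreal (\<kappa> powr p) * ennreal (norm (m k x - \<psi> x) powr p) + ennreal (\<kappa> powr p) * (ennreal (norm (\<psi> x) powr p) * indicator col x))"
      by (cases "x \<in> col") (simp_all add: ennreal_mult ennreal_plus)
  qed
  also have "\<dots> = ennreal (4 powr p) * (?b + ?d + ennreal (\<kappa> powr p) * ?a + ennreal (\<kappa> powr p) * ?c)"
    by (subst nn_integral_cmult, measurable) (simp add: nn_integral_add nn_integral_cmult)
  also have "\<dots> \<le> ennreal (4 powr p) * (ennreal \<delta>' + ennreal \<delta>' + ennreal \<delta>' + ennreal \<delta>')"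
    by (intro mult_left_mono add_mono a b cd kc) auto
  also have "\<dots> = ennreal (4 powr p * (\<delta>' + \<delta>' + \<delta>' + \<delta>'))"
    using \<delta>'(1) by (subst ennreal_mult) (simp_all only: ennreal_plus add_nonneg_nonneg less_imp_le powr_ge_zero)
  also have "\<dots> = ennreal \<delta>" by (simp only: \<delta>'(2))
  finally have 2: "(\<integral>\<^sup>+x. ennreal (norm (grad \<theta> x - H x) powr p) \<partial>?M) \<le> ennreal \<delta>" .
  show ?thesis using \<theta>D 1 2 by blast
qed

lemma zero_trace_W1p_0:
  fixes \<Omega> :: "(real ^ 'n) set" and m :: "nat \<Rightarrow> real ^ 'n \<Rightarrow> real"
  assumes N: "2 \<le> CARD('n)" and p: "1 \<le> p" and D: "chart_boundary D (frontier \<Omega>)"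
    and m: "\<And>k. m k \<in> test_functions UNIV"
    and supp: "\<And>k x. R \<le> norm x \<Longrightarrow> m k x = 0"
    and \<psi>: "\<psi> \<in> Lp p (lebesgue_on D)" and H: "H \<in> Lp p (lebesgue_on D)"
    and lim: "Lp_null p (lebesgue_on D) (\<lambda>k x. m k x - \<psi> x)"
    and glim: "Lp_null p (lebesgue_on D) (\<lambda>k x. grad (m k) x - H x)"
    and tr: "(\<lambda>k. \<integral>\<^sup>+x. ennreal (\<bar>m k x\<bar> powr p) \<partial>surface_measure \<Omega>) \<longlonglongrightarrow> 0"
  shows "\<psi> \<in> W1p_0 p D" "AE x in lebesgue_on D. weak_grad D \<psi> x = H x"
proof -
  have oD: "open D" using D by (simp add: chart_boundary_def)
  have "\<forall>j. \<exists>\<theta>. \<theta> \<in> test_functions D \<and> (\<integral>\<^sup>+x. ennreal (norm (\<theta> x - \<psi> x) powr p) \<partial>lebesgue_on D) \<le> ennreal (inverse (real (Suc j))) \<and>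
     (\<integral>\<^sup>+x. ennreal (norm (grad \<theta> x - H x) powr p) \<partial>lebesgue_on D) \<le> ennreal (inverse (real (Suc j)))"
  proof
    fix j
    have "0 < inverse (real (Suc j))" by simp
    from zero_trace_approx[OF N p D m supp \<psi> H lim glim tr this]
    show "\<exists>\<theta>. \<theta> \<in> test_functions D \<and> (\<integral>\<^sup>+x. ennreal (norm (\<theta> x - \<psi> x) powr p) \<partial>lebesgue_on D) \<le> ennreal (inverse (real (Suc j))) \<and>
     (\<integral>\<^sup>+x. ennreal (norm (grad \<theta> x - H x) powr p) \<partial>lebesgue_on D) \<le> ennreal (inverse (real (Suc j)))"
      by (simp only: Bex_def)
  qed
  then obtain \<theta> where \<theta>: "\<forall>j. \<theta> j \<in> test_functions D \<and> (\<integral>\<^sup>+x. ennreal (norm (\<theta> j x - \<psi> x) powr p) \<partial>lebesgue_on D) \<le> ennreal (inverse (real (Suc j))) \<and>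
     (\<integral>\<^sup>+x. ennreal (norm (grad (\<theta> j) x - H x) powr p) \<partial>lebesgue_on D) \<le> ennreal (inverse (real (Suc j)))"
    by (rule choice[THEN exE])
  have lim0: "(\<lambda>j. ennreal (inverse (real (Suc j)))) \<longlonglongrightarrow> 0"
    using tendsto_ennrealI[OF LIMSEQ_inverse_real_of_nat] by simp
  have "Lp_tendsto p (lebesgue_on D) \<theta> \<psi>" "Lp_tendsto p (lebesgue_on D) (\<lambda>j. grad (\<theta> j)) H"
    unfolding Lp_tendsto_def by (rule tendsto_sandwich[OF _ _ tendsto_const lim0]; use \<theta> in simp)+
  then show "\<psi> \<in> W1p_0 p D" "AE x in lebesgue_on D. weak_grad D \<psi> x = H x"
    using W1p_0_limit[OF oD p _ \<psi> H] \<theta> by blast+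
qed

section \<open>Functions of the two solutions\<close>

section \<open>Superposition with functions of two variables\<close>

text \<open>A \<open>C\<^sup>1\<close> function of two variables with bounded partial derivatives \<open>\<Psi>1\<close>, \<open>\<Psi>2\<close> that preserves smoothness.\<close>

definition admissible :: "(real \<Rightarrow> real \<Rightarrow> real) \<Rightarrow> (real \<Rightarrow> real \<Rightarrow> real) \<Rightarrow> (real \<Rightarrow> real \<Rightarrow> real) \<Rightarrow> real \<Rightarrow> 'n::finite itself \<Rightarrow> bool" where
  "admissible \<Psi> \<Psi>1 \<Psi>2 B _ \<longleftrightarrow> 0 \<le> B \<and>
     (\<forall>f g :: real ^ 'n \<Rightarrow> real. smooth f \<longrightarrow> smooth g \<longrightarrow> smooth (\<lambda>x. \<Psi> (f x) (g x)) \<and>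
        (\<forall>x. grad (\<lambda>x. \<Psi> (f x) (g x)) x = \<Psi>1 (f x) (g x) *\<^sub>R grad f x + \<Psi>2 (f x) (g x) *\<^sub>R grad g x)) \<and>
     continuous_on UNIV (\<lambda>z. \<Psi>1 (fst z) (snd z)) \<and> continuous_on UNIV (\<lambda>z. \<Psi>2 (fst z) (snd z)) \<and>
     continuous_on UNIV (\<lambda>z. \<Psi> (fst z) (snd z)) \<and>
     (\<forall>s t. \<bar>\<Psi>1 s t\<bar> \<le> B \<and> \<bar>\<Psi>2 s t\<bar> \<le> B) \<and>
     (\<forall>s t s' t'. \<bar>\<Psi> s t - \<Psi> s' t'\<bar> \<le> B * (\<bar>s - s'\<bar> + \<bar>t - t'\<bar>))"

lemma admissible_measurable:
  fixes \<Psi> :: "real \<Rightarrow> real \<Rightarrow> real" and u v :: "'a \<Rightarrow> real"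
  assumes "continuous_on UNIV (\<lambda>z. \<Psi> (fst z) (snd z) :: real)"
    and "u \<in> borel_measurable M" "v \<in> borel_measurable M"
  shows "(\<lambda>x. \<Psi> (u x) (v x)) \<in> borel_measurable M"
  using borel_measurable_continuous_on[OF assms(1) borel_measurable_Pair[OF assms(2,3)]] by simp

lemma admissible_tendsto:
  fixes \<Psi> :: "real \<Rightarrow> real \<Rightarrow> real" and f g :: "nat \<Rightarrow> real"
  assumes "continuous_on UNIV (\<lambda>z. \<Psi> (fst z) (snd z) :: real)" "f \<longlonglongrightarrow> a" "g \<longlonglongrightarrow> b"
  shows "(\<lambda>k. \<Psi> (f k) (g k)) \<longlonglongrightarrow> \<Psi> a b"
  using continuous_on_tendsto_compose[OF assms(1) tendsto_Pair[OF assms(2,3)]] by simp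

lemma Lp_null_superposition:
  fixes w w' :: "nat \<Rightarrow> 'a \<Rightarrow> real"
  assumes B: "0 \<le> B" "\<And>s t s' t'. \<bar>\<Psi> s t - \<Psi> s' t'\<bar> \<le> B * (\<bar>s - s'\<bar> + \<bar>t - t'\<bar>)"
    and w: "Lp_null p M (\<lambda>k x. w k x - u x)" "Lp_null p M (\<lambda>k x. w' k x - v x)"
    and [measurable]: "\<And>k. w k \<in> borel_measurable M" "\<And>k. w' k \<in> borel_measurable M" "u \<in> borel_measurable M" "v \<in> borel_measurable M"
    and p: "0 < p"
  shows "Lp_null p M (\<lambda>k x. \<Psi> (w k x) (w' k x) - \<Psi> (u x) (v x))"
proof (rule Lp_null_mono[of p M "\<lambda>k x. \<bar>w k x - u x\<bar> + \<bar>w' k x - v x\<bar>" B])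
  show "Lp_null p M (\<lambda>k x. \<bar>w k x - u x\<bar> + \<bar>w' k x - v x\<bar>)"
    by (rule Lp_null_add[OF _ _ p]) (use w in \<open>auto simp: Lp_null_def\<close>)
qed (use p B in auto)

text \<open>The derivatives of \<open>\<Psi>\<close> are continuous and bounded but not assumed
  Lipschitz, so the coefficients converge only almost everywhere, along a subsequence. A product
  difference splits into a bounded coefficient times the gradient error, and a coefficient error
  times a fixed L^p function.\<close>

lemma Lp_null_superposition_grad:
  fixes w w' :: "nat \<Rightarrow> 'a \<Rightarrow> real" and G G' :: "nat \<Rightarrow> 'a \<Rightarrow> 'b::euclidean_space"
  assumes c1: "continuous_on UNIV (\<lambda>z. \<Psi>1 (fst z) (snd z))" and c2: "continuous_on UNIV (\<lambda>z. \<Psi>2 (fst z) (snd z))"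
    and B: "0 \<le> B" "\<And>s t. \<bar>\<Psi>1 s t\<bar> \<le> B" "\<And>s t. \<bar>\<Psi>2 s t\<bar> \<le> B"
    and w: "Lp_null p M (\<lambda>k x. w k x - u x)" "Lp_null p M (\<lambda>k x. w' k x - v x)"
    and G: "Lp_null p M (\<lambda>k x. G k x - Gu x)" "Lp_null p M (\<lambda>k x. G' k x - Gv x)"
    and m: "\<And>k. w k \<in> borel_measurable M" "\<And>k. w' k \<in> borel_measurable M" "u \<in> borel_measurable M" "v \<in> borel_measurable M"
      "\<And>k. G k \<in> borel_measurable M" "\<And>k. G' k \<in> borel_measurable M"
    and GL: "Gu \<in> Lp p M" "Gv \<in> Lp p M" and p: "0 < p"
  obtains r :: "nat \<Rightarrow> nat" where "strict_mono r"
    "Lp_null p M (\<lambda>k x. (\<Psi>1 (w (r k) x) (w' (r k) x) *\<^sub>R G (r k) x + \<Psi>2 (w (r k) x) (w' (r k) x) *\<^sub>R G' (r k) x)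
        - (\<Psi>1 (u x) (v x) *\<^sub>R Gu x + \<Psi>2 (u x) (v x) *\<^sub>R Gv x))"
proof -
  note [measurable] = m Lp_nn_integral_finite(1)[OF GL(1)] Lp_nn_integral_finite(1)[OF GL(2)]
  obtain r1 where r1: "strict_mono r1" "AE x in M. (\<lambda>k. w (r1 k) x - u x) \<longlonglongrightarrow> 0"
    by (rule Lp_null_AE_subseq[OF w(1) _ p]) measurable
  have "Lp_null p M (\<lambda>k x. w' (r1 k) x - v x)" by (rule Lp_null_subseq[OF w(2) r1(1)])
  then obtain r2 where r2: "strict_mono r2" "AE x in M. (\<lambda>k. w' (r1 (r2 k)) x - v x) \<longlonglongrightarrow> 0"
    by (rule Lp_null_AE_subseq[OF _ _ p]) measurable
  define r where "r k = r1 (r2 k)" for k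
  have r: "strict_mono r" using r1(1) r2(1) by (auto simp: r_def strict_mono_def)
  have ae: "AE x in M. (\<lambda>k. w (r k) x) \<longlonglongrightarrow> u x \<and> (\<lambda>k. w' (r k) x) \<longlonglongrightarrow> v x"
    using r1(2) r2(2)
  proof eventually_elim
    case (elim x)
    then have "(\<lambda>k. w (r k) x - u x) \<longlonglongrightarrow> 0" "(\<lambda>k. w' (r k) x - v x) \<longlonglongrightarrow> 0"
      using LIMSEQ_subseq_LIMSEQ[OF elim(1) r2(1)] by (auto simp: o_def r_def)
    then show ?case by (auto intro: LIM_zero_cancel)
  qed
  have part: "Lp_null p M (\<lambda>k x. \<Phi> (w (r k) x) (w' (r k) x) *\<^sub>R F (r k) x - \<Phi> (u x) (v x) *\<^sub>R Fu x)"
    if c: "continuous_on UNIV (\<lambda>z. \<Phi> (fst z) (snd z))" and b: "\<And>s t. \<bar>\<Phi> s t\<bar> \<le> B"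
      and F: "Lp_null p M (\<lambda>k x. F k x - Fu x)" and Fm[measurable]: "\<And>k. F k \<in> borel_measurable M" and Fu: "Fu \<in> Lp p M"
    for \<Phi> :: "real \<Rightarrow> real \<Rightarrow> real" and F :: "nat \<Rightarrow> 'a \<Rightarrow> 'b" and Fu
  proof -
    note [measurable] = Lp_nn_integral_finite(1)[OF Fu]
    have \<Phi>m[measurable]: "(\<lambda>x. \<Phi> (w k x) (w' k x)) \<in> borel_measurable M" "(\<lambda>x. \<Phi> (u x) (v x)) \<in> borel_measurable M" for k
      by (intro admissible_measurable[OF c] m)+
    have 1: "Lp_null p M (\<lambda>k x. \<Phi> (w (r k) x) (w' (r k) x) *\<^sub>R (F (r k) x - Fu x))"
      by (rule Lp_null_mono[OF Lp_null_subseq[OF F r] p B(1)]) (auto intro!: mult_right_mono b)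
    \<comment> \<open>Two coefficients bounded by \<open>B\<close> differ by at most
      \<open>2 * B\<close>, so \<open>2 * B * norm (Fu x)\<close> is an L^p majorant for dominated
      convergence.\<close>
    have 2: "Lp_null p M (\<lambda>k x. (\<Phi> (w (r k) x) (w' (r k) x) - \<Phi> (u x) (v x)) *\<^sub>R Fu x)"
    proof (rule Lp_null_dct[where w = "\<lambda>x. 2 * B * norm (Fu x)"])
      show "AE x in M. (\<lambda>k. (\<Phi> (w (r k) x) (w' (r k) x) - \<Phi> (u x) (v x)) *\<^sub>R Fu x) \<longlonglongrightarrow> 0"
        using ae
      proof eventually_elim
        case (elim x)
        then have "(\<lambda>k. (\<Phi> (w (r k) x) (w' (r k) x) - \<Phi> (u x) (v x)) *\<^sub>R Fu x) \<longlonglongrightarrow> (\<Phi> (u x) (v x) - \<Phi> (u x) (v x)) *\<^sub>R Fu x"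
          by (intro tendsto_intros admissible_tendsto[OF c]) auto
        then show ?case by simp
      qed
      show "AE x in M. norm ((\<Phi> (w (r k) x) (w' (r k) x) - \<Phi> (u x) (v x)) *\<^sub>R Fu x) \<le> 2 * B * norm (Fu x)" for k
      proof (rule AE_I2)
        fix x
        have "\<bar>\<Phi> (w (r k) x) (w' (r k) x) - \<Phi> (u x) (v x)\<bar> \<le> 2 * B"
          using b[of "w (r k) x" "w' (r k) x"] b[of "u x" "v x"] by linarith
        then show "norm ((\<Phi> (w (r k) x) (w' (r k) x) - \<Phi> (u x) (v x)) *\<^sub>R Fu x) \<le> 2 * B * norm (Fu x)"
          by (simp add: mult_right_mono)
      qed
      have "(\<lambda>x. (2 * B) *\<^sub>R Fu x) \<in> Lp p M"
        by (rule Lp_bound[OF Fu _ p, of _ "2 * B"]) (use B(1) in auto)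
      from Lp_nn_integral_finite(2)[OF this]
      show "(\<integral>\<^sup>+x. ennreal ((2 * B * norm (Fu x)) powr p) \<partial>M) < \<infinity>" using B(1) by simp
    qed (use p in measurable)
    have "Lp_null p M (\<lambda>k x. \<Phi> (w (r k) x) (w' (r k) x) *\<^sub>R (F (r k) x - Fu x) + (\<Phi> (w (r k) x) (w' (r k) x) - \<Phi> (u x) (v x)) *\<^sub>R Fu x)"
      by (rule Lp_null_add[OF 1 2 p]) measurable
    then show ?thesis by (simp add: algebra_simps)
  qed
  show ?thesis
  proof (rule that[OF r])
    note [measurable] = admissible_measurable[OF c1 m(1,2)] admissible_measurable[OF c2 m(1,2)]
      admissible_measurable[OF c1 m(3,4)] admissible_measurable[OF c2 m(3,4)]
    have "Lp_null p M (\<lambda>k x. (\<Psi>1 (w (r k) x) (w' (r k) x) *\<^sub>R G (r k) x - \<Psi>1 (u x) (v x) *\<^sub>R Gu x)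
       + (\<Psi>2 (w (r k) x) (w' (r k) x) *\<^sub>R G' (r k) x - \<Psi>2 (u x) (v x) *\<^sub>R Gv x))"
      by (rule Lp_null_add[OF part[OF c1 B(2) G(1) m(5) GL(1)] part[OF c2 B(3) G(2) m(6) GL(2)] p]) measurable
    then show "Lp_null p M (\<lambda>k x. (\<Psi>1 (w (r k) x) (w' (r k) x) *\<^sub>R G (r k) x + \<Psi>2 (w (r k) x) (w' (r k) x) *\<^sub>R G' (r k) x)
        - (\<Psi>1 (u x) (v x) *\<^sub>R Gu x + \<Psi>2 (u x) (v x) *\<^sub>R Gv x))" by (simp add: algebra_simps)
  qed
qed

section \<open>Functions with vanishing gradient\<close>

text \<open>Differences of \<open>\<theta> k\<close> along segments are bounded by integrals of its
  gradient, which tend to 0, so the L^1 limit is invariant under the translation. The radius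
  \<open>R + s\<close> contains every segment of length \<open>s\<close> that starts in the ball of
  radius \<open>R\<close>.\<close>

lemma L1_limit_translation:
  fixes U :: "real ^ 'n \<Rightarrow> real" and \<theta> :: "nat \<Rightarrow> real ^ 'n \<Rightarrow> real"
  assumes U[measurable]: "U \<in> borel_measurable borel" and e: "norm e = 1" and s: "0 \<le> s"
    and \<theta>: "\<And>k. smooth (\<theta> k)"
    and lim: "(\<lambda>k. \<integral>\<^sup>+x. ennreal \<bar>\<theta> k x - U x\<bar> * indicator (ball 0 (R + s)) x \<partial>lborel) \<longlonglongrightarrow> 0"
    and glim: "(\<lambda>k. \<integral>\<^sup>+x. ennreal (norm (grad (\<theta> k) x)) * indicator (ball 0 (R + s)) x \<partial>lborel) \<longlonglongrightarrow> 0"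
  shows "AE x in lborel. x \<in> ball 0 R \<longrightarrow> U x = U (x - s *\<^sub>R e)"
proof -
  have m[measurable]: "\<theta> k \<in> borel_measurable borel" "grad (\<theta> k) \<in> borel_measurable borel" for k
    by (intro borel_measurable_continuous_onI smooth_continuous smooth_grad_continuous \<theta>)+
  let ?B = "ball (0::real^'n) R" and ?B' = "ball (0::real^'n) (R + s)"
  have [measurable]: "?B \<in> sets borel" "?B' \<in> sets borel" by auto
  have BB: "x \<in> ?B \<Longrightarrow> x - t *\<^sub>R e \<in> ?B'" if "t \<in> {0..s}" for x t
    using norm_triangle_ineq4[of x "t *\<^sub>R e"] that e by simp
  have B'[simp]: "x \<in> ?B \<Longrightarrow> x \<in> ?B'" for x using s by simp
  have le: "(\<integral>\<^sup>+x. ennreal \<bar>U x - U (x - s *\<^sub>R e)\<bar> * indicator ?B x \<partial>lborel)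
     \<le> (\<integral>\<^sup>+x. ennreal \<bar>\<theta> k x - U x\<bar> * indicator ?B' x \<partial>lborel) + ((\<integral>\<^sup>+x. ennreal \<bar>\<theta> k x - U x\<bar> * indicator ?B' x \<partial>lborel)
       + ennreal s * (\<integral>\<^sup>+x. ennreal (norm (grad (\<theta> k) x)) * indicator ?B' x \<partial>lborel))" for k
  proof -
    let ?Q = "\<lambda>x. (\<integral>\<^sup>+t. ennreal (norm (grad (\<theta> k) (x - t *\<^sub>R e))) * indicator {0..s} t \<partial>lborel) * indicator ?B x"
    have "(\<integral>\<^sup>+x. ennreal \<bar>U x - U (x - s *\<^sub>R e)\<bar> * indicator ?B x \<partial>lborel)
      \<le> (\<integral>\<^sup>+x. ennreal \<bar>\<theta> k x - U x\<bar> * indicator ?B' x + (ennreal \<bar>\<theta> k (x - s *\<^sub>R e) - U (x - s *\<^sub>R e)\<bar> * indicator ?B' (x - s *\<^sub>R e) + ?Q x) \<partial>lborel)"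
    proof (rule nn_integral_mono)
      fix x
      show "ennreal \<bar>U x - U (x - s *\<^sub>R e)\<bar> * indicator ?B x
        \<le> ennreal \<bar>\<theta> k x - U x\<bar> * indicator ?B' x + (ennreal \<bar>\<theta> k (x - s *\<^sub>R e) - U (x - s *\<^sub>R e)\<bar> * indicator ?B' (x - s *\<^sub>R e) + ?Q x)"
      proof (cases "x \<in> ?B")
        case True
        have "ennreal \<bar>U x - U (x - s *\<^sub>R e)\<bar> \<le> ennreal (\<bar>\<theta> k x - U x\<bar> + (\<bar>\<theta> k (x - s *\<^sub>R e) - U (x - s *\<^sub>R e)\<bar> + \<bar>\<theta> k x - \<theta> k (x - s *\<^sub>R e)\<bar>))"
          by (rule ennreal_leI) linarith
        also have "\<dots> = ennreal \<bar>\<theta> k x - U x\<bar> + (ennreal \<bar>\<theta> k (x - s *\<^sub>R e) - U (x - s *\<^sub>R e)\<bar> + ennreal \<bar>\<theta> k x - \<theta> k (x - s *\<^sub>R e)\<bar>)"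
          by (simp add: ennreal_plus)
        also have "ennreal \<bar>\<theta> k x - \<theta> k (x - s *\<^sub>R e)\<bar> \<le> (\<integral>\<^sup>+t. ennreal (norm (grad (\<theta> k) (x - t *\<^sub>R e))) * indicator {0..s} t \<partial>lborel)"
        proof (cases "s = 0")
          case False
          then show ?thesis using segment_powr_bound[OF \<theta> e s order_refl, of k x] s by simp
        qed simp
        finally show ?thesis using True BB[of s x] s by (simp add: add_left_mono)
      qed simp
    qed
    also have "\<dots> = (\<integral>\<^sup>+x. ennreal \<bar>\<theta> k x - U x\<bar> * indicator ?B' x \<partial>lborel)
       + ((\<integral>\<^sup>+x. ennreal \<bar>\<theta> k (x - s *\<^sub>R e) - U (x - s *\<^sub>R e)\<bar> * indicator ?B' (x - s *\<^sub>R e) \<partial>lborel) + (\<integral>\<^sup>+x. ?Q x \<partial>lborel))"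
    proof -
      have m1: "(\<lambda>x. ennreal \<bar>\<theta> k x - U x\<bar> * indicator ?B' x) \<in> borel_measurable lborel" by measurable
      have m2: "(\<lambda>x. ennreal \<bar>\<theta> k (x - s *\<^sub>R e) - U (x - s *\<^sub>R e)\<bar> * indicator ?B' (x - s *\<^sub>R e)) \<in> borel_measurable lborel" by measurable
      have m3: "?Q \<in> borel_measurable lborel" by measurable
      show ?thesis by (simp only: nn_integral_add[OF m1 borel_measurable_add[OF m2 m3]] nn_integral_add[OF m2 m3])
    qed
    also have "(\<integral>\<^sup>+x. ennreal \<bar>\<theta> k (x - s *\<^sub>R e) - U (x - s *\<^sub>R e)\<bar> * indicator ?B' (x - s *\<^sub>R e) \<partial>lborel)
       = (\<integral>\<^sup>+x. ennreal \<bar>\<theta> k x - U x\<bar> * indicator ?B' x \<partial>lborel)"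
    proof -
      have "(\<lambda>x. ennreal \<bar>\<theta> k x - U x\<bar> * indicator ?B' x) \<in> borel_measurable borel" by measurable
      from nn_integral_lborel_translate[OF this, of "- (s *\<^sub>R e)"] show ?thesis by simp
    qed
    also have "(\<integral>\<^sup>+x. ?Q x \<partial>lborel) \<le> ennreal s * (\<integral>\<^sup>+x. ennreal (norm (grad (\<theta> k) x)) * indicator ?B' x \<partial>lborel)"
      by (rule nn_integral_segment_le[of _ _ _ _ "\<lambda>_. s"]) (use s BB in auto)
    finally show ?thesis by (simp add: add_left_mono)
  qed
  have "(\<lambda>k. (\<integral>\<^sup>+x. ennreal \<bar>\<theta> k x - U x\<bar> * indicator ?B' x \<partial>lborel) + ((\<integral>\<^sup>+x. ennreal \<bar>\<theta> k x - U x\<bar> * indicator ?B' x \<partial>lborel)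
       + ennreal s * (\<integral>\<^sup>+x. ennreal (norm (grad (\<theta> k) x)) * indicator ?B' x \<partial>lborel))) \<longlonglongrightarrow> 0 + (0 + ennreal s * 0)"
    by (intro tendsto_add lim ennreal_tendsto_cmult glim) simp
  from tendsto_lowerbound[OF this always_eventually] le
  have "(\<integral>\<^sup>+x. ennreal \<bar>U x - U (x - s *\<^sub>R e)\<bar> * indicator ?B x \<partial>lborel) \<le> 0" by simp
  then have z: "(\<integral>\<^sup>+x. ennreal \<bar>U x - U (x - s *\<^sub>R e)\<bar> * indicator ?B x \<partial>lborel) = 0" by simp
  have "(\<lambda>x. ennreal \<bar>U x - U (x - s *\<^sub>R e)\<bar> * indicator ?B x) \<in> borel_measurable lborel" by measurable
  from iffD1[OF nn_integral_0_iff_AE[OF this] z]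
  have "AE x in lborel. ennreal \<bar>U x - U (x - s *\<^sub>R e)\<bar> * indicator ?B x = 0" .
  then show ?thesis by eventually_elim (auto simp: indicator_def)
qed

text \<open>Invariance under translations in one direction suffices: the L^q mass over any ball
  equals that over a copy moved arbitrarily far out, and a finite integral leaves no mass at
  infinity. Neither constancy of \<open>U\<close> nor a Poincare inequality enters.\<close>

lemma Lq_zero_gradient:
  fixes U :: "real ^ 'n \<Rightarrow> real"
  assumes U: "U \<in> borel_measurable lebesgue" and q: "0 < q" and fin: "(\<integral>\<^sup>+x. ennreal (\<bar>U x\<bar> powr q) \<partial>lebesgue) < \<infinity>"
    and approx: "\<And>R. \<exists>\<theta> :: nat \<Rightarrow> real ^ 'n \<Rightarrow> real. (\<forall>k. smooth (\<theta> k)) \<and>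
      (\<lambda>k. \<integral>\<^sup>+x. ennreal \<bar>\<theta> k x - U x\<bar> * indicator (ball 0 R) x \<partial>lebesgue) \<longlonglongrightarrow> 0 \<and>
      (\<lambda>k. \<integral>\<^sup>+x. ennreal (norm (grad (\<theta> k) x)) * indicator (ball 0 R) x \<partial>lebesgue) \<longlonglongrightarrow> 0"
  shows "AE x in lebesgue. U x = 0"
proof -
  obtain V where V: "V \<in> borel_measurable lborel" "AE x in lborel. U x = V x"
    using completion_ex_borel_measurable_real[OF U] by blast
  have [measurable]: "V \<in> borel_measurable borel" using V(1) by simp
  have finV: "(\<integral>\<^sup>+x. ennreal (\<bar>V x\<bar> powr q) \<partial>lborel) < \<infinity>"
    using fin V(2) unfolding nn_integral_completion by (subst nn_integral_cong_AE[where v = "\<lambda>x. ennreal (\<bar>U x\<bar> powr q)"]) auto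
  obtain e :: "real ^ 'n" where e: "norm e = 1" using vector_choose_size[of 1] by auto
  have tr: "AE x in lborel. x \<in> ball 0 R \<longrightarrow> V x = V (x - s *\<^sub>R e)" if s: "0 \<le> s" for R s
  proof -
    obtain \<theta> :: "nat \<Rightarrow> real ^ 'n \<Rightarrow> real" where \<theta>: "\<forall>k. smooth (\<theta> k)"
      "(\<lambda>k. \<integral>\<^sup>+x. ennreal \<bar>\<theta> k x - U x\<bar> * indicator (ball 0 (R + s)) x \<partial>lebesgue) \<longlonglongrightarrow> 0"
      "(\<lambda>k. \<integral>\<^sup>+x. ennreal (norm (grad (\<theta> k) x)) * indicator (ball 0 (R + s)) x \<partial>lebesgue) \<longlonglongrightarrow> 0"
      using approx[of "R + s"] by blast
    have eq: "(\<integral>\<^sup>+x. ennreal \<bar>\<theta> k x - U x\<bar> * indicator (ball 0 (R + s)) x \<partial>lebesgue)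
        = (\<integral>\<^sup>+x. ennreal \<bar>\<theta> k x - V x\<bar> * indicator (ball 0 (R + s)) x \<partial>lborel)" for k
      unfolding nn_integral_completion using V(2) by (intro nn_integral_cong_AE) auto
    show ?thesis
    proof (rule L1_limit_translation[OF _ e s])
      show "V \<in> borel_measurable borel" "\<And>k. smooth (\<theta> k)" using \<theta>(1) by auto
      show "(\<lambda>k. \<integral>\<^sup>+x. ennreal \<bar>\<theta> k x - V x\<bar> * indicator (ball 0 (R + s)) x \<partial>lborel) \<longlonglongrightarrow> 0"
        using \<theta>(2) unfolding eq .
      show "(\<lambda>k. \<integral>\<^sup>+x. ennreal (norm (grad (\<theta> k) x)) * indicator (ball 0 (R + s)) x \<partial>lborel) \<longlonglongrightarrow> 0"
        using \<theta>(3) unfolding nn_integral_completion .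
    qed
  qed
  have "AE x in lborel. x \<in> ball 0 R \<longrightarrow> V x = 0" for R
  proof -
    let ?I = "\<integral>\<^sup>+x. ennreal (\<bar>V x\<bar> powr q) * indicator (ball 0 R) x \<partial>lborel"
    have le: "?I \<le> (\<integral>\<^sup>+x. ennreal (\<bar>V x\<bar> powr q) * indicator (- ball 0 (real n)) x \<partial>lborel)" for n
    proof (cases "R > 0")
      case True
      \<comment> \<open>This shift carries the ball of radius \<open>R\<close> outside the ball of
        radius \<open>n\<close>.\<close>
      define s where "s = R + real n"
      have s: "0 \<le> s" using True by (simp add: s_def)
      have "?I = (\<integral>\<^sup>+x. ennreal (\<bar>V (x - s *\<^sub>R e)\<bar> powr q) * indicator (ball 0 R) x \<partial>lborel)"
        using tr[OF s, of R] by (intro nn_integral_cong_AE) (auto simp: indicator_def elim!: eventually_mono)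
      also have "\<dots> \<le> (\<integral>\<^sup>+x. ennreal (\<bar>V (x - s *\<^sub>R e)\<bar> powr q) * indicator (- ball 0 (real n)) (x - s *\<^sub>R e) \<partial>lborel)"
      proof (intro nn_integral_mono mult_left_mono)
        fix x
        show "indicator (ball 0 R) x \<le> (indicator (- ball 0 (real n)) (x - s *\<^sub>R e) :: ennreal)"
        proof (cases "x \<in> ball 0 R")
          case True
          have "norm (s *\<^sub>R e) \<le> norm (x - s *\<^sub>R e) + norm x"
            using norm_triangle_ineq4[of x "x - s *\<^sub>R e"] by simp
          then have "real n \<le> norm (x - s *\<^sub>R e)" using True e s by (simp add: s_def)
          then show ?thesis by (simp add: indicator_def)
        qed simp
      qed simp
      also have "\<dots> = (\<integral>\<^sup>+x. ennreal (\<bar>V x\<bar> powr q) * indicator (- ball 0 (real n)) x \<partial>lborel)"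
      proof -
        have "(\<lambda>x. ennreal (\<bar>V x\<bar> powr q) * indicator (- ball 0 (real n)) x) \<in> borel_measurable borel" by measurable
        from nn_integral_lborel_translate[OF this, of "- (s *\<^sub>R e)"] show ?thesis by simp
      qed
      finally show ?thesis .
    qed (simp add: not_less ball_empty)
    have "(\<lambda>n. \<integral>\<^sup>+x. ennreal (\<bar>V x\<bar> powr q) * indicator (- ball 0 (real n)) x \<partial>lborel) \<longlonglongrightarrow> 0"
    proof (rule nn_integral_shrinking_tendsto_0[OF _ finV])
      show "\<forall>\<^sub>F n in sequentially. x \<notin> - ball 0 (real n)" for x :: "real ^ 'n"
      proof -
        obtain n0 where "norm x < real n0" using reals_Archimedean2 by blast
        then show ?thesis by (auto simp: eventually_sequentially intro!: exI[of _ n0])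
      qed
    qed auto
    from tendsto_lowerbound[OF this always_eventually] le have "?I \<le> 0" by simp
    then have z: "?I = 0" by simp
    have [measurable]: "ball (0 :: real ^ 'n) R \<in> sets borel" by auto
    have "(\<lambda>x. ennreal (\<bar>V x\<bar> powr q) * indicator (ball 0 R) x) \<in> borel_measurable lborel" by measurable
    from iffD1[OF nn_integral_0_iff_AE[OF this] z]
    have "AE x in lborel. ennreal (\<bar>V x\<bar> powr q) * indicator (ball 0 R) x = 0" .
    then show ?thesis by eventually_elim (auto simp: indicator_def)
  qed
  then have "AE x in lborel. \<forall>n::nat. x \<in> ball 0 (real n) \<longrightarrow> V x = 0" unfolding AE_all_countable by blast
  then have "AE x in lborel. V x = 0"
  proof eventually_elim
    case (elim x)
    obtain n where "norm x < real n" using reals_Archimedean2 by blast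
    then have "x \<in> ball 0 (real n)" by simp
    then show ?case using elim by blast
  qed
  then have "AE x in lborel. U x = 0" using V(2) by eventually_elim simp
  then show ?thesis by (rule AE_completion)
qed

section \<open>The test functions\<close>

lemma grad_compose2:
  assumes "smooth f" "smooth g"
    and "((\<lambda>z. \<Psi> (fst z) (snd z)) has_derivative (\<lambda>h. a * fst h + b * snd h)) (at (f x, g x))"
  shows "grad (\<lambda>x. \<Psi> (f x) (g x) :: real) x = a *\<^sub>R grad f x + b *\<^sub>R grad g x"
proof (rule grad_eqI)
  have "((\<lambda>x. (f x, g x)) has_derivative (\<lambda>h. (grad f x \<bullet> h, grad g x \<bullet> h))) (at x)"
    by (intro has_derivative_Pair smooth_has_grad assms)
  from has_derivative_compose[OF this assms(3)]
  show "((\<lambda>x. \<Psi> (f x) (g x)) has_derivative (\<lambda>h. (a *\<^sub>R grad f x + b *\<^sub>R grad g x) \<bullet> h)) (at x)"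
    by (simp add: inner_add_left)
qed

lemma admissibleI:
  fixes \<Psi> :: "real \<Rightarrow> real \<Rightarrow> real"
  assumes "0 \<le> B" and sm: "\<And>f g :: real ^ 'n \<Rightarrow> real. smooth f \<Longrightarrow> smooth g \<Longrightarrow> smooth (\<lambda>x. \<Psi> (f x) (g x))"
    and der: "\<And>s t. ((\<lambda>z. \<Psi> (fst z) (snd z)) has_derivative (\<lambda>h. \<Psi>1 s t * fst h + \<Psi>2 s t * snd h)) (at (s, t))"
    and cont: "continuous_on UNIV (\<lambda>z. \<Psi>1 (fst z) (snd z))" "continuous_on UNIV (\<lambda>z. \<Psi>2 (fst z) (snd z))"
    and bd: "\<And>s t. \<bar>\<Psi>1 s t\<bar> \<le> B" "\<And>s t. \<bar>\<Psi>2 s t\<bar> \<le> B"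
  shows "admissible \<Psi> \<Psi>1 \<Psi>2 B TYPE('n::finite)"
proof -
  have cps: "continuous_on UNIV (\<lambda>z. \<Psi> (fst z) (snd z))"
    using der by (intro has_derivative_continuous_on[of _ _ "\<lambda>z h. \<Psi>1 (fst z) (snd z) * fst h + \<Psi>2 (fst z) (snd z) * snd h"])
      (metis has_derivative_at_withinI prod.collapse)
  have lip: "\<bar>\<Psi> s t - \<Psi> s' t'\<bar> \<le> B * (\<bar>s - s'\<bar> + \<bar>t - t'\<bar>)" for s t s' t'
  proof -
    have 1: "\<bar>\<Psi> s t - \<Psi> s' t\<bar> \<le> B * \<bar>s - s'\<bar>"
    proof -
      have "((\<lambda>x. \<Psi> x t) has_real_derivative \<Psi>1 x t) (at x within UNIV)" for x
        using has_derivative_compose[OF has_derivative_Pair[OF has_derivative_ident has_derivative_const] der[of x t], of UNIV]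
        by (simp add: has_field_derivative_def mult_commute_abs)
      from field_differentiable_bound[OF convex_UNIV this, of B s s'] bd show ?thesis by simp
    qed
    have 2: "\<bar>\<Psi> s' t - \<Psi> s' t'\<bar> \<le> B * \<bar>t - t'\<bar>"
    proof -
      have "((\<lambda>x. \<Psi> s' x) has_real_derivative \<Psi>2 s' x) (at x within UNIV)" for x
        using has_derivative_compose[OF has_derivative_Pair[OF has_derivative_const has_derivative_ident] der[of s' x], of UNIV]
        by (simp add: has_field_derivative_def mult_commute_abs)
      from field_differentiable_bound[OF convex_UNIV this, of B t t'] bd show ?thesis by simp
    qed
    from 1 2 show ?thesis by (simp add: distrib_left)
  qed
  show ?thesis unfolding admissible_def using assms(1) sm grad_compose2 der cont cps bd lip by blast
qed

text \<open>A smooth substitute for |d|: it vanishes only at 0, is bounded by 1 and by |d|, and has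
  slope at most 1. Applied to \<open>u - v\<close> it detects where the two functions
  differ.\<close>

definition bell :: "real \<Rightarrow> real" where "bell d = 1 - exp (- (d ^ 2))"

text \<open>A positive, bounded, strictly increasing function with derivative l(1 - l). In
  \<open>mix\<close> its growth along the diagonal direction creates the deficit in the sum of the
  partial derivatives.\<close>

definition logistic :: "real \<Rightarrow> real" where "logistic m = inverse (1 + exp (- m))"

text \<open>The mean of \<open>s\<close> and \<open>t\<close>, modified so that it is still monotone in both variables and the
  identity on the diagonal, while its partial derivatives sum to less than \<open>1\<close> off the diagonal.\<close>

definition mix :: "real \<Rightarrow> real \<Rightarrow> real" where
  "mix s t = (s + t) / 2 - bell (s - t) * logistic ((s + t) / 2) / 4"

text \<open>The first partial derivative of \<open>mix\<close>. Differentiating \<open>bell\<close>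
  gives terms of opposite sign in \<open>mix1\<close> and \<open>mix2\<close>, which cancel in the
  sum; differentiating \<open>logistic\<close> gives the same nonnegative term in both, and this
  term is the deficit.\<close>

definition mix1 :: "real \<Rightarrow> real \<Rightarrow> real" where
  "mix1 s t = 1 / 2 - (2 * (s - t) * exp (- ((s - t) ^ 2)) * logistic ((s + t) / 2)
     + bell (s - t) * (logistic ((s + t) / 2) * (1 - logistic ((s + t) / 2))) / 2) / 4"

definition mix2 :: "real \<Rightarrow> real \<Rightarrow> real" where
  "mix2 s t = 1 / 2 - (- 2 * (s - t) * exp (- ((s - t) ^ 2)) * logistic ((s + t) / 2)
     + bell (s - t) * (logistic ((s + t) / 2) * (1 - logistic ((s + t) / 2))) / 2) / 4"

lemma bell_bounds: "0 \<le> bell d" "bell d \<le> 1" "bell d = 0 \<longleftrightarrow> d = 0"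
  by (auto simp: bell_def)

lemma logistic_bounds: "0 < logistic m" "logistic m < 1"
  by (auto simp: logistic_def inverse_less_1_iff add_pos_pos intro!: inverse_less_1_iff[THEN iffD2])

lemma gaussian_slope_bound: "\<bar>2 * d * exp (- (d ^ 2))\<bar> \<le> (1::real)"
proof -
  have "2 * \<bar>d\<bar> \<le> 1 + d ^ 2" using sum_squares_ge_zero[of "\<bar>d\<bar> - 1" 0] by (simp add: power2_eq_square algebra_simps)
  also have "\<dots> \<le> exp (d ^ 2)" by (rule exp_ge_add_one_self)
  finally show ?thesis by (simp add: abs_mult exp_minus field_simps)
qed

text \<open>Places \<open>bell (u - v)\<close> in the same Lebesgue space as
  \<open>u - v\<close>.\<close>

lemma bell_abs_le: "bell d \<le> \<bar>d\<bar>"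
proof (cases "\<bar>d\<bar> \<le> 1")
  case True
  have "1 - d ^ 2 \<le> exp (- (d ^ 2))" using exp_ge_add_one_self[of "- (d ^ 2)"] by simp
  moreover have "d ^ 2 \<le> \<bar>d\<bar>" using True mult_left_le[of "\<bar>d\<bar>" "\<bar>d\<bar>"] by (simp add: power2_eq_square)
  ultimately show ?thesis by (simp add: bell_def)
next
  case False then show ?thesis using bell_bounds(2)[of d] by linarith
qed

text \<open>With x the product of the slope of \<open>bell\<close> and \<open>logistic\<close>, and
  y = b l(1 - l), the partials are 1/2 - (x + y/2)/4 and 1/2 - (-x + y/2)/4. Since |x| <= 1 and 0 <=
  y <= 1, they stay between 1/8 and 3/4; this is what the factor 1/4 in \<open>mix\<close> is for.
  Their sum is 1 - y/4, and y > 0 off the diagonal.\<close>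

lemma mix_derivs:
  shows "0 \<le> mix1 s t" "0 \<le> mix2 s t" "mix1 s t \<le> 1" "mix2 s t \<le> 1" "s \<noteq> t \<Longrightarrow> mix1 s t + mix2 s t < 1" "mix1 s t + mix2 s t \<le> 1"
proof -
  define l where "l = logistic ((s + t) / 2)"
  define g where "g = 2 * (s - t) * exp (- ((s - t) ^ 2))"
  define b where "b = bell (s - t)"
  have l: "0 < l" "l < 1" using logistic_bounds by (auto simp: l_def)
  have b: "0 \<le> b" "b \<le> 1" using bell_bounds by (auto simp: b_def)
  have "\<bar>g * l\<bar> \<le> 1 * 1" unfolding abs_mult using l gaussian_slope_bound[of "s - t"]
    by (intro mult_mono) (auto simp: g_def)
  then have gl: "\<bar>g * l\<bar> \<le> 1" by simp
  have ll: "0 < l * (1 - l)" "l * (1 - l) \<le> 1 * 1" using l by (simp, intro mult_mono) auto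
  have bl: "0 \<le> b * (l * (1 - l))" "b * (l * (1 - l)) \<le> 1 * 1" using b ll by (simp, intro mult_mono) auto
  define x y where "x = g * l" and "y = b * (l * (1 - l))"
  have m1: "mix1 s t = 1 / 2 - (x + y / 2) / 4"
    unfolding mix1_def l_def g_def b_def x_def y_def by (rule refl)
  have "- 2 * (s - t) * exp (- ((s - t) ^ 2)) = - g" unfolding g_def by (simp only: mult_minus_left)
  then have m2: "mix2 s t = 1 / 2 - (- x + y / 2) / 4"
    unfolding mix2_def l_def[symmetric] b_def[symmetric] x_def y_def by (simp only: minus_mult_left)
  have xy: "x \<le> 1" "- x \<le> 1" "0 \<le> y" "y \<le> 1"
    using abs_le_D1[OF gl] abs_le_D2[OF gl] bl by (simp_all add: x_def y_def)
  show "0 \<le> mix1 s t" unfolding m1 m2 using xy by (simp add: field_simps | linarith)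
  show "0 \<le> mix2 s t" unfolding m1 m2 using xy by (simp add: field_simps | linarith)
  show "mix1 s t \<le> 1" unfolding m1 m2 using xy by (simp add: field_simps | linarith)
  show "mix2 s t \<le> 1" unfolding m1 m2 using xy by (simp add: field_simps | linarith)
  show "mix1 s t + mix2 s t \<le> 1" unfolding m1 m2 using xy by (simp add: field_simps | linarith)
  assume "s \<noteq> t"
  then have "b \<noteq> 0" using bell_bounds(3)[of "s - t"] by (simp add: b_def)
  then have "0 < y" using b ll by (simp add: y_def)
  then show "mix1 s t + mix2 s t < 1" unfolding m1 m2 by (simp add: field_simps)
qed

lemma logistic_has_derivative: "(logistic has_real_derivative logistic m * (1 - logistic m)) (at m)"
proof -
  have pos: "1 + exp (- m) \<noteq> 0" by (simp add: add_pos_pos less_imp_neq[symmetric])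
  have eq: "1 - inverse (1 + exp (- m)) = exp (- m) * inverse (1 + exp (- m))"
    using pos by (simp add: field_simps)
  have "((\<lambda>m. inverse (1 + exp (- m))) has_real_derivative inverse (1 + exp (- m)) * (exp (- m) * inverse (1 + exp (- m)))) (at m)"
    using pos by (auto intro!: derivative_eq_intros)
  then show ?thesis unfolding eq[symmetric] logistic_def[abs_def] .
qed

lemma bell_has_derivative: "(bell has_real_derivative 2 * d * exp (- (d ^ 2))) (at d)"
  unfolding bell_def[abs_def] by (auto intro!: derivative_eq_intros)

lemma smooth_bell: "smooth f \<Longrightarrow> smooth (\<lambda>x. bell (f x))"
  unfolding bell_def power2_eq_square by (intro smooth_diff smooth_const smooth_exp smooth_uminus smooth_mult)

lemma smooth_logistic:
  assumes "smooth f" shows "smooth (\<lambda>x. logistic (f x))"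
proof -
  have "0 < 1 + exp (- f x)" for x using exp_gt_zero[of "- f x"] by linarith
  then show ?thesis
    unfolding logistic_def by (intro smooth_inverse smooth_add smooth_const smooth_exp smooth_uminus assms)
qed

lemma mix_continuous: "continuous_on UNIV (\<lambda>z. mix1 (fst z) (snd z))" "continuous_on UNIV (\<lambda>z. mix2 (fst z) (snd z))"
proof -
  have "continuous_on UNIV logistic" "continuous_on UNIV bell"
    using logistic_has_derivative bell_has_derivative by (auto intro!: DERIV_continuous_on)
  note c = this
  have c1: "continuous_on UNIV (\<lambda>z :: real \<times> real. logistic ((fst z + snd z) / 2))"
    by (rule continuous_on_compose2[OF c(1)]) (intro continuous_intros, simp_all)
  have c2: "continuous_on UNIV (\<lambda>z :: real \<times> real. bell (fst z - snd z))"
    by (rule continuous_on_compose2[OF c(2)]) (intro continuous_intros, simp_all)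
  show "continuous_on UNIV (\<lambda>z. mix1 (fst z) (snd z))" "continuous_on UNIV (\<lambda>z. mix2 (fst z) (snd z))"
    unfolding mix1_def mix2_def by (intro continuous_intros c1 c2; simp)+
qed

lemma smooth_mix: "smooth f \<Longrightarrow> smooth g \<Longrightarrow> smooth (\<lambda>x. mix (f x) (g x))"
proof -
  assume f: "smooth f" and g: "smooth g"
  have m: "smooth (\<lambda>x. 1 / 2 * (f x + g x))" by (intro smooth_mult smooth_const smooth_add f g)
  have "smooth (\<lambda>x. 1 / 2 * (f x + g x) - 1 / 4 * (bell (f x - g x) * logistic (1 / 2 * (f x + g x))))"
    by (intro smooth_diff m smooth_mult smooth_const smooth_bell smooth_logistic f g)
  then show ?thesis by (simp add: mix_def)
qed

lemma mix_has_derivative: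
  "((\<lambda>z. mix (fst z) (snd z)) has_derivative (\<lambda>h. mix1 s t * fst h + mix2 s t * snd h)) (at (s, t))"
proof -
  have b: "((\<lambda>z. bell (fst z - snd z)) has_derivative (\<lambda>h. 2 * (s - t) * exp (- ((s - t) ^ 2)) * (fst h - snd h))) (at (s, t))"
    by (rule has_derivative_compose[of "\<lambda>z. fst z - snd z", OF _ bell_has_derivative[unfolded has_field_derivative_def], THEN has_derivative_eq_rhs])
       (auto intro!: derivative_eq_intros)
  have l: "((\<lambda>z. logistic ((fst z + snd z) / 2)) has_derivative (\<lambda>h. logistic ((s + t) / 2) * (1 - logistic ((s + t) / 2)) * ((fst h + snd h) / 2))) (at (s, t))"
    by (rule has_derivative_compose[of "\<lambda>z. (fst z + snd z) / 2", OF _ logistic_has_derivative[unfolded has_field_derivative_def], THEN has_derivative_eq_rhs])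
       (auto intro!: derivative_eq_intros)
  have m: "((\<lambda>z. (fst z + snd z) / 2) has_derivative (\<lambda>h. (fst h + snd h) / 2)) (at (s, t :: real))"
    by (auto intro!: derivative_eq_intros)
  have eq: "(\<lambda>z. mix (fst z) (snd z)) = (\<lambda>z. (fst z + snd z) / 2 - (1 / 4) * (bell (fst z - snd z) * logistic ((fst z + snd z) / 2)))"
    by (simp add: mix_def)
  show ?thesis unfolding eq
    by (rule has_derivative_eq_rhs[OF has_derivative_diff[OF m has_derivative_mult_right[OF has_derivative_mult[OF b l]]]])
       (simp add: mix1_def mix2_def fun_eq_iff field_simps)
qed

lemma admissible_mix: "admissible mix mix1 mix2 1 TYPE('n::finite)"
  using mix_derivs by (intro admissibleI smooth_mix mix_has_derivative mix_continuous) (auto simp: abs_le_iff intro: order_trans[of _ 0])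

lemma admissible_mix_diff: "admissible (\<lambda>s t. mix s t - s) (\<lambda>s t. mix1 s t - 1) mix2 1 TYPE('n::finite)"
proof (intro admissibleI)
  show "((\<lambda>z. mix (fst z) (snd z) - fst z) has_derivative (\<lambda>h. (mix1 s t - 1) * fst h + mix2 s t * snd h)) (at (s, t))" for s t
    by (rule has_derivative_eq_rhs, rule has_derivative_diff[OF mix_has_derivative has_derivative_fst[OF has_derivative_ident]])
       (auto simp: algebra_simps)
  show "\<bar>mix1 s t - 1\<bar> \<le> 1" "\<bar>mix2 s t\<bar> \<le> 1" for s t using mix_derivs[of s t] by (auto simp: abs_le_iff)
qed (auto intro!: smooth_diff smooth_mix continuous_intros mix_continuous)

lemma admissible_diff: "admissible (\<lambda>s t. t - s) (\<lambda>s t. - 1) (\<lambda>s t. 1) 1 TYPE('n::finite)"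
proof (intro admissibleI)
  show "((\<lambda>z::real\<times>real. snd z - fst z) has_derivative (\<lambda>h. - 1 * fst h + 1 * snd h)) (at (s, t))" for s t
    by (auto intro!: derivative_eq_intros)
qed (auto intro!: smooth_diff continuous_intros)

lemma admissible_mean: "admissible (\<lambda>s t. (s + t) / 2) (\<lambda>s t. 1 / 2) (\<lambda>s t. 1 / 2) 1 TYPE('n::finite)"
proof (intro admissibleI)
  show "((\<lambda>z::real\<times>real. (fst z + snd z) / 2) has_derivative (\<lambda>h. 1 / 2 * fst h + 1 / 2 * snd h)) (at (s, t))" for s t
    by (auto intro!: derivative_eq_intros simp: add_divide_distrib)
  show "smooth (\<lambda>x. (f x + g x) / 2)" if "smooth f" "smooth g" for f g :: "real ^ 'n \<Rightarrow> real"
    using smooth_mult[OF smooth_const smooth_add[OF that], of "1 / 2"] by simp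
qed (auto intro!: continuous_intros)

lemma admissible_bell:
  "admissible (\<lambda>s t. bell (s - t)) (\<lambda>s t. 2 * (s - t) * exp (- ((s - t) ^ 2))) (\<lambda>s t. - (2 * (s - t) * exp (- ((s - t) ^ 2)))) 1 TYPE('n::finite)"
proof (intro admissibleI)
  show "((\<lambda>z. bell (fst z - snd z)) has_derivative (\<lambda>h. 2 * (s - t) * exp (- ((s - t) ^ 2)) * fst h + - (2 * (s - t) * exp (- ((s - t) ^ 2))) * snd h)) (at (s, t))" for s t
    by (rule has_derivative_compose[of "\<lambda>z. fst z - snd z", OF _ bell_has_derivative[unfolded has_field_derivative_def], THEN has_derivative_eq_rhs])
       (auto intro!: derivative_eq_intros simp: algebra_simps)
  show "\<bar>2 * (s - t) * exp (- ((s - t) ^ 2))\<bar> \<le> 1" "\<bar>- (2 * (s - t) * exp (- ((s - t) ^ 2)))\<bar> \<le> 1" for s t :: real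
    using gaussian_slope_bound[of "s - t"] by auto
qed (auto intro!: smooth_bell smooth_diff continuous_intros)

text \<open>Monotonicity in each variable allows both arguments to be replaced by their minimum or
  by their maximum, where \<open>mix\<close> is the identity. It keeps \<open>mix u v\<close> above
  1 wherever \<open>u\<close> and \<open>v\<close> are, as the capacity class demands.\<close>

lemma mix_between: "min s t \<le> mix s t" "mix s t \<le> max s t"
proof -
  have mono1: "mix s t \<le> mix s' t" if "s \<le> s'" for s s' t
  proof (rule DERIV_nonneg_imp_nondecreasing[OF that])
    fix x
    have "((\<lambda>x. mix x t) has_real_derivative mix1 x t) (at x)"
      using has_derivative_compose[OF has_derivative_Pair[OF has_derivative_ident has_derivative_const] mix_has_derivative[of x t], of UNIV]
      by (simp add: has_field_derivative_def mult_commute_abs)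
    then show "\<exists>y. ((\<lambda>x. mix x t) has_real_derivative y) (at x) \<and> 0 \<le> y" using mix_derivs(1) by blast
  qed
  have mono2: "mix s t \<le> mix s t'" if "t \<le> t'" for s t t'
  proof (rule DERIV_nonneg_imp_nondecreasing[OF that])
    fix x
    have "((\<lambda>x. mix s x) has_real_derivative mix2 s x) (at x)"
      using has_derivative_compose[OF has_derivative_Pair[OF has_derivative_const has_derivative_ident] mix_has_derivative[of s x], of UNIV]
      by (simp add: has_field_derivative_def mult_commute_abs)
    then show "\<exists>y. ((\<lambda>x. mix s x) has_real_derivative y) (at x) \<and> 0 \<le> y" using mix_derivs(2) by blast
  qed
  have diag: "mix a a = a" for a by (simp add: mix_def bell_def)
  show "min s t \<le> mix s t"
    using order_trans[OF mono1[of "min s t" s "min s t"] mono2[of "min s t" t s]] diag[of "min s t"] by simp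
  show "mix s t \<le> max s t"
    using order_trans[OF mono1[of s "max s t" t] mono2[of t "max s t" "max s t"]] diag[of "max s t"] by simp
qed

section \<open>Testing the equation\<close>

lemma Lp_null_cong_ball:
  fixes f :: "nat \<Rightarrow> real ^ 'n \<Rightarrow> 'b::euclidean_space"
  assumes D: "D \<in> sets lebesgue" and f: "\<And>k x. R \<le> norm x \<Longrightarrow> f k x = 0"
  shows "Lp_null p (lebesgue_on D) f \<longleftrightarrow> Lp_null p (lebesgue_on (D \<inter> ball 0 R)) f"
proof -
  have "(\<integral>\<^sup>+x. ennreal (norm (f k x) powr p) \<partial>lebesgue_on D) = (\<integral>\<^sup>+x. ennreal (norm (f k x) powr p) \<partial>lebesgue_on (D \<inter> ball 0 R))" for k
  proof -
    have "ennreal (norm (f k x) powr p) * indicator D x = ennreal (norm (f k x) powr p) * indicator (D \<inter> ball 0 R) x" for x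
      using f[of x k] by (cases "R \<le> norm x") (auto simp: indicator_def)
    moreover have "D \<inter> ball 0 R \<in> sets lebesgue" by (intro sets.Int D) simp
    ultimately show ?thesis using D by (simp add: nn_integral_restrict_space)
  qed
  then show ?thesis by (simp add: Lp_null_def)
qed

lemma Lp_null_limit_Lp:
  fixes f :: "nat \<Rightarrow> 'a \<Rightarrow> 'b::euclidean_space"
  assumes f: "\<And>k. f k \<in> Lp p M" and g[measurable]: "g \<in> borel_measurable M" and p: "0 < p"
    and lim: "Lp_null p M (\<lambda>k x. f k x - g x)"
  shows "g \<in> Lp p M"
proof -
  note [measurable] = Lp_nn_integral_finite(1)[OF f]
  have "\<forall>\<^sub>F k in sequentially. (\<integral>\<^sup>+x. ennreal (norm (f k x - g x) powr p) \<partial>M) < 1"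
    using lim unfolding Lp_null_def by (rule order_tendstoD) simp
  then obtain k where "(\<integral>\<^sup>+x. ennreal (norm (f k x - g x) powr p) \<partial>M) < 1" by (auto simp: eventually_sequentially)
  then have "(\<integral>\<^sup>+x. ennreal (norm (f k x - g x) powr p) \<partial>M) < \<infinity>"
    by (rule order_less_trans) (simp add: ennreal_one_less_top)
  then have d: "(\<lambda>x. f k x - g x) \<in> Lp p M" by (intro LpI) auto
  have "(\<lambda>x. - (f k x - g x)) \<in> Lp p M"
    by (rule Lp_bound[OF d _ p, of _ 1]) (auto simp: norm_minus_commute)
  from Lp_add[OF f[of k] this p] show ?thesis by simp
qed

lemma test_function_Lp:
  assumes \<psi>: "\<psi> \<in> test_functions E" and D: "D \<in> sets lebesgue" and p: "0 < p"
  shows "\<psi> \<in> Lp p (lebesgue_on D)" "grad \<psi> \<in> Lp p (lebesgue_on D)"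
proof -
  obtain K where K: "smooth \<psi>" "compact K" "K \<subseteq> E" "\<forall>x. x \<notin> K \<longrightarrow> \<psi> x = 0" "\<forall>x. x \<notin> K \<longrightarrow> grad \<psi> x = 0"
    by (rule test_functionE[OF \<psi>])
  obtain B where B: "B > 0" "\<forall>x. \<bar>\<psi> x\<bar> \<le> B" "\<forall>x. norm (grad \<psi> x) \<le> B" by (rule test_function_bounded[OF \<psi>])
  have i: "(\<lambda>x. indicator K x :: real) \<in> Lp p (lebesgue_on D)"
  proof (rule LpI)
    show "(\<lambda>x. indicator K x :: real) \<in> borel_measurable (lebesgue_on D)"
      using K(2) by (intro measurable_restrict_space1 borel_measurable_indicator) (auto simp: compact_imp_closed)
    have "(\<integral>\<^sup>+x. ennreal (norm (indicator K x :: real) powr p) \<partial>lebesgue_on D) \<le> (\<integral>\<^sup>+x. indicator K x \<partial>lebesgue)"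
      using D by (simp add: nn_integral_restrict_space) (intro nn_integral_mono, auto simp: indicator_def)
    also have "\<dots> < \<infinity>" using K(2) emeasure_compact_finite[OF K(2)] by (simp add: compact_imp_closed)
    finally show "(\<integral>\<^sup>+x. ennreal (norm (indicator K x :: real) powr p) \<partial>lebesgue_on D) < \<infinity>" .
  qed
  have "norm (\<psi> x) \<le> B * norm (indicator K x :: real)" "norm (grad \<psi> x) \<le> B * norm (indicator K x :: real)" for x
    using B K by (cases "x \<in> K"; simp)+
  then show "\<psi> \<in> Lp p (lebesgue_on D)" "grad \<psi> \<in> Lp p (lebesgue_on D)"
    using B(1) p smooth_borel_measurable[OF K(1), of D] by (intro Lp_bound[OF i, of _ B]; auto)+
qed

text \<open>\<open>u\<close> and \<open>v\<close> have the same trace and \<open>\<Psi>\<close>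
  vanishes on the diagonal, so the composition has zero trace. The factor \<open>\<zeta>\<close> is
  there because on an unbounded \<open>D\<close> the composition need not be in L^p; it also gives
  the approximations a common bounded support.\<close>

lemma superposition_W1p_0:
  fixes \<Omega> :: "(real ^ 'n) set" and w w' :: "nat \<Rightarrow> real ^ 'n \<Rightarrow> real"
  assumes N: "2 \<le> CARD('n)" and p: "1 \<le> p" and D: "chart_boundary D (frontier \<Omega>)"
    and w: "\<And>k. w k \<in> test_functions UNIV" "\<And>k. w' k \<in> test_functions UNIV"
    and lim: "\<forall>R>0. Lp_tendsto p (lebesgue_on (D \<inter> ball 0 R)) w u" "\<forall>R>0. Lp_tendsto p (lebesgue_on (D \<inter> ball 0 R)) w' v"
    and glim: "\<forall>R>0. Lp_tendsto p (lebesgue_on (D \<inter> ball 0 R)) (\<lambda>k. grad (w k)) Gu"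
      "\<forall>R>0. Lp_tendsto p (lebesgue_on (D \<inter> ball 0 R)) (\<lambda>k. grad (w' k)) Gv"
    and um: "u \<in> borel_measurable (lebesgue_on D)" "v \<in> borel_measurable (lebesgue_on D)"
    and G: "Gu \<in> Lp p (lebesgue_on D)" "Gv \<in> Lp p (lebesgue_on D)"
    and tr: "Lp_tendsto p (surface_measure \<Omega>) w \<phi>" "Lp_tendsto p (surface_measure \<Omega>) w' \<phi>"
    and \<phi>: "\<phi> \<in> borel_measurable (surface_measure \<Omega>)"
    and adm: "admissible \<Psi> \<Psi>1 \<Psi>2 B TYPE('n)" and diag: "\<And>s. \<Psi> s s = 0"
    and \<zeta>: "\<zeta> \<in> test_functions UNIV"
  shows "(\<lambda>x. \<Psi> (u x) (v x) * \<zeta> x) \<in> W1p_0 p D"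
    "AE x in lebesgue_on D. weak_grad D (\<lambda>x. \<Psi> (u x) (v x) * \<zeta> x) x
       = \<Psi> (u x) (v x) *\<^sub>R grad \<zeta> x + \<zeta> x *\<^sub>R (\<Psi>1 (u x) (v x) *\<^sub>R Gu x + \<Psi>2 (u x) (v x) *\<^sub>R Gv x)"
proof -
  note lim = lim[rule_format] and glim = glim[rule_format]
  have oD: "open D" using D by (simp add: chart_boundary_def)
  have DL: "D \<in> sets lebesgue" using oD by auto
  have p0: "0 < p" using p by simp
  have B: "0 \<le> B" and asm: "\<And>f g :: real ^ 'n \<Rightarrow> real. smooth f \<Longrightarrow> smooth g \<Longrightarrow> smooth (\<lambda>x. \<Psi> (f x) (g x))"
    and agr: "\<And>(f :: real ^ 'n \<Rightarrow> real) g x. smooth f \<Longrightarrow> smooth g \<Longrightarrow> grad (\<lambda>x. \<Psi> (f x) (g x)) x = \<Psi>1 (f x) (g x) *\<^sub>R grad f x + \<Psi>2 (f x) (g x) *\<^sub>R grad g x"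
    and c1: "continuous_on UNIV (\<lambda>z. \<Psi>1 (fst z) (snd z))" and c2: "continuous_on UNIV (\<lambda>z. \<Psi>2 (fst z) (snd z))"
    and c0: "continuous_on UNIV (\<lambda>z. \<Psi> (fst z) (snd z))"
    and b1: "\<And>s t. \<bar>\<Psi>1 s t\<bar> \<le> B" and b2: "\<And>s t. \<bar>\<Psi>2 s t\<bar> \<le> B"
    and lip: "\<And>s t s' t'. \<bar>\<Psi> s t - \<Psi> s' t'\<bar> \<le> B * (\<bar>s - s'\<bar> + \<bar>t - t'\<bar>)"
    using adm unfolding admissible_def by blast+
  obtain K where K: "smooth \<zeta>" "compact K" "K \<subseteq> UNIV" "\<forall>x. x \<notin> K \<longrightarrow> \<zeta> x = 0" "\<forall>x. x \<notin> K \<longrightarrow> grad \<zeta> x = 0"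
    by (rule test_functionE[OF \<zeta>])
  obtain Z where Z: "Z > 0" "\<forall>x. \<bar>\<zeta> x\<bar> \<le> Z" "\<forall>x. norm (grad \<zeta> x) \<le> Z" by (rule test_function_bounded[OF \<zeta>])
  obtain R0 where R0: "R0 > 0" "\<forall>x\<in>K. norm x \<le> R0" using compact_imp_bounded[OF K(2)] unfolding bounded_pos by blast
  define R where "R = R0 + 1"
  have R: "R > 0" using R0 by (simp add: R_def)
  have out: "\<zeta> x = 0" "grad \<zeta> x = 0" if "R \<le> norm x" for x
    using that R0 K(4,5) by (auto simp: R_def) (metis add_le_same_cancel1 not_one_le_zero order_trans)+
  let ?M = "lebesgue_on (D \<inter> ball 0 R)"
  have ws: "smooth (w k)" "smooth (w' k)" for k using w test_functions_smooth by blast+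
  note wm = smooth_borel_measurable[OF ws(1), of _ "D \<inter> ball 0 R"] smooth_borel_measurable[OF ws(2), of _ "D \<inter> ball 0 R"]
  have res: "f \<in> borel_measurable ?M" if "f \<in> borel_measurable (lebesgue_on D)" for f :: "real ^ 'n \<Rightarrow> 'b::euclidean_space"
    using that by (rule measurable_restrict_mono) auto
  have GM: "Gu \<in> Lp p ?M" "Gv \<in> Lp p ?M"
  proof -
    have "f \<in> Lp p ?M" if f: "f \<in> Lp p (lebesgue_on D)" for f :: "real ^ 'n \<Rightarrow> real ^ 'n"
    proof (rule LpI)
      show "f \<in> borel_measurable ?M" by (rule res[OF Lp_nn_integral_finite(1)[OF f]])
      have "(\<integral>\<^sup>+x. ennreal (norm (f x) powr p) \<partial>?M) \<le> (\<integral>\<^sup>+x. ennreal (norm (f x) powr p) \<partial>lebesgue_on D)"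
      proof -
        have DB: "D \<inter> ball 0 R \<in> sets lebesgue" by (intro sets.Int DL) simp
        have "(\<integral>\<^sup>+x. ennreal (norm (f x) powr p) \<partial>?M) = (\<integral>\<^sup>+x. ennreal (norm (f x) powr p) * indicator (D \<inter> ball 0 R) x \<partial>lebesgue)"
          by (subst nn_integral_restrict_space) (use DB in auto)
        also have "\<dots> \<le> (\<integral>\<^sup>+x. ennreal (norm (f x) powr p) * indicator D x \<partial>lebesgue)"
          by (intro nn_integral_mono) (auto simp: indicator_def)
        also have "\<dots> = (\<integral>\<^sup>+x. ennreal (norm (f x) powr p) \<partial>lebesgue_on D)"
          by (subst nn_integral_restrict_space) (use DL in auto)
        finally show ?thesis .
      qed
      then show "(\<integral>\<^sup>+x. ennreal (norm (f x) powr p) \<partial>?M) < \<infinity>" using Lp_nn_integral_finite(2)[OF f] by (rule order_le_less_trans)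
    qed
    then show "Gu \<in> Lp p ?M" "Gv \<in> Lp p ?M" using G by auto
  qed
  note l = lim(1)[OF R, unfolded Lp_tendsto_iff_null] lim(2)[OF R, unfolded Lp_tendsto_iff_null]
  note gl = glim(1)[OF R, unfolded Lp_tendsto_iff_null] glim(2)[OF R, unfolded Lp_tendsto_iff_null]
  obtain r :: "nat \<Rightarrow> nat" where r: "strict_mono r"
    "Lp_null p ?M (\<lambda>k x. (\<Psi>1 (w (r k) x) (w' (r k) x) *\<^sub>R grad (w (r k)) x + \<Psi>2 (w (r k) x) (w' (r k) x) *\<^sub>R grad (w' (r k)) x)
        - (\<Psi>1 (u x) (v x) *\<^sub>R Gu x + \<Psi>2 (u x) (v x) *\<^sub>R Gv x))"
    by (rule Lp_null_superposition_grad[OF c1 c2 B b1 b2 l gl wm(1) wm(3) res[OF um(1)] res[OF um(2)] wm(2) wm(4) GM p0])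
  have ps: "Lp_null p ?M (\<lambda>k x. \<Psi> (w k x) (w' k x) - \<Psi> (u x) (v x))"
    by (rule Lp_null_superposition[OF B lip l wm(1) wm(3) res[OF um(1)] res[OF um(2)] p0])
  define \<psi>0 where "\<psi>0 x = \<Psi> (u x) (v x)" for x
  define H0 where "H0 x = \<Psi>1 (u x) (v x) *\<^sub>R Gu x + \<Psi>2 (u x) (v x) *\<^sub>R Gv x" for x
  define g where "g k x = \<Psi> (w (r k) x) (w' (r k) x)" for k x
  have gs: "smooth (g k)" for k unfolding g_def by (intro asm ws)
  have gg: "grad (g k) x = \<Psi>1 (w (r k) x) (w' (r k) x) *\<^sub>R grad (w (r k)) x + \<Psi>2 (w (r k) x) (w' (r k) x) *\<^sub>R grad (w' (r k)) x" for k x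
    unfolding g_def by (rule agr[OF ws])
  define m where "m k x = g k x * \<zeta> x" for k x
  define H where "H x = \<psi>0 x *\<^sub>R grad \<zeta> x + \<zeta> x *\<^sub>R H0 x" for x
  have mt: "m k \<in> test_functions UNIV" for k unfolding m_def by (rule test_functions_mult[OF gs \<zeta>])
  have mg: "grad (m k) x = g k x *\<^sub>R grad \<zeta> x + \<zeta> x *\<^sub>R grad (g k) x" for k x
    unfolding m_def by (rule grad_mult[OF gs K(1)])
  note gm = smooth_borel_measurable[OF gs] and \<zeta>m = smooth_borel_measurable[OF K(1)]
  have \<psi>0m: "\<psi>0 \<in> borel_measurable (lebesgue_on D)" unfolding \<psi>0_def by (rule admissible_measurable[OF c0 um])
  have H0m: "H0 \<in> borel_measurable (lebesgue_on D)"
    unfolding H0_def using admissible_measurable[OF c1 um] admissible_measurable[OF c2 um] Lp_nn_integral_finite(1)[OF G(1)] Lp_nn_integral_finite(1)[OF G(2)]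
    by measurable
  have n0: "Lp_null p ?M (\<lambda>k x. g k x - \<psi>0 x)" unfolding g_def \<psi>0_def by (rule Lp_null_subseq[OF ps r(1)])
  have n1: "Lp_null p ?M (\<lambda>k x. grad (g k) x - H0 x)" using r(2) unfolding gg H0_def .
  have lim': "Lp_null p (lebesgue_on D) (\<lambda>k x. m k x - \<psi>0 x * \<zeta> x)"
  proof (subst Lp_null_cong_ball[OF DL, of R])
    show "Lp_null p ?M (\<lambda>k x. m k x - \<psi>0 x * \<zeta> x)"
    proof (rule Lp_null_mono[OF n0 p0, of Z])
      show "AE x in ?M. norm (m k x - \<psi>0 x * \<zeta> x) \<le> Z * norm (g k x - \<psi>0 x)" for k
      proof (rule AE_I2)
        fix x
        have "norm (m k x - \<psi>0 x * \<zeta> x) = norm (g k x - \<psi>0 x) * \<bar>\<zeta> x\<bar>" by (simp add: m_def left_diff_distrib[symmetric] abs_mult)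
        also have "\<dots> \<le> norm (g k x - \<psi>0 x) * Z" using Z by (intro mult_left_mono) auto
        finally show "norm (m k x - \<psi>0 x * \<zeta> x) \<le> Z * norm (g k x - \<psi>0 x)" by (simp add: mult.commute)
      qed
    qed (use Z gm res[OF \<psi>0m] in auto)
  qed (simp add: m_def out)
  have glim': "Lp_null p (lebesgue_on D) (\<lambda>k x. grad (m k) x - H x)"
  proof (subst Lp_null_cong_ball[OF DL, of R])
    have eq: "grad (m k) x - H x = (g k x - \<psi>0 x) *\<^sub>R grad \<zeta> x + \<zeta> x *\<^sub>R (grad (g k) x - H0 x)" for k x
      by (simp add: mg H_def algebra_simps)
    have a: "Lp_null p ?M (\<lambda>k x. (g k x - \<psi>0 x) *\<^sub>R grad \<zeta> x)"
    proof (rule Lp_null_mono[OF n0 p0, of Z])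
      show "AE x in ?M. norm ((g k x - \<psi>0 x) *\<^sub>R grad \<zeta> x) \<le> Z * norm (g k x - \<psi>0 x)" for k
        using Z by (intro AE_I2) (auto simp: mult.commute intro!: mult_right_mono)
    qed (use Z gm res[OF \<psi>0m] in auto)
    have b: "Lp_null p ?M (\<lambda>k x. \<zeta> x *\<^sub>R (grad (g k) x - H0 x))"
    proof (rule Lp_null_mono[OF n1 p0, of Z])
      show "AE x in ?M. norm (\<zeta> x *\<^sub>R (grad (g k) x - H0 x)) \<le> Z * norm (grad (g k) x - H0 x)" for k
        using Z by (intro AE_I2) (simp add: mult_right_mono)
    qed (use Z gm res[OF H0m] in auto)
    show "Lp_null p ?M (\<lambda>k x. grad (m k) x - H x)" unfolding eq
      by (rule Lp_null_add[OF a b p0])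
         (intro borel_measurable_scaleR borel_measurable_diff gm \<zeta>m res[OF \<psi>0m] res[OF H0m])+
  qed (simp add: mg H_def out)
  have \<psi>L: "(\<lambda>x. \<psi>0 x * \<zeta> x) \<in> Lp p (lebesgue_on D)"
    by (rule Lp_null_limit_Lp[OF test_function_Lp(1)[OF mt DL p0] _ p0 lim']) (intro borel_measurable_times \<psi>0m \<zeta>m)
  have HL: "H \<in> Lp p (lebesgue_on D)"
    unfolding H_def[abs_def]
    by (rule Lp_null_limit_Lp[OF test_function_Lp(2)[OF mt DL p0] _ p0 glim'[unfolded H_def]])
       (intro borel_measurable_add borel_measurable_scaleR \<psi>0m \<zeta>m H0m)
  \<comment> \<open>On the boundary the Lipschitz bound against the diagonal gives |Psi(w,w')| <= B
    |w - w'|, and w - w' tends to 0 in L^p because both sequences tend to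
    \<open>\<phi>\<close>.\<close>
  have tr': "(\<lambda>k. \<integral>\<^sup>+x. ennreal (\<bar>m k x\<bar> powr p) \<partial>surface_measure \<Omega>) \<longlonglongrightarrow> 0"
  proof -
    have ms: "w k \<in> borel_measurable (surface_measure \<Omega>)" "w' k \<in> borel_measurable (surface_measure \<Omega>)" for k
      by (intro borel_measurable_surface borel_measurable_continuous_onI smooth_continuous ws)+
    have t1: "Lp_null p (surface_measure \<Omega>) (\<lambda>k x. w k x - \<phi> x)" using tr(1) by (simp add: Lp_tendsto_iff_null)
    have t2: "Lp_null p (surface_measure \<Omega>) (\<lambda>k x. \<phi> x - w' k x)"
      using tr(2) by (simp add: Lp_tendsto_iff_null Lp_null_def abs_minus_commute)
    have "Lp_null p (surface_measure \<Omega>) (\<lambda>k x. (w k x - \<phi> x) + (\<phi> x - w' k x))"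
      by (rule Lp_null_add[OF t1 t2 p0]) (intro borel_measurable_diff ms \<phi>)+
    then have t3: "Lp_null p (surface_measure \<Omega>) (\<lambda>k x. w (r k) x - w' (r k) x)"
      using Lp_null_subseq[OF _ r(1)] by simp
    have "Lp_null p (surface_measure \<Omega>) m"
    proof (rule Lp_null_mono[OF t3 p0, of "B * Z"])
      show "AE x in surface_measure \<Omega>. norm (m k x) \<le> B * Z * norm (w (r k) x - w' (r k) x)" for k
      proof (rule AE_I2)
        fix x
        have "\<bar>g k x\<bar> \<le> B * \<bar>w (r k) x - w' (r k) x\<bar>"
          using lip[of "w (r k) x" "w' (r k) x" "w' (r k) x" "w' (r k) x"] by (simp add: g_def diag)
        then have "\<bar>g k x\<bar> * \<bar>\<zeta> x\<bar> \<le> (B * \<bar>w (r k) x - w' (r k) x\<bar>) * Z" using Z B by (intro mult_mono) auto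
        then show "norm (m k x) \<le> B * Z * norm (w (r k) x - w' (r k) x)" by (simp add: m_def abs_mult mult_ac)
      qed
    qed (use B Z ms in auto)
    then show ?thesis by (simp add: Lp_null_def)
  qed
  from zero_trace_W1p_0[OF N p D mt _ \<psi>L HL lim' glim' tr', of R]
  show "(\<lambda>x. \<Psi> (u x) (v x) * \<zeta> x) \<in> W1p_0 p D"
    "AE x in lebesgue_on D. weak_grad D (\<lambda>x. \<Psi> (u x) (v x) * \<zeta> x) x
       = \<Psi> (u x) (v x) *\<^sub>R grad \<zeta> x + \<zeta> x *\<^sub>R (\<Psi>1 (u x) (v x) *\<^sub>R Gu x + \<Psi>2 (u x) (v x) *\<^sub>R Gv x)"
    by (simp_all add: \<psi>0_def H_def H0_def m_def out)
qed

text \<open>\<open>smooth_cutoff\<close> at scale \<open>n\<close> for the ball of radius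
  \<open>2 * n\<close>; the two thresholds are this radius minus and plus the scale.\<close>

lemma ball_cutoff:
  obtains C where "C > 0"
    "\<forall>n::nat. 0 < n \<longrightarrow> (\<exists>\<zeta>\<in>test_functions UNIV. \<forall>x::real^'n. 0 \<le> \<zeta> x \<and> \<zeta> x \<le> 1 \<and> norm (grad \<zeta> x) \<le> C / real n \<and>
        (norm x < real n \<longrightarrow> \<zeta> x = 1 \<and> grad \<zeta> x = 0) \<and> (3 * real n < norm x \<longrightarrow> grad \<zeta> x = 0))"
proof -
  obtain C where C: "C > 0"
    "\<forall>\<epsilon>>0. \<forall>A \<in> sets lebesgue. \<exists>\<eta>. smooth \<eta> \<and> (\<forall>x::real^'n. 0 \<le> \<eta> x \<and> \<eta> x \<le> 1 \<and> norm (grad \<eta> x) \<le> C / \<epsilon>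
       \<and> (ball x \<epsilon> \<subseteq> A \<longrightarrow> \<eta> x = 1) \<and> (ball x \<epsilon> \<inter> A = {} \<longrightarrow> \<eta> x = 0))"
    by (rule smooth_cutoff)
  show ?thesis
  proof (rule that[OF C(1)], intro allI impI)
    fix n :: nat assume n: "0 < n"
    have "ball (0::real^'n) (2 * real n) \<in> sets lebesgue" by auto
    then obtain \<eta> where \<eta>s: "smooth \<eta>" and \<eta>: "\<forall>x::real^'n. 0 \<le> \<eta> x \<and> \<eta> x \<le> 1 \<and> norm (grad \<eta> x) \<le> C / real n
       \<and> (ball x (real n) \<subseteq> ball 0 (2 * real n) \<longrightarrow> \<eta> x = 1) \<and> (ball x (real n) \<inter> ball 0 (2 * real n) = {} \<longrightarrow> \<eta> x = 0)"
      using C(2) n by (meson of_nat_0_less_iff)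
    have one: "\<eta> x = 1" if "norm x < real n" for x
    proof -
      have "ball x (real n) \<subseteq> ball 0 (2 * real n)"
      proof
        fix y assume "y \<in> ball x (real n)"
        then show "y \<in> ball 0 (2 * real n)" using norm_triangle_ineq4[of x "x - y"] that by (simp add: dist_norm)
      qed
      then show ?thesis using \<eta> by blast
    qed
    have zero: "\<eta> x = 0" if "x \<notin> cball 0 (3 * real n)" for x
    proof -
      have "ball x (real n) \<inter> ball 0 (2 * real n) = {}"
      proof (rule ccontr)
        assume "ball x (real n) \<inter> ball 0 (2 * real n) \<noteq> {}"
        then obtain y where "dist x y < real n" "norm y < 2 * real n" by auto
        then show False using norm_triangle_ineq[of "x - y" y] that by (simp add: dist_norm)
      qed
      then show ?thesis using \<eta> by blast
    qed
    have g1: "grad \<eta> x = 0" if "norm x < real n" for x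
    proof (rule grad_eqI)
      have "((\<lambda>_. 1) has_derivative (\<lambda>h. 0 \<bullet> h)) (at x)" by simp
      then show "(\<eta> has_derivative (\<lambda>h. 0 \<bullet> h)) (at x)"
        by (rule has_derivative_transform_within_open[OF _ open_ball[of 0 "real n"]]) (use that one in auto)
    qed
    have "\<eta> \<in> test_functions UNIV" by (rule test_functionsI[OF \<eta>s compact_cball subset_UNIV zero])
    moreover have "grad \<eta> x = 0" if "3 * real n < norm x" for x
      by (rule grad_eq_0_outside[of "cball 0 (3 * real n)", OF closed_cball zero]) (use that in auto)
    ultimately show "\<exists>\<zeta>\<in>test_functions UNIV. \<forall>x::real^'n. 0 \<le> \<zeta> x \<and> \<zeta> x \<le> 1 \<and> norm (grad \<zeta> x) \<le> C / real n \<and>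
        (norm x < real n \<longrightarrow> \<zeta> x = 1 \<and> grad \<zeta> x = 0) \<and> (3 * real n < norm x \<longrightarrow> grad \<zeta> x = 0)"
      using \<eta> one g1 by (intro bexI[of _ \<eta>]) auto
  qed
qed

text \<open>If M is the largest of the three powers, the factors are at most M^(1/a), M^(1/b),
  M^(1/c), and these exponents add up to 1.\<close>

lemma young3:
  fixes x y z a b c :: real
  assumes "0 \<le> x" "0 \<le> y" "0 \<le> z" "0 < a" "0 < b" "0 < c" "1 / a + 1 / b + 1 / c = 1"
  shows "x * y * z \<le> x powr a + y powr b + z powr c"
proof -
  define M where "M = max (x powr a) (max (y powr b) (z powr c))"
  have M: "0 \<le> M" "x powr a \<le> M" "y powr b \<le> M" "z powr c \<le> M" by (auto simp: M_def le_max_iff_disj)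
  have root: "t \<le> M powr (1 / d)" if "0 \<le> t" "0 < d" "t powr d \<le> M" for t d
  proof -
    have "t = (t powr d) powr (1 / d)" using that by (simp add: powr_powr)
    also have "\<dots> \<le> M powr (1 / d)" using that by (intro powr_mono2) auto
    finally show ?thesis .
  qed
  have "x * y * z \<le> M powr (1 / a) * M powr (1 / b) * M powr (1 / c)"
    using assms M by (intro mult_mono root mult_nonneg_nonneg) auto
  also have "\<dots> = M powr (1 / a + 1 / b + 1 / c)" by (simp only: powr_add)
  also have "\<dots> = M" using assms(7) M(1) by simp
  also have "\<dots> \<le> x powr a + y powr b + z powr c" by (auto simp: M_def max_def)
  finally show ?thesis .
qed

lemma integrable_conjugate:
  fixes A G :: "'a \<Rightarrow> 'b::euclidean_space"
  assumes A: "A \<in> Lp (p / (p - 1)) M" and G: "G \<in> Lp p M" and p: "1 < p"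
  shows "integrable M (\<lambda>x. A x \<bullet> G x)" "integrable M (\<lambda>x. norm (A x) * norm (G x))"
proof -
  note [measurable] = Lp_nn_integral_finite(1)[OF A] Lp_nn_integral_finite(1)[OF G]
  have i: "integrable M (\<lambda>x. norm (A x) powr (p / (p - 1)) + norm (G x) powr p)"
    using A G by (auto simp: Lp_def)
  have y: "norm (A x) * norm (G x) \<le> norm (A x) powr (p / (p - 1)) + norm (G x) powr p" for x
  proof -
    have q: "p / (p - 1) > 1" "1 / (p / (p - 1)) + 1 / p = 1" using p by (auto simp: field_simps)
    have "norm (A x) * norm (G x) \<le> norm (A x) powr (p / (p - 1)) / (p / (p - 1)) + norm (G x) powr p / p"
      using p q by (intro Youngs_inequality) auto
    also have "\<dots> \<le> norm (A x) powr (p / (p - 1)) / 1 + norm (G x) powr p / 1"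
      using p q(1) by (intro add_mono divide_left_mono) auto
    finally show ?thesis by simp
  qed
  show "integrable M (\<lambda>x. norm (A x) * norm (G x))"
  proof (rule Bochner_Integration.integrable_bound[OF i])
    show "AE x in M. norm (norm (A x) * norm (G x)) \<le> norm (norm (A x) powr (p / (p - 1)) + norm (G x) powr p)"
      using y by (intro AE_I2) simp
  qed measurable
  show "integrable M (\<lambda>x. A x \<bullet> G x)"
  proof (rule Bochner_Integration.integrable_bound[OF i])
    show "AE x in M. norm (A x \<bullet> G x) \<le> norm (norm (A x) powr (p / (p - 1)) + norm (G x) powr p)"
      using order_trans[OF Cauchy_Schwarz_ineq2 y] by (intro AE_I2) simp
  qed measurable
qed

text \<open>Removing the cutoff at infinity: by the three-term Young inequality with exponents
  \<open>p / (p - 1)\<close>, \<open>p\<^sup>* = p N / (N - p)\<close> and \<open>N\<close>, the error term is small since \<open>|\<nabla>\<zeta>| \<le> C / n\<close> on a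
  ball of volume comparable to \<open>n\<^sup>N\<close>.\<close>

lemma remove_cutoff:
  fixes A H :: "real ^ 'n \<Rightarrow> real ^ 'n" and \<psi> :: "real ^ 'n \<Rightarrow> real"
  assumes D: "D \<in> sets lebesgue" and p: "1 < p"
    and A: "A \<in> Lp (p / (p - 1)) (lebesgue_on D)" and H: "H \<in> Lp p (lebesgue_on D)"
    and \<psi>m: "\<psi> \<in> borel_measurable (lebesgue_on D)"
    and dom: "bounded D \<or> (p < real CARD('n) \<and> \<psi> \<in> Lp (sobolev_exponent TYPE('n) p) (lebesgue_on D))"
    and eq: "\<And>\<zeta>. \<zeta> \<in> test_functions UNIV \<Longrightarrow> (LINT x|lebesgue_on D. A x \<bullet> (\<psi> x *\<^sub>R grad \<zeta> x + \<zeta> x *\<^sub>R H x)) = 0"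
  shows "(LINT x|lebesgue_on D. A x \<bullet> H x) = 0"
proof -
  let ?M = "lebesgue_on D"
  obtain C where C: "C > 0"
    "\<forall>n::nat. 0 < n \<longrightarrow> (\<exists>\<zeta>\<in>test_functions UNIV. \<forall>x::real^'n. 0 \<le> \<zeta> x \<and> \<zeta> x \<le> 1 \<and> norm (grad \<zeta> x) \<le> C / real n \<and>
        (norm x < real n \<longrightarrow> \<zeta> x = 1 \<and> grad \<zeta> x = 0) \<and> (3 * real n < norm x \<longrightarrow> grad \<zeta> x = 0))"
    by (rule ball_cutoff)
  note [measurable] = Lp_nn_integral_finite(1)[OF A] Lp_nn_integral_finite(1)[OF H] \<psi>m
  show ?thesis
  proof (cases "bounded D")
    case True
    then obtain b where b: "b > 0" "\<forall>x\<in>D. norm x \<le> b" unfolding bounded_pos by blast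
    obtain n :: nat where n: "b < real n" using reals_Archimedean2 by blast
    then have n0: "0 < n" using b(1) by (cases n) auto
    obtain \<zeta> where \<zeta>: "\<zeta> \<in> test_functions UNIV" "\<forall>x::real^'n. norm x < real n \<longrightarrow> \<zeta> x = 1 \<and> grad \<zeta> x = 0"
      using C(2)[rule_format, OF n0] by blast
    have "(LINT x|?M. A x \<bullet> (\<psi> x *\<^sub>R grad \<zeta> x + \<zeta> x *\<^sub>R H x)) = (LINT x|?M. A x \<bullet> H x)"
    proof (rule Bochner_Integration.integral_cong[OF refl])
      fix x assume "x \<in> space ?M"
      then have "norm x < real n" using b n by fastforce
      then show "A x \<bullet> (\<psi> x *\<^sub>R grad \<zeta> x + \<zeta> x *\<^sub>R H x) = A x \<bullet> H x" using \<zeta>(2) by simp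
    qed
    then show ?thesis using eq[OF \<zeta>(1)] by simp
  next
    case False
    then have pN: "p < real CARD('n)" and \<psi>L: "\<psi> \<in> Lp (sobolev_exponent TYPE('n) p) ?M" using dom by auto
    define a where "a = p / (p - 1)"
    define b where "b = sobolev_exponent TYPE('n) p"
    define N where "N = real CARD('n)"
    have N: "N > 0" "p < N" using pN p by (auto simp: N_def)
    \<comment> \<open>(p - 1)/p + (N - p)/(p N) + 1/N = 1: the Sobolev exponent is exactly the one
      that leaves 1/N for the cutoff gradient.\<close>
    have ab: "0 < a" "0 < b" "1 / a + 1 / b + 1 / N = 1"
      using p N by (auto simp: a_def b_def sobolev_exponent_def N_def[symmetric] field_simps)
    have "\<forall>n::nat. \<exists>\<zeta>\<in>test_functions UNIV. \<forall>x::real^'n. 0 \<le> \<zeta> x \<and> \<zeta> x \<le> 1 \<and> norm (grad \<zeta> x) \<le> C / real (Suc n) \<and>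
        (norm x < real (Suc n) \<longrightarrow> \<zeta> x = 1 \<and> grad \<zeta> x = 0) \<and> (3 * real (Suc n) < norm x \<longrightarrow> grad \<zeta> x = 0)"
      using C(2) by blast
    then obtain \<zeta> where "\<forall>n. \<zeta> n \<in> test_functions UNIV \<and> (\<forall>x::real^'n. 0 \<le> \<zeta> n x \<and> \<zeta> n x \<le> 1 \<and> norm (grad (\<zeta> n) x) \<le> C / real (Suc n) \<and>
        (norm x < real (Suc n) \<longrightarrow> \<zeta> n x = 1 \<and> grad (\<zeta> n) x = 0) \<and> (3 * real (Suc n) < norm x \<longrightarrow> grad (\<zeta> n) x = 0))"
      unfolding Bex_def by (rule choice[THEN exE])
    then have \<zeta>: "\<zeta> n \<in> test_functions UNIV" "0 \<le> \<zeta> n x" "\<zeta> n x \<le> 1" "norm (grad (\<zeta> n) x) \<le> C / real (Suc n)"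
        "norm x < real (Suc n) \<Longrightarrow> \<zeta> n x = 1" "norm x < real (Suc n) \<Longrightarrow> grad (\<zeta> n) x = 0" "3 * real (Suc n) < norm x \<Longrightarrow> grad (\<zeta> n) x = 0" for n x
      by blast+
    note \<zeta>m = smooth_borel_measurable[OF test_functions_smooth[OF \<zeta>(1)], of _ D]
    note [measurable] = \<zeta>m
    \<comment> \<open>The shell that carries the gradient of the cutoff. It escapes to infinity, so
      integrals of fixed integrable functions over it tend to 0.\<close>
    define S where "S n = {x :: real ^ 'n. real (Suc n) \<le> norm x \<and> norm x \<le> 3 * real (Suc n)}" for n
    have Sm: "S n \<in> sets borel" for n unfolding S_def by measurable
    have SL: "S n \<in> sets lebesgue" for n using Sm[of n] by (intro sets_completionI_sets) simp
    have im: "(\<lambda>x. indicator (S n) x :: real) \<in> borel_measurable ?M" "(\<lambda>x. indicator (S n) x :: ennreal) \<in> borel_measurable ?M" for n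
      by (intro measurable_restrict_space1 borel_measurable_indicator SL)+
    \<comment> \<open>The free weight \<open>\<mu>\<close> shifts size between factors: a small
      \<open>\<mu>\<close> makes the last term small uniformly in \<open>n\<close>, at the price of
      a fixed large factor on the first term, whose integral over the shell tends to 0.\<close>
    have pt: "\<bar>A x \<bullet> (\<psi> x *\<^sub>R grad (\<zeta> n) x)\<bar> \<le> (norm (A x) / \<mu>) powr a * indicator (S n) x + \<bar>\<psi> x\<bar> powr b * indicator (S n) x + (\<mu> * (C / real (Suc n))) powr N * indicator (S n) x"
      if \<mu>: "\<mu> > 0" for \<mu> n x
    proof (cases "x \<in> S n")
      case True
      have "\<bar>A x \<bullet> (\<psi> x *\<^sub>R grad (\<zeta> n) x)\<bar> \<le> norm (A x) * norm (\<psi> x *\<^sub>R grad (\<zeta> n) x)" by (rule Cauchy_Schwarz_ineq2)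
      also have "\<dots> \<le> norm (A x) * (\<bar>\<psi> x\<bar> * (C / real (Suc n)))"
        unfolding norm_scaleR real_norm_def by (intro mult_left_mono \<zeta>(4)) auto
      also have "\<dots> = (norm (A x) / \<mu>) * \<bar>\<psi> x\<bar> * (\<mu> * (C / real (Suc n)))" using \<mu> by simp
      also have "\<dots> \<le> (norm (A x) / \<mu>) powr a + \<bar>\<psi> x\<bar> powr b + (\<mu> * (C / real (Suc n))) powr N"
        using \<mu> C(1) ab N by (intro young3) auto
      finally show ?thesis using True by simp
    next
      case False
      then have "grad (\<zeta> n) x = 0" using \<zeta>(6)[of x n] \<zeta>(7)[of n x] by (auto simp: S_def not_le)
      then show ?thesis using False by simp
    qed
    have vol: "(\<integral>\<^sup>+x. ennreal ((\<mu> * (C / real (Suc n))) powr N * indicator (S n) x) \<partial>?M) \<le> ennreal (\<mu> powr N * (C powr N * (4 ^ CARD('n) * unit_ball_vol N)))"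
      if \<mu>: "\<mu> > 0" for \<mu> n
    proof -
      have "(\<integral>\<^sup>+x. ennreal ((\<mu> * (C / real (Suc n))) powr N * indicator (S n) x) \<partial>?M)
         = (\<integral>\<^sup>+x. ennreal ((\<mu> * (C / real (Suc n))) powr N * indicator (S n) x) * indicator D x \<partial>lebesgue)"
        by (subst nn_integral_restrict_space) (use D in auto)
      also have "\<dots> \<le> (\<integral>\<^sup>+x. ennreal ((\<mu> * (C / real (Suc n))) powr N) * indicator (ball 0 (4 * real (Suc n)) :: (real ^ 'n) set) x \<partial>lebesgue)"
        by (rule nn_integral_mono) (auto simp: indicator_def S_def)
      also have "\<dots> = ennreal ((\<mu> * (C / real (Suc n))) powr N) * ennreal (unit_ball_vol N * (4 * real (Suc n)) ^ CARD('n))"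
        by (subst nn_integral_cmult_indicator) (auto simp: emeasure_ball N_def simp del: of_nat_Suc)
      also have "\<dots> = ennreal ((\<mu> * (C / real (Suc n))) powr N * (unit_ball_vol N * (4 * real (Suc n)) ^ CARD('n)))"
        using N by (simp add: ennreal_mult)
      also have "(\<mu> * (C / real (Suc n))) powr N * (unit_ball_vol N * (4 * real (Suc n)) ^ CARD('n)) = \<mu> powr N * (C powr N * (4 ^ CARD('n) * unit_ball_vol N))"
        using \<mu> C(1) by (simp add: powr_mult powr_divide power_mult_distrib N_def powr_realpow del: of_nat_Suc)
      finally show ?thesis by simp
    qed
    let ?T = "\<lambda>n. LINT x|?M. A x \<bullet> (\<psi> x *\<^sub>R grad (\<zeta> n) x)"
    let ?X = "\<lambda>n. \<integral>\<^sup>+x. ennreal (norm (A x) powr a) * indicator (S n) x \<partial>?M"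
    let ?Y = "\<lambda>n. \<integral>\<^sup>+x. ennreal (norm (\<psi> x) powr b) * indicator (S n) x \<partial>?M"
    have SM: "D \<inter> S n \<in> sets ?M" for n using D Sm[of n] by (auto simp: sets_restrict_space_iff)
    have bd: "(\<integral>\<^sup>+x. ennreal \<bar>A x \<bullet> (\<psi> x *\<^sub>R grad (\<zeta> n) x)\<bar> \<partial>?M)
       \<le> ennreal ((1 / \<mu>) powr a) * ?X n + ?Y n + ennreal (\<mu> powr N * (C powr N * (4 ^ CARD('n) * unit_ball_vol N)))" if \<mu>: "\<mu> > 0" for \<mu> n
    proof -
      note [measurable] = im
      have "(\<integral>\<^sup>+x. ennreal \<bar>A x \<bullet> (\<psi> x *\<^sub>R grad (\<zeta> n) x)\<bar> \<partial>?M)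
        \<le> (\<integral>\<^sup>+x. ennreal ((1 / \<mu>) powr a) * (ennreal (norm (A x) powr a) * indicator (S n) x) + ennreal (norm (\<psi> x) powr b) * indicator (S n) x
            + ennreal ((\<mu> * (C / real (Suc n))) powr N * indicator (S n) x) \<partial>?M)"
      proof (rule nn_integral_mono)
        fix x
        have "(norm (A x) / \<mu>) powr a = (1 / \<mu>) powr a * norm (A x) powr a" using \<mu> by (simp add: powr_divide)
        then have "ennreal \<bar>A x \<bullet> (\<psi> x *\<^sub>R grad (\<zeta> n) x)\<bar> \<le> ennreal ((1 / \<mu>) powr a * norm (A x) powr a * indicator (S n) x + \<bar>\<psi> x\<bar> powr b * indicator (S n) x + (\<mu> * (C / real (Suc n))) powr N * indicator (S n) x)"
          using pt[OF \<mu>, of x n] by (intro ennreal_leI) simp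
        then show "ennreal \<bar>A x \<bullet> (\<psi> x *\<^sub>R grad (\<zeta> n) x)\<bar> \<le> ennreal ((1 / \<mu>) powr a) * (ennreal (norm (A x) powr a) * indicator (S n) x) + ennreal (norm (\<psi> x) powr b) * indicator (S n) x
            + ennreal ((\<mu> * (C / real (Suc n))) powr N * indicator (S n) x)"
          by (cases "x \<in> S n") (simp_all add: ennreal_mult ennreal_plus)
      qed
      also have "\<dots> = ennreal ((1 / \<mu>) powr a) * ?X n + ?Y n + (\<integral>\<^sup>+x. ennreal ((\<mu> * (C / real (Suc n))) powr N * indicator (S n) x) \<partial>?M)"
        by (subst nn_integral_add, measurable, subst nn_integral_add, measurable, subst nn_integral_cmult, measurable)
      finally show ?thesis using vol[OF \<mu>, of n] by (meson add_left_mono order_trans)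
    qed
    have ev: "\<forall>\<^sub>F n in sequentially. x \<notin> D \<inter> S n" for x
    proof -
      obtain n0 where n0: "norm x < real n0" using reals_Archimedean2 by blast
      have "x \<notin> S n" if "n0 \<le> n" for n using n0 that by (simp add: S_def)
      then show ?thesis by (auto simp: eventually_sequentially)
    qed
    have DS: "(\<integral>\<^sup>+x. f x * indicator (S n) x \<partial>?M) = (\<integral>\<^sup>+x. f x * indicator (D \<inter> S n) x \<partial>?M)" for f :: "real ^ 'n \<Rightarrow> ennreal" and n
      by (intro nn_integral_cong) (auto simp: indicator_def)
    have X0: "?X \<longlonglongrightarrow> 0" unfolding DS
      by (rule nn_integral_shrinking_tendsto_0[OF _ _ SM ev]) (use Lp_nn_integral_finite[OF A] in \<open>auto simp: a_def\<close>)
    have Y0: "?Y \<longlonglongrightarrow> 0" unfolding DS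
      by (rule nn_integral_shrinking_tendsto_0[OF _ _ SM ev]) (use Lp_nn_integral_finite[OF \<psi>L] in \<open>auto simp: b_def\<close>)
    have Xfin: "?X n < \<infinity>" "?Y n < \<infinity>" for n
    proof -
      have "?X n \<le> (\<integral>\<^sup>+x. ennreal (norm (A x) powr a) \<partial>?M)" by (intro nn_integral_mono) (auto simp: indicator_def)
      then show "?X n < \<infinity>" using Lp_nn_integral_finite(2)[OF A] by (simp add: a_def order_le_less_trans)
      have "?Y n \<le> (\<integral>\<^sup>+x. ennreal (norm (\<psi> x) powr b) \<partial>?M)" by (intro nn_integral_mono) (auto simp: indicator_def)
      then show "?Y n < \<infinity>" using Lp_nn_integral_finite(2)[OF \<psi>L] by (simp add: b_def order_le_less_trans)
    qed
    have Tint: "integrable ?M (\<lambda>x. A x \<bullet> (\<psi> x *\<^sub>R grad (\<zeta> n) x))" for n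
    proof (rule integrableI_bounded)
      have "ennreal ((1 / 1) powr a) * ?X n + ?Y n + ennreal (1 powr N * (C powr N * (4 ^ CARD('n) * unit_ball_vol N))) < \<infinity>"
        using Xfin[of n] by (simp add: ennreal_mult_less_top)
      with bd[of 1 n] show "(\<integral>\<^sup>+x. ennreal (norm (A x \<bullet> (\<psi> x *\<^sub>R grad (\<zeta> n) x))) \<partial>?M) < \<infinity>"
        unfolding real_norm_def by (intro order_le_less_trans[OF bd[of 1 n]]) auto
    qed measurable
    have "?T \<longlonglongrightarrow> 0"
    proof (rule tendstoI)
      fix e :: real assume e: "e > 0"
      define K where "K = C powr N * (4 ^ CARD('n) * unit_ball_vol N)"
      have K: "K > 0" using C(1) N by (simp add: K_def)
      \<comment> \<open>Solves \<open>\<mu> powr N * K = e / 4\<close>, so the volume term takes one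
        quarter of \<open>e\<close>; the two shell integrals eventually take another quarter
        each.\<close>
      define \<mu> where "\<mu> = (e / (4 * K)) powr (1 / N)"
      have \<mu>: "\<mu> > 0" using e K by (simp add: \<mu>_def)
      have \<mu>K: "\<mu> powr N * K = e / 4" using e K N by (simp add: \<mu>_def powr_powr)
      have "(\<lambda>n. ennreal ((1 / \<mu>) powr a) * ?X n) \<longlonglongrightarrow> ennreal ((1 / \<mu>) powr a) * 0" by (intro ennreal_tendsto_cmult X0) simp
      then have e1: "\<forall>\<^sub>F n in sequentially. ennreal ((1 / \<mu>) powr a) * ?X n < ennreal (e / 4)" using e by (intro order_tendstoD) auto
      have e2: "\<forall>\<^sub>F n in sequentially. ?Y n < ennreal (e / 4)" using Y0 e by (intro order_tendstoD) auto
      from e1 e2 show "\<forall>\<^sub>F n in sequentially. dist (?T n) 0 < e"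
      proof eventually_elim
        case (elim n)
        have "ennreal \<bar>?T n\<bar> \<le> (\<integral>\<^sup>+x. ennreal \<bar>A x \<bullet> (\<psi> x *\<^sub>R grad (\<zeta> n) x)\<bar> \<partial>?M)"
          using integral_norm_bound_ennreal[OF Tint[of n]] by simp
        also have "\<dots> \<le> ennreal (e / 4) + ennreal (e / 4) + ennreal (e / 4)"
          using bd[OF \<mu>, of n] elim unfolding K_def[symmetric] \<mu>K by (meson add_mono less_imp_le order_refl order_trans)
        also have "\<dots> = ennreal (3 * e / 4)" using e by (simp flip: ennreal_plus)
        finally have "\<bar>?T n\<bar> \<le> 3 * e / 4" using e by (simp add: ennreal_le_iff)
        then show ?case using e by simp
      qed
    qed
    moreover have "(\<lambda>n. LINT x|?M. \<zeta> n x * (A x \<bullet> H x)) \<longlonglongrightarrow> (LINT x|?M. A x \<bullet> H x)"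
    proof (rule integral_dominated_convergence[where w = "\<lambda>x. \<bar>A x \<bullet> H x\<bar>"])
      show "integrable ?M (\<lambda>x. \<bar>A x \<bullet> H x\<bar>)" using integrable_conjugate(1)[OF A H p] by (rule integrable_abs)
      show "AE x in ?M. (\<lambda>n. \<zeta> n x * (A x \<bullet> H x)) \<longlonglongrightarrow> A x \<bullet> H x"
      proof (rule AE_I2, rule tendsto_eventually)
        fix x :: "real ^ 'n"
        obtain n0 where n0: "norm x < real n0" using reals_Archimedean2 by blast
        have "\<zeta> n x * (A x \<bullet> H x) = A x \<bullet> H x" if "n0 \<le> n" for n using n0 that by (simp add: \<zeta>(5))
        then show "\<forall>\<^sub>F n in sequentially. \<zeta> n x * (A x \<bullet> H x) = A x \<bullet> H x" by (auto simp: eventually_sequentially)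
      qed
      show "AE x in ?M. norm (\<zeta> n x * (A x \<bullet> H x)) \<le> \<bar>A x \<bullet> H x\<bar>" for n
        using \<zeta>(2,3) by (intro AE_I2) (auto simp: abs_mult intro!: mult_left_le_one_le)
    qed measurable
    moreover have "(LINT x|?M. \<zeta> n x * (A x \<bullet> H x)) = - ?T n" for n
    proof -
      have i2: "integrable ?M (\<lambda>x. \<zeta> n x * (A x \<bullet> H x))"
      proof (rule Bochner_Integration.integrable_bound[OF integrable_conjugate(1)[OF A H p]])
        show "AE x in ?M. norm (\<zeta> n x * (A x \<bullet> H x)) \<le> norm (A x \<bullet> H x)"
          using \<zeta>(2,3) by (intro AE_I2) (auto simp: abs_mult intro!: mult_left_le_one_le)
      qed measurable
      have "0 = (LINT x|?M. A x \<bullet> (\<psi> x *\<^sub>R grad (\<zeta> n) x) + \<zeta> n x * (A x \<bullet> H x))"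
        using eq[OF \<zeta>(1)[of n]] by (simp add: inner_add_right)
      also have "\<dots> = ?T n + (LINT x|?M. \<zeta> n x * (A x \<bullet> H x))" by (rule Bochner_Integration.integral_add[OF Tint i2])
      finally show ?thesis by simp
    qed
    ultimately have "(\<lambda>n. - ?T n) \<longlonglongrightarrow> (LINT x|?M. A x \<bullet> H x)" "(\<lambda>n. - ?T n) \<longlonglongrightarrow> - 0"
      by (simp, intro tendsto_minus)
    then show ?thesis using LIMSEQ_unique by fastforce
  qed
qed

section \<open>Testing inequalities and uniqueness for the equation\<close>

section \<open>Norms and subdifferentials\<close>

lemma is_norm_bound:
  fixes F :: "real ^ 'n \<Rightarrow> real"
  assumes F: "is_norm F"
  obtains C where "C > 0" "\<forall>x. F x \<le> C * norm x" "continuous_on UNIV F"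
proof -
  have nn: "0 \<le> F x" and sc: "F (c *\<^sub>R x) = \<bar>c\<bar> * F x" and tri: "F (x + y) \<le> F x + F y" for c x y
    using F by (auto simp: is_norm_def)
  have F0: "F 0 = 0" using F by (auto simp: is_norm_def)
  have sum: "F (\<Sum>i\<in>I. f i) \<le> (\<Sum>i\<in>I. F (f i))" for I :: "'n set" and f
    by (induction I rule: infinite_finite_induct) (auto simp: F0 intro: order_trans[OF tri])
  define C where "C = (\<Sum>i\<in>UNIV. F (axis i (1::real) :: real ^ 'n)) + 1"
  have C0: "C > 0" using nn by (simp add: C_def add_nonneg_pos sum_nonneg)
  have C: "F x \<le> C * norm x" for x
  proof -
    have "F x = F (\<Sum>i\<in>UNIV. x $ i *\<^sub>R axis i 1)"
      using basis_expansion[of x] by (simp add: scalar_mult_eq_scaleR)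
    also have "\<dots> \<le> (\<Sum>i\<in>UNIV. F (x $ i *\<^sub>R axis i 1))" by (rule sum)
    also have "\<dots> = (\<Sum>i\<in>UNIV. \<bar>x $ i\<bar> * F (axis i 1))" by (simp add: sc)
    also have "\<dots> \<le> (\<Sum>i\<in>UNIV. norm x * F (axis i 1))"
      by (intro sum_mono mult_right_mono component_le_norm_cart nn)
    also have "\<dots> \<le> C * norm x" by (simp add: C_def sum_distrib_left[symmetric] algebra_simps)
    finally show ?thesis .
  qed
  have lip: "\<bar>F x - F y\<bar> \<le> C * norm (x - y)" for x y
  proof -
    have "F x \<le> F (x - y) + F y" using tri[of "x - y" y] by simp
    moreover have "F y \<le> F (y - x) + F x" using tri[of "y - x" x] by simp
    moreover have "F (x - y) \<le> C * norm (x - y)" "F (y - x) \<le> C * norm (x - y)"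
      using C[of "x - y"] C[of "y - x"] by (auto simp: norm_minus_commute)
    ultimately show ?thesis by linarith
  qed
  have "C-lipschitz_on UNIV F" using lip C0 by (auto simp: lipschitz_on_def dist_norm)
  then have "continuous_on UNIV F" by (rule lipschitz_on_continuous_on)
  with that C0 C show ?thesis by blast
qed

text \<open>Testing the subgradient inequality at 0 and at twice \<open>\<xi>\<close> gives Euler's
  identity; testing at \<open>\<eta> + \<xi>\<close> and using subadditivity gives the dual norm
  bound. Only these two facts about z enter the uniqueness proof.\<close>

lemma subdifferential_norm:
  fixes F :: "real ^ 'n \<Rightarrow> real"
  assumes F: "is_norm F" and z: "z \<in> subdifferential F \<xi>"
  shows "z \<bullet> \<xi> = F \<xi>" "z \<bullet> \<eta> \<le> F \<eta>"
proof -
  have s: "z \<bullet> (\<eta> - \<xi>) \<le> F \<eta> - F \<xi>" for \<eta> using z by (simp add: subdifferential_def)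
  have sc: "F (c *\<^sub>R x) = \<bar>c\<bar> * F x" and tri: "F (x + y) \<le> F x + F y" for c x y using F by (auto simp: is_norm_def)
  have F0: "F 0 = 0" using F by (auto simp: is_norm_def)
  show 1: "z \<bullet> \<xi> = F \<xi>" using s[of 0] s[of "2 *\<^sub>R \<xi>"] by (simp add: F0 sc inner_diff_right)
  show "z \<bullet> \<eta> \<le> F \<eta>" using s[of "\<eta> + \<xi>"] tri[of \<eta> \<xi>] by simp
qed

lemma powr_monotone_gap:
  fixes a b s :: real
  assumes "0 \<le> a" "0 \<le> b" "0 < s"
  shows "(a powr s - b powr s) * (a - b) \<ge> 0" "(a powr s - b powr s) * (a - b) = 0 \<Longrightarrow> a = b"
proof -
  consider "a < b" | "a = b" | "b < a" by linarith
  then have "(a powr s - b powr s) * (a - b) > 0 \<or> a = b"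
  proof cases
    case 1 then show ?thesis using powr_less_mono2[of s a b] assms by (simp add: mult_neg_neg)
  next
    case 3 then show ?thesis using powr_less_mono2[of s b a] assms by simp
  qed simp
  then show "(a powr s - b powr s) * (a - b) \<ge> 0" "(a powr s - b powr s) * (a - b) = 0 \<Longrightarrow> a = b" by auto
qed

text \<open>Strict convexity read off from the tangent at the midpoint c: the power is above it at
  \<open>a\<close> by \<open>powr_tangent\<close> and strictly above it at \<open>b\<close>; in the
  average of the two, the linear parts cancel.\<close>

lemma powr_strict_midpoint:
  fixes a b p :: real
  assumes "0 \<le> a" "0 \<le> b" "1 < p"
  shows "((a + b) / 2) powr p \<le> (a powr p + b powr p) / 2"
    "((a + b) / 2) powr p = (a powr p + b powr p) / 2 \<Longrightarrow> a = b"
proof -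
  have strict: "((a + b) / 2) powr p < (a powr p + b powr p) / 2" if ab: "0 \<le> a" "a < b" for a b
  proof -
    define c where "c = (a + b) / 2"
    have c: "0 < c" "a < c" "c < b" using ab by (auto simp: c_def)
    \<comment> \<open>x^p minus the linear part of its tangent at \<open>c\<close> has derivative p
      (x^(p-1) - c^(p-1)), positive for x > c.\<close>
    have "c powr p - p * c powr (p - 1) * c < b powr p - p * c powr (p - 1) * b"
    proof (rule DERIV_pos_imp_increasing_open[OF c(3)])
      fix x assume x: "c < x" "x < b"
      have "((\<lambda>x. x powr p - p * c powr (p - 1) * x) has_real_derivative (p * x powr (p - 1) - p * c powr (p - 1))) (at x)"
        using x c by (auto intro!: derivative_eq_intros simp: powr_diff)
      moreover have "c powr (p - 1) < x powr (p - 1)" using x c assms by (intro powr_less_mono2) auto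
      ultimately show "\<exists>y. ((\<lambda>x. x powr p - p * c powr (p - 1) * x) has_real_derivative y) (at x) \<and> 0 < y"
        using assms by (intro exI[of _ "p * x powr (p - 1) - p * c powr (p - 1)"]) simp
    qed (use c assms in \<open>auto intro!: continuous_intros\<close>)
    moreover have "p * a * c powr (p - 1) \<le> a powr p + (p - 1) * c powr p"
      using ab c assms by (intro powr_tangent) auto
    moreover have "c powr (p - 1) * c = c powr p" using c by (simp add: powr_diff)
    moreover have "p * c powr (p - 1) * b = 2 * (p * c powr (p - 1) * c) - p * a * c powr (p - 1)"
    proof -
      have b: "b = 2 * c - a" unfolding c_def by (simp add: field_simps)
      show ?thesis unfolding b by (simp add: algebra_simps)
    qed
    ultimately have "c powr p < (a powr p + b powr p) / 2"
      by (simp add: left_diff_distrib mult.assoc)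
    then show ?thesis by (simp add: c_def)
  qed
  consider "a < b" | "a = b" | "b < a" by linarith
  then have "((a + b) / 2) powr p < (a powr p + b powr p) / 2 \<or> a = b"
    using strict[of a b] strict[of b a] assms by cases (auto simp: add.commute)
  then show "((a + b) / 2) powr p \<le> (a powr p + b powr p) / 2"
    "((a + b) / 2) powr p = (a powr p + b powr p) / 2 \<Longrightarrow> a = b" by auto
qed

lemma integral_nonpos_imp_AE_0:
  fixes f :: "'a \<Rightarrow> real"
  assumes "integrable M f" "AE x in M. 0 \<le> f x" "(LINT x|M. f x) \<le> 0"
  shows "AE x in M. f x = 0"
proof -
  have "(LINT x|M. f x) = 0" using integral_nonneg_AE[OF assms(2)] assms(3) by simp
  then show ?thesis using integral_nonneg_eq_0_iff_AE[OF assms(1,2)] by simp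
qed

section \<open>Uniqueness of weak solutions\<close>

lemma sobolevD:
  assumes "u \<in> sobolev q p D"
  shows "u \<in> Lp q (lebesgue_on D)" "has_weak_gradient D u (weak_grad D u)" "weak_grad D u \<in> Lp p (lebesgue_on D)"
  using assms weak_grad_has_weak_gradient by (auto simp: sobolev_def)

text \<open>The equation may be tested with Psi(u,v) itself, although on an exterior domain this
  need not belong to \<open>W1p_0\<close>: it is tested with a cutoff factor, which
  \<open>remove_cutoff\<close> then eliminates. The flux F^(p-1) z lies in the conjugate space
  L^(p/(p-1)), so all pairings converge.\<close>

lemma tested_equation:
  fixes \<Omega> :: "(real ^ 'n) set" and F :: "real ^ 'n \<Rightarrow> real"
  assumes N: "2 \<le> CARD('n)" and F: "is_norm F" and p: "1 < p" and D: "chart_boundary D (frontier \<Omega>)"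
    and q: "0 < q" "bounded D \<or> (p < real CARD('n) \<and> q = sobolev_exponent TYPE('n) p)"
    and u: "u \<in> sobolev q p D" and v: "v \<in> sobolev q p D"
    and tr: "has_trace p \<Omega> D u \<phi>" "has_trace p \<Omega> D v \<phi>" and \<phi>: "\<phi> \<in> borel_measurable (surface_measure \<Omega>)"
    and z: "z \<in> borel_measurable (lebesgue_on D)" "AE x in lebesgue_on D. z x \<in> subdifferential F (weak_grad D u x)"
    and eq: "\<forall>\<psi>\<in>W1p_0 p D. (LINT x|lebesgue_on D. F (weak_grad D u x) powr (p - 1) * (z x \<bullet> weak_grad D \<psi> x)) = 0"
    and adm: "admissible \<Psi> \<Psi>1 \<Psi>2 B TYPE('n)" and diag: "\<And>s. \<Psi> s s = 0"
  shows "(LINT x|lebesgue_on D. F (weak_grad D u x) powr (p - 1) * (z x \<bullet> (\<Psi>1 (u x) (v x) *\<^sub>R weak_grad D u x + \<Psi>2 (u x) (v x) *\<^sub>R weak_grad D v x))) = 0"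
    "integrable (lebesgue_on D) (\<lambda>x. F (weak_grad D u x) powr (p - 1) * (z x \<bullet> (\<Psi>1 (u x) (v x) *\<^sub>R weak_grad D u x + \<Psi>2 (u x) (v x) *\<^sub>R weak_grad D v x)))"
proof -
  note eq = eq[rule_format]
  let ?M = "lebesgue_on D"
  have oD: "open D" using D by (simp add: chart_boundary_def)
  have DL: "D \<in> sets lebesgue" using oD by auto
  have p1: "1 \<le> p" "0 < p" using p by auto
  obtain C where C: "C > 0" "\<forall>x. F x \<le> C * norm x" "continuous_on UNIV F" by (rule is_norm_bound[OF F])
  have Fn: "0 \<le> F x" for x using F by (simp add: is_norm_def)
  have Fm[measurable]: "F \<in> borel_measurable borel" by (rule borel_measurable_continuous_onI[OF C(3)])
  note su = sobolevD[OF u] and sv = sobolevD[OF v]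
  note um = Lp_nn_integral_finite(1)[OF su(1)] and vm = Lp_nn_integral_finite(1)[OF sv(1)]
  note Gum[measurable] = Lp_nn_integral_finite(1)[OF su(3)] and Gvm[measurable] = Lp_nn_integral_finite(1)[OF sv(3)]
  note [measurable] = z(1)
  have B: "0 \<le> B" and c1: "continuous_on UNIV (\<lambda>z. \<Psi>1 (fst z) (snd z))" and c2: "continuous_on UNIV (\<lambda>z. \<Psi>2 (fst z) (snd z))"
    and c0: "continuous_on UNIV (\<lambda>z. \<Psi> (fst z) (snd z))"
    and b1: "\<And>s t. \<bar>\<Psi>1 s t\<bar> \<le> B" and b2: "\<And>s t. \<bar>\<Psi>2 s t\<bar> \<le> B"
    and lip: "\<And>s t s' t'. \<bar>\<Psi> s t - \<Psi> s' t'\<bar> \<le> B * (\<bar>s - s'\<bar> + \<bar>t - t'\<bar>)"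
    using adm unfolding admissible_def by blast+
  define A where "A x = F (weak_grad D u x) powr (p - 1) *\<^sub>R z x" for x
  define H where "H x = \<Psi>1 (u x) (v x) *\<^sub>R weak_grad D u x + \<Psi>2 (u x) (v x) *\<^sub>R weak_grad D v x" for x
  note [measurable] = admissible_measurable[OF c1 um vm] admissible_measurable[OF c2 um vm]
  have Am[measurable]: "A \<in> borel_measurable ?M" unfolding A_def by measurable
  have Hm: "H \<in> borel_measurable ?M" unfolding H_def by measurable
  have HL: "H \<in> Lp p ?M"
  proof -
    have "(\<lambda>x. \<Psi>1 (u x) (v x) *\<^sub>R weak_grad D u x) \<in> Lp p ?M"
      by (rule Lp_bound[OF su(3) _ p1(2) B]) (auto intro!: mult_right_mono b1)
    moreover have "(\<lambda>x. \<Psi>2 (u x) (v x) *\<^sub>R weak_grad D v x) \<in> Lp p ?M"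
      by (rule Lp_bound[OF sv(3) _ p1(2) B]) (auto intro!: mult_right_mono b2)
    ultimately show ?thesis unfolding H_def[abs_def] by (rule Lp_add[OF _ _ p1(2)])
  qed
  have AL: "A \<in> Lp (p / (p - 1)) ?M"
  proof (rule LpI[OF Am])
    \<comment> \<open>Taking \<open>z x\<close> as its own test direction in the dual norm bound
      gives |z|^2 <= F(z) <= C |z|.\<close>
    have zb: "norm (z x) \<le> C" if "z x \<in> subdifferential F (weak_grad D u x)" for x
    proof (cases "z x = 0")
      case False
      have "norm (z x) * norm (z x) = z x \<bullet> z x" by (simp add: dot_square_norm power2_eq_square)
      also have "\<dots> \<le> F (z x)" by (rule subdifferential_norm(2)[OF F that])
      also have "\<dots> \<le> C * norm (z x)" using C(2) by blast
      finally show ?thesis using False by simp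
    qed (use C(1) in simp)
    have "(\<integral>\<^sup>+x. ennreal (norm (A x) powr (p / (p - 1))) \<partial>?M) \<le> (\<integral>\<^sup>+x. ennreal (C powr (p / (p - 1)) * C powr p) * ennreal (norm (weak_grad D u x) powr p) \<partial>?M)"
    proof (rule nn_integral_mono_AE, use z(2) in eventually_elim)
      case (elim x)
      have "norm (A x) = F (weak_grad D u x) powr (p - 1) * norm (z x)" by (simp add: A_def)
      also have "\<dots> \<le> F (weak_grad D u x) powr (p - 1) * C" using zb[OF elim] by (intro mult_left_mono) auto
      also have "\<dots> \<le> (C * norm (weak_grad D u x)) powr (p - 1) * C"
        using C Fn p by (intro mult_right_mono powr_mono2) auto
      finally have "norm (A x) powr (p / (p - 1)) \<le> ((C * norm (weak_grad D u x)) powr (p - 1) * C) powr (p / (p - 1))"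
        using p by (intro powr_mono2) auto
      also have "\<dots> = C powr (p / (p - 1)) * C powr p * norm (weak_grad D u x) powr p"
        using p by (simp add: powr_mult powr_powr)
      finally show ?case by (simp flip: ennreal_mult)
    qed
    also have "\<dots> = ennreal (C powr (p / (p - 1)) * C powr p) * (\<integral>\<^sup>+x. ennreal (norm (weak_grad D u x) powr p) \<partial>?M)"
      by (rule nn_integral_cmult) measurable
    also have "\<dots> < \<infinity>" using Lp_nn_integral_finite(2)[OF su(3)] by (simp add: ennreal_mult_less_top)
    finally show "(\<integral>\<^sup>+x. ennreal (norm (A x) powr (p / (p - 1))) \<partial>?M) < \<infinity>" .
  qed
  obtain w where w: "\<And>k. w k \<in> test_functions UNIV"
    "\<forall>R>0. Lp_tendsto p (lebesgue_on (D \<inter> ball 0 R)) w u"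
    "\<forall>R>0. Lp_tendsto p (lebesgue_on (D \<inter> ball 0 R)) (\<lambda>k. grad (w k)) (weak_grad D u)"
    "Lp_tendsto p (surface_measure \<Omega>) w \<phi>"
    using tr(1) unfolding has_trace_def by blast
  obtain w' where w': "\<And>k. w' k \<in> test_functions UNIV"
    "\<forall>R>0. Lp_tendsto p (lebesgue_on (D \<inter> ball 0 R)) w' v"
    "\<forall>R>0. Lp_tendsto p (lebesgue_on (D \<inter> ball 0 R)) (\<lambda>k. grad (w' k)) (weak_grad D v)"
    "Lp_tendsto p (surface_measure \<Omega>) w' \<phi>"
    using tr(2) unfolding has_trace_def by blast
  have \<psi>m: "(\<lambda>x. \<Psi> (u x) (v x)) \<in> borel_measurable ?M" by (rule admissible_measurable[OF c0 um vm])
  \<comment> \<open>Comparison with the diagonal bounds |Psi(u,v)| by B |u - v|, which puts it in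
    the Sobolev space's L^q.\<close>
  have dom: "bounded D \<or> (p < real CARD('n) \<and> (\<lambda>x. \<Psi> (u x) (v x)) \<in> Lp (sobolev_exponent TYPE('n) p) ?M)"
  proof (cases "bounded D")
    case False
    then have q': "p < real CARD('n)" "q = sobolev_exponent TYPE('n) p" using q by auto
    have "(\<lambda>x. - v x) \<in> Lp q ?M" by (rule Lp_bound[OF sv(1) _ q(1), of _ 1]) (use vm in auto)
    from Lp_add[OF su(1) this q(1)] have d: "(\<lambda>x. u x + - v x) \<in> Lp q ?M" .
    have "(\<lambda>x. \<Psi> (u x) (v x)) \<in> Lp q ?M"
    proof (rule Lp_bound[OF d \<psi>m q(1) B], rule AE_I2)
      show "norm (\<Psi> (u x) (v x)) \<le> B * norm (u x + - v x)" for x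
        using lip[of "u x" "v x" "v x" "v x"] by (simp add: diag)
    qed
    then show ?thesis using q' by simp
  qed simp
  have "(LINT x|?M. A x \<bullet> H x) = 0"
  proof (rule remove_cutoff[OF DL p AL HL \<psi>m dom])
    fix \<zeta> :: "real ^ 'n \<Rightarrow> real" assume \<zeta>: "\<zeta> \<in> test_functions UNIV"
    note S = superposition_W1p_0[OF N p1(1) D w(1) w'(1) w(2) w'(2) w(3) w'(3) um vm su(3) sv(3) w(4) w'(4) \<phi> adm diag \<zeta>]
    note \<zeta>m = smooth_borel_measurable[OF test_functions_smooth[OF \<zeta>], of D]
    have wm: "weak_grad D (\<lambda>x. \<Psi> (u x) (v x) * \<zeta> x) \<in> borel_measurable ?M"
      using S(1) unfolding W1p_0_def by (auto dest!: sobolevD(3) intro: Lp_nn_integral_finite(1))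
    have "(LINT x|?M. A x \<bullet> (\<Psi> (u x) (v x) *\<^sub>R grad \<zeta> x + \<zeta> x *\<^sub>R H x))
       = (LINT x|?M. F (weak_grad D u x) powr (p - 1) * (z x \<bullet> weak_grad D (\<lambda>x. \<Psi> (u x) (v x) * \<zeta> x) x))"
    proof (rule integral_cong_AE)
      show "(\<lambda>x. A x \<bullet> (\<Psi> (u x) (v x) *\<^sub>R grad \<zeta> x + \<zeta> x *\<^sub>R H x)) \<in> borel_measurable ?M"
        by (intro borel_measurable_inner borel_measurable_add borel_measurable_scaleR Am Hm \<psi>m \<zeta>m)
      show "(\<lambda>x. F (weak_grad D u x) powr (p - 1) * (z x \<bullet> weak_grad D (\<lambda>x. \<Psi> (u x) (v x) * \<zeta> x) x)) \<in> borel_measurable ?M"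
        using wm by measurable
      show "AE x in ?M. A x \<bullet> (\<Psi> (u x) (v x) *\<^sub>R grad \<zeta> x + \<zeta> x *\<^sub>R H x)
          = F (weak_grad D u x) powr (p - 1) * (z x \<bullet> weak_grad D (\<lambda>x. \<Psi> (u x) (v x) * \<zeta> x) x)"
        using S(2) by eventually_elim (simp add: A_def H_def)
    qed
    also have "\<dots> = 0" by (rule eq[OF S(1)])
    finally show "(LINT x|?M. A x \<bullet> (\<Psi> (u x) (v x) *\<^sub>R grad \<zeta> x + \<zeta> x *\<^sub>R H x)) = 0" .
  qed
  moreover have "integrable ?M (\<lambda>x. A x \<bullet> H x)" by (rule integrable_conjugate(1)[OF AL HL p])
  ultimately show "(LINT x|?M. F (weak_grad D u x) powr (p - 1) * (z x \<bullet> (\<Psi>1 (u x) (v x) *\<^sub>R weak_grad D u x + \<Psi>2 (u x) (v x) *\<^sub>R weak_grad D v x))) = 0"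
    "integrable ?M (\<lambda>x. F (weak_grad D u x) powr (p - 1) * (z x \<bullet> (\<Psi>1 (u x) (v x) *\<^sub>R weak_grad D u x + \<Psi>2 (u x) (v x) *\<^sub>R weak_grad D v x)))"
    by (simp_all add: A_def H_def)
qed

lemma powr_norm_integrable:
  fixes F :: "real ^ 'n \<Rightarrow> real"
  assumes F: "is_norm F" and G: "G \<in> Lp p M" and p: "0 < p"
  shows "(\<lambda>x. F (G x)) \<in> Lp p M"
proof -
  obtain C where C: "C > 0" "\<forall>x. F x \<le> C * norm x" "continuous_on UNIV F" by (rule is_norm_bound[OF F])
  have Fn: "0 \<le> F x" for x using F by (simp add: is_norm_def)
  have [measurable]: "F \<in> borel_measurable borel" by (rule borel_measurable_continuous_onI[OF C(3)])
  note [measurable] = Lp_nn_integral_finite(1)[OF G]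
  show ?thesis by (rule Lp_bound[OF G _ p, of _ C]) (use C Fn in auto)
qed

lemma integrable_powr_mult:
  fixes a b :: "'a \<Rightarrow> real"
  assumes a: "a \<in> Lp p M" "\<And>x. 0 \<le> a x" and b: "b \<in> Lp p M" and p: "1 < p"
  shows "integrable M (\<lambda>x. a x powr (p - 1) * b x)"
proof -
  note [measurable] = Lp_nn_integral_finite(1)[OF a(1)]
  have "(\<lambda>x. a x powr (p - 1)) \<in> Lp (p / (p - 1)) M"
    using Lp_nn_integral_finite(2)[OF a(1)] p a(2) by (intro LpI) (auto simp: powr_powr)
  from integrable_conjugate(1)[OF this b p] show ?thesis by simp
qed

text \<open>The exponent \<open>q\<close> unifies the two problems: it is \<open>p\<close> on the
  bounded domain and the Sobolev exponent on the exterior one.\<close>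

lemma weak_solution_unique:
  fixes \<Omega> :: "(real ^ 'n) set" and F :: "real ^ 'n \<Rightarrow> real"
  assumes N: "2 \<le> CARD('n)" and F: "is_norm F" and p: "1 < p" and D: "chart_boundary D (frontier \<Omega>)"
    and q: "0 < q" "bounded D \<or> (p < real CARD('n) \<and> q = sobolev_exponent TYPE('n) p)"
    and u: "u \<in> sobolev q p D" and v: "v \<in> sobolev q p D"
    and tr: "has_trace p \<Omega> D u \<phi>" "has_trace p \<Omega> D v \<phi>" and \<phi>: "\<phi> \<in> borel_measurable (surface_measure \<Omega>)"
    and equ: "satisfies_equation F p D u" and eqv: "satisfies_equation F p D v"
  shows "AE x in lebesgue_on D. u x = v x"
proof -
  let ?M = "lebesgue_on D"
  have oD: "open D" using D by (simp add: chart_boundary_def)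
  have DL: "D \<in> sets lebesgue" using oD by auto
  have p1: "1 \<le> p" "0 < p" using p by auto
  have Fn: "0 \<le> F x" "F x = 0 \<longleftrightarrow> x = 0" for x using F by (simp_all add: is_norm_def)
  note su = sobolevD[OF u] and sv = sobolevD[OF v]
  note um[measurable] = Lp_nn_integral_finite(1)[OF su(1)] and vm[measurable] = Lp_nn_integral_finite(1)[OF sv(1)]
  define a where "a x = F (weak_grad D u x)" for x
  define b where "b x = F (weak_grad D v x)" for x
  have aL: "a \<in> Lp p ?M" and bL: "b \<in> Lp p ?M"
    unfolding a_def[abs_def] b_def[abs_def] by (intro powr_norm_integrable[OF F] su sv p1)+
  note [measurable] = Lp_nn_integral_finite(1)[OF aL] Lp_nn_integral_finite(1)[OF bL]
  have ab0: "0 \<le> a x" "0 \<le> b x" for x by (auto simp: a_def b_def Fn)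
  have aa: "a x powr (p - 1) * a x = a x powr p" for x
    using ab0(1)[of x] p by (cases "a x = 0") (auto simp: powr_diff)
  obtain z where z: "z \<in> borel_measurable ?M" "AE x in ?M. z x \<in> subdifferential F (weak_grad D u x)"
    "\<forall>\<psi>\<in>W1p_0 p D. (LINT x|?M. F (weak_grad D u x) powr (p - 1) * (z x \<bullet> weak_grad D \<psi> x)) = 0"
    using equ unfolding satisfies_equation_def by blast
  obtain z' where z': "z' \<in> borel_measurable ?M" "AE x in ?M. z' x \<in> subdifferential F (weak_grad D v x)"
    "\<forall>\<psi>\<in>W1p_0 p D. (LINT x|?M. F (weak_grad D v x) powr (p - 1) * (z' x \<bullet> weak_grad D \<psi> x)) = 0"
    using eqv unfolding satisfies_equation_def by blast
  note Tu = tested_equation[OF N F p D q u v tr \<phi> z]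
  note Tv = tested_equation[OF N F p D q v u tr(2,1) \<phi> z']
  have i: "integrable ?M (\<lambda>x. a x powr (p - 1) * b x)" "integrable ?M (\<lambda>x. b x powr (p - 1) * a x)"
    "integrable ?M (\<lambda>x. a x powr (p - 1) * a x)" "integrable ?M (\<lambda>x. b x powr (p - 1) * b x)"
    by (intro integrable_powr_mult aL bL ab0 p)+
  \<comment> \<open>With the test function v - u: z . grad v is at most F(grad v) by the dual norm
    bound, and z . grad u equals F(grad u).\<close>
  have "0 \<le> (LINT x|?M. a x powr (p - 1) * b x - a x powr (p - 1) * a x)"
  proof -
    have "0 = (LINT x|?M. F (weak_grad D u x) powr (p - 1) * (z x \<bullet> ((- 1) *\<^sub>R weak_grad D u x + 1 *\<^sub>R weak_grad D v x)))"
      using Tu(1)[OF admissible_diff] by simp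
    also have "\<dots> \<le> (LINT x|?M. a x powr (p - 1) * b x - a x powr (p - 1) * a x)"
    proof (rule integral_mono_AE)
      show "integrable ?M (\<lambda>x. F (weak_grad D u x) powr (p - 1) * (z x \<bullet> ((- 1) *\<^sub>R weak_grad D u x + 1 *\<^sub>R weak_grad D v x)))"
        using Tu(2)[OF admissible_diff] by simp
      show "AE x in ?M. F (weak_grad D u x) powr (p - 1) * (z x \<bullet> ((- 1) *\<^sub>R weak_grad D u x + 1 *\<^sub>R weak_grad D v x)) \<le> a x powr (p - 1) * b x - a x powr (p - 1) * a x"
        using z(2)
      proof eventually_elim
        case (elim x)
        have "z x \<bullet> ((- 1) *\<^sub>R weak_grad D u x + 1 *\<^sub>R weak_grad D v x) \<le> b x - a x"
          using subdifferential_norm(1)[OF F elim] subdifferential_norm(2)[OF F elim, of "weak_grad D v x"] by (simp add: a_def b_def inner_diff_right)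
        then have "a x powr (p - 1) * (z x \<bullet> ((- 1) *\<^sub>R weak_grad D u x + 1 *\<^sub>R weak_grad D v x)) \<le> a x powr (p - 1) * (b x - a x)"
          by (rule mult_left_mono) simp
        then show ?case by (simp add: a_def right_diff_distrib)
      qed
    qed (intro Bochner_Integration.integrable_diff i)
    finally show ?thesis .
  qed
  moreover have "0 \<le> (LINT x|?M. b x powr (p - 1) * a x - b x powr (p - 1) * b x)"
  proof -
    have "0 = (LINT x|?M. F (weak_grad D v x) powr (p - 1) * (z' x \<bullet> ((- 1) *\<^sub>R weak_grad D v x + 1 *\<^sub>R weak_grad D u x)))"
      using Tv(1)[OF admissible_diff] by simp
    also have "\<dots> \<le> (LINT x|?M. b x powr (p - 1) * a x - b x powr (p - 1) * b x)"
    proof (rule integral_mono_AE)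
      show "integrable ?M (\<lambda>x. F (weak_grad D v x) powr (p - 1) * (z' x \<bullet> ((- 1) *\<^sub>R weak_grad D v x + 1 *\<^sub>R weak_grad D u x)))"
        using Tv(2)[OF admissible_diff] by simp
      show "AE x in ?M. F (weak_grad D v x) powr (p - 1) * (z' x \<bullet> ((- 1) *\<^sub>R weak_grad D v x + 1 *\<^sub>R weak_grad D u x)) \<le> b x powr (p - 1) * a x - b x powr (p - 1) * b x"
        using z'(2)
      proof eventually_elim
        case (elim x)
        have "z' x \<bullet> ((- 1) *\<^sub>R weak_grad D v x + 1 *\<^sub>R weak_grad D u x) \<le> a x - b x"
          using subdifferential_norm(1)[OF F elim] subdifferential_norm(2)[OF F elim, of "weak_grad D u x"] by (simp add: a_def b_def inner_diff_right)
        then have "b x powr (p - 1) * (z' x \<bullet> ((- 1) *\<^sub>R weak_grad D v x + 1 *\<^sub>R weak_grad D u x)) \<le> b x powr (p - 1) * (a x - b x)"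
          by (rule mult_left_mono) simp
        then show ?case by (simp add: b_def right_diff_distrib)
      qed
    qed (intro Bochner_Integration.integrable_diff i)
    finally show ?thesis .
  qed
  \<comment> \<open>The sum of the two tested inequalities is minus this integral, whose integrand
    is nonnegative by monotonicity of the power.\<close>
  ultimately have "(LINT x|?M. (a x powr (p - 1) - b x powr (p - 1)) * (a x - b x)) \<le> 0"
  proof -
    assume 1: "0 \<le> (LINT x|?M. a x powr (p - 1) * b x - a x powr (p - 1) * a x)"
      and 2: "0 \<le> (LINT x|?M. b x powr (p - 1) * a x - b x powr (p - 1) * b x)"
    have "(LINT x|?M. (a x powr (p - 1) - b x powr (p - 1)) * (a x - b x))
       = (LINT x|?M. - (a x powr (p - 1) * b x - a x powr (p - 1) * a x) - (b x powr (p - 1) * a x - b x powr (p - 1) * b x))"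
      by (intro Bochner_Integration.integral_cong refl) (simp add: algebra_simps)
    also have "\<dots> = - (LINT x|?M. a x powr (p - 1) * b x - a x powr (p - 1) * a x) - (LINT x|?M. b x powr (p - 1) * a x - b x powr (p - 1) * b x)"
      using i by (subst Bochner_Integration.integral_diff) (auto intro!: Bochner_Integration.integrable_diff)
    finally show ?thesis using 1 2 by linarith
  qed
  moreover have "integrable ?M (\<lambda>x. (a x powr (p - 1) - b x powr (p - 1)) * (a x - b x))"
  proof -
    have "integrable ?M (\<lambda>x. (a x powr (p - 1) * a x - a x powr (p - 1) * b x) - (b x powr (p - 1) * a x - b x powr (p - 1) * b x))"
      by (intro Bochner_Integration.integrable_diff i)
    then show ?thesis by (simp add: algebra_simps)
  qed
  moreover have "AE x in ?M. 0 \<le> (a x powr (p - 1) - b x powr (p - 1)) * (a x - b x)"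
    by (intro AE_I2 powr_monotone_gap(1) ab0) (use p in simp)
  ultimately have "AE x in ?M. (a x powr (p - 1) - b x powr (p - 1)) * (a x - b x) = 0"
    by (intro integral_nonpos_imp_AE_0)
  then have ab: "AE x in ?M. a x = b x"
    by eventually_elim (rule powr_monotone_gap(2)[OF ab0], use p in auto)
  have c: "\<bar>1 - (mix1 s t + mix2 s t)\<bar> \<le> 1" for s t
    using mix_derivs(1)[of s t] mix_derivs(2)[of s t] mix_derivs(6)[of s t] by (auto simp: abs_le_iff)
  have ca: "norm ((1 - (mix1 (u x) (v x) + mix2 (u x) (v x))) * a x powr p) \<le> norm (a x powr p)" for x
    using mult_right_mono[OF c[of "u x" "v x"] abs_ge_zero[of "a x powr p"]] by (simp add: abs_mult)
  \<comment> \<open>With the test function mix(u,v) - u: as \<open>mix2\<close> is nonnegative and z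
    . grad v <= b = a, the tested integrand is at most minus the one displayed here. Both a >= 0 and
    the deficit in the partials make the latter nonnegative.\<close>
  have "(LINT x|?M. (1 - (mix1 (u x) (v x) + mix2 (u x) (v x))) * a x powr p) \<le> 0"
  proof -
    have "0 = (LINT x|?M. - (F (weak_grad D u x) powr (p - 1) * (z x \<bullet> ((mix1 (u x) (v x) - 1) *\<^sub>R weak_grad D u x + mix2 (u x) (v x) *\<^sub>R weak_grad D v x))))"
      using Tu(1)[OF admissible_mix_diff] by (simp add: mix_def bell_def)
    also have "\<dots> \<ge> (LINT x|?M. (1 - (mix1 (u x) (v x) + mix2 (u x) (v x))) * a x powr p)"
    proof (rule integral_mono_AE)
      show "integrable ?M (\<lambda>x. - (F (weak_grad D u x) powr (p - 1) * (z x \<bullet> ((mix1 (u x) (v x) - 1) *\<^sub>R weak_grad D u x + mix2 (u x) (v x) *\<^sub>R weak_grad D v x))))"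
        using Tu(2)[OF admissible_mix_diff] by (simp add: mix_def bell_def)
      show "AE x in ?M. (1 - (mix1 (u x) (v x) + mix2 (u x) (v x))) * a x powr p \<le> - (F (weak_grad D u x) powr (p - 1) * (z x \<bullet> ((mix1 (u x) (v x) - 1) *\<^sub>R weak_grad D u x + mix2 (u x) (v x) *\<^sub>R weak_grad D v x)))"
        using z(2) ab
      proof eventually_elim
        case (elim x)
        have "z x \<bullet> ((mix1 (u x) (v x) - 1) *\<^sub>R weak_grad D u x + mix2 (u x) (v x) *\<^sub>R weak_grad D v x)
            = (mix1 (u x) (v x) - 1) * a x + mix2 (u x) (v x) * (z x \<bullet> weak_grad D v x)"
          using subdifferential_norm(1)[OF F elim(1)] by (simp add: a_def inner_add_right)
        also have "\<dots> \<le> (mix1 (u x) (v x) - 1) * a x + mix2 (u x) (v x) * a x"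
          using subdifferential_norm(2)[OF F elim(1), of "weak_grad D v x"] mix_derivs(2)[of "u x" "v x"] elim(2)
          by (intro add_left_mono mult_left_mono) (auto simp: b_def)
        finally have "a x powr (p - 1) * (z x \<bullet> ((mix1 (u x) (v x) - 1) *\<^sub>R weak_grad D u x + mix2 (u x) (v x) *\<^sub>R weak_grad D v x))
           \<le> a x powr (p - 1) * ((mix1 (u x) (v x) - 1) * a x + mix2 (u x) (v x) * a x)" by (rule mult_left_mono) simp
        also have "\<dots> = - ((1 - (mix1 (u x) (v x) + mix2 (u x) (v x))) * (a x powr (p - 1) * a x))" by (simp add: algebra_simps)
        finally show ?case unfolding aa unfolding a_def by (linarith | rule le_minus_iff[THEN iffD1])
      qed
      show "integrable ?M (\<lambda>x. (1 - (mix1 (u x) (v x) + mix2 (u x) (v x))) * a x powr p)"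
      proof (rule Bochner_Integration.integrable_bound[OF i(3)])
        note [measurable] = admissible_measurable[OF mix_continuous(1) um vm] admissible_measurable[OF mix_continuous(2) um vm]
        show "(\<lambda>x. (1 - (mix1 (u x) (v x) + mix2 (u x) (v x))) * a x powr p) \<in> borel_measurable ?M" by measurable
        show "AE x in ?M. norm ((1 - (mix1 (u x) (v x) + mix2 (u x) (v x))) * a x powr p) \<le> norm (a x powr (p - 1) * a x)"
          unfolding aa by (rule AE_I2) (rule ca)
      qed
    qed
    finally show ?thesis .
  qed
  moreover have mi: "integrable ?M (\<lambda>x. (1 - (mix1 (u x) (v x) + mix2 (u x) (v x))) * a x powr p)"
  proof (rule Bochner_Integration.integrable_bound[OF i(3)])
    note [measurable] = admissible_measurable[OF mix_continuous(1) um vm] admissible_measurable[OF mix_continuous(2) um vm]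
    show "(\<lambda>x. (1 - (mix1 (u x) (v x) + mix2 (u x) (v x))) * a x powr p) \<in> borel_measurable ?M" by measurable
    show "AE x in ?M. norm ((1 - (mix1 (u x) (v x) + mix2 (u x) (v x))) * a x powr p) \<le> norm (a x powr (p - 1) * a x)"
      unfolding aa by (rule AE_I2) (rule ca)
  qed
  ultimately have "AE x in ?M. (1 - (mix1 (u x) (v x) + mix2 (u x) (v x))) * a x powr p = 0"
    using mix_derivs(6) by (intro integral_nonpos_imp_AE_0) auto
  \<comment> \<open>Off the diagonal the factor is strictly positive, so \<open>a x = 0\<close>, and
    \<open>b x = 0\<close> follows; a norm vanishes only at 0.\<close>
  with ab have g0: "AE x in ?M. u x \<noteq> v x \<longrightarrow> weak_grad D u x = 0 \<and> weak_grad D v x = 0"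
  proof eventually_elim
    case (elim x)
    show ?case
    proof
      assume "u x \<noteq> v x"
      then have "a x = 0" using mix_derivs(5)[of "u x" "v x"] elim(2) by auto
      moreover from this elim(1) have "b x = 0" by simp
      ultimately show "weak_grad D u x = 0 \<and> weak_grad D v x = 0" using Fn(2) by (simp add: a_def b_def)
    qed
  qed
  obtain w where w: "\<And>k. w k \<in> test_functions UNIV"
    "\<forall>R>0. Lp_tendsto p (lebesgue_on (D \<inter> ball 0 R)) w u"
    "\<forall>R>0. Lp_tendsto p (lebesgue_on (D \<inter> ball 0 R)) (\<lambda>k. grad (w k)) (weak_grad D u)"
    "Lp_tendsto p (surface_measure \<Omega>) w \<phi>"
    using tr(1) unfolding has_trace_def by blast
  obtain w' where w': "\<And>k. w' k \<in> test_functions UNIV"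
    "\<forall>R>0. Lp_tendsto p (lebesgue_on (D \<inter> ball 0 R)) w' v"
    "\<forall>R>0. Lp_tendsto p (lebesgue_on (D \<inter> ball 0 R)) (\<lambda>k. grad (w' k)) (weak_grad D v)"
    "Lp_tendsto p (surface_measure \<Omega>) w' \<phi>"
    using tr(2) unfolding has_trace_def by blast
  have bd0: "bell (s - s) = 0" for s by (simp add: bell_def)
  have bc: "continuous_on UNIV (\<lambda>z. bell (fst z - snd z))"
    using admissible_bell[where 'n = 'n] unfolding admissible_def by blast
  \<comment> \<open>Extension by 0 is harmless because \<open>bell (u - v)\<close> has zero trace:
    its cut-off versions are limits of functions supported in \<open>D\<close>, so no gradient
    concentrates on the boundary.\<close>
  define U where "U x = indicator D x *\<^sub>R bell (u x - v x)" for x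
  have bm: "(\<lambda>x. bell (u x - v x)) \<in> borel_measurable ?M" using admissible_measurable[OF bc um vm] .
  have Um: "U \<in> borel_measurable lebesgue"
    using bm DL unfolding U_def[abs_def] by (simp add: borel_measurable_restrict_space_iff)
  have "(\<lambda>x. - v x) \<in> Lp q ?M" by (rule Lp_bound[OF sv(1) _ q(1), of _ 1]) (use vm in auto)
  from Lp_add[OF su(1) this q(1)] have d: "(\<lambda>x. u x + - v x) \<in> Lp q ?M" .
  have "(\<lambda>x. bell (u x - v x)) \<in> Lp q ?M"
    by (rule Lp_bound[OF d bm q(1), of 1]) (use bell_bounds(1) bell_abs_le in auto)
  then have fin: "(\<integral>\<^sup>+x. ennreal (\<bar>bell (u x - v x)\<bar> powr q) \<partial>?M) < \<infinity>"
    using Lp_nn_integral_finite(2) by fastforce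
  have "AE x in lebesgue. U x = 0"
  proof (rule Lq_zero_gradient[OF Um q(1)])
    have "(\<integral>\<^sup>+x. ennreal (\<bar>U x\<bar> powr q) \<partial>lebesgue) = (\<integral>\<^sup>+x. ennreal (\<bar>bell (u x - v x)\<bar> powr q) \<partial>?M)"
      using DL by (subst nn_integral_restrict_space) (auto intro!: nn_integral_cong simp: U_def indicator_def)
    then show "(\<integral>\<^sup>+x. ennreal (\<bar>U x\<bar> powr q) \<partial>lebesgue) < \<infinity>" using fin by simp
    fix R :: real
    obtain n :: nat where n: "max R 1 < real n" using reals_Archimedean2 by blast
    then have n0: "0 < n" by (cases n) auto
    obtain C where C: "C > 0"
      "\<forall>n::nat. 0 < n \<longrightarrow> (\<exists>\<zeta>\<in>test_functions UNIV. \<forall>x::real^'n. 0 \<le> \<zeta> x \<and> \<zeta> x \<le> 1 \<and> norm (grad \<zeta> x) \<le> C / real n \<and>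
        (norm x < real n \<longrightarrow> \<zeta> x = 1 \<and> grad \<zeta> x = 0) \<and> (3 * real n < norm x \<longrightarrow> grad \<zeta> x = 0))"
      by (rule ball_cutoff)
    obtain \<zeta> where \<zeta>: "\<zeta> \<in> test_functions UNIV" "\<forall>x::real^'n. norm x < real n \<longrightarrow> \<zeta> x = 1 \<and> grad \<zeta> x = 0"
      using C(2)[rule_format, OF n0] by blast
    note S = superposition_W1p_0[OF N p1(1) D w(1) w'(1) w(2) w'(2) w(3) w'(3) um vm su(3) sv(3) w(4) w'(4) \<phi> admissible_bell bd0 \<zeta>(1)]
    let ?h = "\<lambda>x. bell (u x - v x) * \<zeta> x"
    obtain \<theta> where \<theta>: "\<And>k. \<theta> k \<in> test_functions D" "Lp_tendsto p ?M \<theta> ?h" "Lp_tendsto p ?M (\<lambda>k. grad (\<theta> k)) (weak_grad D ?h)"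
      using S(1) unfolding W1p_0_def by blast
    have hm: "?h \<in> borel_measurable ?M" "weak_grad D ?h \<in> borel_measurable ?M"
    proof -
      have hs: "?h \<in> sobolev p p D" using S(1) unfolding W1p_0_def by blast
      show "?h \<in> borel_measurable ?M" by (rule Lp_nn_integral_finite(1)[OF sobolevD(1)[OF hs]])
      show "weak_grad D ?h \<in> borel_measurable ?M" by (rule Lp_nn_integral_finite(1)[OF sobolevD(3)[OF hs]])
    qed
    have \<theta>s: "smooth (\<theta> k)" for k using \<theta>(1) test_functions_smooth by blast
    note \<theta>m = smooth_borel_measurable[OF \<theta>s, of _ D]
    have KM: "D \<inter> ball 0 R \<in> sets ?M" "emeasure ?M (D \<inter> ball 0 R) < \<infinity>"
    proof -
      have DB: "D \<inter> ball 0 R \<in> sets lebesgue" by (intro sets.Int DL) simp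
      show "D \<inter> ball 0 R \<in> sets ?M" using DL DB by (auto simp: sets_restrict_space_iff)
      have "emeasure ?M (D \<inter> ball 0 R) = emeasure lebesgue (D \<inter> ball 0 R)" using DL by (simp add: emeasure_restrict_space)
      also have "\<dots> \<le> emeasure lebesgue (ball 0 R :: (real ^ 'n) set)" by (intro emeasure_mono) auto
      also have "\<dots> < \<infinity>" using emeasure_bounded_finite[OF bounded_ball, of "0::real^'n" R] by simp
      finally show "emeasure ?M (D \<inter> ball 0 R) < \<infinity>" .
    qed
    have zero: "\<theta> k x = 0" "grad (\<theta> k) x = 0" if "x \<notin> D" for k x
    proof -
      obtain K where K: "smooth (\<theta> k)" "compact K" "K \<subseteq> D" "\<forall>x. x \<notin> K \<longrightarrow> \<theta> k x = 0" "\<forall>x. x \<notin> K \<longrightarrow> grad (\<theta> k) x = 0"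
        by (rule test_functionE[OF \<theta>(1)])
      show "\<theta> k x = 0" "grad (\<theta> k) x = 0" using K that by blast+
    qed
    have L1: "(\<lambda>k. \<integral>\<^sup>+x. ennreal (norm (\<theta> k x - ?h x)) * indicator (D \<inter> ball 0 R) x \<partial>?M) \<longlonglongrightarrow> 0"
      by (rule Lp_null_imp_L1[OF \<theta>(2)[unfolded Lp_tendsto_iff_null] _ p1(1) KM]) (use \<theta>m hm in measurable)
    have L2: "(\<lambda>k. \<integral>\<^sup>+x. ennreal (norm (grad (\<theta> k) x - weak_grad D ?h x)) * indicator (D \<inter> ball 0 R) x \<partial>?M) \<longlonglongrightarrow> 0"
      by (rule Lp_null_imp_L1[OF \<theta>(3)[unfolded Lp_tendsto_iff_null] _ p1(1) KM]) (use \<theta>m hm in measurable)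
    have \<zeta>1: "\<zeta> x = 1" "grad \<zeta> x = 0" if "x \<in> ball 0 R" for x using that \<zeta>(2) n by auto
    have e1: "(\<integral>\<^sup>+x. ennreal \<bar>\<theta> k x - U x\<bar> * indicator (ball 0 R) x \<partial>lebesgue)
       = (\<integral>\<^sup>+x. ennreal (norm (\<theta> k x - ?h x)) * indicator (D \<inter> ball 0 R) x \<partial>?M)" for k
      using DL zero(1) \<zeta>1 by (subst nn_integral_restrict_space) (auto intro!: nn_integral_cong simp: U_def indicator_def)
    have e2: "(\<integral>\<^sup>+x. ennreal (norm (grad (\<theta> k) x)) * indicator (ball 0 R) x \<partial>lebesgue)
       = (\<integral>\<^sup>+x. ennreal (norm (grad (\<theta> k) x - weak_grad D ?h x)) * indicator (D \<inter> ball 0 R) x \<partial>?M)" for k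
    proof -
      have "(\<integral>\<^sup>+x. ennreal (norm (grad (\<theta> k) x)) * indicator (ball 0 R) x \<partial>lebesgue)
         = (\<integral>\<^sup>+x. ennreal (norm (grad (\<theta> k) x)) * indicator (D \<inter> ball 0 R) x \<partial>?M)"
        using DL zero(2) by (subst nn_integral_restrict_space) (auto intro!: nn_integral_cong simp: indicator_def)
      also have "\<dots> = (\<integral>\<^sup>+x. ennreal (norm (grad (\<theta> k) x - weak_grad D ?h x)) * indicator (D \<inter> ball 0 R) x \<partial>?M)"
      proof (rule nn_integral_cong_AE, use S(2) g0 in eventually_elim)
        case (elim x)
        \<comment> \<open>Where u = v the slope of \<open>bell\<close> at 0 vanishes, elsewhere both
          gradients do; inside this ball the cutoff is 1 with zero gradient.\<close>
        have "weak_grad D ?h x = 0" if "x \<in> ball 0 R"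
          using elim \<zeta>1[OF that] by (cases "u x = v x") auto
        then show ?case by (simp add: indicator_def)
      qed
      finally show ?thesis .
    qed
    show "\<exists>\<theta> :: nat \<Rightarrow> real ^ 'n \<Rightarrow> real. (\<forall>k. smooth (\<theta> k)) \<and>
      (\<lambda>k. \<integral>\<^sup>+x. ennreal \<bar>\<theta> k x - U x\<bar> * indicator (ball 0 R) x \<partial>lebesgue) \<longlonglongrightarrow> 0 \<and>
      (\<lambda>k. \<integral>\<^sup>+x. ennreal (norm (grad (\<theta> k) x)) * indicator (ball 0 R) x \<partial>lebesgue) \<longlonglongrightarrow> 0"
      using \<theta>s L1 L2 unfolding e1[symmetric] e2[symmetric] by blast
  qed
  then have "AE x in lebesgue. x \<in> D \<longrightarrow> u x = v x"
  proof eventually_elim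
    case (elim x)
    then show ?case using bell_bounds(3)[of "u x - v x"] by (auto simp: U_def)
  qed
  then show ?thesis using DL by (simp add: AE_restrict_space_iff)
qed

section \<open>The capacity problem on the whole space\<close>

section \<open>Chain rule for weak gradients and minimizers of the capacity functional\<close>

text \<open>The reflected kernel around \<open>x\<close> is a test function, so the definition of
  the weak gradient moves the derivative from the kernel to \<open>G\<close>; the sign of the
  reflection cancels that of integration by parts. The form by components is due to
  \<open>mollify\<close> acting on real functions.\<close>

lemma grad_mollify_component:
  fixes u :: "real ^ 'n \<Rightarrow> real"
  assumes G: "has_weak_gradient UNIV u G"
  shows "grad (mollify k u) x $ i = mollify k (\<lambda>y. G y $ i) x"
proof -
  define \<epsilon> where "\<epsilon> = inverse (real (Suc k))"
  have \<epsilon>: "0 < \<epsilon>" by (simp add: \<epsilon>_def)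
  have \<rho>: "moll \<epsilon> \<in> test_functions (UNIV :: (real ^ 'n) set)" by (rule moll_test_function[OF \<epsilon>])
  have u: "locally_integrable_on u UNIV" and Gl: "locally_integrable_on G UNIV"
    using G by (auto simp: has_weak_gradient_def)
  let ?\<psi> = "\<lambda>y. moll \<epsilon> (x - y)"
  have aff: "(\<lambda>y. moll \<epsilon> ((- 1) *\<^sub>R y + x)) = ?\<psi>" by simp
  obtain K where K: "smooth (moll \<epsilon> :: real ^ 'n \<Rightarrow> real)" "compact K" "K \<subseteq> UNIV" "\<forall>x :: real ^ 'n. x \<notin> K \<longrightarrow> moll \<epsilon> x = 0"
      "\<forall>x :: real ^ 'n. x \<notin> K \<longrightarrow> grad (moll \<epsilon>) x = 0"
    by (rule test_functionE[OF \<rho>])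
  have s: "smooth ?\<psi>" using smooth_affine[OF K(1), of "- 1" x] unfolding aff .
  have \<psi>: "?\<psi> \<in> test_functions UNIV"
  proof (rule test_functionsI[OF s compact_reflect[OF K(2), of x] subset_UNIV])
    fix y assume "y \<notin> (\<lambda>y. x - y) ` K"
    then have "x - y \<notin> K" using image_eqI[of y "\<lambda>y. x - y" "x - y" K] by auto
    then show "moll \<epsilon> (x - y) = 0" using K(4) by blast
  qed
  have g: "grad ?\<psi> y = - grad (moll \<epsilon>) (x - y)" for y
  proof -
    have "partial j ?\<psi> y = - partial j (moll \<epsilon>) (x - y)" for j
      using fun_cong[OF partial_affine[OF K(1), of j "- 1" x], of y] unfolding aff by simp
    then show ?thesis by (simp add: grad_def vec_eq_iff)
  qed
  have "grad (mollify k u) x = (LINT y|lebesgue. u y *\<^sub>R grad (moll \<epsilon>) (x - y))"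
    unfolding mollify_def \<epsilon>_def[symmetric] by (rule grad_convolve[OF u \<rho>])
  also have "\<dots> = - (LINT y|lebesgue. u y *\<^sub>R grad ?\<psi> y)" unfolding g by simp
  also have "\<dots> = (LINT y|lebesgue. ?\<psi> y *\<^sub>R G y)"
    using G \<psi> unfolding has_weak_gradient_def lebesgue_on_UNIV_eq by auto
  finally have "grad (mollify k u) x $ i = (LINT y|lebesgue. ?\<psi> y *\<^sub>R G y) $ i" by simp
  also have "\<dots> = (LINT y|lebesgue. (?\<psi> y *\<^sub>R G y) $ i)"
    using integral_bounded_linear[OF bounded_linear_vec_nth, of lebesgue "\<lambda>y. ?\<psi> y *\<^sub>R G y" i]
      integrable_test_mult[OF \<psi> Gl] by (simp add: lebesgue_on_UNIV_eq del: vector_scaleR_component)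
  also have "\<dots> = mollify k (\<lambda>y. G y $ i) x"
    unfolding mollify_def \<epsilon>_def[symmetric] convolve_def by simp
  finally show ?thesis .
qed

lemma Lp_null_1_iff:
  assumes "S \<in> sets lebesgue"
  shows "Lp_null 1 (lebesgue_on S) f \<longleftrightarrow> (\<lambda>k. \<integral>\<^sup>+x. ennreal (norm (f k x)) * indicator S x \<partial>lebesgue) \<longlonglongrightarrow> 0"
  using assms unfolding Lp_null_def by (simp add: nn_integral_restrict_space)

text \<open>Exponent 1 on balls treats \<open>u\<close> and its gradient alike, although they belong
  to different Lebesgue spaces: both are locally integrable.\<close>

lemma mollify_approx:
  fixes u :: "real ^ 'n \<Rightarrow> real"
  assumes G: "has_weak_gradient UNIV u G" and Gm: "G \<in> borel_measurable lebesgue"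
  shows "smooth (mollify k u)"
    "Lp_null 1 (lebesgue_on (ball 0 R)) (\<lambda>k x. mollify k u x - u x)"
    "Lp_null 1 (lebesgue_on (ball 0 R)) (\<lambda>k x. grad (mollify k u) x - G x)"
proof -
  have u: "locally_integrable_on u UNIV" and Gl: "locally_integrable_on G UNIV"
    using G by (auto simp: has_weak_gradient_def)
  have sm: "smooth (mollify k f)" if "locally_integrable_on f UNIV" for k and f :: "real ^ 'n \<Rightarrow> real"
    unfolding mollify_def by (intro smooth_convolve that moll_test_function) simp
  show "smooth (mollify k u)" by (rule sm[OF u])
  have B: "ball 0 R \<in> sets (lebesgue :: (real ^ 'n) measure)" by simp
  show "Lp_null 1 (lebesgue_on (ball 0 R)) (\<lambda>k x. mollify k u x - u x)"
    using mollify_L1_local[OF u, of R] by (simp add: Lp_null_1_iff)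
  have Gi: "locally_integrable_on (\<lambda>y. G y $ i) UNIV" for i
    using Gl unfolding locally_integrable_on_def by (auto intro!: integrable_bounded_linear[OF bounded_linear_vec_nth])
  let ?d = "\<lambda>k i. \<integral>\<^sup>+x. ennreal \<bar>mollify k (\<lambda>y. G y $ i) x - G x $ i\<bar> * indicator (ball 0 R) x \<partial>lebesgue"
  have "(\<lambda>k. \<Sum>i\<in>UNIV. ?d k i) \<longlonglongrightarrow> (\<Sum>i\<in>(UNIV :: 'n set). 0)"
    by (intro tendsto_sum mollify_L1_local Gi)
  then have lim: "(\<lambda>k. \<Sum>i\<in>UNIV. ?d k i) \<longlonglongrightarrow> 0" by simp
  have le: "(\<integral>\<^sup>+x. ennreal (norm (grad (mollify k u) x - G x)) * indicator (ball 0 R) x \<partial>lebesgue) \<le> (\<Sum>i\<in>UNIV. ?d k i)" for k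
  proof -
    have "(\<integral>\<^sup>+x. ennreal (norm (grad (mollify k u) x - G x)) * indicator (ball 0 R) x \<partial>lebesgue)
       \<le> (\<integral>\<^sup>+x. (\<Sum>i\<in>UNIV. ennreal \<bar>mollify k (\<lambda>y. G y $ i) x - G x $ i\<bar> * indicator (ball 0 R) x) \<partial>lebesgue)"
    proof (rule nn_integral_mono)
      fix x
      have "norm (grad (mollify k u) x - G x) \<le> (\<Sum>i\<in>UNIV. \<bar>mollify k (\<lambda>y. G y $ i) x - G x $ i\<bar>)"
        using norm_le_l1_cart[of "grad (mollify k u) x - G x"] by (simp add: grad_mollify_component[OF G])
      then have "ennreal (norm (grad (mollify k u) x - G x)) \<le> (\<Sum>i\<in>UNIV. ennreal \<bar>mollify k (\<lambda>y. G y $ i) x - G x $ i\<bar>)"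
        by (subst sum_ennreal) (auto intro: ennreal_leI)
      then show "ennreal (norm (grad (mollify k u) x - G x)) * indicator (ball 0 R) x
         \<le> (\<Sum>i\<in>UNIV. ennreal \<bar>mollify k (\<lambda>y. G y $ i) x - G x $ i\<bar> * indicator (ball 0 R) x)"
        unfolding sum_distrib_right[symmetric] by (rule mult_right_mono) simp
    qed
    also have "\<dots> = (\<Sum>i\<in>UNIV. ?d k i)"
    proof (rule nn_integral_sum)
      fix i :: 'n
      have mm: "mollify k (\<lambda>y. G y $ i) \<in> borel_measurable lebesgue"
        by (rule continuous_imp_lebesgue_measurable[OF smooth_continuous[OF sm[OF Gi]]])
      have gm: "(\<lambda>y. G y $ i) \<in> borel_measurable lebesgue"
        by (rule measurable_compose[OF Gm borel_measurable_nth])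
      show "(\<lambda>x. ennreal \<bar>mollify k (\<lambda>y. G y $ i) x - G x $ i\<bar> * indicator (ball 0 R) x) \<in> borel_measurable lebesgue"
        using mm gm B by (intro borel_measurable_times_ennreal borel_measurable_indicator measurable_compose[OF _ measurable_ennreal]
            borel_measurable_abs borel_measurable_diff)
    qed
    finally show ?thesis .
  qed
  show "Lp_null 1 (lebesgue_on (ball 0 R)) (\<lambda>k x. grad (mollify k u) x - G x)"
    unfolding Lp_null_1_iff[OF B] by (rule tendsto_sandwich[OF _ _ tendsto_const lim]) (use le in auto)
qed

lemma admissibleD:
  assumes "admissible \<Psi> \<Psi>1 \<Psi>2 B TYPE('n)"
  shows "0 \<le> B" "\<And>f g :: real ^ 'n \<Rightarrow> real. smooth f \<Longrightarrow> smooth g \<Longrightarrow> smooth (\<lambda>x. \<Psi> (f x) (g x))"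
    "\<And>(f :: real ^ 'n \<Rightarrow> real) g x. smooth f \<Longrightarrow> smooth g \<Longrightarrow>
       grad (\<lambda>x. \<Psi> (f x) (g x)) x = \<Psi>1 (f x) (g x) *\<^sub>R grad f x + \<Psi>2 (f x) (g x) *\<^sub>R grad g x"
    "continuous_on UNIV (\<lambda>z. \<Psi>1 (fst z) (snd z))" "continuous_on UNIV (\<lambda>z. \<Psi>2 (fst z) (snd z))"
    "continuous_on UNIV (\<lambda>z. \<Psi> (fst z) (snd z))"
    "\<And>s t. \<bar>\<Psi>1 s t\<bar> \<le> B" "\<And>s t. \<bar>\<Psi>2 s t\<bar> \<le> B"
    "\<And>s t s' t'. \<bar>\<Psi> s t - \<Psi> s' t'\<bar> \<le> B * (\<bar>s - s'\<bar> + \<bar>t - t'\<bar>)"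
  using assms unfolding admissible_def by blast+

lemma chain_approx:
  fixes u v :: "real ^ 'n \<Rightarrow> real"
  assumes u: "has_weak_gradient UNIV u Gu" "u \<in> borel_measurable lebesgue" "Gu \<in> borel_measurable lebesgue"
    and v: "has_weak_gradient UNIV v Gv" "v \<in> borel_measurable lebesgue" "Gv \<in> borel_measurable lebesgue"
    and adm: "admissible \<Psi> \<Psi>1 \<Psi>2 B TYPE('n)"
  obtains \<theta> where "\<forall>k. smooth (\<theta> k)" "Lp_null 1 (lebesgue_on (ball 0 R)) (\<lambda>k x. \<theta> k x - \<Psi> (u x) (v x))"
    "Lp_null 1 (lebesgue_on (ball 0 R)) (\<lambda>k x. grad (\<theta> k) x - (\<Psi>1 (u x) (v x) *\<^sub>R Gu x + \<Psi>2 (u x) (v x) *\<^sub>R Gv x))"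
proof -
  let ?M = "lebesgue_on (ball 0 R) :: (real ^ 'n) measure"
  note A = admissibleD[OF adm]
  note wu = mollify_approx[OF u(1,3)] and wv = mollify_approx[OF v(1,3)]
  note mu = smooth_borel_measurable[OF wu(1), of _ "ball 0 R"] and mv = smooth_borel_measurable[OF wv(1), of _ "ball 0 R"]
  note res = measurable_restrict_space1[where \<Omega> = "ball 0 R"]
  have GL: "G \<in> Lp 1 ?M" if "has_weak_gradient UNIV w G" "G \<in> borel_measurable lebesgue" for w :: "real ^ 'n \<Rightarrow> real" and G
  proof -
    have "locally_integrable_on G UNIV" using that(1) by (simp add: has_weak_gradient_def)
    from locally_integrable_onD[OF this compact_cball subset_UNIV, of 0 R]
    have "integrable lebesgue (\<lambda>x. indicator (ball 0 R) x *\<^sub>R (indicator (cball 0 R) x *\<^sub>R G x))"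
      by (rule integrable_mult_indicator[rotated]) simp
    moreover have "(\<lambda>x. indicator (ball 0 R) x *\<^sub>R (indicator (cball 0 R) x *\<^sub>R G x)) = (\<lambda>x. indicator (ball 0 R) x *\<^sub>R G x)"
      by (auto simp: fun_eq_iff indicator_def)
    ultimately have i: "integrable lebesgue (\<lambda>x. indicator (ball 0 R) x *\<^sub>R G x)" by (simp only:)
    have "integrable ?M G" by (subst integrable_restrict_space) (simp_all add: i)
    then show ?thesis by (auto simp: Lp_def)
  qed
  obtain r :: "nat \<Rightarrow> nat" where r: "strict_mono r"
    "Lp_null 1 ?M (\<lambda>k x. (\<Psi>1 (mollify (r k) u x) (mollify (r k) v x) *\<^sub>R grad (mollify (r k) u) x
         + \<Psi>2 (mollify (r k) u x) (mollify (r k) v x) *\<^sub>R grad (mollify (r k) v) x)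
        - (\<Psi>1 (u x) (v x) *\<^sub>R Gu x + \<Psi>2 (u x) (v x) *\<^sub>R Gv x))"
    by (rule Lp_null_superposition_grad[OF A(4,5,1,7,8) wu(2) wv(2) wu(3) wv(3) mu(1) mv(1) res[OF u(2)] res[OF v(2)] mu(2) mv(2)
          GL[OF u(1,3)] GL[OF v(1,3)] zero_less_one])
  let ?\<theta> = "\<lambda>k x. \<Psi> (mollify (r k) u x) (mollify (r k) v x)"
  show ?thesis
  proof (rule that[of ?\<theta>])
    show "\<forall>k. smooth (?\<theta> k)" using A(2) wu(1) wv(1) by blast
    show "Lp_null 1 ?M (\<lambda>k x. ?\<theta> k x - \<Psi> (u x) (v x))"
      using Lp_null_subseq[OF Lp_null_superposition[OF A(1,9) wu(2) wv(2) mu(1) mv(1) res[OF u(2)] res[OF v(2)] zero_less_one] r(1)] .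
    show "Lp_null 1 ?M (\<lambda>k x. grad (?\<theta> k) x - (\<Psi>1 (u x) (v x) *\<^sub>R Gu x + \<Psi>2 (u x) (v x) *\<^sub>R Gv x))"
      using r(2) unfolding A(3)[OF wu(1) wv(1)] .
  qed
qed

text \<open>No trace is involved on the whole space, so mollifications serve as the smooth
  approximations. They converge in L^1 on each ball, which already determines weak
  gradients.\<close>

lemma chain_weak_gradient:
  fixes u v :: "real ^ 'n \<Rightarrow> real"
  assumes u: "has_weak_gradient UNIV u Gu" "u \<in> borel_measurable lebesgue" "Gu \<in> borel_measurable lebesgue"
    and v: "has_weak_gradient UNIV v Gv" "v \<in> borel_measurable lebesgue" "Gv \<in> borel_measurable lebesgue"
    and adm: "admissible \<Psi> \<Psi>1 \<Psi>2 B TYPE('n)"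
  shows "has_weak_gradient UNIV (\<lambda>x. \<Psi> (u x) (v x)) (\<lambda>x. \<Psi>1 (u x) (v x) *\<^sub>R Gu x + \<Psi>2 (u x) (v x) *\<^sub>R Gv x)"
proof -
  note A = admissibleD[OF adm]
  let ?h = "\<lambda>x. \<Psi> (u x) (v x)" and ?H = "\<lambda>x. \<Psi>1 (u x) (v x) *\<^sub>R Gu x + \<Psi>2 (u x) (v x) *\<^sub>R Gv x"
  have l: "locally_integrable_on u UNIV" "locally_integrable_on v UNIV" "locally_integrable_on Gu UNIV" "locally_integrable_on Gv UNIV"
    using u(1) v(1) by (auto simp: has_weak_gradient_def)
  have hm: "?h \<in> borel_measurable lebesgue" by (rule admissible_measurable[OF A(6) u(2) v(2)])
  have Hm: "?H \<in> borel_measurable lebesgue"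
    by (intro borel_measurable_add borel_measurable_scaleR admissible_measurable[OF A(4) u(2) v(2)] admissible_measurable[OF A(5) u(2) v(2)] u v)
  note res = measurable_restrict_space1
  \<comment> \<open>The Lipschitz bound against the origin gives linear growth: |Psi(s,t)| <=
    |Psi(0,0)| + B (|s| + |t|).\<close>
  have hl: "locally_integrable_on ?h UNIV"
    unfolding locally_integrable_on_def
  proof (intro allI impI)
    fix K :: "(real ^ 'n) set" assume K: "compact K \<and> K \<subseteq> UNIV"
    have c: "locally_integrable_on (\<lambda>x :: real ^ 'n. \<bar>\<Psi> 0 0\<bar>) UNIV" by (rule locally_integrable_continuous) simp
    have "integrable (lebesgue_on K) (\<lambda>x. \<bar>\<Psi> 0 0\<bar> + B * (\<bar>u x\<bar> + \<bar>v x\<bar>))"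
    proof (rule Bochner_Integration.integrable_add)
      show "integrable (lebesgue_on K) (\<lambda>x. \<bar>\<Psi> 0 0\<bar>)" using c K unfolding locally_integrable_on_def by blast
      have "integrable (lebesgue_on K) u" "integrable (lebesgue_on K) v" using l(1,2) K unfolding locally_integrable_on_def by blast+
      then show "integrable (lebesgue_on K) (\<lambda>x. B * (\<bar>u x\<bar> + \<bar>v x\<bar>))"
        by (intro integrable_mult_right Bochner_Integration.integrable_add integrable_abs)
    qed
    then show "integrable (lebesgue_on K) ?h"
    proof (rule Bochner_Integration.integrable_bound[OF _ res[OF hm]], intro AE_I2)
      fix x
      have "\<bar>?h x\<bar> \<le> \<bar>\<Psi> 0 0\<bar> + \<bar>?h x - \<Psi> 0 0\<bar>" by linarith
      also have "\<dots> \<le> \<bar>\<Psi> 0 0\<bar> + B * (\<bar>u x\<bar> + \<bar>v x\<bar>)" using A(9)[of "u x" "v x" 0 0] by simp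
      finally show "norm (?h x) \<le> norm (\<bar>\<Psi> 0 0\<bar> + B * (\<bar>u x\<bar> + \<bar>v x\<bar>))" by simp
    qed
  qed
  have Hl: "locally_integrable_on ?H UNIV"
    unfolding locally_integrable_on_def
  proof (intro allI impI)
    fix K :: "(real ^ 'n) set" assume K: "compact K \<and> K \<subseteq> UNIV"
    have "integrable (lebesgue_on K) (\<lambda>x. B * norm (Gu x) + B * norm (Gv x))"
    proof -
      have "integrable (lebesgue_on K) Gu" "integrable (lebesgue_on K) Gv" using l(3,4) K unfolding locally_integrable_on_def by blast+
      then show ?thesis by (intro Bochner_Integration.integrable_add integrable_mult_right integrable_norm)
    qed
    then show "integrable (lebesgue_on K) ?H"
    proof (rule Bochner_Integration.integrable_bound[OF _ res[OF Hm]], intro AE_I2)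
      fix x
      have "norm (?H x) \<le> norm (\<Psi>1 (u x) (v x) *\<^sub>R Gu x) + norm (\<Psi>2 (u x) (v x) *\<^sub>R Gv x)" by (rule norm_triangle_ineq)
      also have "\<dots> \<le> B * norm (Gu x) + B * norm (Gv x)" by (auto intro!: add_mono mult_right_mono A(7,8))
      finally show "norm (?H x) \<le> norm (B * norm (Gu x) + B * norm (Gv x))" by simp
    qed
  qed
  show ?thesis
    unfolding has_weak_gradient_def
  proof (intro conjI ballI hl Hl)
    fix \<psi> :: "real ^ 'n \<Rightarrow> real" assume \<psi>: "\<psi> \<in> test_functions UNIV"
    obtain K where K: "smooth \<psi>" "compact K" "K \<subseteq> UNIV" "\<forall>x. x \<notin> K \<longrightarrow> \<psi> x = 0" "\<forall>x. x \<notin> K \<longrightarrow> grad \<psi> x = 0"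
      by (rule test_functionE[OF \<psi>])
    obtain R where R: "K \<subseteq> ball 0 R" using compact_imp_bounded[OF K(2)] bounded_subset_ballD by blast
    \<comment> \<open>The subsequence in \<open>chain_approx\<close> may depend on the ball. Each
      test function is therefore treated on one ball that contains its support, and the integrals
      are then extended to the whole space.\<close>
    let ?D = "ball 0 R :: (real ^ 'n) set"
    obtain \<theta> where \<theta>: "\<forall>k. smooth (\<theta> k)" "Lp_null 1 (lebesgue_on ?D) (\<lambda>k x. \<theta> k x - ?h x)"
      "Lp_null 1 (lebesgue_on ?D) (\<lambda>k x. grad (\<theta> k) x - ?H x)"
      by (rule chain_approx[OF u v adm])
    have sm: "smooth (\<theta> k)" for k using \<theta>(1) by blast
    have conv: "(\<lambda>k. \<integral>\<^sup>+x. ennreal (norm (f k x)) * indicator C x \<partial>lebesgue_on ?D) \<longlonglongrightarrow> 0"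
      if "Lp_null 1 (lebesgue_on ?D) f" for f :: "nat \<Rightarrow> real ^ 'n \<Rightarrow> 'b::euclidean_space" and C
    proof (rule tendsto_sandwich[OF _ _ tendsto_const that[unfolded Lp_null_def]])
      show "\<forall>\<^sub>F k in sequentially. (\<integral>\<^sup>+x. ennreal (norm (f k x)) * indicator C x \<partial>lebesgue_on ?D)
           \<le> (\<integral>\<^sup>+x. ennreal (norm (f k x) powr 1) \<partial>lebesgue_on ?D)"
        by (intro always_eventually allI nn_integral_mono) (simp add: indicator_def)
    qed simp
    have wg: "has_weak_gradient ?D ?h ?H"
      by (rule weak_gradient_limit[OF open_ball _ _ res[OF hm] res[OF Hm] sm])
         (use hl Hl conv[OF \<theta>(2)] conv[OF \<theta>(3)] in \<open>auto simp: locally_integrable_on_def\<close>)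
    have \<psi>D: "\<psi> \<in> test_functions ?D" by (rule test_functionsI[OF K(1,2) R]) (use K(4) in blast)
    have out: "\<psi> x = 0" "grad \<psi> x = 0" if "x \<notin> ?D" for x using K(4,5) R that by blast+
    have r1: "(LINT x|lebesgue_on ?D. ?h x *\<^sub>R grad \<psi> x) = (LINT x|lebesgue. ?h x *\<^sub>R grad \<psi> x)"
      unfolding integral_lebesgue_on_indicator[OF lmeasurable_ball[THEN fmeasurableD]]
      by (intro Bochner_Integration.integral_cong refl) (use out in \<open>auto simp: indicator_def\<close>)
    have r2: "(LINT x|lebesgue_on ?D. \<psi> x *\<^sub>R ?H x) = (LINT x|lebesgue. \<psi> x *\<^sub>R ?H x)"
      unfolding integral_lebesgue_on_indicator[OF lmeasurable_ball[THEN fmeasurableD]]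
      by (intro Bochner_Integration.integral_cong refl) (use out in \<open>auto simp: indicator_def\<close>)
    have "(LINT x|lebesgue_on ?D. ?h x *\<^sub>R grad \<psi> x) = - (LINT x|lebesgue_on ?D. \<psi> x *\<^sub>R ?H x)"
      using wg \<psi>D unfolding has_weak_gradient_def by blast
    then show "(LINT x|lebesgue_on UNIV. ?h x *\<^sub>R grad \<psi> x) = - (LINT x|lebesgue_on UNIV. \<psi> x *\<^sub>R ?H x)"
      unfolding r1 r2 lebesgue_on_UNIV_eq .
  qed
qed

lemma chain_sobolev:
  fixes u v :: "real ^ 'n \<Rightarrow> real"
  assumes u: "u \<in> sobolev q p UNIV" and v: "v \<in> sobolev q p UNIV" and p: "0 < p" and q: "0 < q"
    and adm: "admissible \<Psi> \<Psi>1 \<Psi>2 B TYPE('n)" and le: "\<And>s t. \<bar>\<Psi> s t\<bar> \<le> \<bar>s\<bar> + \<bar>t\<bar>"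
  shows "(\<lambda>x. \<Psi> (u x) (v x)) \<in> sobolev q p UNIV"
    "AE x in lebesgue. weak_grad UNIV (\<lambda>x. \<Psi> (u x) (v x)) x
       = \<Psi>1 (u x) (v x) *\<^sub>R weak_grad UNIV u x + \<Psi>2 (u x) (v x) *\<^sub>R weak_grad UNIV v x"
proof -
  note A = admissibleD[OF adm]
  note su = sobolevD[OF u, unfolded lebesgue_on_UNIV_eq] and sv = sobolevD[OF v, unfolded lebesgue_on_UNIV_eq]
  note um = Lp_nn_integral_finite(1)[OF su(1)] Lp_nn_integral_finite(1)[OF su(3)]
    and vm = Lp_nn_integral_finite(1)[OF sv(1)] Lp_nn_integral_finite(1)[OF sv(3)]
  let ?h = "\<lambda>x. \<Psi> (u x) (v x)"
  let ?H1 = "\<lambda>x. \<Psi>1 (u x) (v x) *\<^sub>R weak_grad UNIV u x" and ?H2 = "\<lambda>x. \<Psi>2 (u x) (v x) *\<^sub>R weak_grad UNIV v x"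
  have wg: "has_weak_gradient UNIV ?h (\<lambda>x. ?H1 x + ?H2 x)"
    by (rule chain_weak_gradient[OF su(2) um sv(2) vm adm])
  show ae: "AE x in lebesgue. weak_grad UNIV ?h x = ?H1 x + ?H2 x"
    using weak_grad_AE[OF open_UNIV wg] unfolding lebesgue_on_UNIV_eq .
  have H1m: "?H1 \<in> borel_measurable lebesgue" by (intro borel_measurable_scaleR admissible_measurable[OF A(4)] um vm)
  have H2m: "?H2 \<in> borel_measurable lebesgue" by (intro borel_measurable_scaleR admissible_measurable[OF A(5)] um vm)
  have "?H1 \<in> Lp p lebesgue" by (rule Lp_bound[OF su(3) H1m p A(1)]) (auto intro!: mult_right_mono A(7))
  moreover have "?H2 \<in> Lp p lebesgue" by (rule Lp_bound[OF sv(3) H2m p A(1)]) (auto intro!: mult_right_mono A(8))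
  ultimately have HL: "(\<lambda>x. ?H1 x + ?H2 x) \<in> Lp p lebesgue" by (rule Lp_add[OF _ _ p])
  have wgm: "weak_grad UNIV ?h \<in> borel_measurable lebesgue"
    by (rule borel_measurable_AE[OF Lp_nn_integral_finite(1)[OF HL]]) (use ae in \<open>auto elim: eventually_mono\<close>)
  have wgL: "weak_grad UNIV ?h \<in> Lp p lebesgue"
    by (rule Lp_bound[OF HL wgm p, of 1]) (use ae in \<open>auto elim: eventually_mono\<close>)
  have "(\<lambda>x. \<bar>u x\<bar>) \<in> Lp q lebesgue" by (rule Lp_bound[OF su(1) _ q, of _ 1]) (use um in auto)
  moreover have "(\<lambda>x. \<bar>v x\<bar>) \<in> Lp q lebesgue" by (rule Lp_bound[OF sv(1) _ q, of _ 1]) (use vm in auto)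
  ultimately have d: "(\<lambda>x. \<bar>u x\<bar> + \<bar>v x\<bar>) \<in> Lp q lebesgue" by (rule Lp_add[OF _ _ q])
  have "?h \<in> Lp q lebesgue"
    by (rule Lp_bound[OF d admissible_measurable[OF A(6) um(1) vm(1)] q, of 1]) (use le in auto)
  then show "?h \<in> sobolev q p UNIV" using wg wgL by (auto simp: sobolev_def lebesgue_on_UNIV_eq)
qed

text \<open>Minimality against two competitors replaces the tested equation. As both stay in the
  class and their gradients are explicit, comparing energies pointwise gives first equality of F on
  the gradients and then the vanishing of the gradients off the diagonal.\<close>

lemma capacity_minimizer_unique:
  fixes u v :: "real ^ 'n \<Rightarrow> real" and F :: "real ^ 'n \<Rightarrow> real"
  assumes F: "is_norm F" and p: "1 < p" and q: "0 < q"
    and u: "u \<in> sobolev q p UNIV" "AE x in lebesgue_on \<Omega>. 1 \<le> u x"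
    and v: "v \<in> sobolev q p UNIV" "AE x in lebesgue_on \<Omega>. 1 \<le> v x"
    and eq: "capacity_functional F p u = capacity_functional F p v"
    and min: "\<And>w. w \<in> sobolev q p UNIV \<Longrightarrow> AE x in lebesgue_on \<Omega>. 1 \<le> w x \<Longrightarrow> capacity_functional F p u \<le> capacity_functional F p w"
  shows "AE x in lebesgue. u x = v x"
proof -
  have p0: "0 < p" using p by simp
  have Fn: "0 \<le> F x" "F x = 0 \<longleftrightarrow> x = 0" "F (c *\<^sub>R x) = \<bar>c\<bar> * F x" "F (x + y) \<le> F x + F y" for x y c
    using F by (simp_all add: is_norm_def)
  note su = sobolevD[OF u(1), unfolded lebesgue_on_UNIV_eq] and sv = sobolevD[OF v(1), unfolded lebesgue_on_UNIV_eq]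
  note um = Lp_nn_integral_finite(1)[OF su(1)] Lp_nn_integral_finite(1)[OF su(3)]
    and vm = Lp_nn_integral_finite(1)[OF sv(1)] Lp_nn_integral_finite(1)[OF sv(3)]
  define a where "a x = F (weak_grad UNIV u x)" for x
  define b where "b x = F (weak_grad UNIV v x)" for x
  have aL: "a \<in> Lp p lebesgue" and bL: "b \<in> Lp p lebesgue"
    unfolding a_def[abs_def] b_def[abs_def] by (intro powr_norm_integrable[OF F] su sv p0)+
  note am[measurable] = Lp_nn_integral_finite(1)[OF aL] and bm[measurable] = Lp_nn_integral_finite(1)[OF bL]
  have ab0: "0 \<le> a x" "0 \<le> b x" for x by (auto simp: a_def b_def Fn)
  have Li: "integrable lebesgue (\<lambda>x. c x powr p)" if "c \<in> Lp p lebesgue" "\<And>x. 0 \<le> c x" for c :: "real ^ 'n \<Rightarrow> real"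
    using that by (simp add: Lp_def)
  have Fi: "integrable lebesgue (\<lambda>x. F (weak_grad UNIV w x) powr p)" if "w \<in> sobolev q p UNIV" for w
    using sobolevD(3)[OF that] by (intro Li powr_norm_integrable[OF F] p0 Fn(1)) (simp add: lebesgue_on_UNIV_eq)
  have ai: "integrable lebesgue (\<lambda>x. a x powr p)" and bi: "integrable lebesgue (\<lambda>x. b x powr p)"
    by (intro Li aL bL ab0)+
  have Eu: "capacity_functional F p u = (LINT x|lebesgue. a x powr p)" "capacity_functional F p v = (LINT x|lebesgue. b x powr p)"
    by (simp_all add: capacity_functional_def a_def b_def)
  have ab: "AE x in lebesgue. a x = b x"
  proof -
    \<comment> \<open>F at the averaged gradient is at most (a + b)/2 by convexity of
      \<open>F\<close>. Minimality then leaves no room in the midpoint inequality for the power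
      \<open>p > 1\<close>, whose strict convexity forces a = b.\<close>
    let ?m = "\<lambda>x. (u x + v x) / 2"
    have le: "\<bar>(s + t) / 2\<bar> \<le> \<bar>s\<bar> + \<bar>t\<bar>" for s t :: real
    proof -
      have "\<bar>(s + t) / 2\<bar> = \<bar>s + t\<bar> / 2" by simp
      then show ?thesis using abs_triangle_ineq[of s t] abs_ge_zero[of s] abs_ge_zero[of t] by linarith
    qed
    note M = chain_sobolev[OF u(1) v(1) p0 q admissible_mean le]
    have ms: "?m \<in> sobolev q p UNIV" by (rule M(1))
    have mg: "AE x in lebesgue. weak_grad UNIV ?m x = (1 / 2) *\<^sub>R weak_grad UNIV u x + (1 / 2) *\<^sub>R weak_grad UNIV v x"
      by (rule M(2))
    have m1: "AE x in lebesgue_on \<Omega>. 1 \<le> ?m x" using u(2) v(2) by eventually_elim simp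
    have "(\<lambda>x. a x + b x) \<in> Lp p lebesgue" by (rule Lp_add[OF aL bL p0])
    then have "(\<lambda>x. (a x + b x) / 2) \<in> Lp p lebesgue"
      by (rule Lp_bound[OF _ _ p0, of _ _ _ 1]) (use ab0 in auto)
    then have hi: "integrable lebesgue (\<lambda>x. ((a x + b x) / 2) powr p)" by (rule Li) (use ab0 in auto)
    have "capacity_functional F p u \<le> capacity_functional F p ?m" by (rule min[OF ms m1])
    also have "\<dots> \<le> (LINT x|lebesgue. ((a x + b x) / 2) powr p)"
      unfolding capacity_functional_def
    proof (rule integral_mono_AE[OF Fi[OF ms] hi])
      show "AE x in lebesgue. F (weak_grad UNIV ?m x) powr p \<le> ((a x + b x) / 2) powr p"
        using mg
      proof eventually_elim
        case (elim x)
        have "F (weak_grad UNIV ?m x) \<le> (a x + b x) / 2"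
          unfolding elim using Fn(4)[of "(1 / 2) *\<^sub>R weak_grad UNIV u x" "(1 / 2) *\<^sub>R weak_grad UNIV v x"]
          by (simp add: Fn(3) a_def b_def)
        then show ?case by (intro powr_mono2) (use p0 Fn in auto)
      qed
    qed
    finally have 1: "(LINT x|lebesgue. a x powr p) \<le> (LINT x|lebesgue. ((a x + b x) / 2) powr p)" by (simp only: Eu)
    have si: "integrable lebesgue (\<lambda>x. (a x powr p + b x powr p) / 2)" using ai bi by simp
    have "(LINT x|lebesgue. (a x powr p + b x powr p) / 2 - ((a x + b x) / 2) powr p)
       = ((LINT x|lebesgue. a x powr p) + (LINT x|lebesgue. b x powr p)) / 2 - (LINT x|lebesgue. ((a x + b x) / 2) powr p)"
      using si hi ai bi by (simp add: Bochner_Integration.integral_diff Bochner_Integration.integral_add)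
    also have "\<dots> \<le> 0" using 1 eq by (simp add: Eu)
    finally have "AE x in lebesgue. (a x powr p + b x powr p) / 2 - ((a x + b x) / 2) powr p = 0"
      by (intro integral_nonpos_imp_AE_0 Bochner_Integration.integrable_diff si hi AE_I2)
         (use powr_strict_midpoint(1)[OF ab0 p] in \<open>simp add: algebra_simps\<close>)
    then show ?thesis
    proof eventually_elim
      case (elim x)
      show ?case by (rule powr_strict_midpoint(2)[OF ab0 p]) (use elim in simp)
    qed
  qed
  have g0: "AE x in lebesgue. u x \<noteq> v x \<longrightarrow> weak_grad UNIV u x = 0 \<and> weak_grad UNIV v x = 0"
  proof -
    let ?m = "\<lambda>x. mix (u x) (v x)" and ?c = "\<lambda>x. mix1 (u x) (v x) + mix2 (u x) (v x)"
    have le: "\<bar>mix s t\<bar> \<le> \<bar>s\<bar> + \<bar>t\<bar>" for s t using mix_between[of s t] by linarith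
    note M = chain_sobolev[OF u(1) v(1) p0 q admissible_mix le]
    have m1: "AE x in lebesgue_on \<Omega>. 1 \<le> ?m x" using u(2) v(2)
    proof eventually_elim
      case (elim x)
      then show ?case using mix_between(1)[of "u x" "v x"] by linarith
    qed
    \<comment> \<open>The factor by which \<open>mix\<close> shrinks the gradient: F of the
      competitor's gradient is at most \<open>?c x * a x\<close>, so minimality forces equality
      almost everywhere, and thus a = 0 wherever the factor is below 1.\<close>
    have c: "0 \<le> ?c x" "?c x \<le> 1" for x using mix_derivs(1,2,6)[of "u x" "v x"] by auto
    have cm: "?c \<in> borel_measurable lebesgue"
      by (intro borel_measurable_add admissible_measurable[OF mix_continuous(1) um(1) vm(1)] admissible_measurable[OF mix_continuous(2) um(1) vm(1)])
    have "(\<lambda>x. ?c x * a x) \<in> Lp p lebesgue"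
    proof (rule Lp_bound[OF aL _ p0, of _ 1])
      show "(\<lambda>x. ?c x * a x) \<in> borel_measurable lebesgue" by (rule borel_measurable_times[OF cm am])
      show "AE x in lebesgue. norm (?c x * a x) \<le> 1 * norm (a x)"
        using c ab0 by (intro AE_I2) (simp add: abs_mult mult_left_le_one_le)
    qed simp
    then have hi: "integrable lebesgue (\<lambda>x. (?c x * a x) powr p)" by (rule Li) (use c ab0 in auto)
    have "capacity_functional F p u \<le> capacity_functional F p ?m" by (rule min[OF M(1) m1])
    also have "\<dots> \<le> (LINT x|lebesgue. (?c x * a x) powr p)"
      unfolding capacity_functional_def
    proof (rule integral_mono_AE[OF Fi[OF M(1)] hi])
      show "AE x in lebesgue. F (weak_grad UNIV ?m x) powr p \<le> (?c x * a x) powr p"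
        using M(2) ab
      proof eventually_elim
        case (elim x)
        have "F (weak_grad UNIV ?m x) \<le> mix1 (u x) (v x) * a x + mix2 (u x) (v x) * b x"
          unfolding elim(1) using Fn(4)[of "mix1 (u x) (v x) *\<^sub>R weak_grad UNIV u x" "mix2 (u x) (v x) *\<^sub>R weak_grad UNIV v x"]
            mix_derivs(1,2)[of "u x" "v x"] by (simp add: Fn(3) a_def b_def)
        also have "\<dots> = ?c x * a x" using elim(2) by (simp add: algebra_simps)
        finally show ?case by (intro powr_mono2) (use p0 Fn in auto)
      qed
    qed
    finally have "(LINT x|lebesgue. a x powr p - (?c x * a x) powr p) \<le> 0"
      using ai hi by (simp add: Eu Bochner_Integration.integral_diff)
    then have "AE x in lebesgue. a x powr p - (?c x * a x) powr p = 0"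
    proof (intro integral_nonpos_imp_AE_0 Bochner_Integration.integrable_diff ai hi AE_I2)
      fix x
      have "?c x * a x \<le> a x" using mult_right_mono[OF c(2) ab0(1)[of x]] by simp
      then show "0 \<le> a x powr p - (?c x * a x) powr p"
        using powr_mono2[of p "?c x * a x" "a x"] p0 c ab0 by simp
    qed
    then show ?thesis using ab
    proof eventually_elim
      case (elim x)
      show ?case
      proof
        assume ne: "u x \<noteq> v x"
        have "a x = 0"
        proof (rule ccontr)
          assume "a x \<noteq> 0"
          then have "0 < a x" using ab0(1)[of x] by linarith
          then have "?c x * a x < a x" using mix_derivs(5)[OF ne] by simp
          then have "(?c x * a x) powr p < a x powr p" using p0 c ab0 by (intro powr_less_mono2) auto
          then show False using elim(1) by simp
        qed
        moreover from this elim(2) have "b x = 0" by simp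
        ultimately show "weak_grad UNIV u x = 0 \<and> weak_grad UNIV v x = 0" using Fn(2) by (simp add: a_def b_def)
      qed
    qed
  qed
  define U where "U x = bell (u x - v x)" for x
  let ?\<beta> = "\<lambda>s t. 2 * (s - t) * exp (- ((s - t) ^ 2)) :: real"
  note bD = admissibleD[OF admissible_bell[where 'n = 'n]]
  have Um: "U \<in> borel_measurable lebesgue"
    unfolding U_def[abs_def] by (rule admissible_measurable[OF bD(6) um(1) vm(1)])
  have le: "\<bar>bell (s - t)\<bar> \<le> \<bar>s\<bar> + \<bar>t\<bar>" for s t using bell_abs_le[of "s - t"] bell_bounds(1)[of "s - t"] by linarith
  have "U \<in> Lp q (lebesgue_on UNIV)"
    unfolding U_def[abs_def] by (rule sobolevD(1)[OF chain_sobolev(1)[OF u(1) v(1) p0 q admissible_bell le]])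
  then have fin: "(\<integral>\<^sup>+x. ennreal (\<bar>U x\<bar> powr q) \<partial>lebesgue) < \<infinity>"
    using Lp_nn_integral_finite(2) by (fastforce simp: lebesgue_on_UNIV_eq)
  have "AE x in lebesgue. U x = 0"
  proof (rule Lq_zero_gradient[OF Um q fin])
    fix R :: real
    have B: "ball 0 R \<in> sets (lebesgue :: (real ^ 'n) measure)" by simp
    obtain \<theta> where \<theta>: "\<forall>k. smooth (\<theta> k)" "Lp_null 1 (lebesgue_on (ball 0 R)) (\<lambda>k x. \<theta> k x - bell (u x - v x))"
      "Lp_null 1 (lebesgue_on (ball 0 R)) (\<lambda>k x. grad (\<theta> k) x - (?\<beta> (u x) (v x) *\<^sub>R weak_grad UNIV u x + - ?\<beta> (u x) (v x) *\<^sub>R weak_grad UNIV v x))"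
      by (rule chain_approx[OF su(2) um sv(2) vm admissible_bell])
    have "(\<integral>\<^sup>+x. ennreal (norm (grad (\<theta> k) x - (?\<beta> (u x) (v x) *\<^sub>R weak_grad UNIV u x + - ?\<beta> (u x) (v x) *\<^sub>R weak_grad UNIV v x))) * indicator (ball 0 R) x \<partial>lebesgue)
       = (\<integral>\<^sup>+x. ennreal (norm (grad (\<theta> k) x)) * indicator (ball 0 R) x \<partial>lebesgue)" for k
    proof (rule nn_integral_cong_AE, use g0 in eventually_elim)
      case (elim x)
      \<comment> \<open>On the diagonal the coefficient carries the factor u - v = 0; off the
        diagonal both gradients vanish.\<close>
      then show ?case by (cases "u x = v x") auto
    qed
    then have "(\<lambda>k. \<integral>\<^sup>+x. ennreal (norm (grad (\<theta> k) x)) * indicator (ball 0 R) x \<partial>lebesgue) \<longlonglongrightarrow> 0"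
      using \<theta>(3) unfolding Lp_null_1_iff[OF B] by simp
    moreover have "(\<lambda>k. \<integral>\<^sup>+x. ennreal \<bar>\<theta> k x - U x\<bar> * indicator (ball 0 R) x \<partial>lebesgue) \<longlonglongrightarrow> 0"
      using \<theta>(2) unfolding Lp_null_1_iff[OF B] by (simp add: U_def)
    ultimately show "\<exists>\<theta> :: nat \<Rightarrow> real ^ 'n \<Rightarrow> real. (\<forall>k. smooth (\<theta> k)) \<and>
      (\<lambda>k. \<integral>\<^sup>+x. ennreal \<bar>\<theta> k x - U x\<bar> * indicator (ball 0 R) x \<partial>lebesgue) \<longlonglongrightarrow> 0 \<and>
      (\<lambda>k. \<integral>\<^sup>+x. ennreal (norm (grad (\<theta> k) x)) * indicator (ball 0 R) x \<partial>lebesgue) \<longlonglongrightarrow> 0"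
      using \<theta>(1) by blast
  qed
  then show ?thesis
  proof eventually_elim
    case (elim x)
    then show ?case using bell_bounds(3)[of "u x - v x"] by (simp add: U_def)
  qed
qed

theorem corollary1p2:
  fixes F :: "real ^ 'n \<Rightarrow> real" and \<Omega> :: "(real ^ 'n) set" and p :: real
  assumes "2 \<le> CARD('n)"
    and "is_norm F"
    and "1 < p"
    and "bounded \<Omega>" and "lipschitz_domain \<Omega>"
  shows "(\<forall>\<phi> \<in> boundary_sobolev (1 - 1 / p) p \<Omega>. \<forall>u v.
            weak_solution_interior F p \<Omega> \<phi> u \<and> weak_solution_interior F p \<Omega> \<phi> v \<longrightarrow>
            (AE x in lebesgue_on \<Omega>. u x = v x))
       \<and> (p < real CARD('n) \<longrightarrow>
          (\<forall>\<phi> \<in> boundary_sobolev (1 - 1 / p) p \<Omega>. \<forall>u v.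
            weak_solution_exterior F p \<Omega> \<phi> u \<and> weak_solution_exterior F p \<Omega> \<phi> v \<longrightarrow>
            (AE x in lebesgue_on (- closure \<Omega>). u x = v x)))
       \<and> (p < real CARD('n) \<longrightarrow>
          (\<forall>u v.
            is_arg_min (capacity_functional F p) (\<lambda>w. w \<in> capacity_class p \<Omega>) u \<and>
            is_arg_min (capacity_functional F p) (\<lambda>w. w \<in> capacity_class p \<Omega>) v \<longrightarrow>
            (AE x in lebesgue. u x = v x)))"
proof (intro conjI impI ballI allI)
  note cb = chart_boundary_lipschitz_domain[OF assms(5,4)]
  have \<phi>m: "\<phi> \<in> borel_measurable (surface_measure \<Omega>)" if "\<phi> \<in> boundary_sobolev (1 - 1 / p) p \<Omega>" for \<phi>
    using that by (auto simp: boundary_sobolev_def Lp_def)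
  have q: "0 < sobolev_exponent TYPE('n) p" if "p < real CARD('n)"
    using that assms(3) by (simp add: sobolev_exponent_def)
  show "AE x in lebesgue_on \<Omega>. u x = v x"
    if \<phi>: "\<phi> \<in> boundary_sobolev (1 - 1 / p) p \<Omega>"
      and uv: "weak_solution_interior F p \<Omega> \<phi> u \<and> weak_solution_interior F p \<Omega> \<phi> v" for \<phi> u v
    using uv assms(3,4) unfolding weak_solution_interior_def
    by (intro weak_solution_unique[OF assms(1-3) cb(1) _ _ _ _ _ _ \<phi>m[OF \<phi>], of p]) auto
  show "AE x in lebesgue_on (- closure \<Omega>). u x = v x"
    if N: "p < real CARD('n)" and \<phi>: "\<phi> \<in> boundary_sobolev (1 - 1 / p) p \<Omega>"
      and uv: "weak_solution_exterior F p \<Omega> \<phi> u \<and> weak_solution_exterior F p \<Omega> \<phi> v" for \<phi> u v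
    using uv N q[OF N] unfolding weak_solution_exterior_def
    by (intro weak_solution_unique[OF assms(1-3) cb(2) _ _ _ _ _ _ \<phi>m[OF \<phi>], of "sobolev_exponent TYPE('n) p"]) auto
  show "AE x in lebesgue. u x = v x"
    if N: "p < real CARD('n)"
      and uv: "is_arg_min (capacity_functional F p) (\<lambda>w. w \<in> capacity_class p \<Omega>) u \<and>
        is_arg_min (capacity_functional F p) (\<lambda>w. w \<in> capacity_class p \<Omega>) v" for u v
  proof (rule capacity_minimizer_unique[OF assms(2,3) q[OF N]])
    have u: "u \<in> capacity_class p \<Omega>" "\<And>w. w \<in> capacity_class p \<Omega> \<Longrightarrow> capacity_functional F p u \<le> capacity_functional F p w"
      and v: "v \<in> capacity_class p \<Omega>" "\<And>w. w \<in> capacity_class p \<Omega> \<Longrightarrow> capacity_functional F p v \<le> capacity_functional F p w"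
      using uv by (auto simp: is_arg_min_linorder)
    show "u \<in> sobolev (sobolev_exponent TYPE('n) p) p UNIV" "AE x in lebesgue_on \<Omega>. 1 \<le> u x"
      "v \<in> sobolev (sobolev_exponent TYPE('n) p) p UNIV" "AE x in lebesgue_on \<Omega>. 1 \<le> v x"
      using u(1) v(1) by (auto simp: capacity_class_def)
    show "capacity_functional F p u = capacity_functional F p v"
      using u(2)[OF v(1)] v(2)[OF u(1)] by simp
    show "capacity_functional F p u \<le> capacity_functional F p w"
      if "w \<in> sobolev (sobolev_exponent TYPE('n) p) p UNIV" "AE x in lebesgue_on \<Omega>. 1 \<le> w x" for w
      using that by (intro u(2)) (simp add: capacity_class_def)
  qed
qed

end
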